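(* Let $d\ge 1$, let $G$ be a compact Lie group with a fixed maximal torus $\mathcal{T}$ with Lie algebra $\mathfrak{t}$, let $\alpha\in\mathbb{T}^d$ be Diophantine, and let $\Phi=(\alpha,A(\cdot))$, $A(\cdot)\in C^\infty(\mathbb{T}^d,G)$, be an almost reducible cocycle with fibered rotation vector $\varrho=\varrho(\Phi)$. If $\varrho$ satisfies a Diophantine condition with respect to $\alpha$, then for any representative $a\in\mathfrak{t}$ of $\varrho$ the cocycle $\Phi$ is $C^\infty$ smoothly conjugate to $(\alpha,\exp(a))$, i.e. there exists $H(\cdot)\in C^\infty(\mathbb{T}^d,G)$ with $H(\cdot+\alpha)A(\cdot)H^{*}(\cdot)\equiv\exp(a)$.
   Context: $\mathbb{T}^d=\mathbb{R}^d/\mathbb{Z}^d$. A vector $\alpha\in\mathbb{T}^d$ is Diophantine if there are $\gamma,\tau>0$ with $|\alpha\cdot k|_{\mathbb{Z}}\ge \gamma^{-1}|k|^{-\tau}$ for all $k\in\mathbb{Z}^d\setminus\{0\}$, where $|\cdot|_{\mathbb{Z}}$ is the distance to the nearest integer. A (smooth quasi-periodic) cocycle over $\alpha$ is a pair $\Phi=(\alpha,A(\cdot))$ with $A(\cdot)\in C^\infty(\mathbb{T}^d,G)$, acting on $\mathbb{T}^d\times G$ by $(x,S)\mapsto(x+\alpha,A(x)S)$. It is constant if $A(\cdot)$ is a constant map. For $H(\cdot)\in C^\infty(\mathbb{T}^d,G)$, $\mathrm{Conj}_{H(\cdot)}(\alpha,A(\cdot))=(\alpha,H(\cdot+\alpha)A(\cdot)H^*(\cdot))$,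 where $H^*(x)=H(x)^{-1}$. Convergence of cocycles over $\alpha$ in $C^\infty$ means convergence of the maps $A(\cdot)$ in $C^\infty$. $\Phi=(\alpha,A(\cdot))$ is almost reducible if there exist $H_i(\cdot)\in C^\infty(\mathbb{T}^d,G)$ and constants $A_i\in G$ with $A_i^*H_i(\cdot+\alpha)A(\cdot)H_i^*(\cdot)\to\mathrm{Id}$ in $C^\infty$. Sobolev spaces: $G$ is regarded as a group of unitary matrices, and $H^s$ ($s\in\mathbb{R}$) convergence of $G$-valued maps on $\mathbb{T}^d$ means convergence of matrix entries in the usual Sobolev space $H^s(\mathbb{T}^d)$. Roots: $\Delta\subset\mathfrak{t}^*$ is the finite set of non-zero real linear forms $\rho$ on $\mathfrak{t}$ such that for $A=\exp(a)$, $a\in\mathfrak{t}$, the adjoint action of $A$ on the Lie algebra $g$ of $G$ acts on the root vector $j_\rho\in\mathfrak{t}^{\perp}$ by $\mathrm{Ad}(A).j_\rho=e^{2i\pi\rho(a)}j_\rho$. Rotation vector: $a_\infty\in\mathfrak{t}$ is a rotation vector for $\Phi$, written $a_\infty=\varrho(\Phi)$, if for some $s\in\mathbb{R}$ there is a sequence $H_i(\cdot)\in C^\infty(\mathbb{T}^d,G)$ converging in $H^s$ to some $H(\cdot)\in H^s(\mathbb{T}^d,G)$ such that $\mathrm{Conj}_{H_i(\cdot)}\Phi\to(\alpha,\exp(a_\infty))$ in $C^\infty$. Such $a_\infty$ are called representatives of $\varrho(\Phi)$; $\varrho(\Phi)$ is regarded as an element of $\mathfrak{t}$ modulo $(\alpha\cdot\mathbb{Z}^d)\mathcal{Z}$,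 the subgroup generated by $\{(\alpha\cdot k)z: k\in\mathbb{Z}^d,\ z\in\mathcal{Z}\}$, where $\alpha$ is lifted to $\mathbb{R}^d$ and $\mathcal{Z}=\{a\in\mathfrak{t}: \exp(2i\pi\rho(a))=1\ \forall\rho\in\Delta\}$ is the lattice of preimages in $\mathfrak{t}$ of the centre of $G$. Diophantine condition relative to $\alpha$: $\beta\in\mathbb{T}$ belongs to $DC_\alpha(\tilde\gamma,\tilde\tau)$ if $|\beta-\alpha\cdot k|_{\mathbb{Z}}\ge\tilde\gamma^{-1}|k|^{-\tilde\tau}$ for all $k\in\mathbb{Z}^d\setminus\{0\}$. The vector $\varrho$ satisfies a Diophantine condition with respect to $\alpha$ if for a representative $a$ all the roots $\rho(a)$, $\rho\in\Delta$, belong to $DC_\alpha(\tilde\gamma,\tilde\tau)$ for some $\tilde\gamma,\tilde\tau>0$. *)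

theory Defs
  imports "HOL-Analysis.Analysis"
begin

section \<open>Groups of unitary matrices\<close>

definition conj_transpose :: "complex^'n^'n \<Rightarrow> complex^'n^'n" where
  "conj_transpose A = (\<chi> i j. cnj (A $ j $ i))"

definition unitary :: "complex^'n^'n \<Rightarrow> bool" where
  "unitary A \<longleftrightarrow> A ** conj_transpose A = mat 1 \<and> conj_transpose A ** A = mat 1"

text \<open>Every compact Lie group is isomorphic to a compact subgroup of some unitary group (of
  arbitrary size), and every such subgroup is a Lie group.  No connectedness is required.\<close>

definition compact_group :: "(complex^'n^'n) set \<Rightarrow> bool" where
  "compact_group G \<longleftrightarrow>
     (\<forall>A\<in>G. unitary A) \<and> mat 1 \<in> G \<and> (\<forall>A\<in>G. \<forall>B\<in>G. A ** B \<in> G) \<and>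
     (\<forall>A\<in>G. matrix_inv A \<in> G) \<and> compact G"

definition torus_group :: "(complex^'n^'n) set \<Rightarrow> bool" where
  "torus_group T \<longleftrightarrow> compact_group T \<and> connected T \<and> (\<forall>A\<in>T. \<forall>B\<in>T. A ** B = B ** A)"

definition maximal_torus :: "(complex^'n^'n) set \<Rightarrow> (complex^'n^'n) set \<Rightarrow> bool" where
  "maximal_torus G T \<longleftrightarrow>
     torus_group T \<and> T \<subseteq> G \<and> (\<forall>S. torus_group S \<and> S \<subseteq> G \<and> T \<subseteq> S \<longrightarrow> S = T)"

definition mexp :: "complex^'n^'n \<Rightarrow> complex^'n^'n" where
  "mexp X = (\<Sum>k. (1 / fact k) *\<^sub>R ((**) X ^^ k) (mat 1))"

definition lie_algebra :: "(complex^'n^'n) set \<Rightarrow> (complex^'n^'n) set" where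
  "lie_algebra G = {X. \<forall>t::real. mexp (t *\<^sub>R X) \<in> G}"

definition Ad :: "complex^'n^'n \<Rightarrow> complex^'n^'n \<Rightarrow> complex^'n^'n" where
  "Ad A X = A ** X ** matrix_inv A"

definition mscale :: "complex \<Rightarrow> complex^'n^'n \<Rightarrow> complex^'n^'n" where
  "mscale c X = (\<chi> i j. c * X $ i $ j)"

text \<open>A Lie algebra of skew-Hermitian matrices meets its multiple by \<open>\<i>\<close> only in \<open>0\<close>, so its
  complexification is realised inside the complex matrices.\<close>

definition complexification :: "(complex^'n^'n) set \<Rightarrow> (complex^'n^'n) set" where
  "complexification V = {X + mscale \<i> Y | X Y. X \<in> V \<and> Y \<in> V}"

text \<open>The orthogonal complement is taken for the inner product of \<open>complex^'n^'n\<close>, which is the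
  real part of \<open>trace (X ** conj_transpose Y)\<close> and hence invariant under \<open>Ad\<close> on unitary matrices.
  Root vectors live in the complexified Lie algebra, on which \<open>Ad\<close> acts complex linearly.
  Forms on the Lie algebra of the torus are represented by functions that are
  \<open>undefined\<close> outside of it.\<close>

definition roots ::
    "(complex^'n^'n) set \<Rightarrow> (complex^'n^'n) set \<Rightarrow> (complex^'n^'n \<Rightarrow> real) set" where
  "roots G T = {\<rho> \<in> extensional (lie_algebra T).
     (\<forall>a\<in>lie_algebra T. \<forall>b\<in>lie_algebra T. \<rho> (a + b) = \<rho> a + \<rho> b) \<and>
     (\<forall>c. \<forall>a\<in>lie_algebra T. \<rho> (c *\<^sub>R a) = c * \<rho> a) \<and>
     (\<exists>a\<in>lie_algebra T. \<rho> a \<noteq> 0) \<and>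
     (\<exists>j \<in> complexification (lie_algebra G \<inter> orthogonal_comp (lie_algebra T)).
        j \<noteq> 0 \<and> (\<forall>a\<in>lie_algebra T. Ad (mexp a) j = mscale (exp (2 * \<i> * of_real pi * of_real (\<rho> a))) j))}"

section \<open>Functions on the torus\<close>

text \<open>Functions on \<open>\<real>\<^sup>d / \<int>\<^sup>d\<close> are \<open>\<int>\<^sup>d\<close>-periodic functions on \<open>real^'d\<close>; elements of the
  torus are given by lifts to \<open>real^'d\<close>.\<close>

definition real_vec :: "int^'d \<Rightarrow> real^'d" where
  "real_vec k = (\<chi> i. real_of_int (k $ i))"

definition periodic :: "(real^'d \<Rightarrow> 'b) \<Rightarrow> bool" where
  "periodic f \<longleftrightarrow> (\<forall>x k. f (x + real_vec k) = f x)"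

fun partials :: "'d::finite list \<Rightarrow> (real^'d \<Rightarrow> 'b::real_normed_vector) \<Rightarrow> real^'d \<Rightarrow> 'b" where
  "partials [] f = f"
| "partials (i # is) f = (\<lambda>x. frechet_derivative (partials is f) (at x) (axis i 1))"

definition smooth :: "(real^'d \<Rightarrow> 'b::real_normed_vector) \<Rightarrow> bool" where
  "smooth f \<longleftrightarrow> (\<forall>is. partials is f differentiable_on UNIV)"

definition smooth_maps :: "(complex^'n^'n) set \<Rightarrow> (real^'d \<Rightarrow> complex^'n^'n) set" where
  "smooth_maps G = {f. smooth f \<and> periodic f \<and> range f \<subseteq> G}"

definition smooth_lim ::
    "(nat \<Rightarrow> real^'d \<Rightarrow> 'b::real_normed_vector) \<Rightarrow> (real^'d \<Rightarrow> 'b) \<Rightarrow> bool" where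
  "smooth_lim f g \<longleftrightarrow>
     (\<forall>is. uniform_limit UNIV (\<lambda>i. partials is (f i)) (partials is g) sequentially)"

definition fourier_coeff :: "(real^'d \<Rightarrow> complex) \<Rightarrow> int^'d \<Rightarrow> complex" where
  "fourier_coeff u k =
     (LINT x:cbox 0 1|lebesgue. exp (- (2 * \<i> * of_real pi * of_real (real_vec k \<bullet> x))) * u x)"

text \<open>Squared Sobolev norm of order \<open>s\<close>; it is \<open>\<infinity>\<close> when the series diverges.\<close>

definition sobolev_norm2 :: "real \<Rightarrow> (real^'d \<Rightarrow> complex) \<Rightarrow> ennreal" where
  "sobolev_norm2 s u =
     (\<Sum>\<^sub>\<infinity>k. ennreal ((1 + (norm (real_vec k))\<^sup>2) powr s * (cmod (fourier_coeff u k))\<^sup>2))"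

text \<open>Also for \<open>s < 0\<close> the elements of the space of \<open>G\<close>-valued maps of class \<open>H\<^sup>s\<close> are genuine
  measurable maps with values in \<open>G\<close>, not arbitrary distributions: they are bounded, so that their
  Fourier coefficients are defined.\<close>

definition sobolev_maps :: "real \<Rightarrow> (complex^'n^'n) set \<Rightarrow> (real^'d \<Rightarrow> complex^'n^'n) set" where
  "sobolev_maps s G = {f. f \<in> borel_measurable lebesgue \<and> periodic f \<and> range f \<subseteq> G \<and>
     (\<forall>p q. sobolev_norm2 s (\<lambda>x. f x $ p $ q) < \<infinity>)}"

definition sobolev_lim ::
    "real \<Rightarrow> (nat \<Rightarrow> real^'d \<Rightarrow> complex^'n^'n) \<Rightarrow> (real^'d \<Rightarrow> complex^'n^'n) \<Rightarrow> bool" where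
  "sobolev_lim s f g \<longleftrightarrow>
     (\<forall>p q. (\<lambda>i. sobolev_norm2 s (\<lambda>x. f i x $ p $ q - g x $ p $ q)) \<longlonglongrightarrow> 0)"

section \<open>Diophantine conditions\<close>

definition diophantine :: "real^'d \<Rightarrow> bool" where
  "diophantine \<alpha> \<longleftrightarrow> (\<exists>\<gamma>>0. \<exists>\<tau>>0. \<forall>k::int^'d. k \<noteq> 0 \<longrightarrow>
     infdist (\<alpha> \<bullet> real_vec k) \<int> \<ge> inverse \<gamma> * norm (real_vec k) powr (- \<tau>))"

definition DC :: "real^'d \<Rightarrow> real \<Rightarrow> real \<Rightarrow> real set" where
  "DC \<alpha> \<gamma> \<tau> = {\<beta>. \<forall>k::int^'d. k \<noteq> 0 \<longrightarrow>
     infdist (\<beta> - \<alpha> \<bullet> real_vec k) \<int> \<ge> inverse \<gamma> * norm (real_vec k) powr (- \<tau>)}"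

section \<open>Cocycles\<close>

text \<open>The cocycle \<open>(\<alpha>, A)\<close> is represented by the two arguments \<open>\<alpha>\<close> and \<open>A\<close>; conjugation
  leaves the first component unchanged.\<close>

definition conj_cocycle ::
    "real^'d \<Rightarrow> (real^'d \<Rightarrow> complex^'n^'n) \<Rightarrow> (real^'d \<Rightarrow> complex^'n^'n) \<Rightarrow> real^'d \<Rightarrow> complex^'n^'n" where
  "conj_cocycle \<alpha> H A = (\<lambda>x. H (x + \<alpha>) ** A x ** matrix_inv (H x))"

definition almost_reducible ::
    "(complex^'n^'n) set \<Rightarrow> real^'d \<Rightarrow> (real^'d \<Rightarrow> complex^'n^'n) \<Rightarrow> bool" where
  "almost_reducible G \<alpha> A \<longleftrightarrow> (\<exists>H B. (\<forall>i. H i \<in> smooth_maps G) \<and> (\<forall>i. B i \<in> G) \<and>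
     smooth_lim (\<lambda>i x. matrix_inv (B i) ** conj_cocycle \<alpha> (H i) A x) (\<lambda>x. mat 1))"

text \<open>The set of all representatives of the fibered rotation vector.\<close>

definition rotation_vectors ::
    "(complex^'n^'n) set \<Rightarrow> (complex^'n^'n) set \<Rightarrow> real^'d \<Rightarrow> (real^'d \<Rightarrow> complex^'n^'n) \<Rightarrow>
     (complex^'n^'n) set" where
  "rotation_vectors G T \<alpha> A = {a \<in> lie_algebra T. \<exists>s Hs. \<exists>H \<in> sobolev_maps s G.
     (\<forall>i. Hs i \<in> smooth_maps G) \<and> sobolev_lim s Hs H \<and>
     smooth_lim (\<lambda>i. conj_cocycle \<alpha> (Hs i) A) (\<lambda>x. mexp a)}"

definition rotation_vector_diophantine ::
    "(complex^'n^'n) set \<Rightarrow> (complex^'n^'n) set \<Rightarrow> real^'d \<Rightarrow> (real^'d \<Rightarrow> complex^'n^'n) \<Rightarrow> bool" where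
  "rotation_vector_diophantine G T \<alpha> A \<longleftrightarrow> (\<exists>a \<in> rotation_vectors G T \<alpha> A.
     \<exists>\<gamma>>0. \<exists>\<tau>>0. \<forall>\<rho> \<in> roots G T. \<rho> a \<in> DC \<alpha> \<gamma> \<tau>)"

end

theory Submission
  imports Defs
begin

text \<open>Put \<open>E = exp a\<close>.  The Diophantine conditions bound the inverse of \<open>Y \<mapsto> Y(\<cdot> + \<alpha>) - E Y E*\<close> off its kernel,
  the constants commuting with \<open>E\<close>, with a finite loss of derivatives.  So a cocycle close to \<open>E\<close> is
  conjugated to \<open>E\<close> by a KAM iteration, except for a constant drift in that kernel.  The Sobolev limit
  removes the drift: conjugacies that converge in a negative Sobolev space and have unitary values and
  unitary limit converge in \<open>L\<^sup>1\<close>; hence, after conjugating by one of them, the later ones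
  are close to the identity in mean and almost conjugate the cocycle to \<open>E\<close>, which forces the
  drift to be of second order.

  The iteration yields a conjugacy \<open>K\<close> of any prescribed finite regularity, with a starting point that depends
  on it.  Given another representative \<open>b\<close> with limit conjugacy \<open>H\<close>, the Fourier coefficients of the transition
  map \<open>H K*\<close> intertwine \<open>e\<^sub>k(\<alpha>) E\<close> and \<open>exp b\<close>; they are pairwise orthogonal, hence only finitely
  many are nonzero.  So \<open>H\<close> is almost everywhere as regular as \<open>K\<close>, for every regularity, and is the smooth
  conjugacy to \<open>exp b\<close>.\<close>

text \<open>The resonant constant D is the one part of the error that the cohomological equation
  cannot remove. A conservation law controls it: pairing the almost invariance relation of a unitary
  V with D and integrating over the torus cancels the terms in V(x) and V(x - \<alpha>), so that
  |D|^2 (1 - mean |V - 1|) is at most |D| times the remaining errors. This only needs V to be within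
  1/2 of the identity in mean, which is the reason for L1 distances and the origin of the constants
  1/8 and 1/4 below.

  The Diophantine condition speaks of roots, while the divisors concern the whole Lie algebra. A
  joint eigenvector of the torus is either a root vector or fixed by the torus, and in the second
  case the divisor is governed by \<alpha> alone.

  Norms are weighted by (1 + |k|/N)^S with a scale N that grows along the iteration. Such a weight
  is at most 2^S on the frequencies solved at scale N, so solving costs only the power of N that
  comes from the divisors.\<close>

lemma mscale_nth [simp]: "mscale c X $ i $ j = c * X $ i $ j"
  by (simp add: mscale_def)

lemma conj_transpose_nth [simp]: "conj_transpose X $ i $ j = cnj (X $ j $ i)"
  by (simp add: conj_transpose_def)

lemma mat_eqI: "(\<And>i j. (X::'a^'n^'m) $ i $ j = Y $ i $ j) \<Longrightarrow> X = Y"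
  by (simp add: vec_eq_iff)

lemma mscale_add: "mscale c (X + Y) = mscale c X + mscale c Y"
  by (intro mat_eqI) (simp add: algebra_simps)
lemma mscale_diff: "mscale c (X - Y) = mscale c X - mscale c Y"
  by (intro mat_eqI) (simp add: algebra_simps)
lemma mscale_add_left: "mscale (c + d) X = mscale c X + mscale d X"
  by (intro mat_eqI) (simp add: algebra_simps)
lemma mscale_diff_left: "mscale (c - d) X = mscale c X - mscale d X"
  by (intro mat_eqI) (simp add: algebra_simps)
lemma mscale_mscale [simp]: "mscale c (mscale d X) = mscale (c * d) X"
  by (intro mat_eqI) (simp add: algebra_simps)
lemma mscale_zero [simp]: "mscale c 0 = 0" "mscale 0 X = 0"
  by (intro mat_eqI; simp)+
lemma mscale_one [simp]: "mscale 1 X = X"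
  by (intro mat_eqI) simp
lemma mscale_uminus: "mscale c (- X) = - mscale c X" "mscale (- c) X = - mscale c X"
  by (intro mat_eqI; simp)+
lemma mscale_of_real: "mscale (of_real r) X = r *\<^sub>R X"
  by (intro mat_eqI) (simp flip: scaleR_conv_of_real)
lemma mscale_scaleR: "mscale c (r *\<^sub>R X) = r *\<^sub>R mscale c X"
  by (intro mat_eqI) simp
lemma mscale_mult_left: "mscale c X ** Y = mscale c (X ** Y)"
  by (intro mat_eqI) (simp add: matrix_matrix_mult_def sum_distrib_left mult.assoc)
lemma mscale_mult_right: "X ** mscale c Y = mscale c (X ** Y)"
  by (intro mat_eqI) (simp add: matrix_matrix_mult_def sum_distrib_left mult.left_commute)
lemma mscale_inject: "mscale c X = mscale d X \<longleftrightarrow> c = d \<or> X = 0"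
proof
  assume *: "mscale c X = mscale d X"
  have "c * X$i$j = d * X$i$j" for i j
    using arg_cong[OF *, of "\<lambda>M. M$i$j"] by simp
  then show "c = d \<or> X = 0" by (auto simp: vec_eq_iff)
qed auto

section \<open>Adjoints and the Frobenius norm\<close>

lemma ct_add: "conj_transpose (X + Y) = conj_transpose X + conj_transpose Y"
  by (intro mat_eqI) simp
lemma ct_diff: "conj_transpose (X - Y) = conj_transpose X - conj_transpose Y"
  by (intro mat_eqI) simp
lemma ct_scaleR: "conj_transpose (r *\<^sub>R X) = r *\<^sub>R conj_transpose X"
  by (intro mat_eqI) simp
lemma ct_mscale: "conj_transpose (mscale c X) = mscale (cnj c) (conj_transpose X)"
  by (intro mat_eqI) simp
lemma ct_ct [simp]: "conj_transpose (conj_transpose X) = X"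
  by (intro mat_eqI) simp
lemma ct_mult: "conj_transpose (X ** Y) = conj_transpose Y ** conj_transpose X"
  by (intro mat_eqI) (simp add: matrix_matrix_mult_def mult.commute)
lemma ct_mat [simp]: "conj_transpose (mat 1) = mat 1"
  by (intro mat_eqI) (simp add: mat_def)

lemma norm_matrix_sq: "(norm (X::complex^'n^'m))\<^sup>2 = (\<Sum>i\<in>UNIV. \<Sum>j\<in>UNIV. (cmod (X $ i $ j))\<^sup>2)"
  by (simp add: norm_vec_def L2_set_def sum_nonneg)

lemma norm_mscale: "norm (mscale c X) = cmod c * norm X"
proof -
  have "(norm (mscale c X))\<^sup>2 = (cmod c * norm X)\<^sup>2"
    by (simp add: norm_matrix_sq power_mult_distrib norm_mult sum_distrib_left)
  then show ?thesis by (rule power2_eq_imp_eq) auto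
qed

lemma norm_ct [simp]: "norm (conj_transpose X) = norm X"
proof -
  have "(norm (conj_transpose X))\<^sup>2 = (norm X)\<^sup>2"
    unfolding norm_matrix_sq by (subst sum.swap) simp
  then show ?thesis by (rule power2_eq_imp_eq) auto
qed

text \<open>Cauchy-Schwarz for each entry of the product, then a sum over all entries.\<close>

lemma norm_matrix_mult_le: "norm ((X::complex^'n^'n) ** Y) \<le> norm X * norm Y"
proof -
  have "(norm (X ** Y))\<^sup>2 \<le> (norm X * norm Y)\<^sup>2"
  proof -
    have "(cmod ((X ** Y)$i$j))\<^sup>2 \<le> (\<Sum>k\<in>UNIV. (cmod (X$i$k))\<^sup>2) * (\<Sum>k\<in>UNIV. (cmod (Y$k$j))\<^sup>2)" for i j
    proof -
      have "cmod ((X ** Y)$i$j) \<le> (\<Sum>k\<in>UNIV. cmod (X$i$k) * cmod (Y$k$j))"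
        unfolding matrix_matrix_mult_def by (simp add: sum_norm_le norm_mult)
      then have "(cmod ((X ** Y)$i$j))\<^sup>2 \<le> (\<Sum>k\<in>UNIV. cmod (X$i$k) * cmod (Y$k$j))\<^sup>2"
        by (rule power_mono) simp
      also have "\<dots> \<le> (\<Sum>k\<in>UNIV. (cmod (X$i$k))\<^sup>2) * (\<Sum>k\<in>UNIV. (cmod (Y$k$j))\<^sup>2)"
        by (rule Cauchy_Schwarz_ineq_sum)
      finally show ?thesis .
    qed
    then have "(norm (X ** Y))\<^sup>2 \<le> (\<Sum>i\<in>UNIV. \<Sum>j\<in>UNIV. (\<Sum>k\<in>UNIV. (cmod (X$i$k))\<^sup>2) * (\<Sum>k\<in>UNIV. (cmod (Y$k$j))\<^sup>2))"
      unfolding norm_matrix_sq by (intro sum_mono)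
    also have "\<dots> = (\<Sum>i\<in>UNIV. \<Sum>k\<in>UNIV. (cmod (X$i$k))\<^sup>2) * (\<Sum>j\<in>UNIV. \<Sum>k\<in>UNIV. (cmod (Y$k$j))\<^sup>2)"
      by (simp add: sum_product)
    also have "(\<Sum>j\<in>UNIV. \<Sum>k\<in>UNIV. (cmod (Y$k$j))\<^sup>2) = (norm Y)\<^sup>2"
      unfolding norm_matrix_sq by (rule sum.swap)
    also have "(\<Sum>i\<in>UNIV. \<Sum>k\<in>UNIV. (cmod (X$i$k))\<^sup>2) = (norm X)\<^sup>2"
      unfolding norm_matrix_sq ..
    finally show ?thesis by (simp add: power_mult_distrib)
  qed
  then show ?thesis by (rule power2_le_imp_le) simp
qed

lemma matrix_mult_scaleR:
  fixes X Y :: "complex^'n^'n"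
  shows "(r *\<^sub>R X) ** Y = r *\<^sub>R (X ** Y)" "X ** (r *\<^sub>R Y) = r *\<^sub>R (X ** Y)"
  unfolding mscale_of_real[symmetric] by (simp_all only: mscale_mult_left mscale_mult_right)

lemma matrix_add_rdistrib: "(X + Y) ** Z = X ** Z + Y ** (Z::complex^'n^'n)"
  by (intro mat_eqI) (simp add: matrix_matrix_mult_def algebra_simps sum.distrib)

lemma bounded_bilinear_matrix_mult: "bounded_bilinear ((**) :: complex^'n^'n \<Rightarrow> complex^'n^'n \<Rightarrow> complex^'n^'n)"
  by (standard, auto simp: matrix_add_ldistrib matrix_add_rdistrib matrix_mult_scaleR intro!: exI[of _ 1] norm_matrix_mult_le)

interpretation mm: bounded_bilinear "(**) :: complex^'n^'n \<Rightarrow> complex^'n^'n \<Rightarrow> complex^'n^'n"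
  by (rule bounded_bilinear_matrix_mult)

lemmas mat_simps = mm.add_left mm.add_right mm.diff_left mm.diff_right mm.minus_left mm.minus_right
  mscale_mult_left mscale_mult_right matrix_mult_scaleR matrix_mul_assoc

lemma bounded_linear_ct: "bounded_linear (conj_transpose :: complex^'n^'n \<Rightarrow> _)"
  by (rule bounded_linear_intro[where K=1]) (simp_all add: ct_add ct_scaleR)

lemma bounded_bilinear_mscale: "bounded_bilinear (mscale :: complex \<Rightarrow> complex^'n^'n \<Rightarrow> _)"
  by (standard, auto simp: mscale_add mscale_add_left mscale_scaleR norm_mscale intro!: exI[of _ 1])
     (intro mat_eqI, simp)

interpretation ms: bounded_bilinear "mscale :: complex \<Rightarrow> complex^'n^'n \<Rightarrow> _"
  by (rule bounded_bilinear_mscale)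

text \<open>The inner product of the underlying real space is the real part of the Hilbert-Schmidt
  product. Multiplication by X, on either side, therefore has multiplication by the adjoint matrix
  as its adjoint, and multiplication by a unitary matrix is orthogonal.\<close>

lemma inner_matrix: "inner (X::complex^'n^'n) Y = Re (trace (X ** conj_transpose Y))"
  by (simp add: inner_vec_def trace_def matrix_matrix_mult_def inner_complex_def)

lemma inner_mult_left: "inner (X ** Y) (Z::complex^'n^'n) = inner Y (conj_transpose X ** Z)"
proof -
  have "trace (X ** (Y ** conj_transpose Z)) = trace ((Y ** conj_transpose Z) ** X)"
    by (rule trace_mul_sym)
  then show ?thesis by (simp add: inner_matrix ct_mult matrix_mul_assoc)
qed

lemma inner_ct: "inner (conj_transpose X) (conj_transpose Y) = inner X (Y::complex^'n^'n)"
proof -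
  have "trace (conj_transpose X ** Y) = cnj (trace (X ** conj_transpose Y))"
    unfolding trace_def matrix_matrix_mult_def
    by (simp add: mult.commute, rule sum.swap)
  then show ?thesis by (simp add: inner_matrix)
qed

lemma inner_mult_right: "inner (X ** Y) (Z::complex^'n^'n) = inner X (Z ** conj_transpose Y)"
  using inner_mult_left[of "conj_transpose Y" "conj_transpose X" "conj_transpose Z"]
    inner_ct[of "X ** Y" Z] inner_ct[of X "Z ** conj_transpose Y"]
  by (simp add: ct_mult)

lemma inner_mscale: "inner (mscale c X) (Y::complex^'n^'n) = inner X (mscale (cnj c) Y)"
proof -
  have "inner (mscale c X) Y = Re (c * trace (X ** conj_transpose Y))"
    unfolding inner_matrix by (simp add: mscale_mult_left trace_def sum_distrib_left)
  moreover have "inner X (mscale (cnj c) Y) = Re (c * trace (X ** conj_transpose Y))"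
    unfolding inner_matrix by (simp add: ct_mscale mscale_mult_right trace_def sum_distrib_left)
  ultimately show ?thesis by simp
qed

section \<open>Unitary matrices\<close>

lemma unitary_ct: "unitary U \<Longrightarrow> unitary (conj_transpose U)"
  by (simp add: unitary_def)

lemma unitaryD: "unitary U \<Longrightarrow> conj_transpose U ** U = mat 1" "unitary U \<Longrightarrow> U ** conj_transpose U = mat 1"
  by (simp_all add: unitary_def)

lemma unitary_mult: "unitary U \<Longrightarrow> unitary V \<Longrightarrow> unitary (U ** V)"
proof -
  assume U: "unitary U" and V: "unitary V"
  have "(U ** V) ** (conj_transpose V ** conj_transpose U) = U ** (V ** conj_transpose V) ** conj_transpose U"
    "(conj_transpose V ** conj_transpose U) ** (U ** V) = conj_transpose V ** (conj_transpose U ** U) ** V"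
    by (simp_all only: matrix_mul_assoc)
  then show ?thesis
    using U V by (simp add: unitary_def ct_mult)
qed

lemma inner_unitary: "unitary U \<Longrightarrow> inner (U ** X) (U ** Y) = inner X Y"
  "unitary U \<Longrightarrow> inner (X ** U) (Y ** U) = inner X Y"
  by (simp add: inner_mult_left matrix_mul_assoc unitaryD)
     (simp add: inner_mult_right unitaryD flip: matrix_mul_assoc)

lemma norm_unitary: "unitary U \<Longrightarrow> norm (U ** X) = norm X" "unitary U \<Longrightarrow> norm (X ** U) = norm X"
  by (simp_all add: norm_eq_sqrt_inner inner_unitary)

lemma norm_unitary_eq: "unitary (U::complex^'n^'n) \<Longrightarrow> norm U = norm (mat 1 :: complex^'n^'n)"
  by (metis matrix_mul_rid norm_unitary(1))

lemma matrix_inv_unitary: "unitary U \<Longrightarrow> matrix_inv U = conj_transpose U"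
proof -
  assume U: "unitary U"
  then have "\<exists>V. U ** V = mat 1 \<and> V ** U = mat 1"
    by (auto simp: unitary_def)
  then have "U ** matrix_inv U = mat 1 \<and> matrix_inv U ** U = mat 1"
    unfolding matrix_inv_def by (rule someI_ex)
  then have "conj_transpose U ** (U ** matrix_inv U) = conj_transpose U ** mat 1" by simp
  then show ?thesis
    using U by (simp add: matrix_mul_assoc unitaryD)
qed

subsection \<open>The matrix exponential\<close>

text \<open>The Frobenius norm of the identity is not \<open>1\<close>; a copy of the matrices with the operator norm is
  a Banach algebra to which the library exponential applies.\<close>

typedef (overloaded) ('n::finite) cmat = "UNIV :: (complex^'n^'n) set" ..
setup_lifting type_definition_cmat

instantiation cmat :: (finite) real_normed_algebra_1
begin
lift_definition zero_cmat :: "'a cmat" is 0 .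
lift_definition one_cmat :: "'a cmat" is "mat 1" .
lift_definition plus_cmat :: "'a cmat \<Rightarrow> 'a cmat \<Rightarrow> 'a cmat" is "(+)" .
lift_definition minus_cmat :: "'a cmat \<Rightarrow> 'a cmat \<Rightarrow> 'a cmat" is "(-)" .
lift_definition uminus_cmat :: "'a cmat \<Rightarrow> 'a cmat" is "uminus" .
lift_definition times_cmat :: "'a cmat \<Rightarrow> 'a cmat \<Rightarrow> 'a cmat" is "(**)" .
lift_definition scaleR_cmat :: "real \<Rightarrow> 'a cmat \<Rightarrow> 'a cmat" is "(*\<^sub>R)" .
lift_definition norm_cmat :: "'a cmat \<Rightarrow> real" is "\<lambda>A. onorm ((*v) A)" .
definition dist_cmat :: "'a cmat \<Rightarrow> 'a cmat \<Rightarrow> real" where "dist_cmat a b = norm (a - b)"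
definition sgn_cmat :: "'a cmat \<Rightarrow> 'a cmat" where "sgn_cmat a = scaleR (inverse (norm a)) a"
definition uniformity_cmat :: "('a cmat \<times> 'a cmat) filter" where
  "uniformity_cmat = (INF e\<in>{0 <..}. principal {(x, y). dist x y < e})"
definition open_cmat :: "'a cmat set \<Rightarrow> bool" where
  "open_cmat U \<longleftrightarrow> (\<forall>x\<in>U. eventually (\<lambda>(x', y). x' = x \<longrightarrow> y \<in> U) uniformity)"

lemma onorm_zero_matrix: "onorm ((*v) (A::complex^'n^'n)) = 0 \<longleftrightarrow> A = 0"
proof
  assume "onorm ((*v) A) = 0"
  then have "A *v x = 0" for x
    using onorm_eq_0[of "(*v) A"] by simp
  then show "A = 0"
    by (simp add: matrix_eq)
next
  assume "A = 0"
  then have "(*v) A = (\<lambda>x. 0)" by (simp add: fun_eq_iff)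
  then show "onorm ((*v) A) = 0" by (simp add: onorm_zero)
qed

instance
proof
  fix a b c :: "'a cmat" and r s :: real
  show "a + b + c = a + (b + c)" by transfer simp
  show "a + b = b + a" by transfer simp
  show "0 + a = a" by transfer simp
  show "- a + a = 0" by transfer simp
  show "a - b = a + - b" by transfer simp
  show "a * b * c = a * (b * c)" by transfer (simp add: matrix_mul_assoc)
  show "1 * a = a" "a * 1 = a" by (transfer; simp)+
  show "(a + b) * c = a * c + b * c" by transfer (rule mm.add_left)
  show "a * (b + c) = a * b + a * c" by transfer (rule mm.add_right)
  show "(0::'a cmat) \<noteq> 1" by transfer (simp add: vec_eq_iff mat_def)
  show "r *\<^sub>R (a + b) = r *\<^sub>R a + r *\<^sub>R b" "(r + s) *\<^sub>R a = r *\<^sub>R a + s *\<^sub>R a"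
    "r *\<^sub>R s *\<^sub>R a = (r * s) *\<^sub>R a" "1 *\<^sub>R a = a"
    by (transfer; simp add: algebra_simps)+
  show "r *\<^sub>R a * b = r *\<^sub>R (a * b)" "a * r *\<^sub>R b = r *\<^sub>R (a * b)"
    by (transfer; simp add: matrix_mult_scaleR)+
  show "norm a = 0 \<longleftrightarrow> a = 0" by transfer (rule onorm_zero_matrix)
  show "norm (a + b) \<le> norm a + norm b"
  proof -
    have "(*v) (Rep_cmat a + Rep_cmat b) = (\<lambda>x. Rep_cmat a *v x + Rep_cmat b *v x)"
      by (simp add: fun_eq_iff matrix_vector_mult_add_rdistrib)
    then show ?thesis
      using onorm_triangle[of "(*v) (Rep_cmat a)" "(*v) (Rep_cmat b)"]
      by (simp add: norm_cmat.rep_eq plus_cmat.rep_eq)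
  qed
  show "norm (r *\<^sub>R a) = \<bar>r\<bar> * norm a"
  proof -
    have "(*v) (r *\<^sub>R Rep_cmat a) = (\<lambda>x. r *\<^sub>R (Rep_cmat a *v x))"
      by (simp add: fun_eq_iff vec_eq_iff matrix_vector_mult_def scaleR_sum_right)
    then show ?thesis
      using onorm_scaleR[of "(*v) (Rep_cmat a)" r]
      by (simp add: norm_cmat.rep_eq scaleR_cmat.rep_eq)
  qed
  show "norm (a * b) \<le> norm a * norm b"
    using onorm_compose[of "(*v) (Rep_cmat a)" "(*v) (Rep_cmat b)"]
    by (simp add: norm_cmat.rep_eq times_cmat.rep_eq o_def matrix_vector_mul_assoc)
  show "norm (1::'a cmat) = 1"
  proof -
    have "(*v) (mat 1 :: complex^'a^'a) = (\<lambda>x. x)" by (simp add: fun_eq_iff)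
    then show ?thesis by (simp add: norm_cmat.rep_eq one_cmat.rep_eq onorm_id)
  qed
  show "dist a b = norm (a - b)" "sgn a = scaleR (inverse (norm a)) a"
    "uniformity = (INF e\<in>{0 <..}. principal {(x::'a cmat, y). dist x y < e})"
    by (simp_all add: dist_cmat_def sgn_cmat_def uniformity_cmat_def)
  show "open U \<longleftrightarrow> (\<forall>x\<in>U. eventually (\<lambda>(x', y). x' = x \<longrightarrow> y \<in> U) uniformity)" for U :: "'a cmat set"
    by (simp add: open_cmat_def)
qed
end

lemma norm_matrix_vector_le: "norm ((A::complex^'n^'n) *v x) \<le> norm A * norm x"
proof -
  have "(norm (A *v x))\<^sup>2 \<le> (norm A * norm x)\<^sup>2"
  proof -
    have "(cmod ((A *v x)$i))\<^sup>2 \<le> (\<Sum>k\<in>UNIV. (cmod (A$i$k))\<^sup>2) * (\<Sum>k\<in>UNIV. (cmod (x$k))\<^sup>2)" for i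
    proof -
      have "cmod ((A *v x)$i) \<le> (\<Sum>k\<in>UNIV. cmod (A$i$k) * cmod (x$k))"
        unfolding matrix_vector_mult_def by (simp add: sum_norm_le norm_mult)
      then have "(cmod ((A *v x)$i))\<^sup>2 \<le> (\<Sum>k\<in>UNIV. cmod (A$i$k) * cmod (x$k))\<^sup>2"
        by (rule power_mono) simp
      also have "\<dots> \<le> (\<Sum>k\<in>UNIV. (cmod (A$i$k))\<^sup>2) * (\<Sum>k\<in>UNIV. (cmod (x$k))\<^sup>2)"
        by (rule Cauchy_Schwarz_ineq_sum)
      finally show ?thesis .
    qed
    then have "(\<Sum>i\<in>UNIV. (cmod ((A *v x)$i))\<^sup>2) \<le>
        (\<Sum>i\<in>UNIV. (\<Sum>k\<in>UNIV. (cmod (A$i$k))\<^sup>2) * (\<Sum>k\<in>UNIV. (cmod (x$k))\<^sup>2))"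
      by (intro sum_mono)
    then show ?thesis
      unfolding power_mult_distrib norm_matrix_sq
      by (simp add: norm_vec_def L2_set_def sum_nonneg flip: sum_distrib_right)
  qed
  then show ?thesis by (rule power2_le_imp_le) simp
qed

lemma bounded_linear_Abs_cmat: "bounded_linear (Abs_cmat :: complex^'n^'n \<Rightarrow> _)"
proof (rule bounded_linear_intro[where K=1])
  show "norm (Abs_cmat x) \<le> norm x * 1" for x :: "complex^'n^'n"
    by (simp add: norm_cmat.abs_eq onorm_bound norm_matrix_vector_le)
qed (simp_all add: plus_cmat.abs_eq scaleR_cmat.abs_eq)

text \<open>Together with the bound in the other direction this makes the operator norm and the
  Frobenius norm equivalent, so that series and limits pass between \<open>cmat\<close> and the
  matrices. Each of the \<open>CARD('n)\<close> squared entries is at most the operator norm, whence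
  the factor.\<close>

lemma bounded_linear_Rep_cmat: "bounded_linear (Rep_cmat :: 'n::finite cmat \<Rightarrow> _)"
proof (rule bounded_linear_intro[where K="CARD('n)"])
  show "norm (Rep_cmat x) \<le> norm x * CARD('n)" for x :: "'n cmat"
  proof -
    have "cmod (Rep_cmat x $ i $ j) \<le> norm x" for i j
    proof -
      have "Rep_cmat x $ i $ j = (Rep_cmat x *v axis j 1) $ i"
        by (simp add: matrix_vector_mult_def axis_def if_distrib cong: if_cong)
      also have "cmod \<dots> \<le> norm (Rep_cmat x *v axis j 1)" by (rule Finite_Cartesian_Product.norm_nth_le)
      also have "\<dots> \<le> norm x * norm (axis j (1::complex) :: complex^'n)"
        unfolding norm_cmat.rep_eq by (rule onorm) simp
      finally show ?thesis by (simp add: norm_axis_1)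
    qed
    then have "(norm (Rep_cmat x))\<^sup>2 \<le> (\<Sum>i\<in>(UNIV::'n set). \<Sum>j\<in>(UNIV::'n set). (norm x)\<^sup>2)"
      unfolding norm_matrix_sq by (intro sum_mono power_mono) auto
    also have "\<dots> = (norm x * CARD('n))\<^sup>2" by (simp add: power2_eq_square)
    finally show ?thesis by (rule power2_le_imp_le) simp
  qed
qed (simp_all add: plus_cmat.rep_eq scaleR_cmat.rep_eq)

instance cmat :: (finite) banach
proof
  fix X :: "nat \<Rightarrow> 'a cmat" assume "Cauchy X"
  then have "Cauchy (\<lambda>n. Rep_cmat (X n))" by (rule bounded_linear.Cauchy[OF bounded_linear_Rep_cmat])
  then obtain L where "(\<lambda>n. Rep_cmat (X n)) \<longlonglongrightarrow> L" using Cauchy_convergent_iff convergentD by blast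
  then have "(\<lambda>n. Abs_cmat (Rep_cmat (X n))) \<longlonglongrightarrow> Abs_cmat L"
    by (rule bounded_linear.tendsto[OF bounded_linear_Abs_cmat])
  then show "convergent X" by (auto simp: Rep_cmat_inverse intro: convergentI)
qed

definition mpow :: "complex^'n^'n \<Rightarrow> nat \<Rightarrow> complex^'n^'n" where
  "mpow X k = ((**) X ^^ k) (mat 1)"

lemma mpow_0 [simp]: "mpow X 0 = mat 1"
  and mpow_Suc: "mpow X (Suc k) = X ** mpow X k"
  by (simp_all add: mpow_def)

lemma Rep_cmat_power: "Rep_cmat (x ^ k) = mpow (Rep_cmat x) k"
  by (induction k) (simp_all add: mpow_Suc one_cmat.rep_eq times_cmat.rep_eq)

lemma mexp_sums_aux: "(\<lambda>k. (1 / fact k) *\<^sub>R mpow X k) sums Rep_cmat (exp (Abs_cmat X))"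
proof -
  have "(\<lambda>k. Rep_cmat (Abs_cmat X ^ k /\<^sub>R fact k)) sums Rep_cmat (exp (Abs_cmat X))"
    by (rule bounded_linear.sums[OF bounded_linear_Rep_cmat exp_converges])
  then show ?thesis
    by (simp add: scaleR_cmat.rep_eq Rep_cmat_power Abs_cmat_inverse divide_inverse)
qed

lemma mexp_conv_exp: "mexp X = Rep_cmat (exp (Abs_cmat X))"
  unfolding mexp_def mpow_def[symmetric] using mexp_sums_aux by (rule sums_unique[symmetric])

lemma mexp_sums: "(\<lambda>k. (1 / fact k) *\<^sub>R mpow X k) sums mexp X"
  unfolding mexp_conv_exp by (rule mexp_sums_aux)

lemma mexp_add: "X ** Y = Y ** X \<Longrightarrow> mexp (X + Y) = mexp X ** mexp Y"
  using exp_add_commuting[of "Abs_cmat X" "Abs_cmat Y"]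
  by (simp add: mexp_conv_exp times_cmat.abs_eq plus_cmat.abs_eq times_cmat.rep_eq[symmetric])

lemma mexp_0 [simp]: "mexp 0 = mat 1"
  by (simp add: mexp_conv_exp one_cmat.rep_eq flip: zero_cmat_def)

lemma mexp_minus: "mexp X ** mexp (- X) = mat 1" "mexp (- X) ** mexp X = mat 1"
  using mexp_add[of X "- X"] mexp_add[of "- X" X] by (simp_all add: mat_simps)

lemma mexp_add_scaleR: "mexp ((s + t) *\<^sub>R X) = mexp (s *\<^sub>R X) ** mexp (t *\<^sub>R X)"
  unfolding scaleR_add_left by (rule mexp_add) (simp add: mat_simps)

lemma mexp_of_nat: "mexp (real k *\<^sub>R X) = mpow (mexp X) k"
proof (induction k)
  case (Suc k)
  have "mexp (real (Suc k) *\<^sub>R X) = mexp (1 *\<^sub>R X) ** mexp (real k *\<^sub>R X)"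
    unfolding mexp_add_scaleR[symmetric] by simp
  then show ?case by (simp add: Suc mpow_Suc)
qed simp

lemma mpow_intertwine: "X ** P = P ** Y \<Longrightarrow> mpow X k ** P = (P::complex^'n^'n) ** mpow Y k"
proof (induction k)
  case (Suc k)
  then show ?case by (simp add: mpow_Suc) (metis matrix_mul_assoc)
qed simp

text \<open>The relation passes to all powers and, by continuity of multiplication, to the
  exponential series. For invertible P it says that conjugation commutes with the exponential; for Y
  = X it says that whatever commutes with X commutes with its exponential.\<close>

lemma mexp_intertwine: "X ** P = P ** Y \<Longrightarrow> mexp X ** P = (P::complex^'n^'n) ** mexp Y"
proof -
  assume *: "X ** P = P ** Y"
  have "(\<lambda>k. ((1 / fact k) *\<^sub>R mpow X k) ** P) sums (mexp X ** P)"
    by (rule bounded_linear.sums[OF mm.bounded_linear_left[of P] mexp_sums[of X]])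
  moreover have "(\<lambda>k. P ** ((1 / fact k) *\<^sub>R mpow Y k)) sums (P ** mexp Y)"
    by (rule bounded_linear.sums[OF mm.bounded_linear_right[of P] mexp_sums[of Y]])
  ultimately show ?thesis
    by (simp add: matrix_mult_scaleR mpow_intertwine[OF *] sums_unique2)
qed

lemma mexp_scalar: "mexp (mscale c (mat 1)) = mscale (exp c) (mat 1 :: complex^'n^'n)"
proof -
  have p: "mpow (mscale c (mat 1)) k = mscale (c ^ k) (mat 1 :: complex^'n^'n)" for k
    by (induction k) (simp_all add: mpow_Suc mat_simps mult.commute)
  have "(\<lambda>k. mscale (c ^ k /\<^sub>R fact k) (mat 1)) sums mscale (exp c) (mat 1 :: complex^'n^'n)"
    by (rule bounded_linear.sums[OF ms.bounded_linear_left exp_converges])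
  moreover have "mscale (c ^ k /\<^sub>R fact k) (mat 1) = (1 / fact k) *\<^sub>R mpow (mscale c (mat 1 :: complex^'n^'n)) k" for k
    unfolding p by (simp add: ms.scaleR_left divide_inverse)
  ultimately show ?thesis
    using mexp_sums[of "mscale c (mat 1 :: complex^'n^'n)"] sums_unique2 by auto
qed

text \<open>The hypothesis reads X P = P (X + c 1), and the scalar part splits off from the
  exponential because it is central. This turns an infinitesimal eigenvalue into an eigenvalue of
  the adjoint action.\<close>

lemma mexp_eigen:
  assumes "X ** P - P ** X = mscale c (P::complex^'n^'n)"
  shows "mexp X ** P = mscale (exp c) (P ** mexp X)"
proof -
  have "X ** P = P ** (X + mscale c (mat 1))"
    using assms by (simp add: mat_simps algebra_simps)
  then have "mexp X ** P = P ** mexp (X + mscale c (mat 1))" by (rule mexp_intertwine)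
  also have "mexp (X + mscale c (mat 1)) = mexp X ** mscale (exp c) (mat 1)"
    using mexp_add[of X "mscale c (mat 1)"] by (simp add: mat_simps mexp_scalar)
  finally show ?thesis by (simp add: mat_simps)
qed

subsection \<open>Weighted trigonometric polynomials\<close>

definition ek :: "int^'d \<Rightarrow> real^'d \<Rightarrow> complex" where
  "ek k x = exp (2 * \<i> * of_real pi * of_real (real_vec k \<bullet> x))"

lemma real_vec_add: "real_vec (k + l) = real_vec k + real_vec l"
  by (simp add: real_vec_def vec_eq_iff)
lemma real_vec_uminus: "real_vec (- k) = - real_vec k"
  by (simp add: real_vec_def vec_eq_iff)
lemma real_vec_0 [simp]: "real_vec 0 = 0"
  by (simp add: real_vec_def vec_eq_iff)
lemma real_vec_nth [simp]: "real_vec k $ i = real_of_int (k $ i)"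
  by (simp add: real_vec_def)
lemma real_vec_eq_0_iff [simp]: "real_vec k = 0 \<longleftrightarrow> k = 0"
  by (simp add: vec_eq_iff)

lemma ek_add: "ek (k + l) x = ek k x * ek l x"
  by (simp add: ek_def real_vec_add inner_add_left ring_distribs exp_add)
lemma ek_shift: "ek k (x + y) = ek k x * ek k y"
  by (simp add: ek_def inner_add_right ring_distribs exp_add)
lemma ek_0 [simp]: "ek 0 x = 1" "ek k 0 = 1"
  by (simp_all add: ek_def)
lemma ek_cis: "ek k x = cis (2 * pi * (real_vec k \<bullet> x))"
  by (simp add: ek_def cis_conv_exp mult_ac)
lemma norm_ek [simp]: "cmod (ek k x) = 1"
  by (simp add: ek_cis)
lemma cnj_ek: "cnj (ek k x) = ek (- k) x"
  by (simp add: ek_cis cis_cnj real_vec_uminus)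
lemma ek_real_vec [simp]: "ek k (real_vec l) = 1"
proof -
  have "real_vec k \<bullet> real_vec l = of_int (\<Sum>i\<in>UNIV. k $ i * l $ i)"
    by (simp add: inner_vec_def)
  then show ?thesis
    unfolding ek_cis by (simp only: cis_multiple_2pi Ints_of_int)
qed
lemma continuous_on_ek [continuous_intros]: "continuous_on S (ek k)"
  unfolding ek_def by (intro continuous_intros)

text \<open>A list of frequencies with coefficients, in which frequencies may repeat. No normal form
  is kept, so sums are concatenations and products are lists of all pairwise products;
  \<open>tnorm\<close> then only dominates the Wiener norm, which suffices for upper bounds.\<close>

definition tpoly :: "((int^'d) \<times> (complex^'n^'n)) list \<Rightarrow> real^'d \<Rightarrow> complex^'n^'n" where
  "tpoly ps x = (\<Sum>p\<leftarrow>ps. mscale (ek (fst p) x) (snd p))"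

definition tnorm :: "(int^'d \<Rightarrow> real) \<Rightarrow> ((int^'d) \<times> (complex^'n^'n)) list \<Rightarrow> real" where
  "tnorm w ps = (\<Sum>p\<leftarrow>ps. w (fst p) * norm (snd p))"

lemma tpoly_simps [simp]: "tpoly [] x = 0" "tpoly (p # ps) x = mscale (ek (fst p) x) (snd p) + tpoly ps x"
  and tnorm_simps [simp]: "tnorm w [] = 0" "tnorm w (p # ps) = w (fst p) * norm (snd p) + tnorm w ps"
  by (simp_all add: tpoly_def tnorm_def)

lemma tpoly_append [simp]: "tpoly (ps @ qs) x = tpoly ps x + tpoly qs x"
  and tnorm_append [simp]: "tnorm w (ps @ qs) = tnorm w ps + tnorm w qs"
  by (simp_all add: tpoly_def tnorm_def)

text \<open>Submultiplicativity makes the weighted norm an algebra norm, symmetry makes it invariant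
  under adjoints, and the lower bound 1 makes it dominate the supremum norm.\<close>

definition weight :: "(int^'d \<Rightarrow> real) \<Rightarrow> bool" where
  "weight w \<longleftrightarrow> w 0 = 1 \<and> (\<forall>k. 1 \<le> w k) \<and> (\<forall>k l. w (k + l) \<le> w k * w l) \<and> (\<forall>k. w (- k) = w k)"

lemma weightD: assumes "weight w" shows "w 0 = 1" "1 \<le> w k" "0 \<le> w k" "w (k + l) \<le> w k * w l" "w (- k) = w k"
  using assms order_trans[of 0 1 "w k"] by (auto simp: weight_def)

lemma tnorm_nonneg: "weight w \<Longrightarrow> 0 \<le> tnorm w ps"
  unfolding tnorm_def by (intro sum_list_nonneg) (auto simp: weightD)

lemma norm_tpoly_le: "weight w \<Longrightarrow> norm (tpoly ps x) \<le> tnorm w ps"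
proof (induction ps)
  case (Cons p ps)
  have "norm (tpoly (p # ps) x) \<le> norm (snd p) + norm (tpoly ps x)"
    by (simp add: norm_triangle_le norm_mscale)
  also have "\<dots> \<le> w (fst p) * norm (snd p) + tnorm w ps"
    using Cons mult_right_mono[of 1 "w (fst p)" "norm (snd p)"] by (intro add_mono) (auto simp: weightD)
  finally show ?case by simp
qed simp

lemma continuous_on_tpoly [continuous_intros]: "continuous_on S (tpoly ps)"
proof (induction ps)
  case (Cons p ps)
  then show ?case
    by (simp add: tpoly_def) (intro continuous_intros ms.continuous_on)
qed (simp add: tpoly_def)

lemma tpoly_periodic: "tpoly ps (x + real_vec l) = tpoly ps x"
  by (induction ps) (simp_all add: ek_shift)

text \<open>The weighted Wiener norm is at most \<open>r\<close>; the closure of polynomials replaces Fourier coefficients,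
  which are awkward for products and exponentials.\<close>

definition wb :: "(int^'d \<Rightarrow> real) \<Rightarrow> real \<Rightarrow> (real^'d \<Rightarrow> complex^'n^'n) \<Rightarrow> bool" where
  "wb w r f \<longleftrightarrow> (\<forall>\<epsilon>>0. \<exists>ps. tnorm w ps \<le> r \<and> (\<forall>x. norm (f x - tpoly ps x) \<le> \<epsilon>))"

lemma wbE:
  assumes "wb w r f" "\<epsilon> > 0"
  obtains ps where "tnorm w ps \<le> r" "\<And>x. norm (f x - tpoly ps x) \<le> \<epsilon>"
  using assms unfolding wb_def by blast

lemma wb_tpoly: "tnorm w ps \<le> r \<Longrightarrow> wb w r (tpoly ps)"
  unfolding wb_def by (metis diff_self norm_zero order_less_imp_le)

lemma wb_const:
  fixes w :: "int^'d \<Rightarrow> real"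
  assumes "weight w" "norm C \<le> r" shows "wb w r (\<lambda>_. C)"
proof -
  from assms have "wb w r (tpoly [(0, C)])" by (intro wb_tpoly) (simp add: weightD)
  moreover have "tpoly [(0::int^'d, C)] = (\<lambda>_. C)" by (simp add: fun_eq_iff)
  ultimately show ?thesis by simp
qed

lemma wb_0: "weight w \<Longrightarrow> 0 \<le> r \<Longrightarrow> wb w r (\<lambda>_. 0)"
  by (rule wb_const) auto

lemma wb_mono: "wb w r f \<Longrightarrow> r \<le> s \<Longrightarrow> wb w s f"
  unfolding wb_def by (meson order_trans)

lemma wb_norm: assumes "weight w" "wb w r f" shows "norm (f x) \<le> r"
proof (rule field_le_epsilon)
  fix e :: real assume "e > 0"
  with assms obtain ps where "tnorm w ps \<le> r" "norm (f x - tpoly ps x) \<le> e" by (metis wbE)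
  then show "norm (f x) \<le> r + e"
    using norm_tpoly_le[OF assms(1), of ps x] norm_triangle_sub[of "f x" "tpoly ps x"] by linarith
qed

lemma wb_nonneg: "weight w \<Longrightarrow> wb w r f \<Longrightarrow> 0 \<le> r"
  using wb_norm norm_ge_zero order_trans by blast

lemma wb_add: assumes "wb w r f" "wb w s g" shows "wb w (r + s) (\<lambda>x. f x + g x)"
  unfolding wb_def
proof (intro allI impI)
  fix e :: real assume "e > 0"
  then have "e / 2 > 0" by simp
  obtain ps where ps: "tnorm w ps \<le> r" "\<And>x. norm (f x - tpoly ps x) \<le> e / 2" using wbE[OF assms(1) \<open>e / 2 > 0\<close>] by blast
  obtain qs where qs: "tnorm w qs \<le> s" "\<And>x. norm (g x - tpoly qs x) \<le> e / 2" using wbE[OF assms(2) \<open>e / 2 > 0\<close>] by blast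
  have "norm (f x + g x - tpoly (ps @ qs) x) \<le> e" for x
    using norm_triangle_le[of "f x - tpoly ps x" "g x - tpoly qs x" e] ps(2)[of x] qs(2)[of x]
    by (simp add: algebra_simps)
  then show "\<exists>ps. tnorm w ps \<le> r + s \<and> (\<forall>x. norm (f x + g x - tpoly ps x) \<le> e)"
    using ps(1) qs(1) by (intro exI[of _ "ps @ qs"]) auto
qed

text \<open>The index map covers shifts, adjoints and linear images at once.\<close>

lemma wb_map:
  fixes f :: "real^'d \<Rightarrow> complex^'n^'n" and L :: "complex^'n^'n \<Rightarrow> complex^'n^'n"
  assumes f: "wb w r f" and w: "weight w" and "K \<ge> 0" and L: "\<And>c. norm (L c) \<le> K * norm c"
    and add: "\<And>c d. L (c - d) = L c - L d"
    and M: "\<And>k c. norm (M k c) \<le> K * norm c"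
    and \<sigma>: "\<And>k. w (\<sigma> k) = w k"
    and eq: "\<And>k x c. L (mscale (ek k (h x)) c) = mscale (ek (\<sigma> k) x) (M k c)"
  shows "wb w (K * r) (\<lambda>x. L (f (h x)))"
  unfolding wb_def
proof (intro allI impI)
  fix e :: real assume "e > 0"
  then have "e / (K + 1) > 0" using \<open>K \<ge> 0\<close> by simp
  obtain ps where ps: "tnorm w ps \<le> r" "\<And>x. norm (f x - tpoly ps x) \<le> e / (K + 1)"
    using wbE[OF f \<open>e / (K + 1) > 0\<close>] by blast
  define qs where "qs = map (\<lambda>p. (\<sigma> (fst p), M (fst p) (snd p))) ps"
  have L0: "L 0 = 0" using add[of 0 0] by simp
  have Ladd: "L (c + d) = L c + L d" for c d
    using add[of c "- d"] add[of 0 d] L0 by simp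
  have q: "tpoly qs x = L (tpoly ps (h x))" for x
    unfolding qs_def by (induction ps) (simp_all add: L0 Ladd eq)
  have "tnorm w qs \<le> K * tnorm w ps"
    unfolding qs_def
  proof (induction ps)
    case (Cons p ps)
    have "w (fst p) * norm (M (fst p) (snd p)) \<le> w (fst p) * (K * norm (snd p))"
      using M w by (intro mult_left_mono) (auto simp: weightD)
    with Cons show ?case by (simp add: \<sigma> algebra_simps)
  qed simp
  also have "\<dots> \<le> K * r" using ps \<open>K \<ge> 0\<close> by (simp add: mult_left_mono)
  finally have "tnorm w qs \<le> K * r" .
  moreover have "norm (L (f (h x)) - tpoly qs x) \<le> e" for x
  proof -
    have "norm (L (f (h x)) - tpoly qs x) \<le> K * norm (f (h x) - tpoly ps (h x))"
      unfolding q add[symmetric] by (rule L)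
    also have "\<dots> \<le> K * (e / (K + 1))" using ps(2) \<open>K \<ge> 0\<close> by (intro mult_left_mono)
    also have "\<dots> \<le> e" using \<open>K \<ge> 0\<close> \<open>e > 0\<close> by (simp add: field_simps)
    finally show ?thesis .
  qed
  ultimately show "\<exists>ps. tnorm w ps \<le> K * r \<and> (\<forall>x. norm (L (f (h x)) - tpoly ps x) \<le> e)" by blast
qed

lemma wb_scaleR: assumes "weight w" "wb w r f" shows "wb w (\<bar>c\<bar> * r) (\<lambda>x. c *\<^sub>R f x)"
  using assms by (intro wb_map[where \<sigma>="\<lambda>k. k" and M="\<lambda>_ d. c *\<^sub>R d" and h="\<lambda>x. x"])
    (auto simp: algebra_simps mscale_scaleR)

lemma wb_minus: assumes "weight w" "wb w r f" shows "wb w r (\<lambda>x. - f x)"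
  using wb_scaleR[OF assms, of "-1"] by simp

lemma wb_diff: assumes "weight w" "wb w r f" "wb w s g" shows "wb w (r + s) (\<lambda>x. f x - g x)"
  using wb_add[OF assms(2) wb_minus[OF assms(1,3)]] by simp

lemma wb_shift: assumes "weight w" "wb w r f" shows "wb w r (\<lambda>x. f (x + a))"
  using wb_map[OF assms(2,1), of 1 "\<lambda>c. c" "\<lambda>k c. mscale (ek k a) c" "\<lambda>k. k" "\<lambda>x. x + a"]
  by (simp add: norm_mscale ek_shift mult.commute)

lemma wb_ct: assumes "weight w" "wb w r f" shows "wb w r (\<lambda>x. conj_transpose (f x))"
  using wb_map[OF assms(2,1), of 1 conj_transpose "\<lambda>k c. conj_transpose c" "uminus" "\<lambda>x. x"] assms(1)
  by (simp add: ct_diff weightD ct_mscale cnj_ek)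

lemma wb_unitary_sandwich:
  assumes "weight w" "wb w r f" "unitary U" "unitary V" shows "wb w r (\<lambda>x. U ** f x ** V)"
  using wb_map[OF assms(2,1), of 1 "\<lambda>c. U ** c ** V" "\<lambda>k c. U ** c ** V" "\<lambda>k. k" "\<lambda>x. x"] assms(3,4)
  by (simp add: mat_simps norm_unitary)

definition tprod :: "((int^'d) \<times> (complex^'n^'n)) list \<Rightarrow> ((int^'d) \<times> (complex^'n^'n)) list \<Rightarrow> ((int^'d) \<times> (complex^'n^'n)) list" where
  "tprod ps qs = concat (map (\<lambda>p. map (\<lambda>q. (fst p + fst q, snd p ** snd q)) qs) ps)"

lemma tpoly_tprod: "tpoly (tprod ps qs) x = tpoly ps x ** tpoly qs x"
proof -
  have "tpoly (map (\<lambda>q. (fst p + fst q, snd p ** snd q)) qs) x = mscale (ek (fst p) x) (snd p) ** tpoly qs x" for p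
    by (induction qs) (simp_all add: mat_simps ek_add mscale_add mult.commute)
  then show ?thesis
    by (induction ps) (simp_all add: tprod_def mat_simps)
qed

lemma tnorm_tprod: assumes w: "weight w" shows "tnorm w (tprod ps qs) \<le> tnorm w ps * tnorm w qs"
proof -
  have *: "tnorm w (map (\<lambda>q. (fst p + fst q, snd p ** snd q)) qs) \<le> (w (fst p) * norm (snd p)) * tnorm w qs" for p
  proof (induction qs)
    case (Cons q qs)
    have "w (fst p + fst q) * norm (snd p ** snd q) \<le> (w (fst p) * w (fst q)) * (norm (snd p) * norm (snd q))"
      using w by (intro mult_mono norm_matrix_mult_le) (auto simp: weightD)
    with Cons show ?case by (simp add: algebra_simps)
  qed simp
  show ?thesis
  proof (induction ps)
    case (Cons p ps)
    then show ?case using *[of p] by (simp add: tprod_def algebra_simps)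
  qed (simp add: tprod_def)
qed

lemma wb_mult:
  assumes w: "weight w" and f: "wb w r f" and g: "wb w s g"
  shows "wb w (r * s) (\<lambda>x. f x ** g x)"
  unfolding wb_def
proof (intro allI impI)
  fix e :: real assume "e > 0"
  have rs: "r \<ge> 0" "s \<ge> 0" using f g w wb_nonneg by blast+
  \<comment> \<open>The summand 1 keeps the denominator positive when both bounds are 0. The error
    of the product is split as (f - p) g + p (g - q), which respects the order of the
    factors.\<close>
  define d where "d = e / (r + s + 1)"
  have "d > 0" using \<open>e > 0\<close> rs by (simp add: d_def)
  obtain ps where ps: "tnorm w ps \<le> r" "\<And>x. norm (f x - tpoly ps x) \<le> d" using wbE[OF f \<open>d > 0\<close>] by blast
  obtain qs where qs: "tnorm w qs \<le> s" "\<And>x. norm (g x - tpoly qs x) \<le> d" using wbE[OF g \<open>d > 0\<close>] by blast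
  have "norm (f x ** g x - tpoly (tprod ps qs) x) \<le> e" for x
  proof -
    have "f x ** g x - tpoly (tprod ps qs) x = (f x - tpoly ps x) ** g x + tpoly ps x ** (g x - tpoly qs x)"
      by (simp add: tpoly_tprod mat_simps)
    also have "norm \<dots> \<le> norm (f x - tpoly ps x) * norm (g x) + norm (tpoly ps x) * norm (g x - tpoly qs x)"
      by (intro norm_triangle_le add_mono norm_matrix_mult_le)
    also have "\<dots> \<le> d * s + r * d"
      using ps(1) ps(2)[of x] qs(2)[of x] wb_norm[OF w g, of x] norm_tpoly_le[OF w, of ps x] \<open>d > 0\<close> rs
      by (intro add_mono mult_mono) auto
    also have "\<dots> = (r + s) * d" by (simp add: algebra_simps)
    also have "\<dots> \<le> (r + s + 1) * d" using \<open>d > 0\<close> by simp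
    also have "\<dots> = e" using rs by (simp add: d_def)
    finally show ?thesis .
  qed
  moreover have "tnorm w (tprod ps qs) \<le> r * s"
    using tnorm_tprod[OF w, of ps qs] ps(1) qs(1) rs tnorm_nonneg[OF w]
    by (meson mult_mono order_trans)
  ultimately show "\<exists>ps. tnorm w ps \<le> r * s \<and> (\<forall>x. norm (f x ** g x - tpoly ps x) \<le> e)" by blast
qed

lemma wb_weight:
  assumes "wb w r f" "\<And>k. w' k \<le> C * w k" "C \<ge> 0" shows "wb w' (C * r) f"
  unfolding wb_def
proof (intro allI impI)
  fix e :: real assume "e > 0"
  then obtain ps where ps: "tnorm w ps \<le> r" "\<And>x. norm (f x - tpoly ps x) \<le> e" using wbE[OF assms(1)] by blast
  have "tnorm w' ps \<le> C * tnorm w ps"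
  proof (induction ps)
    case (Cons p ps)
    have "w' (fst p) * norm (snd p) \<le> C * w (fst p) * norm (snd p)"
      using assms(2) by (intro mult_right_mono) auto
    with Cons show ?case by (simp add: algebra_simps)
  qed simp
  also have "\<dots> \<le> C * r" using ps assms(3) by (simp add: mult_left_mono)
  finally show "\<exists>ps. tnorm w' ps \<le> C * r \<and> (\<forall>x. norm (f x - tpoly ps x) \<le> e)" using ps by blast
qed

lemma wb_uniform_limit:
  assumes f: "\<And>n::nat. wb w r (f n)" and lim: "uniform_limit UNIV f g sequentially"
  shows "wb w r g"
  unfolding wb_def
proof (intro allI impI)
  fix e :: real assume "e > 0"
  then have "e / 2 > 0" by simp
  from uniform_limitD[OF lim this] obtain n where n: "\<And>x. dist (f n x) (g x) < e / 2"
    by (auto simp: eventually_sequentially)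
  obtain ps where ps: "tnorm w ps \<le> r" "\<And>x. norm (f n x - tpoly ps x) \<le> e / 2"
    using wbE[OF f \<open>e / 2 > 0\<close>] by blast
  have "norm (g x - tpoly ps x) \<le> e" for x
    using n[of x] ps(2)[of x] norm_triangle_ineq[of "g x - f n x" "f n x - tpoly ps x"]
    by (simp add: dist_norm norm_minus_commute)
  then show "\<exists>ps. tnorm w ps \<le> r \<and> (\<forall>x. norm (g x - tpoly ps x) \<le> e)" using ps by blast
qed

lemma wb_sum: "weight w \<Longrightarrow> (\<And>j. j < (n::nat) \<Longrightarrow> wb w (R j) (F j)) \<Longrightarrow> wb w (\<Sum>j<n. R j) (\<lambda>x. \<Sum>j<n. F j x)"
  by (induction n) (auto intro: wb_0 wb_add)

lemma wb_sums:
  assumes w: "weight w" and F: "\<And>j. wb w (R j) (F j)" and R: "R sums S" and g: "\<And>x. (\<lambda>j. F j x) sums g x"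
  shows "wb w S g"
proof (rule wb_uniform_limit)
  have R0: "R j \<ge> 0" for j using wb_nonneg[OF w F] .
  show "wb w S (\<lambda>x. \<Sum>j<n. F j x)" for n
    using wb_sum[OF w F, where n=n] by (rule wb_mono) (use R R0 sum_le_suminf[of R "{..<n}"] in \<open>auto simp: sums_iff\<close>)
  have "uniform_limit UNIV (\<lambda>n x. \<Sum>i<n. F i x) (\<lambda>x. suminf (\<lambda>i. F i x)) sequentially"
    by (rule Weierstrass_m_test[where M=R]) (use R wb_norm[OF w F] in \<open>auto simp: sums_iff\<close>)
  moreover have "(\<lambda>x. suminf (\<lambda>i. F i x)) = g" using g by (auto simp: sums_iff)
  ultimately show "uniform_limit UNIV (\<lambda>n x. \<Sum>j<n. F j x) g sequentially" by simp
qed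

lemma wb_continuous: assumes "wb w r f" shows "continuous_on UNIV f"
proof -
  have "\<exists>ps. \<forall>x. norm (f x - tpoly ps x) \<le> 1 / Suc n" for n
    using wbE[OF assms, of "1 / Suc n"] by auto
  then obtain P where P: "\<And>n x. norm (f x - tpoly (P n) x) \<le> 1 / Suc n" by metis
  have "uniform_limit UNIV (\<lambda>n. tpoly (P n)) f sequentially"
  proof (rule uniform_limitI)
    fix e :: real assume "e > 0"
    then obtain N where N: "1 / Suc N < e" using nat_approx_posE by metis
    have "dist (tpoly (P n) x) (f x) < e" if "n \<ge> N" for n x
    proof -
      have "1 / real (Suc n) \<le> 1 / Suc N" using that by (intro divide_left_mono) auto
      then show ?thesis using N P[of x n] by (simp add: dist_norm norm_minus_commute)
    qed
    then show "\<forall>\<^sub>F n in sequentially. \<forall>x\<in>UNIV. dist (tpoly (P n) x) (f x) < e"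
      by (auto simp: eventually_sequentially)
  qed
  then show ?thesis
    by (rule uniform_limit_theorem[rotated]) (simp_all add: continuous_on_tpoly)
qed

lemma wb_periodic: assumes "wb w r f" shows "periodic f"
  unfolding periodic_def
proof (intro allI)
  fix x k
  have "norm (f (x + real_vec k) - f x) \<le> 0"
  proof (rule field_le_epsilon)
    fix e :: real assume "e > 0"
    then have "e / 2 > 0" by simp
    from wbE[OF assms this] obtain ps where ps: "\<And>x. norm (f x - tpoly ps x) \<le> e / 2" by metis
    have "norm (f (x + real_vec k) - f x) =
        norm ((f (x + real_vec k) - tpoly ps (x + real_vec k)) - (f x - tpoly ps x))"
      by (simp only: tpoly_periodic) simp
    also have "\<dots> \<le> e / 2 + e / 2"
      by (intro norm_triangle_le_diff add_mono ps)
    finally show "norm (f (x + real_vec k) - f x) \<le> 0 + e" by simp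
  qed
  then show "f (x + real_vec k) = f x" by simp
qed

subsection \<open>Exponential and logarithm in weighted norms\<close>

text \<open>The part of the exponential of order at least 2. The nonlinear estimates of the
  iteration are all reduced to this quadratically small remainder.\<close>

definition mexp2 :: "complex^'n^'n \<Rightarrow> complex^'n^'n" where
  "mexp2 X = mexp X - mat 1 - X"

lemma mexp2_0 [simp]: "mexp2 0 = 0"
  by (simp add: mexp2_def)

lemma mexp_eq: "mexp X = mat 1 + X + mexp2 X"
  by (simp add: mexp2_def)

lemma mexp2_sums: "(\<lambda>k. (1 / fact (k + 2)) *\<^sub>R mpow X (k + 2)) sums mexp2 X"
proof -
  have "(\<lambda>k. (1 / fact (k + 2)) *\<^sub>R mpow X (k + 2)) sums (mexp X - (\<Sum>k<2. (1 / fact k) *\<^sub>R mpow X k))"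
    by (rule sums_split_initial_segment[OF mexp_sums])
  moreover have "(\<Sum>k<2. (1 / fact k) *\<^sub>R mpow X k) = mat 1 + X"
    by (simp add: numeral_2_eq_2 mpow_Suc)
  ultimately show ?thesis by (simp add: mexp2_def algebra_simps)
qed

lemma wb_mpow: "weight w \<Longrightarrow> wb w r f \<Longrightarrow> wb w (r ^ Suc k) (\<lambda>x. mpow (f x) (Suc k))"
  by (induction k) (auto simp: mpow_Suc intro: wb_mult)

text \<open>Induction with f^(n+1) - g^(n+1) = f (f^n - g^n) + (f - g) g^n, which keeps the order of
  noncommuting factors. The constant is s times the derivative of r^(k+1).\<close>

lemma wb_mpow_diff:
  assumes w: "weight w" and f: "wb w r f" and g: "wb w r g" and fg: "wb w s (\<lambda>x. f x - g x)"
  shows "wb w (real (Suc k) * r ^ k * s) (\<lambda>x. mpow (f x) (Suc k) - mpow (g x) (Suc k))"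
proof (induction k)
  case 0
  then show ?case using fg by (simp add: mpow_Suc)
next
  case (Suc k)
  have "wb w (r * (real (Suc k) * r ^ k * s) + s * r ^ Suc k)
      (\<lambda>x. f x ** (mpow (f x) (Suc k) - mpow (g x) (Suc k)) + (f x - g x) ** mpow (g x) (Suc k))"
    by (intro wb_add wb_mult w f fg Suc wb_mpow g)
  moreover have "r * (real (Suc k) * r ^ k * s) + s * r ^ Suc k = real (Suc (Suc k)) * r ^ Suc k * s"
    by (simp add: algebra_simps)
  moreover have "f x ** (mpow (f x) (Suc k) - mpow (g x) (Suc k)) + (f x - g x) ** mpow (g x) (Suc k) =
      mpow (f x) (Suc (Suc k)) - mpow (g x) (Suc (Suc k))" for x
    by (simp add: mpow_Suc[of _ "Suc k"] mm.diff_left mm.diff_right)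
  ultimately show ?case by simp
qed

text \<open>The terms of the series contribute r^(k+1) s / (k+1)!, which add up to (exp r - 1) s,
  and exp r - 1 is at most r + r^2 for r at most 1. The Lipschitz constant is proportional to the
  radius, which gives a quadratic bound for g = 0.\<close>

lemma wb_mexp2_diff:
  assumes w: "weight w" and f: "wb w r f" and g: "wb w r g" and fg: "wb w s (\<lambda>x. f x - g x)" and r1: "r \<le> 1"
  shows "wb w (2 * r * s) (\<lambda>x. mexp2 (f x) - mexp2 (g x))"
proof -
  have r: "r \<ge> 0" and s: "s \<ge> 0" using wb_nonneg[OF w f] wb_nonneg[OF w fg] .
  let ?F = "\<lambda>k x. (1 / fact (k + 2)) *\<^sub>R mpow (f x) (k + 2) - (1 / fact (k + 2)) *\<^sub>R mpow (g x) (k + 2)"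
  have "wb w (r ^ (k + 1) / fact (k + 1) * s) (?F k)" for k
  proof -
    have "wb w (\<bar>1 / fact (k + 2)\<bar> * (real (Suc (Suc k)) * r ^ Suc k * s))
        (\<lambda>x. (1 / fact (k + 2)) *\<^sub>R (mpow (f x) (Suc (Suc k)) - mpow (g x) (Suc (Suc k))))"
      by (intro wb_scaleR wb_mpow_diff w f g fg)
    moreover have "\<bar>1 / fact (k + 2)\<bar> * (real (Suc (Suc k)) * r ^ Suc k * s) = r ^ (k + 1) / fact (k + 1) * s"
      by (simp add: field_simps del: of_nat_Suc)
    ultimately show ?thesis by (simp only: scaleR_diff_right add_2_eq_Suc')
  qed
  moreover have "(\<lambda>k. r ^ (k + 1) / fact (k + 1) * s) sums ((exp r - 1) * s)"
  proof -
    have "(\<lambda>k. r ^ (k + 1) /\<^sub>R fact (k + 1)) sums (exp r - (\<Sum>k<1. r ^ k /\<^sub>R fact k))"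
      by (rule sums_split_initial_segment[OF exp_converges])
    then show ?thesis using sums_mult2[of "\<lambda>k. r ^ (k + 1) /\<^sub>R fact (k + 1)" "exp r - 1" s]
      by (simp add: divide_inverse mult_ac)
  qed
  moreover have "(\<lambda>k. ?F k x) sums (mexp2 (f x) - mexp2 (g x))" for x
    by (intro sums_diff mexp2_sums)
  ultimately have "wb w ((exp r - 1) * s) (\<lambda>x. mexp2 (f x) - mexp2 (g x))"
    by (rule wb_sums[OF w])
  moreover have "exp r - 1 \<le> 2 * r"
    using exp_bound[OF r r1] r r1 by (smt (verit) mult_left_le power2_eq_square)
  ultimately show ?thesis by (meson mult_right_mono s wb_mono)
qed

lemma wb_mexp2:
  assumes "weight w" "wb w r f" "r \<le> 1" shows "wb w (2 * r * r) (\<lambda>x. mexp2 (f x))"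
  using wb_mexp2_diff[OF assms(1,2) wb_0[OF assms(1) wb_nonneg[OF assms(1,2)]], of r] assms by simp

lemma weight_1: "weight (\<lambda>_. 1)"
  by (simp add: weight_def)

text \<open>Constant functions with the weight 1 turn the estimate for functions into one for single
  matrices; the dimension 1 of the torus is an arbitrary choice.\<close>

lemma mexp2_lipschitz:
  fixes X Y :: "complex^'n^'n"
  assumes "norm X \<le> r" "norm Y \<le> r" "r \<le> 1"
  shows "norm (mexp2 X - mexp2 Y) \<le> 2 * r * norm (X - Y)"
proof -
  have "wb (\<lambda>_::int^1. 1) (2 * r * norm (X - Y)) (\<lambda>_. mexp2 X - mexp2 Y)"
    using assms by (intro wb_mexp2_diff wb_const weight_1) auto
  then show ?thesis using wb_norm[OF weight_1] by blast
qed

lemma norm_mexp2: "norm (X::complex^'n^'n) \<le> 1 \<Longrightarrow> norm (mexp2 X) \<le> 2 * norm X * norm X"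
  using mexp2_lipschitz[of X "norm X" 0] by simp

text \<open>If the exponentials agree, X - Y is minus the difference of the remainders, whose norm
  is at most half of |X - Y|. This identifies the logarithm found in function space with the one
  found in the Lie algebra.\<close>

lemma mexp_inj_small:
  fixes X Y :: "complex^'n^'n"
  assumes "norm X \<le> 1/4" "norm Y \<le> 1/4" "mexp X = mexp Y" shows "X = Y"
proof -
  have "X - Y = - (mexp2 X - mexp2 Y)" using assms(3) by (simp add: mexp2_def)
  then have "norm (X - Y) = norm (mexp2 X - mexp2 Y)" by (metis norm_minus_cancel)
  also have "\<dots> \<le> 2 * (1/4) * norm (X - Y)" using assms by (intro mexp2_lipschitz) auto
  finally show ?thesis by simp
qed

text \<open>The equation exp X = 1 + F reads X = F - \<open>mexp2\<close> X. The iteration from 0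
  stays in the ball of radius 2r because r + 8 r^2 is at most 2r, and it contracts by 4r, at most
  1/2. Both use that r is at most 1/8.\<close>

lemma wb_log:
  assumes w: "weight w" and F: "wb w r F" and r: "r \<le> 1/8"
  obtains X where "wb w (2 * r) X" "\<And>x. mexp (X x) = mat 1 + F x"
proof -
  have r0: "r \<ge> 0" by (rule wb_nonneg[OF w F])
  define X where "X = rec_nat (\<lambda>_. 0) (\<lambda>_ X x. F x - mexp2 (X x))"
  have X0: "X 0 = (\<lambda>_. 0)" and XS: "X (Suc n) = (\<lambda>x. F x - mexp2 (X n x))" for n
    by (simp_all add: X_def)
  have Xb: "wb w (2 * r) (X n)" for n
  proof (induction n)
    case 0 then show ?case by (simp add: X0 wb_0 w r0)
  next
    case (Suc n)
    have "wb w (r + 2 * (2 * r) * (2 * r)) (X (Suc n))"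
      unfolding XS using Suc r by (intro wb_diff wb_mexp2 w F) auto
    then show ?case by (rule wb_mono) (use r0 r mult_left_mono[of r "1/8" r] in auto)
  qed
  have Xd: "wb w (r * (1/2) ^ n) (\<lambda>x. X (Suc n) x - X n x)" for n
  proof (induction n)
    case 0 then show ?case using F by (simp add: XS X0)
  next
    case (Suc n)
    have "wb w (2 * (2 * r) * (r * (1/2) ^ n)) (\<lambda>x. mexp2 (X (Suc n) x) - mexp2 (X n x))"
      using r by (intro wb_mexp2_diff w Xb Suc) auto
    then have "wb w (r * (1/2) ^ Suc n) (\<lambda>x. - (mexp2 (X (Suc n) x) - mexp2 (X n x)))"
      by (intro wb_minus w, rule wb_mono)
        (use mult_right_mono[of "4 * r" "1/2" "r * (1/2) ^ n"] r0 r in \<open>simp add: mult_ac\<close>)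
    moreover have "- (mexp2 (X (Suc n) x) - mexp2 (X n x)) = X (Suc (Suc n)) x - X (Suc n) x" for x
      by (simp add: XS)
    ultimately show ?case by simp
  qed
  have geo: "(\<lambda>n. r * (1/2) ^ n) sums (2 * r)"
    using sums_mult[OF geometric_sums[of "1/2::real"], of r] by (simp add: mult.commute)
  have "summable (\<lambda>n. X (Suc n) x - X n x)" for x
    by (rule summable_comparison_test'[OF sums_summable[OF geo], of 0]) (use wb_norm[OF w Xd] in auto)
  then have L: "(\<lambda>n. X (Suc n) x - X n x) sums (\<Sum>n. X (Suc n) x - X n x)" for x
    by (rule summable_sums)
  define L where "L x = (\<Sum>n. X (Suc n) x - X n x)" for x
  note L = L[folded L_def]
  have "wb w (2 * r) L" by (rule wb_sums[OF w Xd geo L])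
  moreover have "mexp (L x) = mat 1 + F x" for x
  proof -
    have lim: "(\<lambda>n. X n x) \<longlonglongrightarrow> L x"
      using L[of x] unfolding sums_def by (simp add: sum_lessThan_telescope[of "\<lambda>n. X n x" for x] X0)
    have "(\<lambda>n. mexp2 (X n x)) \<longlonglongrightarrow> mexp2 (L x)"
    proof (rule metric_tendsto_imp_tendsto[OF lim], rule always_eventually, rule allI)
      fix n
      have "norm (mexp2 (X n x) - mexp2 (L x)) \<le> 2 * (1/2) * norm (X n x - L x)"
        using wb_norm[OF w Xb, of n x] wb_norm[OF w \<open>wb w (2 * r) L\<close>, of x] r
        by (intro mexp2_lipschitz) auto
      then show "dist (mexp2 (X n x)) (mexp2 (L x)) \<le> dist (X n x) (L x)" by (simp add: dist_norm)
    qed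
    then have "(\<lambda>n. X (Suc n) x) \<longlonglongrightarrow> F x - mexp2 (L x)"
      unfolding XS by (intro tendsto_intros)
    with LIMSEQ_Suc[OF lim] have "L x = F x - mexp2 (L x)" by (rule LIMSEQ_unique)
    then show ?thesis by (simp add: mexp2_def algebra_simps)
  qed
  ultimately show thesis by (rule that)
qed

subsection \<open>The Lie algebra of a compact matrix group\<close>

lemma compact_groupD:
  assumes "compact_group G"
  shows "A \<in> G \<Longrightarrow> unitary A" "mat 1 \<in> G" "A \<in> G \<Longrightarrow> B \<in> G \<Longrightarrow> A ** B \<in> G"
    "A \<in> G \<Longrightarrow> conj_transpose A \<in> G" "closed G"
  using assms unfolding compact_group_def
  by (auto simp: compact_imp_closed matrix_inv_unitary[symmetric])

lemma small_log:
  fixes F :: "complex^'n^'n"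
  assumes "norm F \<le> 1/8"
  obtains X where "norm X \<le> 2 * norm F" "mexp X = mat 1 + F"
proof -
  obtain X :: "real^1 \<Rightarrow> complex^'n^'n"
    where "wb (\<lambda>_. 1) (2 * norm F) X" "\<And>x. mexp (X x) = mat 1 + F"
    using wb_log[OF weight_1 wb_const[OF weight_1 order_refl, of F] assms] by blast
  then show thesis using that[of "X 0"] wb_norm[OF weight_1] by blast
qed

lemma tendsto_mpow: "(f \<longlongrightarrow> X) F \<Longrightarrow> ((\<lambda>n. mpow (f n) k) \<longlongrightarrow> mpow X k) F"
  by (induction k) (auto simp: mpow_Suc intro: mm.tendsto)

text \<open>The Lipschitz bound of the remainder holds in the unit ball. Scaling by 1/N brings the
  sequence there, and the N-th power of the exponential undoes the scaling.\<close>

lemma tendsto_mexp: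
  fixes f :: "nat \<Rightarrow> complex^'n^'n"
  assumes f: "f \<longlonglongrightarrow> X" shows "(\<lambda>n. mexp (f n)) \<longlonglongrightarrow> mexp X"
proof -
  obtain N :: nat where N: "norm X + 1 < real N" using reals_Archimedean2 by blast
  then have N0: "real N > 0" by (smt (verit) norm_ge_zero)
  define s where "s = 1 / real N"
  have s0: "s > 0" using N0 by (simp add: s_def)
  have sX: "norm (s *\<^sub>R Y) \<le> 1" if "norm Y < norm X + 1" for Y :: "complex^'n^'n"
    using that N N0 by (simp add: s_def field_simps)
  have ev: "\<forall>\<^sub>F n in sequentially. norm (f n) < norm X + 1"
    by (rule order_tendstoD(2)[OF tendsto_norm[OF f]]) simp
  have sf: "(\<lambda>n. s *\<^sub>R f n) \<longlonglongrightarrow> s *\<^sub>R X" by (intro tendsto_intros f)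
  have 0: "(\<lambda>n. 2 * 1 * norm (s *\<^sub>R f n - s *\<^sub>R X)) \<longlonglongrightarrow> 0"
    by (rule tendsto_eq_intros tendsto_norm_zero LIM_zero sf refl | simp)+
  have "(\<lambda>n. mexp2 (s *\<^sub>R f n) - mexp2 (s *\<^sub>R X)) \<longlonglongrightarrow> 0"
    by (rule Lim_null_comparison[OF _ 0], rule eventually_mono[OF ev], rule mexp2_lipschitz)
      (simp_all add: sX del: norm_scaleR)
  then have "(\<lambda>n. mexp2 (s *\<^sub>R f n)) \<longlonglongrightarrow> mexp2 (s *\<^sub>R X)" by (rule LIM_zero_cancel)
  then have "(\<lambda>n. mexp (s *\<^sub>R f n)) \<longlonglongrightarrow> mexp (s *\<^sub>R X)"
    unfolding mexp_eq by (intro tendsto_intros sf)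
  then have "(\<lambda>n. mpow (mexp (s *\<^sub>R f n)) N) \<longlonglongrightarrow> mpow (mexp (s *\<^sub>R X)) N"
    by (rule tendsto_mpow)
  then show ?thesis using N0 by (simp add: mexp_of_nat[symmetric] s_def)
qed

lemma mexp_difference_quotient:
  fixes X :: "complex^'n^'n"
  assumes s: "s \<longlonglongrightarrow> 0" "\<And>n. s n > 0"
  shows "(\<lambda>n. (mexp (s n *\<^sub>R X) - mat 1) /\<^sub>R s n) \<longlonglongrightarrow> X"
proof -
  have sX: "(\<lambda>n. s n *\<^sub>R X) \<longlonglongrightarrow> 0" using tendsto_scaleR[OF s(1) tendsto_const] by simp
  have ev: "\<forall>\<^sub>F n in sequentially. norm (s n *\<^sub>R X) < 1"
    by (rule order_tendstoD(2)[OF tendsto_norm_zero[OF sX]]) simp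
  have 0: "(\<lambda>n. s n * (2 * norm X * norm X)) \<longlonglongrightarrow> 0" using tendsto_mult[OF s(1) tendsto_const] by simp
  have "(\<lambda>n. mexp2 (s n *\<^sub>R X) /\<^sub>R s n) \<longlonglongrightarrow> 0"
  proof (rule Lim_null_comparison[OF _ 0], rule eventually_mono[OF ev])
    fix n assume "norm (s n *\<^sub>R X) < 1"
    then have "norm (mexp2 (s n *\<^sub>R X)) \<le> 2 * norm (s n *\<^sub>R X) * norm (s n *\<^sub>R X)" by (intro norm_mexp2) simp
    then have "norm (mexp2 (s n *\<^sub>R X)) \<le> s n * (s n * (2 * norm X * norm X))"
      using s(2)[of n] by (simp add: mult_ac)
    then show "norm (mexp2 (s n *\<^sub>R X) /\<^sub>R s n) \<le> s n * (2 * norm X * norm X)"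
      using s(2)[of n] by (simp add: field_simps)
  qed
  then have "(\<lambda>n. X + mexp2 (s n *\<^sub>R X) /\<^sub>R s n) \<longlonglongrightarrow> X + 0" by (intro tendsto_intros)
  moreover have "(mexp (s n *\<^sub>R X) - mat 1) /\<^sub>R s n = X + mexp2 (s n *\<^sub>R X) /\<^sub>R s n" for n
    using s(2)[of n] by (simp add: mexp_eq scaleR_add_right)
  ultimately show ?thesis by simp
qed

lemma mpow_in_group: "compact_group G \<Longrightarrow> g \<in> G \<Longrightarrow> mpow g k \<in> G"
  by (induction k) (auto simp: mpow_Suc intro: compact_groupD)

text \<open>A limit of rescaled group elements generates a one-parameter subgroup: exp(t Z) is the
  limit of the powers of \<open>g n\<close> whose exponent is t / \<open>s n\<close> rounded down.
  Closure of the Lie algebra under sums and the closed subgroup theorem follow by exhibiting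
  suitable g and s.\<close>

lemma lie_algebra_closure:
  fixes G :: "(complex^'n^'n) set"
  assumes G: "compact_group G" and g: "\<And>n. g n \<in> G" and s: "s \<longlonglongrightarrow> 0" "\<And>n. s n > 0"
    and Z: "(\<lambda>n. (g n - mat 1) /\<^sub>R s n) \<longlonglongrightarrow> Z"
  shows "Z \<in> lie_algebra G"
proof -
  have g1: "(\<lambda>n. g n - mat 1) \<longlonglongrightarrow> 0"
    using tendsto_scaleR[OF s(1) Z] s(2) by (simp add: less_imp_neq[symmetric])
  have ev: "\<forall>\<^sub>F n in sequentially. norm (g n - mat 1) < 1/8"
    by (rule order_tendstoD(2)[OF tendsto_norm_zero[OF g1]]) simp
  have "\<exists>X. norm (g n - mat 1) < 1/8 \<longrightarrow> norm X \<le> 2 * norm (g n - mat 1) \<and> mexp X = g n" for n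
    using small_log[of "g n - mat 1"] by (metis add_diff_cancel_left' add_diff_eq less_imp_le)
  then obtain X where "\<And>n. norm (g n - mat 1) < 1/8 \<longrightarrow> norm (X n) \<le> 2 * norm (g n - mat 1) \<and> mexp (X n) = g n"
    by metis
  then have evX: "\<forall>\<^sub>F n in sequentially. norm (X n) \<le> 2 * norm (g n - mat 1) \<and> mexp (X n) = g n \<and> norm (g n - mat 1) < 1/8"
    using ev by (auto elim: eventually_mono)
  have 0: "(\<lambda>n. 8 * (norm (g n - mat 1) * norm ((g n - mat 1) /\<^sub>R s n))) \<longlonglongrightarrow> 0"
    using tendsto_mult[OF tendsto_norm_zero[OF g1] tendsto_norm[OF Z]] tendsto_mult[OF tendsto_const[of 8]] by fastforce
  have "(\<lambda>n. mexp2 (X n) /\<^sub>R s n) \<longlonglongrightarrow> 0"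
  proof (rule Lim_null_comparison[OF _ 0], rule eventually_mono[OF evX])
    fix n assume *: "norm (X n) \<le> 2 * norm (g n - mat 1) \<and> mexp (X n) = g n \<and> norm (g n - mat 1) < 1/8"
    then have "norm (mexp2 (X n)) \<le> 2 * norm (X n) * norm (X n)" by (intro norm_mexp2) auto
    also have "\<dots> = 2 * (norm (X n) * norm (X n))" by simp
    also have "\<dots> \<le> 2 * ((2 * norm (g n - mat 1)) * (2 * norm (g n - mat 1)))"
      using * by (intro mult_left_mono mult_mono) auto
    finally have "norm (mexp2 (X n)) / s n \<le> 8 * (norm (g n - mat 1) * norm (g n - mat 1)) / s n"
      using s(2)[of n] by (intro divide_right_mono) auto
    moreover have "norm (Y /\<^sub>R s n) = norm Y / s n" for Y :: "complex^'n^'n"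
      using s(2)[of n] by (simp add: divide_inverse mult.commute)
    ultimately show "norm (mexp2 (X n) /\<^sub>R s n) \<le> 8 * (norm (g n - mat 1) * norm ((g n - mat 1) /\<^sub>R s n))"
      by simp
  qed
  with Z have "(\<lambda>n. (g n - mat 1) /\<^sub>R s n - mexp2 (X n) /\<^sub>R s n) \<longlonglongrightarrow> Z - 0" by (rule tendsto_diff)
  moreover have "\<forall>\<^sub>F n in sequentially. (g n - mat 1) /\<^sub>R s n - mexp2 (X n) /\<^sub>R s n = X n /\<^sub>R s n"
    using evX by eventually_elim (auto simp: mexp2_def scaleR_diff_right[symmetric])
  ultimately have Xs: "(\<lambda>n. X n /\<^sub>R s n) \<longlonglongrightarrow> Z" by (simp add: tendsto_cong)
  have pos: "mexp (t *\<^sub>R Z) \<in> G" if "t \<ge> 0" for t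
  proof -
    \<comment> \<open>Rounding down leaves an error of at most \<open>s n\<close> in the time t, so
      the \<open>m n\<close>-fold multiple of the logarithm \<open>X n\<close> tends to t Z.\<close>
    define m where "m n = nat \<lfloor>t / s n\<rfloor>" for n
    have ms: "(\<lambda>n. real (m n) * s n) \<longlonglongrightarrow> t"
    proof (rule Lim_transform[OF tendsto_const[of t]])
      show "(\<lambda>n. real (m n) * s n - t) \<longlonglongrightarrow> 0"
      proof (rule Lim_null_comparison[OF _ s(1)], rule always_eventually, rule allI)
        fix n
        have "real (m n) = of_int \<lfloor>t / s n\<rfloor>" using that s(2)[of n] by (simp add: m_def)
        then have "real (m n) \<le> t / s n" "t / s n < real (m n) + 1" by linarith+
        then show "norm (real (m n) * s n - t) \<le> s n" using s(2)[of n] by (simp add: field_simps)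
      qed
    qed
    have "(\<lambda>n. (real (m n) * s n) *\<^sub>R (X n /\<^sub>R s n)) \<longlonglongrightarrow> t *\<^sub>R Z"
      by (intro tendsto_scaleR ms Xs)
    moreover have "(real (m n) * s n) *\<^sub>R (X n /\<^sub>R s n) = real (m n) *\<^sub>R X n" for n
      using s(2)[of n] by simp
    ultimately have "(\<lambda>n. real (m n) *\<^sub>R X n) \<longlonglongrightarrow> t *\<^sub>R Z"
      by (simp only:)
    then have lim: "(\<lambda>n. mexp (real (m n) *\<^sub>R X n)) \<longlonglongrightarrow> mexp (t *\<^sub>R Z)" by (rule tendsto_mexp)
    show ?thesis
    proof (rule Lim_in_closed_set[OF compact_groupD(5)[OF G] _ _ lim])
      show "\<forall>\<^sub>F n in sequentially. mexp (real (m n) *\<^sub>R X n) \<in> G"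
        using evX by eventually_elim (auto simp: mexp_of_nat intro: mpow_in_group G g)
    qed simp
  qed
  have "mexp (t *\<^sub>R Z) \<in> G" for t
  proof (cases "t \<ge> 0")
    case False
    then have *: "mexp ((- t) *\<^sub>R Z) \<in> G" by (intro pos) simp
    have "conj_transpose (mexp ((- t) *\<^sub>R Z)) = mexp (t *\<^sub>R Z)"
    proof -
      have u: "conj_transpose (mexp ((- t) *\<^sub>R Z)) ** mexp ((- t) *\<^sub>R Z) = mat 1"
        using compact_groupD(1)[OF G *] by (rule unitaryD)
      have "conj_transpose (mexp ((- t) *\<^sub>R Z)) = conj_transpose (mexp ((- t) *\<^sub>R Z)) ** (mexp ((- t) *\<^sub>R Z) ** mexp (t *\<^sub>R Z))"
        using mexp_minus(2)[of "t *\<^sub>R Z"] by simp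
      also have "\<dots> = mexp (t *\<^sub>R Z)"
        unfolding matrix_mul_assoc u by simp
      finally show ?thesis .
    qed
    then show ?thesis using compact_groupD(4)[OF G *] by simp
  qed (rule pos)
  then show ?thesis by (simp add: lie_algebra_def)
qed

lemma lie_algebra_scaleR: "X \<in> lie_algebra G \<Longrightarrow> c *\<^sub>R X \<in> lie_algebra G"
  by (simp add: lie_algebra_def)

lemma mexp_in_group: "X \<in> lie_algebra G \<Longrightarrow> mexp X \<in> G"
  unfolding lie_algebra_def by (metis (mono_tags) mem_Collect_eq scaleR_one)

lemma lie_algebra_seq:
  obtains s :: "nat \<Rightarrow> real" where "s \<longlonglongrightarrow> 0" "\<And>n. s n > 0"
  using LIMSEQ_inverse_real_of_nat by (rule that) simp

lemma mexp_scaleR_tendsto_1: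
  fixes X :: "complex^'n^'n"
  shows "s \<longlonglongrightarrow> 0 \<Longrightarrow> (\<lambda>n. mexp (s n *\<^sub>R X)) \<longlonglongrightarrow> mat 1"
  using tendsto_mexp[of "\<lambda>n. s n *\<^sub>R X" 0] tendsto_scaleR[of s 0 sequentially "\<lambda>_. X" X] by simp

text \<open>Differentiate exp(sX) exp(sY) at s = 0 along a null sequence.\<close>

lemma lie_algebra_add:
  assumes G: "compact_group G" and X: "X \<in> lie_algebra G" and Y: "Y \<in> lie_algebra G"
  shows "X + Y \<in> lie_algebra G"
proof -
  obtain s :: "nat \<Rightarrow> real" where s: "s \<longlonglongrightarrow> 0" "\<And>n. s n > 0" using lie_algebra_seq by blast
  show ?thesis
  proof (rule lie_algebra_closure[OF G _ s])
    show "mexp (s n *\<^sub>R X) ** mexp (s n *\<^sub>R Y) \<in> G" for n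
      using G X Y by (intro compact_groupD mexp_in_group lie_algebra_scaleR)
    have "(\<lambda>n. ((mexp (s n *\<^sub>R X) - mat 1) /\<^sub>R s n) ** mexp (s n *\<^sub>R Y) + (mexp (s n *\<^sub>R Y) - mat 1) /\<^sub>R s n)
        \<longlonglongrightarrow> X ** mat 1 + Y"
      by (intro tendsto_add mm.tendsto mexp_difference_quotient s mexp_scaleR_tendsto_1)
    then show "(\<lambda>n. (mexp (s n *\<^sub>R X) ** mexp (s n *\<^sub>R Y) - mat 1) /\<^sub>R s n) \<longlonglongrightarrow> X + Y"
      by (simp add: mat_simps scaleR_diff_right)
  qed
qed

lemma subspace_lie_algebra: "compact_group G \<Longrightarrow> subspace (lie_algebra G)"
  by (auto simp: subspace_def lie_algebra_add lie_algebra_scaleR)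
     (simp add: lie_algebra_def compact_groupD)

text \<open>Differentiate the unitarity relation of exp(sX) at s = 0.\<close>

lemma lie_algebra_skew:
  assumes G: "compact_group G" and X: "X \<in> lie_algebra G" shows "conj_transpose X = - X"
proof -
  obtain s :: "nat \<Rightarrow> real" where s: "s \<longlonglongrightarrow> 0" "\<And>n. s n > 0" using lie_algebra_seq by blast
  define U where "U n = mexp (s n *\<^sub>R X)" for n
  have q: "(\<lambda>n. (U n - mat 1) /\<^sub>R s n) \<longlonglongrightarrow> X" unfolding U_def by (rule mexp_difference_quotient[OF s])
  have q': "(\<lambda>n. conj_transpose ((U n - mat 1) /\<^sub>R s n)) \<longlonglongrightarrow> conj_transpose X"
    by (rule bounded_linear.tendsto[OF bounded_linear_ct q])
  have 1: "(\<lambda>n. conj_transpose (U n)) \<longlonglongrightarrow> conj_transpose (mat 1)"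
    unfolding U_def by (intro bounded_linear.tendsto[OF bounded_linear_ct] mexp_scaleR_tendsto_1 s)
  have "(\<lambda>n. ((U n - mat 1) /\<^sub>R s n) ** conj_transpose (U n) + conj_transpose ((U n - mat 1) /\<^sub>R s n)) \<longlonglongrightarrow>
      X ** conj_transpose (mat 1) + conj_transpose X"
    by (intro tendsto_add mm.tendsto q q' 1)
  moreover have "((U n - mat 1) /\<^sub>R s n) ** conj_transpose (U n) + conj_transpose ((U n - mat 1) /\<^sub>R s n) = 0" for n
  proof -
    have "unitary (U n)" unfolding U_def using G X by (intro compact_groupD(1)[OF G] mexp_in_group lie_algebra_scaleR)
    then show ?thesis by (simp add: mat_simps ct_scaleR ct_diff unitaryD flip: scaleR_add_right)
  qed
  ultimately have "X + conj_transpose X = 0" by (simp add: LIMSEQ_const_iff)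
  then show ?thesis by (simp add: eq_neg_iff_add_eq_0 add.commute)
qed

lemma lie_algebra_commute:
  assumes T: "compact_group T" "\<And>A B. A \<in> T \<Longrightarrow> B \<in> T \<Longrightarrow> A ** B = B ** A"
    and X: "X \<in> lie_algebra T" and Y: "Y \<in> lie_algebra T"
  shows "X ** Y = Y ** X"
proof -
  obtain s :: "nat \<Rightarrow> real" where s: "s \<longlonglongrightarrow> 0" "\<And>n. s n > 0" using lie_algebra_seq by blast
  let ?q = "\<lambda>X n. (mexp (s n *\<^sub>R X) - mat 1) /\<^sub>R s n"
  have "(\<lambda>n. ?q X n ** ?q Y n) \<longlonglongrightarrow> X ** Y" "(\<lambda>n. ?q Y n ** ?q X n) \<longlonglongrightarrow> Y ** X"
    by (intro mm.tendsto mexp_difference_quotient s)+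
  moreover have "?q X n ** ?q Y n = ?q Y n ** ?q X n" for n
    using T(2)[OF mexp_in_group[OF lie_algebra_scaleR[OF X, of "s n"]] mexp_in_group[OF lie_algebra_scaleR[OF Y, of "s n"]]]
    by (simp add: mat_simps scaleR_diff_right algebra_simps)
  ultimately show ?thesis using LIMSEQ_unique by simp
qed

lemma ct_mexp:
  assumes "compact_group G" "X \<in> lie_algebra G" shows "conj_transpose (mexp X) = mexp (- X)"
proof -
  have u: "conj_transpose (mexp X) ** mexp X = mat 1"
    using assms by (intro unitaryD compact_groupD(1)[OF assms(1)] mexp_in_group)
  have "conj_transpose (mexp X) = conj_transpose (mexp X) ** (mexp X ** mexp (- X))"
    by (simp add: mexp_minus)
  also have "\<dots> = mexp (- X)" unfolding matrix_mul_assoc u by simp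
  finally show ?thesis .
qed

lemma lie_algebra_Ad:
  assumes G: "compact_group G" and X: "X \<in> lie_algebra G" and E: "E \<in> G"
  shows "E ** X ** conj_transpose E \<in> lie_algebra G"
proof -
  have u: "unitary E" using G E by (rule compact_groupD)
  have "mexp (t *\<^sub>R (E ** X ** conj_transpose E)) \<in> G" for t
  proof -
    have "(t *\<^sub>R (E ** X ** conj_transpose E)) ** E = t *\<^sub>R (E ** X ** (conj_transpose E ** E))"
      by (simp only: mat_simps)
    also have "\<dots> = E ** (t *\<^sub>R X)"
      by (simp add: unitaryD[OF u] mat_simps)
    finally have "mexp (t *\<^sub>R (E ** X ** conj_transpose E)) ** E = E ** mexp (t *\<^sub>R X)"
      by (rule mexp_intertwine)
    then have "mexp (t *\<^sub>R (E ** X ** conj_transpose E)) ** (E ** conj_transpose E) = E ** mexp (t *\<^sub>R X) ** conj_transpose E"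
      by (simp add: matrix_mul_assoc)
    then have "mexp (t *\<^sub>R (E ** X ** conj_transpose E)) = E ** mexp (t *\<^sub>R X) ** conj_transpose E"
      by (simp add: unitaryD[OF u])
    then show ?thesis using compact_groupD[OF G] E mexp_in_group[OF lie_algebra_scaleR[OF X]] by simp
  qed
  then show ?thesis by (simp add: lie_algebra_def)
qed

text \<open>The bracket is the derivative at 0 of the adjoint action of exp(sY) on X. The difference
  quotients lie in the Lie algebra, which is closed as a subspace of a finite-dimensional
  space.\<close>

lemma lie_algebra_bracket:
  assumes G: "compact_group G" and X: "X \<in> lie_algebra G" and Y: "Y \<in> lie_algebra G"
  shows "Y ** X - X ** Y \<in> lie_algebra G"
proof -
  obtain s :: "nat \<Rightarrow> real" where s: "s \<longlonglongrightarrow> 0" "\<And>n. s n > 0" using lie_algebra_seq by blast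
  define U where "U n = mexp (s n *\<^sub>R Y)" for n
  have UG: "U n \<in> G" for n unfolding U_def by (intro mexp_in_group lie_algebra_scaleR Y)
  have q: "(\<lambda>n. (U n - mat 1) /\<^sub>R s n) \<longlonglongrightarrow> Y" unfolding U_def by (rule mexp_difference_quotient[OF s])
  have q': "(\<lambda>n. conj_transpose ((U n - mat 1) /\<^sub>R s n)) \<longlonglongrightarrow> - Y"
    using bounded_linear.tendsto[OF bounded_linear_ct q] lie_algebra_skew[OF G Y] by simp
  have 1: "(\<lambda>n. conj_transpose (U n)) \<longlonglongrightarrow> conj_transpose (mat 1)"
    unfolding U_def by (intro bounded_linear.tendsto[OF bounded_linear_ct] mexp_scaleR_tendsto_1 s)
  have lim: "(\<lambda>n. ((U n - mat 1) /\<^sub>R s n) ** X ** conj_transpose (U n) + X ** conj_transpose ((U n - mat 1) /\<^sub>R s n)) \<longlonglongrightarrow>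
      Y ** X ** conj_transpose (mat 1) + X ** (- Y)"
    by (intro tendsto_add mm.tendsto q q' 1 tendsto_const)
  have "((U n - mat 1) /\<^sub>R s n) ** X ** conj_transpose (U n) + X ** conj_transpose ((U n - mat 1) /\<^sub>R s n) =
      (U n ** X ** conj_transpose (U n) - X) /\<^sub>R s n" for n
    by (simp add: mat_simps ct_scaleR ct_diff algebra_simps)
  with lim have lim: "(\<lambda>n. (U n ** X ** conj_transpose (U n) - X) /\<^sub>R s n) \<longlonglongrightarrow> Y ** X - X ** Y"
    by (simp add: mat_simps)
  show ?thesis
  proof (rule closed_sequentially[OF closed_subspace[OF subspace_lie_algebra[OF G]] _ lim])
    show "(U n ** X ** conj_transpose (U n) - X) /\<^sub>R s n \<in> lie_algebra G" for n
      by (intro subspace_mul subspace_diff subspace_lie_algebra G lie_algebra_Ad X UG)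
  qed
qed

text \<open>Closed subgroup theorem: otherwise the components \<open>y\<^sub>n\<close> of the logarithms orthogonal to the Lie
  algebra have a limiting direction, which \<open>lie_algebra_closure\<close> places into the Lie algebra.\<close>

lemma group_log:
  assumes G: "compact_group G"
  obtains r where "r > 0"
    "\<And>g. g \<in> G \<Longrightarrow> norm (g - mat 1) \<le> r \<Longrightarrow> \<exists>X\<in>lie_algebra G. mexp X = g \<and> norm X \<le> 2 * norm (g - mat 1)"
proof (rule ccontr)
  assume no: "\<not> thesis"
  let ?L = "lie_algebra G"
  have sub: "subspace ?L" by (rule subspace_lie_algebra[OF G])
  have "\<exists>g\<in>G. norm (g - mat 1) \<le> 1 / (16 * Suc n) \<and> \<not> (\<exists>X\<in>?L. mexp X = g \<and> norm X \<le> 2 * norm (g - mat 1))" for n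
    using no that[of "1 / (16 * Suc n)"] by fastforce
  then obtain g where g: "\<And>n. g n \<in> G" "\<And>n. norm (g n - mat 1) \<le> 1 / (16 * Suc n)"
    "\<And>n. \<not> (\<exists>X\<in>?L. mexp X = g n \<and> norm X \<le> 2 * norm (g n - mat 1))" by metis
  have g8: "norm (g n - mat 1) \<le> 1/8" for n
    using g(2)[of n] by (rule order_trans) (simp add: field_simps)
  have "\<exists>Z. norm Z \<le> 2 * norm (g n - mat 1) \<and> mexp Z = g n" for n
    using small_log[OF g8[of n]] by (metis add_diff_cancel_left' add_diff_eq)
  then obtain Z where Z: "\<And>n. norm (Z n) \<le> 2 * norm (g n - mat 1)" "\<And>n. mexp (Z n) = g n" by metis
  have "\<exists>x y. x \<in> ?L \<and> (\<forall>w\<in>?L. orthogonal y w) \<and> Z n = x + y" for n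
    using orthogonal_subspace_decomp_exists[of ?L "Z n"] sub by (metis span_eq_iff)
  then obtain x y where x: "\<And>n. x n \<in> ?L" and y: "\<And>n w. w \<in> ?L \<Longrightarrow> orthogonal (y n) w" and xy: "\<And>n. Z n = x n + y n"
    by metis
  have y0: "y n \<noteq> 0" for n using g(3)[of n] Z x xy by (metis add.right_neutral)
  have nz: "norm (x n) \<le> norm (Z n)" "norm (y n) \<le> norm (Z n)" for n
  proof -
    have "orthogonal (x n) (y n)" using y[OF x] by (simp add: orthogonal_commute)
    then have "(norm (Z n))\<^sup>2 = (norm (x n))\<^sup>2 + (norm (y n))\<^sup>2"
      unfolding xy by (simp add: norm_add_Pythagorean)
    then have "(norm (x n))\<^sup>2 \<le> (norm (Z n))\<^sup>2" "(norm (y n))\<^sup>2 \<le> (norm (Z n))\<^sup>2" by simp_all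
    then show "norm (x n) \<le> norm (Z n)" "norm (y n) \<le> norm (Z n)"
      by (simp_all only: power2_le_imp_le norm_ge_zero)
  qed
  have Z0: "Z \<longlonglongrightarrow> 0"
  proof (rule Lim_null_comparison)
    show "\<forall>\<^sub>F n in sequentially. norm (Z n) \<le> inverse (Suc n)"
    proof (rule always_eventually, rule allI)
      fix n
      have "norm (Z n) \<le> 2 * (1 / (16 * Suc n))" using Z(1)[of n] g(2)[of n] by linarith
      also have "\<dots> \<le> inverse (Suc n)" by (simp add: field_simps)
      finally show "norm (Z n) \<le> inverse (Suc n)" .
    qed
  qed (rule LIMSEQ_inverse_real_of_nat)
  have x0: "x \<longlonglongrightarrow> 0" and yn0: "y \<longlonglongrightarrow> 0"
    by (rule Lim_null_comparison[OF always_eventually tendsto_norm_zero[OF Z0]], simp add: nz)+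
  define u where "u n = y n /\<^sub>R norm (y n)" for n
  have u: "u n \<in> sphere 0 1" for n using y0 by (simp add: u_def)
  obtain v r where v: "v \<in> sphere 0 1" "strict_mono r" "(u \<circ> r) \<longlonglongrightarrow> v"
    using compact_sphere[of 0 "1::real"] u unfolding compact_def by metis
  have vL: "orthogonal v w" if "w \<in> ?L" for w
  proof -
    have "u n \<bullet> w = 0" for n using y[OF that, of n] by (simp add: u_def orthogonal_def)
    moreover have "(\<lambda>n. (u \<circ> r) n \<bullet> w) \<longlonglongrightarrow> v \<bullet> w" by (intro tendsto_intros v)
    ultimately show ?thesis by (simp add: orthogonal_def LIMSEQ_const_iff)
  qed
  \<comment> \<open>The group elements exp(-x) g = exp(-x) exp(x + y) differ from 1 by y to first
    order, so their quotients by |y| tend to the limiting direction v. As x and y need not commute,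
    the error is estimated by the Lipschitz bound of \<open>mexp2\<close>.\<close>
  have "v \<in> ?L"
  proof (rule lie_algebra_closure[OF G])
    show "mexp (- x (r n)) ** g (r n) \<in> G" for n
      by (intro compact_groupD[OF G] mexp_in_group g subspace_neg sub x)
    show "(\<lambda>n. norm (y (r n))) \<longlonglongrightarrow> 0"
      using LIMSEQ_subseq_LIMSEQ[OF tendsto_norm_zero[OF yn0] v(2)] by (simp add: o_def)
    show "norm (y (r n)) > 0" for n using y0 by simp
    define e where "e n = (mexp2 (x n + y n) - mexp2 (x n)) /\<^sub>R norm (y n)" for n
    have e0: "e \<longlonglongrightarrow> 0"
    proof (rule Lim_null_comparison)
      show "\<forall>\<^sub>F n in sequentially. norm (e n) \<le> 2 * norm (Z n)"
      proof (rule always_eventually, rule allI)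
        fix n
        have "norm (Z n) \<le> 1" using Z(1)[of n] g8[of n] by simp
        then have "norm (mexp2 (x n + y n) - mexp2 (x n)) \<le> 2 * norm (Z n) * norm ((x n + y n) - x n)"
          using nz[of n] by (intro mexp2_lipschitz) (auto simp: xy)
        then have "norm (mexp2 (x n + y n) - mexp2 (x n)) / norm (y n) \<le> 2 * norm (Z n)"
          using y0[of n] by (simp add: field_simps)
        moreover have "norm (e n) = norm (mexp2 (x n + y n) - mexp2 (x n)) / norm (y n)"
          unfolding e_def norm_scaleR by (simp add: divide_inverse mult.commute)
        ultimately show "norm (e n) \<le> 2 * norm (Z n)" by simp
      qed
      show "(\<lambda>n. 2 * norm (Z n)) \<longlonglongrightarrow> 0"
        using tendsto_mult[OF tendsto_const tendsto_norm_zero[OF Z0], of 2] by simp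
    qed
    have "(\<lambda>n. mexp (- x n)) \<longlonglongrightarrow> mexp (- 0)" by (intro tendsto_mexp tendsto_minus x0)
    then have "(\<lambda>n. mexp (- x (r n))) \<longlonglongrightarrow> mat 1"
      using LIMSEQ_subseq_LIMSEQ[OF _ v(2)] by (fastforce simp: o_def)
    moreover have "(\<lambda>n. e (r n)) \<longlonglongrightarrow> 0" using LIMSEQ_subseq_LIMSEQ[OF e0 v(2)] by (simp add: o_def)
    moreover have "(\<lambda>n. u (r n)) \<longlonglongrightarrow> v" using v(3) by (simp add: o_def)
    ultimately have "(\<lambda>n. mexp (- x (r n)) ** (u (r n) + e (r n))) \<longlonglongrightarrow> mat 1 ** (v + 0)"
      by (intro mm.tendsto tendsto_add)
    moreover have "mexp (- x n) ** (u n + e n) = (mexp (- x n) ** g n - mat 1) /\<^sub>R norm (y n)" for n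
    proof -
      have "u n + e n = (mexp (Z n) - mexp (x n)) /\<^sub>R norm (y n)"
        by (simp add: u_def e_def mexp2_def xy scaleR_add_right[symmetric])
      then show ?thesis by (simp add: Z(2) mat_simps mexp_minus)
    qed
    ultimately show "(\<lambda>n. (mexp (- x (r n)) ** g (r n) - mat 1) /\<^sub>R norm (y (r n))) \<longlonglongrightarrow> v" by simp
  qed
  then have "orthogonal v v" by (rule vL)
  then show False using v(1) by (simp add: orthogonal_self)
qed

subsection \<open>Joint eigenvectors and small divisors\<close>

text \<open>A minimiser of the Rayleigh quotient on the unit sphere of W. The form of S - \<nu> is
  nonnegative on W and vanishes at v, so v lies in its kernel. Minimality of \<nu> is part of the
  conclusion because it yields the lower bound for the linearised operator.\<close>

lemma self_adjoint_min_eigenvector: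
  fixes S :: "'a::euclidean_space \<Rightarrow> 'a"
  assumes W: "subspace W" "W \<noteq> {0}" and S: "linear S" "\<And>w. w \<in> W \<Longrightarrow> S w \<in> W"
    and sa: "\<And>u v. u \<in> W \<Longrightarrow> v \<in> W \<Longrightarrow> S u \<bullet> v = u \<bullet> S v"
  obtains \<nu> v where "v \<in> W" "v \<noteq> 0" "S v = \<nu> *\<^sub>R v" "\<And>w. w \<in> W \<Longrightarrow> \<nu> * (w \<bullet> w) \<le> S w \<bullet> w"
proof -
  obtain w0 where w0: "w0 \<in> W" "w0 \<noteq> 0" using W subspace_0 by blast
  have "compact (sphere 0 1 \<inter> W)" by (intro compact_Int_closed compact_sphere closed_subspace W)
  moreover have "w0 /\<^sub>R norm w0 \<in> sphere 0 1 \<inter> W" using w0 W by (simp add: subspace_mul)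
  moreover have "continuous_on (sphere 0 1 \<inter> W) (\<lambda>v. S v \<bullet> v)"
    using S(1) by (intro continuous_intros linear_continuous_on) (simp add: linear_conv_bounded_linear)
  ultimately obtain v where v: "v \<in> sphere 0 1 \<inter> W" "\<And>w. w \<in> sphere 0 1 \<inter> W \<Longrightarrow> S v \<bullet> v \<le> S w \<bullet> w"
    using continuous_attains_inf[of "sphere 0 1 \<inter> W" "\<lambda>v. S v \<bullet> v"] by blast
  define \<nu> where "\<nu> = S v \<bullet> v"
  have vv: "v \<bullet> v = 1" "v \<in> W" using v(1) by (auto simp: norm_eq_1)
  have min: "\<nu> * (w \<bullet> w) \<le> S w \<bullet> w" if "w \<in> W" for w
  proof (cases "w = 0")
    case False
    have "\<nu> \<le> S (w /\<^sub>R norm w) \<bullet> (w /\<^sub>R norm w)"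
      unfolding \<nu>_def using False that W by (intro v(2)) (simp add: subspace_mul)
    also have "\<dots> = (S w \<bullet> w) / (norm w)\<^sup>2"
      using S(1) by (simp add: linear_cmul power2_eq_square field_simps)
    finally show ?thesis using False by (simp add: field_simps dot_square_norm)
  qed (simp add: linear_0[OF S(1)])
  define B where "B u w = S u \<bullet> w - \<nu> * (u \<bullet> w)" for u w
  have B0: "B v w = 0" if w: "w \<in> W" for w
  proof (rule ccontr)
    assume b: "B v w \<noteq> 0"
    have c: "B w w \<ge> 0" using min[OF w] by (simp add: B_def)
    \<comment> \<open>Adding 1 keeps the denominator positive when B w w = 0. With this t the form
      at v + t w equals -(B v w)^2 (B w w + 2) / (B w w + 1)^2, which is negative.\<close>
    define t where "t = - B v w / (B w w + 1)"
    have "0 \<le> B (v + t *\<^sub>R w) (v + t *\<^sub>R w)"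
      using min[of "v + t *\<^sub>R w"] W vv w by (simp add: B_def subspace_add subspace_mul)
    also have "\<dots> = B v v + t * (B v w + B w v) + t * t * B w w"
      by (simp add: B_def linear_add[OF S(1)] linear_cmul[OF S(1)] inner_add_left inner_add_right algebra_simps)
    also have "B v v = 0" using vv by (simp add: B_def \<nu>_def)
    also have "B w v = B v w" using sa[OF w vv(2)] by (simp add: B_def inner_commute)
    finally have "0 \<le> t * (2 * B v w + t * B w w)" by (simp add: algebra_simps)
    also have "2 * B v w + t * B w w = B v w * (B w w + 2) / (B w w + 1)"
      using c by (simp add: t_def field_simps)
    also have "t * (B v w * (B w w + 2) / (B w w + 1)) = - ((B v w)\<^sup>2 * (B w w + 2) / (B w w + 1)\<^sup>2)"
      using c by (simp add: t_def field_simps power2_eq_square)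
    also have "\<dots> < 0" using b c by (simp add: zero_less_mult_iff)
    finally show False by simp
  qed
  have "S v - \<nu> *\<^sub>R v \<in> W" by (intro subspace_diff subspace_mul W S vv)
  from B0[OF this] have "(S v - \<nu> *\<^sub>R v) \<bullet> (S v - \<nu> *\<^sub>R v) = 0"
    by (simp add: B_def inner_diff_left inner_diff_right algebra_simps)
  then have "S v = \<nu> *\<^sub>R v" by simp
  moreover have "v \<noteq> 0" using vv by auto
  ultimately show thesis using that vv min by blast
qed

text \<open>Subspaces and dimensions are real ones throughout, so a complex subspace is a real one
  that is closed under \<open>mscale\<close>.\<close>

definition csubspace :: "(complex^'n^'n) set \<Rightarrow> bool" where
  "csubspace W \<longleftrightarrow> subspace W \<and> (\<forall>c. \<forall>v\<in>W. mscale c v \<in> W)"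

lemma csubspace_eigenspace:
  assumes W: "csubspace W" and S: "linear S" "\<And>c v. S (mscale c v) = mscale c (S v)"
  shows "csubspace {v \<in> W. S v = \<nu> *\<^sub>R v}"
  using W unfolding csubspace_def subspace_def
  by (auto simp: linear_0[OF S(1)] linear_add[OF S(1)] linear_cmul[OF S(1)] S(2) mscale_scaleR scaleR_add_right)

text \<open>Take a nonzero invariant complex subspace V of least dimension. The operators -i ad b
  are self-adjoint because b is skew. An eigenspace of one of them in V is again complex and, as t
  commutes, invariant; so it is all of V. Every nonzero vector of V is then a joint eigenvector,
  with imaginary eigenvalues.\<close>

lemma joint_eigenvector:
  fixes W t :: "(complex^'n^'n) set"
  assumes W: "csubspace W" "W \<noteq> {0}" and inv: "\<And>b v. b \<in> t \<Longrightarrow> v \<in> W \<Longrightarrow> b ** v - v ** b \<in> W"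
    and skew: "\<And>b. b \<in> t \<Longrightarrow> conj_transpose b = - b"
    and comm: "\<And>b c. b \<in> t \<Longrightarrow> c \<in> t \<Longrightarrow> b ** c = c ** b"
  obtains j r where "j \<in> W" "j \<noteq> 0" "\<And>b. b \<in> t \<Longrightarrow> b ** j - j ** b = mscale (\<i> * of_real (r b)) j"
proof -
  define P where "P V \<longleftrightarrow> csubspace V \<and> V \<noteq> {0} \<and> V \<subseteq> W \<and> (\<forall>b\<in>t. \<forall>v\<in>V. b ** v - v ** b \<in> V)" for V
  have "P W" using W inv by (simp add: P_def)
  then obtain V where V: "P V" and min: "\<And>V'. P V' \<Longrightarrow> dim V \<le> dim V'"
    using ex_has_least_nat[of P W dim] by blast
  have Vs: "csubspace V" "subspace V" "V \<noteq> {0}" "V \<subseteq> W" and Vi: "\<And>b v. b \<in> t \<Longrightarrow> v \<in> V \<Longrightarrow> b ** v - v ** b \<in> V"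
    using V by (auto simp: P_def csubspace_def)
  have eig: "\<exists>\<nu>. \<forall>v\<in>V. b ** v - v ** b = mscale (\<i> * of_real \<nu>) v" if b: "b \<in> t" for b
  proof -
    define S where "S v = mscale (- \<i>) (b ** v - v ** b)" for v
    have lin: "linear S"
      by (rule linearI) (simp_all add: S_def mat_simps mscale_add mscale_diff mscale_scaleR algebra_simps)
    have Sc: "S (mscale c v) = mscale c (S v)" for c v
      by (simp add: S_def mat_simps mscale_diff mult.commute)
    have SV: "S v \<in> V" if "v \<in> V" for v
      using Vi[OF b that] Vs(1) by (simp add: S_def csubspace_def)
    have sa: "S u \<bullet> v = u \<bullet> S v" for u v
    proof -
      have "S u \<bullet> v = (b ** u) \<bullet> mscale \<i> v - (u ** b) \<bullet> mscale \<i> v"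
        by (simp add: S_def inner_mscale inner_diff_left)
      also have "\<dots> = u \<bullet> (conj_transpose b ** mscale \<i> v) - u \<bullet> (mscale \<i> v ** conj_transpose b)"
        by (simp only: inner_mult_left[of b u] inner_mult_right[of u b])
      also have "\<dots> = u \<bullet> S v"
        by (simp add: skew[OF b] S_def mat_simps mscale_diff mscale_uminus inner_diff_right algebra_simps)
      finally show ?thesis .
    qed
    obtain \<nu> v where v: "v \<in> V" "v \<noteq> 0" "S v = \<nu> *\<^sub>R v"
      using self_adjoint_min_eigenvector[OF Vs(2,3) lin SV sa] by blast
    let ?V = "{v \<in> V. S v = \<nu> *\<^sub>R v}"
    have "P ?V"
      unfolding P_def
    proof (intro conjI ballI)
      show "csubspace ?V" by (rule csubspace_eigenspace[OF Vs(1) lin Sc])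
      show "?V \<noteq> {0}" using v by blast
      show "?V \<subseteq> W" using Vs by blast
      fix c u assume c: "c \<in> t" and u: "u \<in> ?V"
      have cb: "c ** b = b ** c" by (rule comm[OF c b])
      have "S (c ** u - u ** c) = c ** S u - S u ** c"
      proof -
        have "b ** (c ** u - u ** c) - (c ** u - u ** c) ** b = (b ** c) ** u - b ** u ** c - c ** u ** b + u ** (c ** b)"
          by (simp add: mat_simps algebra_simps)
        also have "\<dots> = (c ** b) ** u - b ** u ** c - c ** u ** b + u ** (b ** c)" by (simp only: cb)
        also have "\<dots> = c ** (b ** u - u ** b) - (b ** u - u ** b) ** c"
          by (simp add: mat_simps algebra_simps)
        finally have *: "b ** (c ** u - u ** c) - (c ** u - u ** c) ** b = c ** (b ** u - u ** b) - (b ** u - u ** b) ** c" .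
        show ?thesis
          unfolding S_def * by (simp only: mscale_mult_left mscale_mult_right mscale_diff[symmetric])
      qed
      then show "c ** u - u ** c \<in> ?V"
        using u Vi[OF c] by (simp add: mat_simps scaleR_diff_right)
    qed
    then have "dim V \<le> dim ?V" by (rule min)
    moreover have "subspace ?V" using \<open>P ?V\<close> by (simp add: P_def csubspace_def)
    ultimately have "?V = V" using Vs(2) by (intro subspace_dim_equal) auto
    then have "S v = \<nu> *\<^sub>R v" if "v \<in> V" for v using that by blast
    then have "mscale \<i> (S v) = mscale \<i> (\<nu> *\<^sub>R v)" if "v \<in> V" for v using that by simp
    then have "b ** v - v ** b = mscale (\<i> * of_real \<nu>) v" if "v \<in> V" for v
      using that by (simp add: S_def flip: mscale_of_real)
    then show ?thesis by blast
  qed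
  then obtain r where r: "\<And>b v. b \<in> t \<Longrightarrow> v \<in> V \<Longrightarrow> b ** v - v ** b = mscale (\<i> * of_real (r b)) v"
    by metis
  obtain j where "j \<in> V" "j \<noteq> 0" using Vs subspace_0 by blast
  then show thesis using that[of j r] r Vs by blast
qed

lemma csubspace_complexification:
  assumes V: "subspace V" shows "csubspace (complexification V)"
proof -
  have sc: "mscale c v \<in> complexification V" if v: "v \<in> complexification V" for c v
  proof -
    obtain X Y where XY: "X \<in> V" "Y \<in> V" "v = X + mscale \<i> Y" using v by (auto simp: complexification_def)
    have c: "c = of_real (Re c) + \<i> * of_real (Im c)" by (rule complex_eq)
    have "mscale c v = (Re c *\<^sub>R X - Im c *\<^sub>R Y) + mscale \<i> (Re c *\<^sub>R Y + Im c *\<^sub>R X)"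
      unfolding XY(3) by (subst c) (intro mat_eqI, simp, simp add: scaleR_conv_of_real algebra_simps)
    moreover have "Re c *\<^sub>R X - Im c *\<^sub>R Y \<in> V" "Re c *\<^sub>R Y + Im c *\<^sub>R X \<in> V"
      using V XY by (auto intro: subspace_add subspace_diff subspace_mul)
    ultimately show ?thesis by (auto simp: complexification_def)
  qed
  have "subspace (complexification V)"
    unfolding subspace_def
  proof (intro conjI ballI allI)
    show "0 \<in> complexification V"
      unfolding complexification_def using subspace_0[OF V] by force
    fix u v assume "u \<in> complexification V" "v \<in> complexification V"
    then obtain X Y X' Y' where XY: "X \<in> V" "Y \<in> V" "X' \<in> V" "Y' \<in> V" "u = X + mscale \<i> Y" "v = X' + mscale \<i> Y'"
      unfolding complexification_def by blast
    then have "u + v = (X + X') + mscale \<i> (Y + Y')" by (simp add: mscale_add)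
    then show "u + v \<in> complexification V"
      unfolding complexification_def using XY subspace_add[OF V] by blast
  next
    fix c v assume "v \<in> complexification V"
    then show "c *\<^sub>R v \<in> complexification V" using sc[of v "of_real c"] by (simp add: mscale_of_real)
  qed
  with sc show ?thesis by (simp add: csubspace_def)
qed

lemma complexification_image:
  assumes "v \<in> complexification V" "\<And>X. X \<in> V \<Longrightarrow> L X \<in> V'"
    "\<And>X Y. L (X + Y) = L X + L Y" "\<And>c X. L (mscale c X) = mscale c (L X)"
  shows "L v \<in> complexification V'"
proof -
  obtain X Y where "X \<in> V" "Y \<in> V" "v = X + mscale \<i> Y" using assms(1) by (auto simp: complexification_def)
  then show ?thesis using assms(2) unfolding complexification_def by (auto simp: assms(3,4))
qed

text \<open>The adjoint maps X + i Y to -X + i Y for skew X and Y, so the skew part is the real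
  component X.\<close>

lemma skew_part_complexification:
  assumes G: "compact_group G" and v: "v \<in> complexification (lie_algebra G)"
  shows "(1/2) *\<^sub>R (v - conj_transpose v) \<in> lie_algebra G"
proof -
  obtain X Y where XY: "X \<in> lie_algebra G" "Y \<in> lie_algebra G" "v = X + mscale \<i> Y"
    using v by (auto simp: complexification_def)
  have "v - conj_transpose v = X + X"
    unfolding XY(3) ct_add ct_mscale lie_algebra_skew[OF G XY(1)] lie_algebra_skew[OF G XY(2)]
    by (simp add: mscale_uminus)
  then have "(1/2) *\<^sub>R (v - conj_transpose v) = X" by (simp flip: scaleR_2)
  then show ?thesis using XY by simp
qed

text \<open>Taking adjoints preserves the inner product, negates a skew A and fixes i B for a skew
  B. Hence A . i B = -(A . i B), and the mixed terms vanish.\<close>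

lemma complexification_orthogonal:
  assumes "u \<in> complexification V" "v \<in> complexification V'"
    and skew: "\<And>X. X \<in> V \<Longrightarrow> conj_transpose X = - X" "\<And>X. X \<in> V' \<Longrightarrow> conj_transpose X = - X"
    and orth: "\<And>X Y. X \<in> V \<Longrightarrow> Y \<in> V' \<Longrightarrow> X \<bullet> Y = 0"
  shows "u \<bullet> v = 0"
proof -
  obtain X Y X' Y' where XY: "X \<in> V" "Y \<in> V" "X' \<in> V'" "Y' \<in> V'" "u = X + mscale \<i> Y" "v = X' + mscale \<i> Y'"
    using assms(1,2) unfolding complexification_def by blast
  have *: "A \<bullet> mscale \<i> B = 0" if "conj_transpose A = - A" "conj_transpose B = - B" for A B :: "complex^'n^'n"
    using inner_ct[of A "mscale \<i> B"] that by (simp add: ct_mscale mscale_uminus)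
  have "mscale \<i> Y \<bullet> mscale \<i> Y' = Y \<bullet> Y'" by (simp add: inner_mscale)
  then show ?thesis
    using XY skew orth *[of X Y'] *[of X' Y] inner_commute[of X' "mscale \<i> Y"]
    by (simp add: inner_add_left inner_add_right)
qed

text \<open>The definition of a root asks for a root vector over the orthogonal complement of t; a
  nontrivial action of the torus on j forces this. The factor 2 pi passes from infinitesimal
  eigenvalues to the normalisation of \<open>roots\<close>.\<close>

lemma eigenvalue_trivial_or_root:
  fixes G T :: "(complex^'n^'n) set"
  assumes G: "compact_group G" and T: "compact_group T" "T \<subseteq> G" "\<And>A B. A \<in> T \<Longrightarrow> B \<in> T \<Longrightarrow> A ** B = B ** A"
    and j: "j \<in> complexification (lie_algebra G)" "j \<noteq> 0"
    and r: "\<And>b. b \<in> lie_algebra T \<Longrightarrow> b ** j - j ** b = mscale (\<i> * of_real (r b)) j"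
  shows "(\<forall>b\<in>lie_algebra T. r b = 0) \<or> restrict (\<lambda>b. r b / (2 * pi)) (lie_algebra T) \<in> roots G T"
proof (rule disj_imp[THEN iffD2], rule impI)
  let ?t = "lie_algebra T" and ?g = "lie_algebra G"
  assume nontriv: "\<not> (\<forall>b\<in>?t. r b = 0)"
  have tsub: "subspace ?t" and gsub: "subspace ?g" using G T by (auto intro: subspace_lie_algebra)
  have tg: "?t \<subseteq> ?g" using T(2) by (auto simp: lie_algebra_def)
  have radd: "r (a + b) = r a + r b" if ab: "a \<in> ?t" "b \<in> ?t" for a b
  proof -
    have "mscale (\<i> * of_real (r (a + b))) j = (a + b) ** j - j ** (a + b)"
      using r[OF subspace_add[OF tsub ab]] by simp
    also have "\<dots> = (a ** j - j ** a) + (b ** j - j ** b)" by (simp add: mat_simps)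
    also have "\<dots> = mscale (\<i> * of_real (r a + r b)) j"
      using ab by (simp add: r mscale_add_left ring_distribs)
    finally show ?thesis using j(2) by (simp add: mscale_inject flip: of_real_add)
  qed
  have rsc: "r (c *\<^sub>R a) = c * r a" if a: "a \<in> ?t" for a c
  proof -
    have "mscale (\<i> * of_real (r (c *\<^sub>R a))) j = (c *\<^sub>R a) ** j - j ** (c *\<^sub>R a)"
      using r[OF subspace_mul[OF tsub a]] by simp
    also have "\<dots> = c *\<^sub>R (a ** j - j ** a)" by (simp add: mat_simps scaleR_diff_right)
    also have "\<dots> = mscale (\<i> * of_real (c * r a)) j"
      using a by (simp add: r mult_ac flip: mscale_of_real)
    finally show ?thesis using j(2) by (simp add: mscale_inject flip: of_real_mult)
  qed
  have Ad_eig: "mexp b ** j ** conj_transpose (mexp b) = mscale (exp (\<i> * of_real (r b))) j" if b: "b \<in> ?t" for b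
  proof -
    have u: "unitary (mexp b)" using b T by (intro compact_groupD(1)[OF T(1)] mexp_in_group)
    show ?thesis
      unfolding mexp_eigen[OF r[OF b]] by (simp add: mat_simps unitaryD[OF u] flip: matrix_mul_assoc)
  qed
  have jV: "j \<in> complexification (?g \<inter> orthogonal_comp ?t)"
  proof -
    have split: "\<exists>Xt\<in>?t. \<exists>Xp\<in>?g \<inter> orthogonal_comp ?t. X = Xt + Xp" if X: "X \<in> ?g" for X
    proof -
      obtain y z where yz: "y \<in> span ?t" "\<And>w. w \<in> span ?t \<Longrightarrow> orthogonal z w" "X = y + z"
        using orthogonal_subspace_decomp_exists[of ?t X] by blast
      then have "y \<in> ?t" using tsub by (simp add: span_eq_iff[THEN iffD2])
      moreover have "z \<in> ?g" using yz X tg \<open>y \<in> ?t\<close> subspace_diff[OF gsub X, of y] by auto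
      moreover have "z \<in> orthogonal_comp ?t"
        using yz(2) by (auto simp: orthogonal_comp_def orthogonal_commute span_base)
      ultimately show ?thesis using yz(3) by blast
    qed
    obtain X Y where XY: "X \<in> ?g" "Y \<in> ?g" "j = X + mscale \<i> Y" using j by (auto simp: complexification_def)
    obtain Xt Xp where Xs: "Xt \<in> ?t" "Xp \<in> ?g \<inter> orthogonal_comp ?t" "X = Xt + Xp" using split[OF XY(1)] by blast
    obtain Yt Yp where Ys: "Yt \<in> ?t" "Yp \<in> ?g \<inter> orthogonal_comp ?t" "Y = Yt + Yp" using split[OF XY(2)] by blast
    define jt where "jt = Xt + mscale \<i> Yt"
    define jp where "jp = Xp + mscale \<i> Yp"
    have jt: "jt \<in> complexification ?t" and jp: "jp \<in> complexification (?g \<inter> orthogonal_comp ?t)"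
      using Xs Ys by (auto simp: jt_def jp_def complexification_def)
    have jsum: "j = jt + jp" by (simp add: XY Xs Ys jt_def jp_def mscale_add)
    obtain b0 where b0: "b0 \<in> ?t" "r b0 \<noteq> 0" using nontriv by blast
    \<comment> \<open>Scaled to have infinitesimal eigenvalue pi: the adjoint action L of exp b is
      the identity on the complexification of t and -1 on j. Comparison shows that 2 jt = -(L jp +
      jp), which lies over the orthogonal complement of t, so jt = 0.\<close>
    define b where "b = (pi / r b0) *\<^sub>R b0"
    have b: "b \<in> ?t" "r b = pi" using b0 by (simp_all add: b_def rsc subspace_mul[OF tsub])
    define B where "B = mexp b"
    have BT: "B \<in> T" unfolding B_def using b by (intro mexp_in_group)
    then have BG: "B \<in> G" and u: "unitary B" using T compact_groupD(1)[OF T(1)] by auto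
    define L where "L v = B ** v ** conj_transpose B" for v
    have Ladd: "L (v + w) = L v + L w" and Lsc: "L (mscale c v) = mscale c (L v)" for v w c
      by (simp_all add: L_def mat_simps)
    have Lt: "L Z = Z" if "Z \<in> ?t" for Z
    proof -
      have "b ** Z = Z ** b" using lie_algebra_commute[OF T(1,3) b(1) that] .
      then have "B ** Z = Z ** B" unfolding B_def by (rule mexp_intertwine)
      then show ?thesis by (simp add: L_def unitaryD[OF u] flip: matrix_mul_assoc)
    qed
    then have "L jt = jt" unfolding jt_def using Xs Ys by (simp add: Ladd Lsc)
    have Lp: "L Z \<in> ?g \<inter> orthogonal_comp ?t" if Z: "Z \<in> ?g \<inter> orthogonal_comp ?t" for Z
    proof -
      have "L Z \<in> ?g" unfolding L_def using Z BG G by (intro lie_algebra_Ad) auto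
      moreover have "w \<bullet> L Z = 0" if w: "w \<in> ?t" for w
      proof -
        have "w \<bullet> L Z = L w \<bullet> L Z" using Lt[OF w] by simp
        also have "\<dots> = w \<bullet> Z" by (simp add: L_def inner_unitary u unitary_ct)
        also have "\<dots> = 0" using Z w by (auto simp: orthogonal_comp_def orthogonal_def)
        finally show ?thesis .
      qed
      ultimately show ?thesis by (auto simp: orthogonal_comp_def orthogonal_def)
    qed
    have Ljp: "L jp \<in> complexification (?g \<inter> orthogonal_comp ?t)"
      by (rule complexification_image[OF jp Lp Ladd Lsc])
    have "L j = mscale (exp (\<i> * of_real pi)) j" using Ad_eig[OF b(1)] by (simp add: L_def B_def b(2))
    then have "L j = - j" by (simp add: exp_pi_i' mscale_uminus)
    then have "jt + L jp = - (jt + jp)" by (simp add: jsum Ladd \<open>L jt = jt\<close>)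
    then have e: "jt + jt = - (L jp + jp)" by (simp add: algebra_simps eq_neg_iff_add_eq_0)
    have cs: "csubspace (complexification (?g \<inter> orthogonal_comp ?t))"
      by (intro csubspace_complexification subspace_inter gsub subspace_orthogonal_comp)
    then have "subspace (complexification (?g \<inter> orthogonal_comp ?t))" by (simp add: csubspace_def)
    then have "- (L jp + jp) \<in> complexification (?g \<inter> orthogonal_comp ?t)"
      by (intro subspace_neg subspace_add jp Ljp)
    with jt have "jt \<bullet> - (L jp + jp) = 0"
      by (rule complexification_orthogonal)
        (auto intro: lie_algebra_skew[OF G] lie_algebra_skew[OF T(1)] simp: orthogonal_comp_def orthogonal_def)
    then have "jt \<bullet> (jt + jt) = 0" by (simp only: e)
    then have "2 * (jt \<bullet> jt) = 0" unfolding inner_add_right by linarith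
    then have "jt = 0" by simp
    then show ?thesis using jsum jp by simp
  qed
  show "restrict (\<lambda>b. r b / (2 * pi)) ?t \<in> roots G T"
    unfolding roots_def
  proof (intro CollectI conjI ballI allI)
    fix a b assume ab: "a \<in> ?t" "b \<in> ?t"
    then show "restrict (\<lambda>b. r b / (2 * pi)) ?t (a + b) = restrict (\<lambda>b. r b / (2 * pi)) ?t a + restrict (\<lambda>b. r b / (2 * pi)) ?t b"
      using subspace_add[OF tsub ab] by (simp add: radd add_divide_distrib)
  next
    fix c a assume a: "a \<in> ?t"
    then show "restrict (\<lambda>b. r b / (2 * pi)) ?t (c *\<^sub>R a) = c * restrict (\<lambda>b. r b / (2 * pi)) ?t a"
      using subspace_mul[OF tsub a] by (simp add: rsc)
  next
    show "\<exists>a\<in>?t. restrict (\<lambda>b. r b / (2 * pi)) ?t a \<noteq> 0" using nontriv by auto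
    show "\<exists>j\<in>complexification (?g \<inter> orthogonal_comp ?t). j \<noteq> 0 \<and>
        (\<forall>a\<in>?t. Ad (mexp a) j = mscale (exp (2 * \<i> * of_real pi * of_real (restrict (\<lambda>b. r b / (2 * pi)) ?t a))) j)"
    proof (rule bexI[OF _ jV], intro conjI j(2) ballI)
      fix a assume a: "a \<in> ?t"
      have "unitary (mexp a)" using a T by (intro compact_groupD(1)[OF T(1)] mexp_in_group)
      then show "Ad (mexp a) j = mscale (exp (2 * \<i> * of_real pi * of_real (restrict (\<lambda>b. r b / (2 * pi)) ?t a))) j"
        using Ad_eig[OF a] a by (simp add: Ad_def matrix_inv_unitary)
    qed
  qed simp
qed

text \<open>The Taylor bound |sin x - x| <= |x|^3 / 6 leaves at least half of |x| as long as x^2 is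
  at most 3, which holds up to pi/2.\<close>

lemma abs_sin_ge_half:
  fixes x :: real assumes "\<bar>x\<bar> \<le> pi / 2" shows "\<bar>x\<bar> / 2 \<le> \<bar>sin x\<bar>"
proof -
  have "\<bar>sin x - (\<Sum>m<3. sin_coeff m * x ^ m)\<bar> \<le> inverse (fact 3) * \<bar>x\<bar> ^ 3"
    by (rule Maclaurin_sin_bound)
  moreover have "(\<Sum>m<3. sin_coeff m * x ^ m) = x" by (simp add: numeral_3_eq_3 sin_coeff_def)
  ultimately have *: "\<bar>sin x - x\<bar> \<le> \<bar>x\<bar> ^ 3 / 6" by (simp add: fact_numeral)
  have "pi \<le> 34/10" using pi_approx(2) by (rule order_trans) simp
  then have "\<bar>x\<bar> \<le> 17/10" using assms by simp
  then have "\<bar>x\<bar>\<^sup>2 \<le> (17/10)\<^sup>2" by (rule power_mono) simp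
  then have "\<bar>x\<bar>\<^sup>2 \<le> 3" by (simp add: power2_eq_square)
  then have "\<bar>x\<bar> * \<bar>x\<bar>\<^sup>2 \<le> \<bar>x\<bar> * 3" by (rule mult_left_mono) simp
  then have "\<bar>x\<bar> ^ 3 / 6 \<le> \<bar>x\<bar> / 2" by (simp add: power2_eq_square power3_eq_cube)
  with * show ?thesis by linarith
qed

text \<open>With d the signed distance of x - y to a nearest integer, the chord has length 2 |sin(pi
  d)|, at least pi |d|. This converts arithmetic conditions into lower bounds for divisors.\<close>

lemma cmod_cis_diff: "infdist (x - y) \<int> \<le> cmod (cis (2 * pi * x) - cis (2 * pi * y))"
proof -
  define d where "d = x - y - of_int (round (x - y))"
  have d: "\<bar>d\<bar> \<le> 1/2" using of_int_round_abs_le[of "x - y"] by (simp add: d_def abs_minus_commute)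
  have "infdist (x - y) \<int> \<le> \<bar>d\<bar>"
    using infdist_le[of "of_int (round (x - y))" \<int> "x - y"] by (simp add: d_def dist_real_def)
  also have "\<bar>d\<bar> \<le> \<bar>pi * d\<bar> / 2 * 2"
    using pi_ge_two mult_right_mono[of 1 pi "\<bar>d\<bar>"] by (simp add: abs_mult)
  also have "\<bar>pi * d\<bar> / 2 \<le> \<bar>sin (pi * d)\<bar>"
    using d by (intro abs_sin_ge_half) (simp add: abs_mult)
  also have "\<bar>sin (pi * d)\<bar> * 2 = cmod (cis (2 * pi * x) - cis (2 * pi * y))"
  proof -
    have "cis (2 * pi * x) = cis (2 * pi * y) * cis (2 * (pi * d))"
    proof -
      have "2 * pi * x = 2 * pi * y + 2 * (pi * d) + 2 * pi * of_int (round (x - y))"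
        by (simp add: d_def algebra_simps)
      then show ?thesis by (simp add: cis_multiple_2pi flip: cis_mult)
    qed
    then have "cis (2 * pi * x) - cis (2 * pi * y) = cis (2 * pi * y) * (cis (2 * (pi * d)) - 1)"
      by (simp add: algebra_simps)
    then have "cmod (cis (2 * pi * x) - cis (2 * pi * y)) = cmod (cis (2 * (pi * d)) - 1)"
      by (simp add: norm_mult)
    moreover have sq: "(cmod (cis (2 * (pi * d)) - 1))\<^sup>2 = (\<bar>sin (pi * d)\<bar> * 2)\<^sup>2"
    proof -
      have "(cmod (cis (2 * (pi * d)) - 1))\<^sup>2 = (cos (2 * (pi * d)) - 1)\<^sup>2 + (sin (2 * (pi * d)))\<^sup>2"
        by (simp add: cmod_power2)
      also have "\<dots> = 2 - 2 * cos (2 * (pi * d))"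
        using sin_cos_squared_add[of "2 * (pi * d)"] by (simp add: power2_eq_square algebra_simps)
      also have "\<dots> = (\<bar>sin (pi * d)\<bar> * 2)\<^sup>2"
        by (simp add: cos_double_sin power_mult_distrib)
      finally show ?thesis .
    qed
    moreover have "cmod (cis (2 * (pi * d)) - 1) = \<bar>sin (pi * d)\<bar> * 2"
      by (rule power2_eq_imp_eq[OF sq]) simp_all
    ultimately show ?thesis by (simp only:)
  qed
  finally show ?thesis by simp
qed

subsection \<open>Trigonometric approximation on the torus\<close>

abbreviation cube :: "(real^'d) measure" where
  "cube \<equiv> lebesgue_on (cbox 0 1)"

lemma mem_unit_cube: "(x::real^'d) \<in> cbox 0 1 \<longleftrightarrow> (\<forall>i. 0 \<le> x $ i \<and> x $ i \<le> 1)"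
  by (simp add: mem_box_cart)

lemma one_inner_Basis: "b \<in> Basis \<Longrightarrow> (1::real^'d) \<bullet> b = 1"
  by (auto simp: Basis_vec_def inner_axis)

lemma emeasure_cube: "emeasure cube (cbox 0 (1::real^'d)) = 1"
proof -
  have "emeasure lborel (cbox 0 (1::real^'d)) = 1"
    by (subst emeasure_lborel_cbox) (auto simp: one_inner_Basis)
  then show ?thesis by (simp add: emeasure_restrict_space)
qed

interpretation cube: finite_measure "cube :: (real^'d) measure"
  by standard (simp add: emeasure_cube)

lemma measure_cube [simp]: "Sigma_Algebra.measure cube (cbox 0 (1::real^'d)) = 1"
  by (simp add: measure_def emeasure_cube)

lemma integral_exp_int:
  fixes n :: int
  shows "(LBINT t. indicat_real {0..1} t *\<^sub>R exp (2 * \<i> * of_real pi * of_int n * of_real t)) = (if n = 0 then 1 else 0)"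
proof (cases "n = 0")
  case False
  define c where "c = 2 * \<i> * of_real pi * (of_int n :: complex)"
  have c0: "c \<noteq> 0" using False by (simp add: c_def)
  have "(LBINT t. indicat_real {0..1} t *\<^sub>R exp (c * of_real t)) = exp (c * of_real 1) / c - exp (c * of_real 0) / c"
  proof (rule integral_FTC_atLeastAtMost)
    show "((\<lambda>t. exp (c * of_real t) / c) has_vector_derivative exp (c * of_real x)) (at x within {0..1})" for x
      by (rule has_vector_derivative_real_field) (use c0 in \<open>auto intro!: derivative_eq_intros\<close>)
    show "continuous_on {0..1} (\<lambda>t. exp (c * of_real t))" by (intro continuous_intros)
  qed simp
  moreover have "exp c = 1"
    using exp_eq_1[of c] by (simp add: c_def)
  ultimately show ?thesis using False by (simp add: c_def)
qed (simp add: scaleR_conv_of_real)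

interpretation lborel_product: product_sigma_finite "\<lambda>_. lborel :: real measure"
  by standard

text \<open>The integral is rewritten over the product measure indexed by \<open>Basis\<close>,
  where the character splits into one factor per coordinate; a factor of nonzero frequency
  integrates to 0.\<close>

lemma integral_ek: "integral\<^sup>L cube (ek k) = (if k = 0 then 1 else (0::complex))"
proof -
  let ?F = "\<lambda>b t. indicat_real {0..1} t *\<^sub>R exp (2 * \<i> * of_real pi * of_real (real_vec k \<bullet> b) * of_real t)"
  have kb: "\<exists>i. real_vec k \<bullet> b = of_int (k $ i) \<and> b = axis i 1" if "b \<in> Basis" for b
    using that by (auto simp: Basis_vec_def inner_axis)
  have meas: "(\<lambda>x. indicat_real (cbox 0 1) x *\<^sub>R ek k x) \<in> borel_measurable borel"
    by (intro borel_measurable_scaleR borel_measurable_indicator borel_measurable_continuous_onI continuous_on_ek) simp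
  have pt: "indicat_real (cbox 0 1) (\<Sum>b\<in>Basis. f b *\<^sub>R b) *\<^sub>R ek k (\<Sum>b\<in>Basis. f b *\<^sub>R b) = (\<Prod>b\<in>Basis. ?F b (f b))" for f
  proof -
    let ?x = "\<Sum>b\<in>Basis. f b *\<^sub>R b :: real^'a"
    have xb: "?x \<bullet> b = f b" if "b \<in> Basis" for b using that by (rule inner_sum_left_Basis)
    have e: "ek k ?x = (\<Prod>b\<in>Basis. exp (2 * \<i> * of_real pi * of_real (real_vec k \<bullet> b) * of_real (f b)))"
      unfolding ek_def by (subst exp_sum[symmetric]) (simp_all add: inner_sum_right sum_distrib_left mult_ac)
    show ?thesis
    proof (cases "\<forall>b\<in>Basis. f b \<in> {0..1}")
      case True
      then have "?x \<in> cbox 0 1" using xb by (simp add: mem_box one_inner_Basis)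
      moreover have "(\<Prod>b\<in>Basis. ?F b (f b)) = (\<Prod>b\<in>Basis. exp (2 * \<i> * of_real pi * of_real (real_vec k \<bullet> b) * of_real (f b)))"
        using True by (intro prod.cong) auto
      ultimately show ?thesis by (simp add: e)
    next
      case False
      then obtain b where b: "b \<in> Basis" "f b \<notin> {0..1}" by blast
      then have "?x \<notin> cbox 0 1" using xb[OF b(1)] by (auto simp: mem_box one_inner_Basis)
      moreover have "(\<Prod>b\<in>Basis. ?F b (f b)) = 0"
        by (rule prod_zero[OF finite_Basis], rule bexI[of _ b]) (use b in \<open>simp_all add: indicator_def\<close>)
      ultimately show ?thesis by simp
    qed
  qed
  have "integral\<^sup>L cube (ek k) = integral\<^sup>L lborel (\<lambda>x. indicat_real (cbox 0 1) x *\<^sub>R ek k x)"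
    by (subst integral_restrict_space, simp) (intro integral_completion, use meas in simp)
  also have "\<dots> = (LINT f|Pi\<^sub>M Basis (\<lambda>_. lborel). (\<Prod>b\<in>Basis. ?F b (f b)))"
    by (subst lborel_eq, subst integral_distr) (use meas in \<open>simp_all add: pt\<close>)
  also have "\<dots> = (\<Prod>b\<in>Basis. integral\<^sup>L lborel (?F b))"
  proof (rule lborel_product.product_integral_prod)
    fix b :: "real^'a"
    show "integrable lborel (?F b)"
      by (rule borel_integrable_compact) (auto intro!: continuous_intros)
  qed simp
  also have "\<dots> = (\<Prod>b\<in>Basis. if real_vec k \<bullet> b = 0 then 1 else 0)"
  proof (rule prod.cong[OF refl])
    fix b :: "real^'a" assume "b \<in> Basis"
    then obtain i where "real_vec k \<bullet> b = of_int (k $ i)" using kb by blast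
    then show "integral\<^sup>L lborel (?F b) = (if real_vec k \<bullet> b = 0 then 1 else 0)"
      using integral_exp_int[of "k $ i"] by simp
  qed
  also have "\<dots> = (if k = 0 then 1 else 0)"
  proof (cases "k = 0")
    case False
    then have "\<exists>b\<in>Basis. real_vec k \<bullet> b \<noteq> 0" using euclidean_all_zero_iff[of "real_vec k"] by auto
    then show ?thesis using False by (auto intro!: prod_zero)
  qed simp
  finally show ?thesis .
qed

lemma exists_cube_shift: "\<exists>k. x + real_vec k \<in> cbox 0 1"
proof
  show "x + real_vec (\<chi> i. - \<lfloor>x $ i\<rfloor>) \<in> cbox 0 1"
    by (simp add: mem_unit_cube) linarith
qed

lemma periodicD: "periodic f \<Longrightarrow> f (x + real_vec k) = f x"
  by (simp add: periodic_def)

section \<open>Stone-Weierstrass approximation through a product of circles\<close>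

definition circ :: "real^'d \<Rightarrow> complex^'d" where
  "circ x = (\<chi> j. cis (2 * pi * x $ j))"

lemma circ_eqD: assumes "circ x = circ y" shows "\<exists>k. x = y + real_vec k"
proof -
  have "\<exists>n::int. x $ j = y $ j + of_int n" for j
  proof -
    have "cis (2 * pi * x $ j) = cis (2 * pi * y $ j)"
      using assms by (simp add: circ_def vec_eq_iff)
    then have "sin (2 * pi * x $ j) = sin (2 * pi * y $ j) \<and> cos (2 * pi * x $ j) = cos (2 * pi * y $ j)"
      by (simp add: complex_eq_iff)
    then obtain n :: int where "2 * pi * x $ j = 2 * pi * y $ j + 2 * pi * n"
      using sin_cos_eq_iff by blast
    then have "2 * pi * x $ j = 2 * pi * (y $ j + n)" by (simp add: algebra_simps)
    then show ?thesis by (intro exI[of _ n]) simp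
  qed
  then obtain n :: "'a \<Rightarrow> int" where n: "\<And>j. x $ j = y $ j + of_int (n j)" by metis
  then show ?thesis by (intro exI[of _ "\<chi> j. n j"]) (simp add: vec_eq_iff)
qed

definition strig :: "(real^'d \<Rightarrow> complex) \<Rightarrow> bool" where
  "strig h \<longleftrightarrow> (\<exists>ps. \<forall>x. h x = (\<Sum>p\<leftarrow>ps. snd p * ek (fst p) x))"

lemma strig_single: "strig (\<lambda>x. c * ek k x)"
  unfolding strig_def by (intro exI[of _ "[(k, c)]"]) simp

lemma strig_const: "strig (\<lambda>x. c)"
  using strig_single[of c 0] by simp

lemma strig_add: assumes "strig f" "strig g" shows "strig (\<lambda>x. f x + g x)"
proof -
  obtain ps qs where "\<And>x. f x = (\<Sum>p\<leftarrow>ps. snd p * ek (fst p) x)" "\<And>x. g x = (\<Sum>p\<leftarrow>qs. snd p * ek (fst p) x)"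
    using assms unfolding strig_def by blast
  then show ?thesis unfolding strig_def by (intro exI[of _ "ps @ qs"]) simp
qed

lemma strig_sum: "finite A \<Longrightarrow> (\<And>a. a \<in> A \<Longrightarrow> strig (f a)) \<Longrightarrow> strig (\<lambda>x. \<Sum>a\<in>A. f a x)"
  by (induction A rule: finite_induct) (auto intro: strig_add strig_const)

lemma strig_mult: assumes "strig f" "strig g" shows "strig (\<lambda>x. f x * g x)"
proof -
  obtain ps qs where f: "\<And>x. f x = (\<Sum>p\<leftarrow>ps. snd p * ek (fst p) x)" and g: "\<And>x. g x = (\<Sum>q\<leftarrow>qs. snd q * ek (fst q) x)"
    using assms unfolding strig_def by blast
  have one: "strig (\<lambda>x. c * ek k x * (\<Sum>q\<leftarrow>qs. snd q * ek (fst q) x))" for c k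
  proof (induction qs)
    case Nil then show ?case using strig_const[of 0] by simp
  next
    case (Cons q qs)
    then have "strig (\<lambda>x. (c * snd q) * ek (k + fst q) x + c * ek k x * (\<Sum>q\<leftarrow>qs. snd q * ek (fst q) x))"
      by (intro strig_add strig_single)
    then show ?case by (simp add: ek_add algebra_simps)
  qed
  have "strig (\<lambda>x. (\<Sum>p\<leftarrow>ps. snd p * ek (fst p) x) * (\<Sum>q\<leftarrow>qs. snd q * ek (fst q) x))"
  proof (induction ps)
    case Nil then show ?case using strig_const[of 0] by simp
  next
    case (Cons p ps)
    from strig_add[OF one[of "snd p" "fst p"] this] show ?case by (simp add: algebra_simps)
  qed
  then show ?thesis by (simp add: f g)
qed

text \<open>Pulled back by \<open>circ\<close>, a real-linear form is a combination of cosines and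
  sines of the coordinates, hence of characters whose frequency is plus or minus a unit vector. Sums
  and products of trigonometric polynomials are again such.\<close>

lemma strig_polynomial:
  assumes "real_polynomial_function g"
  shows "strig (\<lambda>x::real^'d. of_real (g (circ x)))"
  using assms
proof (induction rule: real_polynomial_function.induct)
  case (linear f)
  have dec: "f (circ x) = (\<Sum>j\<in>UNIV. cos (2 * pi * x $ j) * f (axis j 1) + sin (2 * pi * x $ j) * f (axis j \<i>))" for x :: "real^'d"
  proof -
    have "circ x = (\<Sum>j\<in>UNIV. cos (2 * pi * x $ j) *\<^sub>R axis j 1 + sin (2 * pi * x $ j) *\<^sub>R axis j \<i>)"
    proof (subst vec_eq_iff, rule allI)
      fix i
      have "(\<Sum>j\<in>UNIV. cos (2 * pi * x $ j) *\<^sub>R axis j 1 + sin (2 * pi * x $ j) *\<^sub>R axis j \<i>) $ i =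
          (\<Sum>j\<in>UNIV. if j = i then cis (2 * pi * x $ j) else 0)"
        by (simp only: sum_component) (intro sum.cong, auto simp: axis_def complex_eq_iff)
      then show "circ x $ i = (\<Sum>j\<in>UNIV. cos (2 * pi * x $ j) *\<^sub>R axis j 1 + sin (2 * pi * x $ j) *\<^sub>R axis j \<i>) $ i"
        by (simp add: circ_def)
    qed
    then show ?thesis
      using linear by (simp add: bounded_linear.linear linear_sum linear_add linear_cmul)
  qed
  have ekj: "ek (axis j 1) x = cis (2 * pi * x $ j)" "ek (- axis j 1) x = cis (- (2 * pi * x $ j))" for j and x :: "real^'d"
  proof -
    have "real_vec (axis j 1) = axis j 1" by (simp add: vec_eq_iff axis_def)
    then show "ek (axis j 1) x = cis (2 * pi * x $ j)" "ek (- axis j 1) x = cis (- (2 * pi * x $ j))"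
      by (simp_all add: ek_cis real_vec_uminus inner_axis inner_axis')
  qed
  have c: "complex_of_real (cos (2 * pi * x $ j)) = (1/2) * ek (axis j 1) x + (1/2) * ek (- axis j 1) x"
    and s: "complex_of_real (sin (2 * pi * x $ j)) = (- \<i>/2) * ek (axis j 1) x + (\<i>/2) * ek (- axis j 1) x" for j and x :: "real^'d"
    unfolding ekj by (simp_all add: complex_eq_iff)
  have cs: "strig (\<lambda>x::real^'d. of_real (cos (2 * pi * x $ j)))" "strig (\<lambda>x::real^'d. of_real (sin (2 * pi * x $ j)))" for j
    unfolding c s by (intro strig_add strig_single)+
  show ?case
    unfolding dec of_real_sum of_real_add of_real_mult
    by (intro strig_sum strig_add strig_mult strig_const cs) simp
next
  case (const c) then show ?case by (intro strig_const)
next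
  case (add f g) then show ?case unfolding of_real_add by (intro strig_add)
next
  case (mult f g) then show ?case unfolding of_real_mult by (intro strig_mult)
qed

text \<open>Equal values at points of the cube that differ by a lattice vector let h descend to the
  compact image of \<open>circ\<close>, where polynomial approximation applies. The condition is
  imposed inside the cube only, so that h may be arbitrary outside it.\<close>

lemma trig_approx_cube:
  fixes h :: "real^'d \<Rightarrow> complex^'n^'n"
  assumes cont: "continuous_on (cbox 0 1) h" and "e > 0"
    and per: "\<And>x y k. x \<in> cbox 0 1 \<Longrightarrow> y \<in> cbox 0 1 \<Longrightarrow> x = y + real_vec k \<Longrightarrow> h x = h y"
  shows "\<exists>ps. \<forall>x\<in>cbox 0 1. norm (h x - tpoly ps x) < e"
proof -
  let ?Q = "cbox 0 (1::real^'d)"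
  define S where "S = circ ` ?Q"
  have contc: "continuous_on A circ" for A :: "(real^'d) set"
    unfolding circ_def cis_conv_exp by (intro continuous_intros continuous_on_vec_lambda)
  have S: "compact S" unfolding S_def by (intro compact_continuous_image contc compact_cbox)
  \<comment> \<open>The descended map, through a choice of preimages. It is continuous because
    \<open>circ\<close> sends compact subsets of the cube to compact, hence closed, sets.\<close>
  define \<phi> where "\<phi> z = h (SOME x. x \<in> ?Q \<and> circ x = z)" for z
  have \<phi>: "\<phi> (circ x) = h x" if x: "x \<in> ?Q" for x
  proof -
    define y where "y = (SOME y. y \<in> ?Q \<and> circ y = circ x)"
    have y: "y \<in> ?Q \<and> circ y = circ x"
      unfolding y_def by (rule someI[of _ x]) (simp add: x)
    then obtain k where "y = x + real_vec k" using circ_eqD by blast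
    then have "h y = h x" using per y x by blast
    then show ?thesis by (simp add: \<phi>_def y_def)
  qed
  have "continuous_on S \<phi>"
    unfolding continuous_on_closed_vimage[OF compact_imp_closed[OF S]]
  proof (intro allI impI)
    fix B :: "(complex^'n^'n) set" assume "closed B"
    have "\<phi> -` B \<inter> S = circ ` (h -` B \<inter> ?Q)" using \<phi> by (auto simp: S_def)
    moreover have "closed (h -` B \<inter> ?Q)"
      using cont \<open>closed B\<close> continuous_on_closed_vimage[OF closed_cbox] by blast
    then have "compact (h -` B \<inter> ?Q)" using compact_Int_closed[OF compact_cbox, of "h -` B \<inter> ?Q" 0 1]
      by (simp add: Int_absorb1 Int_commute)
    then have "compact (circ ` (h -` B \<inter> ?Q))" by (intro compact_continuous_image contc)
    ultimately show "closed (\<phi> -` B \<inter> S)" by (simp add: compact_imp_closed)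
  qed
  from Stone_Weierstrass_polynomial_function[OF S this \<open>e > 0\<close>]
  obtain g where g: "polynomial_function g" "\<And>z. z \<in> S \<Longrightarrow> norm (\<phi> z - g z) < e" by auto
  have "\<exists>ps. \<forall>x. tpoly ps x = (\<Sum>b\<in>A. (g (circ x) \<bullet> b) *\<^sub>R b)" if "finite A" for A :: "(complex^'n^'n) set"
    using that
  proof (induction A rule: finite_induct)
    case empty then show ?case by (intro exI[of _ "[]"]) simp
  next
    case (insert b A)
    then obtain ps where ps: "\<And>x. tpoly ps x = (\<Sum>b\<in>A. (g (circ x) \<bullet> b) *\<^sub>R b)" by blast
    have "real_polynomial_function (\<lambda>z. g z \<bullet> b)"
      using g(1) unfolding polynomial_function_def by (auto simp: o_def intro: bounded_linear_inner_left)
    from strig_polynomial[OF this] obtain qs where qs: "\<And>x::real^'d. of_real (g (circ x) \<bullet> b) = (\<Sum>q\<leftarrow>qs. snd q * ek (fst q) x)"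
      unfolding strig_def by blast
    have "tpoly (map (\<lambda>q. (fst q, mscale (snd q) b)) qs) x = mscale (\<Sum>q\<leftarrow>qs. snd q * ek (fst q) x) b" for x :: "real^'d"
      by (induction qs) (simp_all add: mscale_add_left mult.commute)
    then have "tpoly (map (\<lambda>q. (fst q, mscale (snd q) b)) qs) x = (g (circ x) \<bullet> b) *\<^sub>R b" for x :: "real^'d"
      by (simp add: qs[symmetric] mscale_of_real)
    then show ?case using insert
      by (intro exI[of _ "map (\<lambda>q. (fst q, mscale (snd q) b)) qs @ ps"]) (simp add: ps)
  qed
  from this[of Basis] obtain ps where "\<And>x. tpoly ps x = g (circ x)" by (auto simp: euclidean_representation)
  then have "norm (h x - tpoly ps x) < e" if "x \<in> ?Q" for x
    using g(2)[of "circ x"] \<phi>[OF that] that by (simp add: S_def)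
  then show ?thesis by blast
qed

lemma trig_approx_periodic:
  fixes f :: "real^'d \<Rightarrow> complex^'n^'n"
  assumes "continuous_on UNIV f" "periodic f" "e > 0"
  obtains ps where "\<And>x. norm (f x - tpoly ps x) < e"
proof -
  obtain ps where ps: "\<forall>x\<in>cbox 0 1. norm (f x - tpoly ps x) < e"
    using trig_approx_cube[of f e] assms continuous_on_subset by (metis periodicD subset_UNIV)
  have "norm (f x - tpoly ps x) < e" for x
    using exists_cube_shift[of x] ps by (metis assms(2) periodicD tpoly_periodic)
  then show thesis by (rule that)
qed

lemma periodic_continuous_bounded:
  fixes f :: "real^'d \<Rightarrow> 'b::real_normed_vector"
  assumes "continuous_on UNIV f" "periodic f"
  obtains B where "\<And>x. norm (f x) \<le> B"
proof -
  have "bounded (f ` cbox 0 1)"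
    using assms(1) by (intro compact_imp_bounded compact_continuous_image compact_cbox) (rule continuous_on_subset, auto)
  then obtain B where B: "\<And>x. x \<in> cbox 0 1 \<Longrightarrow> norm (f x) \<le> B" by (auto simp: bounded_iff)
  have "norm (f x) \<le> B" for x
    using exists_cube_shift[of x] B by (metis assms(2) periodicD)
  then show thesis by (rule that)
qed

lemma measurable_cube_continuous:
  "continuous_on UNIV f \<Longrightarrow> f \<in> borel_measurable cube"
  by (rule continuous_imp_measurable_on_sets_lebesgue) (auto intro: continuous_on_subset)

lemma measurable_cube_lebesgue: "f \<in> borel_measurable lebesgue \<Longrightarrow> f \<in> borel_measurable cube"
  by (rule measurable_restrict_space1)

lemma integrable_cube_bounded:
  fixes f :: "real^'d \<Rightarrow> 'b::{banach, second_countable_topology}"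
  shows "f \<in> borel_measurable cube \<Longrightarrow> (\<And>x. norm (f x) \<le> B) \<Longrightarrow> integrable cube f"
  by (rule cube.integrable_const_bound[of _ B]) auto

lemma integral_cube_le:
  fixes f :: "real^'d \<Rightarrow> real"
  assumes "integrable cube f" "\<And>x. f x \<le> B" shows "integral\<^sup>L cube f \<le> B"
  using integral_mono[OF assms(1), of "\<lambda>_. B"] assms(2) by simp

text \<open>Cutting off near the boundary of the cube makes the continuous approximants periodic.\<close>

lemma L1_approx:
  fixes f :: "real^'d \<Rightarrow> complex^'n^'n"
  assumes f: "f \<in> borel_measurable lebesgue" and B: "\<And>x. norm (f x) \<le> B" and "e > 0"
  obtains ps where "(LINT x|cube. norm (f x - tpoly ps x)) < e"
proof -
  let ?Q = "cbox 0 (1::real^'d)"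
  define b where "b = max B 1"
  have b: "b > 0" "\<And>x. norm (f x) \<le> b" using B by (simp_all add: b_def max.coboundedI1)
  have "f measurable_on UNIV" using f by (simp add: lebesgue_measurable_imp_measurable_on)
  then obtain N g where N: "negligible N" "\<And>n. continuous_on UNIV (g n)" "\<And>x. x \<notin> N \<Longrightarrow> (\<lambda>n. g n x) \<longlonglongrightarrow> f x"
    unfolding measurable_on_def by auto
  \<comment> \<open>Radial truncation of values at norm b. The continuous approximants carry no
    bound of their own and dominated convergence asks for one; the values of f are
    unchanged.\<close>
  define c where "c y = (b / max b (norm y)) *\<^sub>R y" for y :: "complex^'n^'n"
  have c_le: "norm (c y) \<le> b" and c_id: "norm y \<le> b \<Longrightarrow> c y = y" for y
    using b by (auto simp: c_def field_simps max_def split: if_splits)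
  have cc: "continuous_on UNIV c" unfolding c_def using b by (intro continuous_intros) (auto simp: max_def)
  define \<eta> where "\<eta> n x = min 1 (real n * infdist x (- box 0 (1::real^'d)))" for n and x
  have ne: "- box 0 (1::real^'d) \<noteq> {}"
  proof -
    have "(0::real^'d) \<in> - box 0 1" by (simp add: mem_box_cart)
    then show ?thesis by blast
  qed
  have \<eta>01: "0 \<le> \<eta> n x" "\<eta> n x \<le> 1" for n x by (auto simp: \<eta>_def infdist_nonneg)
  have \<eta>0: "\<eta> n x = 0" if "x \<notin> box 0 1" for n x using that by (simp add: \<eta>_def)
  have \<eta>lim: "(\<lambda>n. \<eta> n x) \<longlonglongrightarrow> 1" if x: "x \<in> box 0 1" for x
  proof -
    have "infdist x (- box 0 1) > 0"
      using x ne infdist_pos_not_in_closed[of "- box 0 1" x] by (simp add: closed_Compl open_box)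
    then obtain m :: nat where m: "1 \<le> real m * infdist x (- box 0 1)"
      using reals_Archimedean3 by (metis less_imp_le)
    have "\<eta> n x = 1" if "n \<ge> m" for n
    proof -
      have "real m * infdist x (- box 0 1) \<le> real n * infdist x (- box 0 1)"
        using that by (intro mult_right_mono infdist_nonneg) auto
      then show ?thesis using m by (simp add: \<eta>_def)
    qed
    then show ?thesis by (intro tendsto_eventually) (auto simp: eventually_sequentially)
  qed
  define h where "h n x = \<eta> n x *\<^sub>R c (g n x)" for n x
  have hc: "continuous_on UNIV (h n)" for n
    unfolding h_def \<eta>_def
    by (intro continuous_intros continuous_on_compose2[OF cc N(2)] continuous_on_infdist) auto
  have h_le: "norm (h n x) \<le> b" for n x
    using \<eta>01[of n x] c_le[of "g n x"] mult_mono[of "\<eta> n x" 1 "norm (c (g n x))" b] b by (simp add: h_def)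
  have hlim: "(\<lambda>n. h n x) \<longlonglongrightarrow> f x" if "x \<notin> N" "x \<in> box 0 1" for x
  proof -
    have "(\<lambda>n. c (g n x)) \<longlonglongrightarrow> c (f x)"
      using cc N(3)[OF that(1)] by (intro isCont_tendsto_compose[where g=c]) (auto simp: continuous_on_eq_continuous_at)
    then have "(\<lambda>n. h n x) \<longlonglongrightarrow> 1 *\<^sub>R c (f x)" unfolding h_def by (intro tendsto_scaleR \<eta>lim that)
    then show ?thesis using c_id b by simp
  qed
  have fm: "f \<in> borel_measurable cube" by (rule measurable_cube_lebesgue[OF f])
  have hm: "h n \<in> borel_measurable cube" for n by (rule measurable_cube_continuous[OF hc])
  have "(\<lambda>n. LINT x|cube. norm (f x - h n x)) \<longlonglongrightarrow> (LINT x|(cube::(real^'d) measure). 0)"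
  proof (rule integral_dominated_convergence[where w="\<lambda>_. 2 * b"])
    have "negligible (N \<union> (cbox 0 1 - box 0 1))" using N(1) by (intro negligible_Un negligible_frontier_interval)
    then have "N \<union> (cbox 0 1 - box 0 1) \<in> null_sets lebesgue" by (simp add: negligible_iff_null_sets)
    then have "AE x in lebesgue. x \<notin> N \<union> (cbox 0 1 - box 0 1)" by (rule AE_not_in)
    then have "AE x in cube. x \<notin> N \<and> x \<in> box 0 1"
      by (subst AE_restrict_space_iff) (auto elim: eventually_mono)
    then show "AE x in cube. (\<lambda>n. norm (f x - h n x)) \<longlonglongrightarrow> 0"
    proof eventually_elim
      case (elim x)
      then have "(\<lambda>n. f x - h n x) \<longlonglongrightarrow> f x - f x" by (intro tendsto_diff tendsto_const hlim) auto
      then show ?case using tendsto_norm_zero by fastforce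
    qed
    have "norm (f x - h n x) \<le> 2 * b" for n x
      using norm_triangle_ineq4[of "f x" "h n x"] b(2)[of x] h_le[of n x] by linarith
    then show "AE x in cube. norm (norm (f x - h n x)) \<le> 2 * b" for n by simp
  qed (use fm hm in auto)
  then have "\<forall>\<^sub>F n in sequentially. (LINT x|cube. norm (f x - h n x)) < e / 2"
    using \<open>e > 0\<close> by (intro order_tendstoD) auto
  then obtain n where n: "(LINT x|cube. norm (f x - h n x)) < e / 2" by (auto simp: eventually_sequentially)
  have "\<exists>ps. \<forall>x\<in>?Q. norm (h n x - tpoly ps x) < e / 2"
  proof (rule trig_approx_cube)
    show "continuous_on ?Q (h n)" using hc by (rule continuous_on_subset) simp
    fix x y k assume xy: "x \<in> ?Q" "y \<in> ?Q" "x = y + real_vec k"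
    show "h n x = h n y"
    proof (cases "k = 0")
      case False
      then obtain i where i: "k $ i \<noteq> 0" by (auto simp: vec_eq_iff)
      have "x $ i = y $ i + of_int (k $ i)" using xy by simp
      moreover have "0 \<le> x $ i" "x $ i \<le> 1" "0 \<le> y $ i" "y $ i \<le> 1" using xy by (auto simp: mem_unit_cube)
      moreover have "1 \<le> \<bar>real_of_int (k $ i)\<bar>" using i by linarith
      ultimately have "(x $ i = 0 \<and> y $ i = 1) \<or> (x $ i = 1 \<and> y $ i = 0)" by linarith
      then have "\<not> (0 < x $ i \<and> x $ i < 1)" "\<not> (0 < y $ i \<and> y $ i < 1)" by auto
      then have "x \<notin> box 0 1" "y \<notin> box 0 1" by (auto simp: mem_box_cart dest!: spec[of _ i])
      then show ?thesis by (simp add: h_def \<eta>0)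
    qed (use xy in simp)
  qed (use \<open>e > 0\<close> in simp)
  then obtain ps where ps: "\<And>x. x \<in> ?Q \<Longrightarrow> norm (h n x - tpoly ps x) < e / 2" by blast
  have tm: "tpoly ps \<in> borel_measurable cube" by (rule measurable_cube_continuous[OF continuous_on_tpoly])
  have int: "integrable cube (\<lambda>x. norm (f x - g x))" if g: "g \<in> borel_measurable cube" "\<And>x. norm (g x) \<le> t" for g t
  proof (rule integrable_cube_bounded)
    show "(\<lambda>x. norm (f x - g x)) \<in> borel_measurable cube" using fm g(1) by simp
    show "norm (norm (f x - g x)) \<le> b + t" for x
      using norm_triangle_ineq4[of "f x" "g x"] b(2)[of x] g(2)[of x] by simp
  qed
  have i1: "integrable cube (\<lambda>x. norm (f x - h n x))" by (rule int[OF hm h_le])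
  have i2: "integrable cube (\<lambda>x. norm (f x - tpoly ps x))"
    by (rule int[OF tm norm_tpoly_le[OF weight_1]])
  have "(LINT x|cube. norm (f x - tpoly ps x)) \<le> (LINT x|cube. norm (f x - h n x) + e / 2)"
  proof (rule integral_mono)
    fix x :: "real^'d" assume "x \<in> space cube"
    then have "x \<in> ?Q" by simp
    then show "norm (f x - tpoly ps x) \<le> norm (f x - h n x) + e / 2"
      using ps[of x] norm_triangle_ineq[of "f x - h n x" "h n x - tpoly ps x"] by simp
  qed (use i1 i2 in auto)
  also have "\<dots> = (LINT x|cube. norm (f x - h n x)) + e / 2"
    using i1 by simp
  finally show thesis using n by (intro that[of ps]) simp
qed

subsection \<open>Fourier coefficients\<close>

text \<open>Fourier coefficients of all matrix entries as one Bochner integral; for bounded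
  measurable maps the entries are values of \<open>fourier_coeff\<close>.\<close>

definition mfc :: "(real^'d \<Rightarrow> complex^'n^'n) \<Rightarrow> int^'d \<Rightarrow> complex^'n^'n" where
  "mfc f k = (LINT x|cube. mscale (ek (- k) x) (f x))"

lemma measurable_mscale:
  assumes "g \<in> borel_measurable M" "f \<in> borel_measurable M"
  shows "(\<lambda>x. mscale (g x) (f x :: complex^'n^'n)) \<in> borel_measurable M"
  using assms by (rule borel_measurable_continuous_Pair)
    (intro ms.continuous_on continuous_intros)

lemma integrable_mfc:
  assumes "f \<in> borel_measurable cube" "\<And>x. norm (f x) \<le> B"
  shows "integrable cube (\<lambda>x. mscale (ek k x) (f x))"
  by (rule integrable_cube_bounded[OF measurable_mscale[OF measurable_cube_continuous[OF continuous_on_ek] assms(1)], of _ B])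
    (simp add: norm_mscale assms(2))

lemma mfc_nth:
  fixes f :: "real^'d \<Rightarrow> complex^'n^'n"
  assumes "f \<in> borel_measurable cube" "\<And>x. norm (f x) \<le> B"
  shows "mfc f k $ p $ q = fourier_coeff (\<lambda>x. f x $ p $ q) k"
proof -
  have "bounded_linear (\<lambda>X::complex^'n^'n. X $ p $ q)"
    using bounded_linear_compose[OF bounded_linear_vec_nth bounded_linear_vec_nth] .
  then have "mfc f k $ p $ q = (LINT x|cube. mscale (ek (- k) x) (f x) $ p $ q)"
    unfolding mfc_def by (rule integral_bounded_linear[symmetric]) (rule integrable_mfc[OF assms])
  also have "\<dots> = fourier_coeff (\<lambda>x. f x $ p $ q) k"
    unfolding fourier_coeff_def set_lebesgue_integral_def
    by (subst integral_restrict_space) (simp_all add: ek_def real_vec_uminus)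
  finally show ?thesis .
qed

lemma norm_mfc_le:
  assumes "f \<in> borel_measurable cube" "\<And>x. norm (f x) \<le> B"
  shows "norm (mfc f k) \<le> B"
proof -
  have "norm (mfc f k) \<le> (LINT x|cube. norm (mscale (ek (- k) x) (f x)))"
    unfolding mfc_def by (rule integral_norm_bound)
  also have "\<dots> \<le> B"
    by (rule integral_cube_le[OF integrable_norm[OF integrable_mfc[OF assms]]]) (simp add: norm_mscale assms(2))
  finally show ?thesis .
qed

lemma mfc_diff:
  assumes "f \<in> borel_measurable cube" "\<And>x. norm (f x) \<le> B" "g \<in> borel_measurable cube" "\<And>x. norm (g x) \<le> B'"
  shows "mfc (\<lambda>x. f x - g x) k = mfc f k - mfc g k"
  unfolding mfc_def mscale_diff by (rule Bochner_Integration.integral_diff) (intro integrable_mfc[OF assms(1,2)] integrable_mfc[OF assms(3,4)])+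

lemma mfc_scaleR: "mfc (\<lambda>x. c *\<^sub>R f x) k = c *\<^sub>R mfc f k"
  unfolding mfc_def mscale_scaleR by simp

lemma tpoly_bound: "norm (tpoly ps x) \<le> tnorm (\<lambda>_. 1) ps"
  by (rule norm_tpoly_le[OF weight_1])

lemma measurable_tpoly: "tpoly ps \<in> borel_measurable cube"
  by (rule measurable_cube_continuous[OF continuous_on_tpoly])

lemma mfc_tpoly: "mfc (tpoly ps) k = (\<Sum>p\<leftarrow>ps. if fst p = k then snd p else 0)"
proof (induction ps)
  case Nil then show ?case by (simp add: mfc_def tpoly_def)
next
  case (Cons p ps)
  have "mfc (tpoly (p # ps)) k = (LINT x|cube. mscale (ek (fst p - k) x) (snd p) + mscale (ek (- k) x) (tpoly ps x))"
    unfolding mfc_def by (simp add: mscale_add ek_add[symmetric] add.commute)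
  also have "\<dots> = (LINT x|cube. mscale (ek (fst p - k) x) (snd p)) + mfc (tpoly ps) k"
    unfolding mfc_def
    by (rule Bochner_Integration.integral_add)
      (rule integrable_mfc[where B="norm (snd p)"], simp, simp, rule integrable_mfc[OF measurable_tpoly tpoly_bound])
  also have "(LINT x|cube. mscale (ek (fst p - k) x) (snd p)) = mscale (integral\<^sup>L cube (ek (fst p - k))) (snd p)"
    by (rule integral_bounded_linear[OF ms.bounded_linear_left])
      (rule integrable_cube_bounded[where B=1], auto intro: measurable_cube_continuous continuous_on_ek)
  finally show ?case using Cons by (simp add: integral_ek)
qed

lemma inner_mfc:
  assumes f: "f \<in> borel_measurable cube" "\<And>x. norm (f x) \<le> B"
  shows "(LINT x|cube. f x \<bullet> tpoly ps x) = (\<Sum>p\<leftarrow>ps. mfc f (fst p) \<bullet> snd p)"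
proof (induction ps)
  case Nil then show ?case by (simp add: tpoly_def)
next
  case (Cons p ps)
  have int: "integrable cube (\<lambda>x. f x \<bullet> tpoly ps x)" for ps
  proof (rule integrable_cube_bounded)
    show "(\<lambda>x. f x \<bullet> tpoly ps x) \<in> borel_measurable cube" by (intro borel_measurable_inner f(1) measurable_tpoly)
    show "norm (f x \<bullet> tpoly ps x) \<le> B * tnorm (\<lambda>_. 1) ps" for x
      using Cauchy_Schwarz_ineq2[of "f x" "tpoly ps x"] mult_mono[OF f(2)[of x] tpoly_bound[of ps x]] order_trans[OF norm_ge_zero f(2)]
      by force
  qed
  have "f x \<bullet> mscale (ek (fst p) x) (snd p) = mscale (ek (- fst p) x) (f x) \<bullet> snd p" for x
    by (simp add: inner_mscale cnj_ek)
  moreover have "(LINT x|cube. mscale (ek (- fst p) x) (f x) \<bullet> snd p) = mfc f (fst p) \<bullet> snd p"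
    unfolding mfc_def by (rule integral_inner_left) (rule integrable_mfc[OF f])
  moreover have "integrable cube (\<lambda>x. f x \<bullet> mscale (ek (fst p) x) (snd p))"
    using int[of "[p]"] by simp
  ultimately show ?case using Cons int[of ps] by (simp add: inner_add_right)
qed

text \<open>As f is orthogonal to every trigonometric polynomial p, the integral of |f|^2 equals
  that of f . (f - p), at most B times the L1 distance from f to p. Boundedness lets an L1
  approximation do the work of an L2 one.\<close>

lemma mfc_eq_0_AE:
  fixes f :: "real^'d \<Rightarrow> complex^'n^'n"
  assumes f: "f \<in> borel_measurable lebesgue" "\<And>x. norm (f x) \<le> B" and 0: "\<And>k. mfc f k = 0"
  shows "AE x in cube. f x = 0"
proof -
  have fm: "f \<in> borel_measurable cube" by (rule measurable_cube_lebesgue[OF f(1)])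
  have B0: "B \<ge> 0" using f(2) norm_ge_zero order_trans by blast
  have if2: "integrable cube (\<lambda>x. f x \<bullet> f x)"
    by (rule integrable_cube_bounded[where B="B * B"])
      (use fm f(2) B0 in \<open>auto simp: dot_square_norm power2_eq_square intro!: mult_mono\<close>)
  have "(LINT x|cube. f x \<bullet> f x) \<le> 0"
  proof (rule field_le_epsilon)
    fix e :: real assume "e > 0"
    then have "e / (B + 1) > 0" using B0 by simp
    then obtain ps where ps: "(LINT x|cube. norm (f x - tpoly ps x)) < e / (B + 1)"
      using L1_approx[OF f] by blast
    have ifp: "integrable cube (\<lambda>x. f x \<bullet> tpoly ps x)"
    proof (rule integrable_cube_bounded)
      show "(\<lambda>x. f x \<bullet> tpoly ps x) \<in> borel_measurable cube" by (intro borel_measurable_inner fm measurable_tpoly)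
      show "norm (f x \<bullet> tpoly ps x) \<le> B * tnorm (\<lambda>_. 1) ps" for x
        using Cauchy_Schwarz_ineq2[of "f x" "tpoly ps x"] mult_mono[OF f(2)[of x] tpoly_bound[of ps x]] B0
        by force
    qed
    have id: "integrable cube (\<lambda>x. norm (f x - tpoly ps x))"
    proof (rule integrable_cube_bounded)
      show "(\<lambda>x. norm (f x - tpoly ps x)) \<in> borel_measurable cube" using fm measurable_tpoly[of ps] by simp
      show "norm (norm (f x - tpoly ps x)) \<le> B + tnorm (\<lambda>_. 1) ps" for x
        using norm_triangle_ineq4[of "f x" "tpoly ps x"] f(2)[of x] tpoly_bound[of ps x] by simp
    qed
    have "(LINT x|cube. f x \<bullet> tpoly ps x) = 0"
      unfolding inner_mfc[OF fm f(2)] by (simp add: 0 sum_list_0)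
    then have "(LINT x|cube. f x \<bullet> f x) = (LINT x|cube. f x \<bullet> f x - f x \<bullet> tpoly ps x)"
      using if2 ifp by simp
    also have "\<dots> \<le> (LINT x|cube. B * norm (f x - tpoly ps x))"
    proof (rule integral_mono)
      show "f x \<bullet> f x - f x \<bullet> tpoly ps x \<le> B * norm (f x - tpoly ps x)" for x
        using norm_cauchy_schwarz[of "f x" "f x - tpoly ps x"] mult_right_mono[OF f(2)[of x], of "norm (f x - tpoly ps x)"]
        by (simp add: inner_diff_right)
    qed (use if2 ifp id in auto)
    also have "\<dots> \<le> B * (e / (B + 1))" using mult_left_mono[OF less_imp_le[OF ps] B0] by simp
    also have "\<dots> \<le> e" using B0 \<open>e > 0\<close> by (simp add: field_simps)
    finally show "(LINT x|cube. f x \<bullet> f x) \<le> 0 + e" by simp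
  qed
  then have "(LINT x|cube. f x \<bullet> f x) = 0" by (intro antisym integral_nonneg_AE) auto
  then show ?thesis using if2 by (subst (asm) integral_nonneg_eq_0_iff_AE) auto
qed

text \<open>A nonempty open set is not negligible, which settles the open cube; continuity extends
  equality to the closed cube and periodicity to the whole space.\<close>

lemma continuous_AE_cube_eq:
  fixes f g :: "real^'d \<Rightarrow> 'b::real_normed_vector"
  assumes f: "continuous_on UNIV f" "periodic f" and g: "continuous_on UNIV g" "periodic g"
    and ae: "AE x in cube. f x = g x"
  shows "f = g"
proof -
  have box: "f x = g x" if x: "x \<in> box 0 1" for x
  proof (rule ccontr)
    assume ne: "f x \<noteq> g x"
    let ?U = "{y \<in> box 0 1. f y - g y \<noteq> 0}"
    have "open ?U"
    proof -
      have "continuous_on (box 0 1) (\<lambda>y. f y - g y)"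
        using f g by (intro continuous_on_diff) (auto intro: continuous_on_subset)
      then have "open (box 0 1 \<inter> (\<lambda>y. f y - g y) -` (- {0}))"
        by (rule continuous_open_preimage) auto
      moreover have "box 0 1 \<inter> (\<lambda>y. f y - g y) -` (- {0}) = ?U" by auto
      ultimately show ?thesis by simp
    qed
    moreover have "?U \<noteq> {}" using x ne by auto
    moreover have "negligible ?U"
    proof -
      have "AE y in lebesgue. y \<in> cbox 0 1 \<longrightarrow> f y = g y"
        using ae by (subst (asm) AE_restrict_space_iff) auto
      then obtain N where N: "N \<in> null_sets lebesgue" "{y. \<not> (y \<in> cbox 0 1 \<longrightarrow> f y = g y)} \<subseteq> N"
        by (auto simp: eventually_ae_filter)
      then have "?U \<subseteq> N" using box_subset_cbox by auto
      then show ?thesis using N negligible_subset negligible_iff_null_sets by blast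
    qed
    ultimately show False using open_not_negligible by blast
  qed
  have cl: "f x = g x" if x: "x \<in> cbox 0 1" for x
  proof -
    have "closed {y. f y = g y}"
      using continuous_closed_vimage[of "{0}" "\<lambda>y. f y - g y"] f g
      by (simp add: vimage_def continuous_on_diff continuous_on_eq_continuous_at continuous_diff)
    then have "closure (box 0 1) \<subseteq> {y. f y = g y}" using box by (intro closure_minimal) auto
    moreover have "closure (box 0 (1::real^'d)) = cbox 0 1"
      by (rule closure_box) (auto simp: box_ne_empty one_inner_Basis)
    ultimately show ?thesis using x by auto
  qed
  show ?thesis
  proof
    fix x show "f x = g x"
      using exists_cube_shift[of x] cl f(2) g(2) by (metis periodicD)
  qed
qed

lemma mfc_inject:
  fixes f g :: "real^'d \<Rightarrow> complex^'n^'n"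
  assumes f: "continuous_on UNIV f" "periodic f" and g: "continuous_on UNIV g" "periodic g"
    and eq: "\<And>k. mfc f k = mfc g k"
  shows "f = g"
proof -
  obtain B where B: "\<And>x. norm (f x) \<le> B" using periodic_continuous_bounded[OF f] by blast
  obtain B' where B': "\<And>x. norm (g x) \<le> B'" using periodic_continuous_bounded[OF g] by blast
  have "AE x in cube. f x - g x = 0"
  proof (rule mfc_eq_0_AE)
    show "(\<lambda>x. f x - g x) \<in> borel_measurable lebesgue"
      using continuous_imp_measurable_on_sets_lebesgue[OF continuous_on_diff[OF f(1) g(1)]] by (simp add: lebesgue_on_UNIV_eq)
    show "norm (f x - g x) \<le> B + B'" for x
      using norm_triangle_ineq4[of "f x" "g x"] B[of x] B'[of x] by linarith
    show "mfc (\<lambda>x. f x - g x) k = 0" for k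
      by (subst mfc_diff[OF measurable_cube_continuous[OF f(1)] B measurable_cube_continuous[OF g(1)] B']) (simp add: eq)
  qed
  then have "AE x in cube. f x = g x" by simp
  then show ?thesis by (rule continuous_AE_cube_eq[OF f g])
qed

lemma norm_mfc_diff_le:
  assumes f: "continuous_on UNIV f" "periodic f" and g: "continuous_on UNIV g" "periodic g"
    and e: "\<And>x. norm (f x - g x) \<le> e"
  shows "norm (mfc f k - mfc g k) \<le> e"
proof -
  obtain B where B: "\<And>x. norm (f x) \<le> B" using periodic_continuous_bounded[OF f] by blast
  obtain B' where B': "\<And>x. norm (g x) \<le> B'" using periodic_continuous_bounded[OF g] by blast
  show ?thesis
    unfolding mfc_diff[OF measurable_cube_continuous[OF f(1)] B measurable_cube_continuous[OF g(1)] B', symmetric]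
    by (rule norm_mfc_le) (use f g e in \<open>auto intro: measurable_cube_continuous continuous_on_diff\<close>)
qed

lemma periodic_tpoly: "periodic (tpoly ps)"
  by (simp add: periodic_def tpoly_periodic)

text \<open>The identity is exact for trigonometric polynomials, and both sides depend continuously
  on f in the supremum norm. This takes the place of cutting and reassembling the shifted
  cube.\<close>

lemma mfc_shift:
  fixes f :: "real^'d \<Rightarrow> complex^'n^'n"
  assumes f: "continuous_on UNIV f" "periodic f"
  shows "mfc (\<lambda>x. f (x + v)) k = mscale (ek k v) (mfc f k)"
proof -
  have fv: "continuous_on UNIV (\<lambda>x. f (x + v))" "periodic (\<lambda>x. f (x + v))"
    using f by (auto intro!: continuous_on_compose2[OF f(1)] continuous_intros simp: periodic_def add_ac)
      (metis add.assoc add.commute)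
  have "norm (mfc (\<lambda>x. f (x + v)) k - mscale (ek k v) (mfc f k)) \<le> 0"
  proof (rule field_le_epsilon)
    fix e :: real assume "e > 0"
    then have "e / 2 > 0" by simp
    obtain ps where ps: "\<And>x. norm (f x - tpoly ps x) < e / 2" using trig_approx_periodic[OF f \<open>e / 2 > 0\<close>] by blast
    define qs where "qs = map (\<lambda>p. (fst p, mscale (ek (fst p) v) (snd p))) ps"
    have q: "tpoly qs x = tpoly ps (x + v)" for x
      unfolding qs_def by (induction ps) (simp_all add: ek_shift)
    have qk: "mfc (tpoly qs) k = mscale (ek k v) (mfc (tpoly ps) k)"
      unfolding mfc_tpoly qs_def by (induction ps) (auto simp: mscale_add)
    have 1: "norm (mfc (\<lambda>x. f (x + v)) k - mfc (tpoly qs) k) \<le> e / 2"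
      by (rule norm_mfc_diff_le[OF fv continuous_on_tpoly periodic_tpoly]) (use ps in \<open>simp add: q less_imp_le\<close>)
    have 2: "norm (mfc (tpoly ps) k - mfc f k) \<le> e / 2"
      by (rule norm_mfc_diff_le[OF continuous_on_tpoly periodic_tpoly f]) (use ps in \<open>simp add: norm_minus_commute less_imp_le\<close>)
    have "mfc (\<lambda>x. f (x + v)) k - mscale (ek k v) (mfc f k) =
        (mfc (\<lambda>x. f (x + v)) k - mfc (tpoly qs) k) + mscale (ek k v) (mfc (tpoly ps) k - mfc f k)"
      by (simp add: qk mscale_diff)
    also have "norm \<dots> \<le> e / 2 + norm (mscale (ek k v) (mfc (tpoly ps) k - mfc f k))"
      by (intro norm_triangle_le add_mono 1 order_refl)
    also have "\<dots> \<le> e" using 2 by (simp add: norm_mscale)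
    finally show "norm (mfc (\<lambda>x. f (x + v)) k - mscale (ek k v) (mfc f k)) \<le> 0 + e" by simp
  qed
  then show ?thesis by simp
qed

subsection \<open>Fourier coefficients of functions of bounded weighted norm\<close>

text \<open>The coefficient of a polynomial at k is the sum of its list entries of frequency k, so
  the triangle inequality bounds the weighted sum by \<open>tnorm\<close>. Finiteness of K lets one
  uniform approximation control all coefficients involved.\<close>

lemma wb_mfc_sum:
  assumes w: "weight w" and f: "wb w r f" and K: "finite K"
  shows "(\<Sum>k\<in>K. w k * norm (mfc f k)) \<le> r"
proof (rule field_le_epsilon)
  fix e :: real assume "e > 0"
  define s where "s = (\<Sum>k\<in>K. w k) + 1"
  have s: "s > 0" using sum_nonneg[of K w] weightD(3)[OF w] by (simp add: s_def)
  have "e / s > 0" using \<open>e > 0\<close> s by simp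
  obtain ps where ps: "tnorm w ps \<le> r" "\<And>x. norm (f x - tpoly ps x) \<le> e / s" using wbE[OF f \<open>e / s > 0\<close>] by blast
  have tp: "(\<Sum>k\<in>K. w k * norm (mfc (tpoly ps) k)) \<le> tnorm w ps"
  proof -
    have "(\<Sum>k\<in>K. w k * norm (\<Sum>p\<leftarrow>ps. if fst p = k then snd p else 0)) \<le> tnorm w ps"
    proof (induction ps)
      case (Cons p ps)
      have "(\<Sum>k\<in>K. w k * norm (\<Sum>p\<leftarrow>p # ps. if fst p = k then snd p else 0)) \<le>
          (\<Sum>k\<in>K. (if k = fst p then w k * norm (snd p) else 0) + w k * norm (\<Sum>p\<leftarrow>ps. if fst p = k then snd p else 0))"
        using w by (intro sum_mono) (auto simp: distrib_left[symmetric] intro!: mult_left_mono norm_triangle_ineq weightD)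
      also have "\<dots> \<le> w (fst p) * norm (snd p) + tnorm w ps"
        unfolding sum.distrib using K w by (intro add_mono Cons) (auto simp: sum.delta' weightD)
      finally show ?case by simp
    qed simp
    then show ?thesis by (simp add: mfc_tpoly)
  qed
  have d: "norm (mfc f k - mfc (tpoly ps) k) \<le> e / s" for k
    by (rule norm_mfc_diff_le[OF wb_continuous[OF f] wb_periodic[OF f] continuous_on_tpoly periodic_tpoly ps(2)])
  have "(\<Sum>k\<in>K. w k * norm (mfc f k)) \<le> (\<Sum>k\<in>K. w k * norm (mfc (tpoly ps) k) + w k * (e / s))"
  proof (rule sum_mono)
    fix k
    have "norm (mfc f k) \<le> norm (mfc (tpoly ps) k) + e / s"
      using d[of k] norm_triangle_sub[of "mfc f k" "mfc (tpoly ps) k"] by linarith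
    then show "w k * norm (mfc f k) \<le> w k * norm (mfc (tpoly ps) k) + w k * (e / s)"
      unfolding distrib_left[symmetric] by (rule mult_left_mono) (rule weightD(3)[OF w])
  qed
  also have "\<dots> \<le> r + (\<Sum>k\<in>K. w k) * (e / s)"
    unfolding sum.distrib sum_distrib_right using tp ps(1) by simp
  also have "(\<Sum>k\<in>K. w k) * (e / s) \<le> s * (e / s)"
    using \<open>e / s > 0\<close> by (intro mult_right_mono) (auto simp: s_def)
  also have "s * (e / s) = e" using s by simp
  finally show "(\<Sum>k\<in>K. w k * norm (mfc f k)) \<le> r + e" by simp
qed

lemma wb_mfc: assumes "weight w" "wb w r f" shows "w k * norm (mfc f k) \<le> r"
  using wb_mfc_sum[OF assms, of "{k}"] by simp

definition trunc :: "(int^'d) set \<Rightarrow> (real^'d \<Rightarrow> complex^'n^'n) \<Rightarrow> real^'d \<Rightarrow> complex^'n^'n" where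
  "trunc K f x = (\<Sum>k\<in>K. mscale (ek k x) (mfc f k))"

lemma sum_eq_tpoly:
  assumes "finite K"
  shows "\<exists>ps. (\<forall>x. tpoly ps x = (\<Sum>k\<in>K. mscale (ek k x) (c k))) \<and> (\<forall>w. tnorm w ps = (\<Sum>k\<in>K. w k * norm (c k)))
    \<and> (\<forall>l. mfc (tpoly ps) l = (if l \<in> K then c l else 0))"
  unfolding mfc_tpoly using assms
proof (induction K rule: finite_induct)
  case empty then show ?case by (intro exI[of _ "[]"]) simp
next
  case (insert k K)
  then obtain ps where "\<And>x. tpoly ps x = (\<Sum>k\<in>K. mscale (ek k x) (c k))" "\<And>w. tnorm w ps = (\<Sum>k\<in>K. w k * norm (c k))"
    "\<And>l. (\<Sum>p\<leftarrow>ps. if fst p = l then snd p else 0) = (if l \<in> K then c l else 0)" by blast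
  then show ?case using insert(1,2) by (intro exI[of _ "(k, c k) # ps"]) auto
qed

text \<open>Discarding the list entries with frequency in K turns an approximation of f into one of
  its tail, because the finitely many removed coefficients are close as well. On the remaining
  frequencies the two weights compare by c.\<close>

lemma wb_trunc_diff:
  assumes w: "weight w" and f: "wb w r f" and K: "finite K" and c: "c \<ge> 0"
    and w': "\<And>k. k \<notin> K \<Longrightarrow> w' k \<le> c * w k"
  shows "wb w' (c * r) (\<lambda>x. f x - trunc K f x)"
  unfolding wb_def
proof (intro allI impI)
  fix e :: real assume "e > 0"
  define s where "s = 1 + real (card K)"
  have s: "s > 0" by (simp add: s_def)
  have "e / s > 0" using \<open>e > 0\<close> s by simp
  obtain ps where ps: "tnorm w ps \<le> r" "\<And>x. norm (f x - tpoly ps x) \<le> e / s" using wbE[OF f \<open>e / s > 0\<close>] by blast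
  define qs where "qs = filter (\<lambda>p. fst p \<notin> K) ps"
  have "tnorm w' qs \<le> c * tnorm w ps"
    unfolding qs_def
  proof (induction ps)
    case (Cons p ps)
    have "w' (fst p) * norm (snd p) \<le> c * w (fst p) * norm (snd p)" if "fst p \<notin> K"
      using w'[OF that] by (intro mult_right_mono) auto
    moreover have "0 \<le> c * (w (fst p) * norm (snd p))" using c w by (simp add: weightD)
    ultimately show ?case using Cons by (auto simp: algebra_simps)
  qed simp
  also have "\<dots> \<le> c * r" using ps(1) c by (rule mult_left_mono)
  finally have 1: "tnorm w' qs \<le> c * r" .
  have dec: "tpoly ps x = tpoly qs x + trunc K (tpoly ps) x" for x
  proof -
    have "tpoly ps x = tpoly qs x + (\<Sum>k\<in>K. mscale (ek k x) (\<Sum>p\<leftarrow>ps. if fst p = k then snd p else 0))"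
      unfolding qs_def
    proof (induction ps)
      case (Cons p ps)
      have "(\<Sum>k\<in>K. mscale (ek k x) (\<Sum>q\<leftarrow>p # ps. if fst q = k then snd q else 0)) =
          (\<Sum>k\<in>K. (if k = fst p then mscale (ek k x) (snd p) else 0) + mscale (ek k x) (\<Sum>q\<leftarrow>ps. if fst q = k then snd q else 0))"
        by (intro sum.cong) (auto simp: mscale_add)
      then show ?case using Cons K by (simp add: sum.distrib sum.delta')
    qed simp
    then show ?thesis by (simp add: trunc_def mfc_tpoly)
  qed
  have d: "norm (mfc f k - mfc (tpoly ps) k) \<le> e / s" for k
    by (rule norm_mfc_diff_le[OF wb_continuous[OF f] wb_periodic[OF f] continuous_on_tpoly periodic_tpoly ps(2)])
  have "norm (f x - trunc K f x - tpoly qs x) \<le> e" for x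
  proof -
    have "f x - trunc K f x - tpoly qs x = (f x - tpoly ps x) - (\<Sum>k\<in>K. mscale (ek k x) (mfc f k - mfc (tpoly ps) k))"
      using dec[of x] by (simp add: trunc_def mscale_diff sum_subtractf)
    also have "norm \<dots> \<le> e / s + (\<Sum>k\<in>K. e / s)"
      by (intro norm_triangle_le_diff add_mono ps(2) sum_norm_le) (simp add: norm_mscale d)
    also have "\<dots> = s * (e / s)" by (simp add: s_def algebra_simps flip: add_divide_distrib)
    also have "\<dots> = e" using s by simp
    finally show ?thesis .
  qed
  with 1 show "\<exists>ps. tnorm w' ps \<le> c * r \<and> (\<forall>x. norm (f x - trunc K f x - tpoly ps x) \<le> e)" by blast
qed

subsection \<open>Fourier series of smooth functions\<close>

text \<open>N is a frequency scale: the weight is at most 2^m up to |k| = N and grows polynomially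
  beyond. Enlarging N lowers the weight, so bounds are inherited by later scales; N = 1 measures
  ordinary regularity.\<close>

definition wgt :: "real \<Rightarrow> nat \<Rightarrow> int^'d \<Rightarrow> real" where
  "wgt N m k = (1 + norm (real_vec k) / N) ^ m"

lemma weight_wgt: assumes N: "N > 0" shows "weight (wgt N m)"
  unfolding weight_def
proof (intro conjI allI)
  show "wgt N m (k + l) \<le> wgt N m k * wgt N m l" for k l :: "int^'a"
  proof -
    have n: "0 \<le> norm (real_vec k) / N" "0 \<le> norm (real_vec l) / N" using N by auto
    have "1 + norm (real_vec (k + l)) / N \<le> 1 + (norm (real_vec k) / N + norm (real_vec l) / N)"
      unfolding real_vec_add add_divide_distrib[symmetric]
      using N by (intro add_left_mono divide_right_mono norm_triangle_ineq) auto
    also have "\<dots> \<le> (1 + norm (real_vec k) / N) * (1 + norm (real_vec l) / N)"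
      using mult_nonneg_nonneg[OF n] by (simp add: algebra_simps)
    finally have "wgt N m (k + l) \<le> ((1 + norm (real_vec k) / N) * (1 + norm (real_vec l) / N)) ^ m"
      unfolding wgt_def using N by (intro power_mono) auto
    then show ?thesis by (simp add: wgt_def power_mult_distrib)
  qed
qed (use N in \<open>auto simp: wgt_def real_vec_uminus intro!: one_le_power\<close>)

lemma wgt_1_pos: "0 < 1 + norm (real_vec k)"
  by (rule add_pos_nonneg) auto

text \<open>As |k| dominates every coordinate, a term is at most the product over the coordinates of
  1 / (1 + |k i|)^2, and sums over boxes factor into one-dimensional sums. This accounts for the
  exponent 2 per dimension.\<close>

lemma lattice_summable:
  "(\<lambda>k::int^'d. 1 / (1 + norm (real_vec k)) ^ (2 * CARD('d))) summable_on UNIV"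
proof (rule nonneg_bounded_partial_sums_imp_summable_on)
  define g where "g n = 1 / (1 + \<bar>real_of_int n\<bar>) ^ 2" for n :: int
  define s where "s = (\<Sum>n::nat. 1 / (1 + real n) ^ 2)"
  have sm: "summable (\<lambda>n::nat. 1 / (1 + real n) ^ 2)"
    using summable_Suc_iff[of "\<lambda>n. 1 / (real n) ^ 2"] inverse_power_summable[of 2, where 'a=real]
    by (simp add: divide_inverse add.commute)
  have gs: "(\<Sum>n\<in>{-int N..int N}. g n) \<le> 2 * s" for N
  proof -
    have "(\<Sum>n\<in>{-int N..int N}. g n) \<le> (\<Sum>n\<in>int ` {..N} \<union> (\<lambda>n. - int n) ` {..N}. g n)"
    proof (rule sum_mono2)
      show "{- int N..int N} \<subseteq> int ` {..N} \<union> (\<lambda>n. - int n) ` {..N}"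
      proof
        fix n assume "n \<in> {- int N..int N}"
        then show "n \<in> int ` {..N} \<union> (\<lambda>n. - int n) ` {..N}"
          by (cases n rule: int_cases2) (auto simp: image_iff)
      qed
    qed (auto simp: g_def)
    also have "\<dots> \<le> (\<Sum>n\<in>int ` {..N}. g n) + (\<Sum>n\<in>(\<lambda>n. - int n) ` {..N}. g n)"
      by (subst sum_Un) (auto simp: g_def intro!: sum_nonneg)
    also have "(\<Sum>n\<in>int ` {..N}. g n) = (\<Sum>n\<le>N. 1 / (1 + real n) ^ 2)"
      by (subst sum.reindex) (auto simp: g_def inj_on_def)
    also have "(\<Sum>n\<in>(\<lambda>n. - int n) ` {..N}. g n) = (\<Sum>n\<le>N. 1 / (1 + real n) ^ 2)"
      by (subst sum.reindex) (auto simp: g_def inj_on_def)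
    also have "(\<Sum>n\<le>N. 1 / (1 + real n) ^ 2) \<le> s"
      unfolding s_def by (rule sum_le_suminf[OF sm]) auto
    finally show ?thesis by simp
  qed
  have bound: "(\<Sum>k\<in>F. 1 / (1 + norm (real_vec k)) ^ (2 * CARD('d))) \<le> (2 * s) ^ CARD('d)" if F: "finite F" for F :: "(int^'d) set"
  proof -
    define N where "N = nat (Max (insert 0 ((\<lambda>(k, i). \<bar>k $ i\<bar>) ` (F \<times> UNIV))))"
    have N: "\<bar>k $ i\<bar> \<le> int N" if "k \<in> F" for k i
    proof -
      have "\<bar>k $ i\<bar> \<le> Max (insert 0 ((\<lambda>(k, i). \<bar>k $ i\<bar>) ` (F \<times> UNIV)))"
        using F that by (intro Max_ge) (auto simp: image_iff)
      moreover have "0 \<le> Max (insert 0 ((\<lambda>(k, i). \<bar>k $ i\<bar>) ` (F \<times> UNIV)))"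
        using F by (intro Max_ge) auto
      ultimately show ?thesis unfolding N_def by (metis int_nat_eq)
    qed
    have le: "1 / (1 + norm (real_vec k)) ^ (2 * CARD('d)) \<le> (\<Prod>i\<in>UNIV. g (k $ i))" for k :: "int^'d"
    proof -
      have "1 / (1 + norm (real_vec k)) ^ (2 * CARD('d)) = (\<Prod>i\<in>(UNIV::'d set). 1 / (1 + norm (real_vec k)) ^ 2)"
        by (simp add: power_mult power_one_over)
      also have "\<dots> \<le> (\<Prod>i\<in>UNIV. g (k $ i))"
      proof (rule prod_mono, intro conjI)
        fix i
        have "\<bar>real_of_int (k $ i)\<bar> \<le> norm (real_vec k)"
          using component_le_norm_cart[of "real_vec k" i] by simp
        then show "1 / (1 + norm (real_vec k)) ^ 2 \<le> g (k $ i)"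
          unfolding g_def by (intro divide_left_mono power_mono) (auto intro!: mult_pos_pos zero_less_power add_pos_nonneg)
      qed simp
      finally show ?thesis .
    qed
    let ?P = "Pi\<^sub>E (UNIV::'d set) (\<lambda>_. {-int N..int N})"
    have "(\<Sum>k\<in>F. 1 / (1 + norm (real_vec k)) ^ (2 * CARD('d))) \<le> (\<Sum>k\<in>F. \<Prod>i\<in>UNIV. g (k $ i))"
      by (intro sum_mono le)
    also have "\<dots> = (\<Sum>h\<in>vec_nth ` F. \<Prod>i\<in>UNIV. g (h i))"
      by (subst sum.reindex) (auto simp: inj_on_def vec_nth_inject)
    also have "\<dots> \<le> (\<Sum>h\<in>?P. \<Prod>i\<in>UNIV. g (h i))"
    proof (rule sum_mono2)
      show "finite ?P" by (intro finite_PiE) auto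
      have "k $ i \<in> {-int N..int N}" if "k \<in> F" for k i using N[OF that, of i] by simp linarith
      then show "vec_nth ` F \<subseteq> ?P" by (auto simp: PiE_def Pi_def)
    qed (auto simp: g_def intro!: prod_nonneg)
    also have "\<dots> = (\<Prod>i\<in>(UNIV::'d set). \<Sum>n\<in>{-int N..int N}. g n)"
      by (subst prod_sum_PiE) auto
    also have "\<dots> \<le> (\<Prod>i\<in>(UNIV::'d set). 2 * s)"
      using gs by (intro prod_mono) (auto simp: g_def intro!: sum_nonneg)
    finally show ?thesis by simp
  qed
  show "\<forall>\<^sub>F F in finite_subsets_at_top UNIV. (\<Sum>k\<in>F. 1 / (1 + norm (real_vec (k::int^'d))) ^ (2 * CARD('d))) \<le> (2 * s) ^ CARD('d)"
    by (intro eventually_finite_subsets_at_top_weakI bound)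
qed simp

definition lattice_sum :: "'d::finite itself \<Rightarrow> real" where
  "lattice_sum _ = (\<Sum>\<^sub>\<infinity>k::int^'d. 1 / (1 + norm (real_vec k)) ^ (2 * CARD('d)))"

lemma lattice_sum_nonneg: "lattice_sum TYPE('d::finite) \<ge> 0"
  unfolding lattice_sum_def by (rule infsum_nonneg) simp

lemma lattice_sum_ge:
  "finite F \<Longrightarrow> (\<Sum>k\<in>F. 1 / (1 + norm (real_vec (k::int^'d))) ^ (2 * CARD('d))) \<le> lattice_sum TYPE('d)"
  unfolding lattice_sum_def by (rule finite_sum_le_infsum[OF lattice_summable]) auto

lemma decay_divide:
  "norm (a k) * (1 + norm (real_vec k)) ^ (m + p) \<le> b \<Longrightarrow> (1 + norm (real_vec k)) ^ m * norm (a k) \<le> b * (1 / (1 + norm (real_vec k)) ^ p)"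
  using wgt_1_pos[of k] by (simp add: power_add field_simps)

lemma summable_of_decay:
  fixes a :: "int^'d \<Rightarrow> 'b::real_normed_vector"
  assumes "\<And>k. norm (a k) * (1 + norm (real_vec k)) ^ (2 * CARD('d)) \<le> b"
  shows "(\<lambda>k. norm (a k)) summable_on UNIV"
proof (rule summable_on_comparison_test)
  show "(\<lambda>k::int^'d. b * (1 / (1 + norm (real_vec k)) ^ (2 * CARD('d)))) summable_on UNIV"
    by (rule summable_on_cmult_right[OF lattice_summable])
  show "norm (a k) \<le> b * (1 / (1 + norm (real_vec k)) ^ (2 * CARD('d)))" for k
    using decay_divide[of a k 0] assms[of k] by simp
qed simp

definition fser :: "(int^'d \<Rightarrow> complex^'n^'n) \<Rightarrow> real^'d \<Rightarrow> complex^'n^'n" where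
  "fser a x = (\<Sum>\<^sub>\<infinity>k. mscale (ek k x) (a k))"

lemma fser_summable:
  "(\<lambda>k. norm (a k)) summable_on UNIV \<Longrightarrow> (\<lambda>k. mscale (ek k x) (a k)) summable_on A"
  by (rule summable_on_subset_banach[OF abs_summable_summable]) (auto simp: norm_mscale)

text \<open>The error is uniform in x, being bounded by the tail of the norms. The set K0 is
  prescribed so that a coefficient under examination already occurs in the partial sum.\<close>

lemma fser_approx:
  fixes a :: "int^'d \<Rightarrow> complex^'n^'n"
  assumes a: "(\<lambda>k. norm (a k)) summable_on UNIV" and e: "e > 0" and K0: "finite K0"
  obtains K where "finite K" "K0 \<subseteq> K" "\<And>x. norm (fser a x - (\<Sum>k\<in>K. mscale (ek k x) (a k))) \<le> e"
proof -
  let ?b = "\<lambda>k. norm (a k)"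
  have "(?b has_sum infsum ?b UNIV) UNIV" using a by (rule has_sum_infsum)
  then have "\<forall>\<^sub>F K in finite_subsets_at_top UNIV. dist (sum ?b K) (infsum ?b UNIV) < e"
    unfolding has_sum_def using e by (rule tendstoD)
  then obtain X where X: "finite X" "\<And>Y. finite Y \<Longrightarrow> X \<subseteq> Y \<Longrightarrow> dist (sum ?b Y) (infsum ?b UNIV) < e"
    unfolding eventually_finite_subsets_at_top by auto
  define K where "K = X \<union> K0"
  have K: "finite K" "dist (sum ?b K) (infsum ?b UNIV) < e" "K0 \<subseteq> K"
    using X K0 by (auto simp: K_def)
  have sb: "?b summable_on A" for A using a by (rule summable_on_subset_banach) simp
  have "infsum ?b UNIV = infsum ?b (- K) + infsum ?b K"
    using infsum_Un_disjoint[of ?b "- K" K, OF sb sb] by (simp add: Compl_partition2)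
  then have tail: "infsum ?b (- K) \<le> e" using K by (simp add: dist_real_def)
  have "norm (fser a x - (\<Sum>k\<in>K. mscale (ek k x) (a k))) \<le> e" for x
  proof -
    have "fser a x = infsum (\<lambda>k. mscale (ek k x) (a k)) (- K) + infsum (\<lambda>k. mscale (ek k x) (a k)) K"
      unfolding fser_def
      using infsum_Un_disjoint[of "\<lambda>k. mscale (ek k x) (a k)" "- K" K, OF fser_summable[OF a] fser_summable[OF a]] by (simp add: Compl_partition2)
    then have "norm (fser a x - (\<Sum>k\<in>K. mscale (ek k x) (a k))) = norm (infsum (\<lambda>k. mscale (ek k x) (a k)) (- K))"
      using K(1) by simp
    also have "\<dots> \<le> infsum (\<lambda>k. norm (mscale (ek k x) (a k))) (- K)"
      by (rule norm_infsum_bound) (simp add: norm_mscale sb)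
    also have "\<dots> \<le> e" using tail by (simp add: norm_mscale)
    finally show ?thesis .
  qed
  with K(1,3) show thesis by (rule that)
qed

lemma fser_tpoly:
  assumes "(\<lambda>k. norm (a k)) summable_on UNIV" "e > 0" "finite K0"
  obtains K ps where "finite K" "K0 \<subseteq> K" "\<And>x. norm (fser a x - tpoly ps x) \<le> e"
    "\<And>w. tnorm w ps = (\<Sum>k\<in>K. w k * norm (a k))" "\<And>l. mfc (tpoly ps) l = (if l \<in> K then a l else 0)"
proof -
  obtain K where K: "finite K" "K0 \<subseteq> K" "\<And>x. norm (fser a x - (\<Sum>k\<in>K. mscale (ek k x) (a k))) \<le> e"
    using fser_approx[OF assms] by blast
  obtain ps where "\<And>x. tpoly ps x = (\<Sum>k\<in>K. mscale (ek k x) (a k))" "\<And>w. tnorm w ps = (\<Sum>k\<in>K. w k * norm (a k))"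
    "\<And>l. mfc (tpoly ps) l = (if l \<in> K then a l else 0)"
    using sum_eq_tpoly[OF K(1), of a] by blast
  with K show thesis by (intro that[of K ps]) auto
qed

lemma wb_fser:
  fixes a :: "int^'d \<Rightarrow> complex^'n^'n"
  assumes a: "(\<lambda>k. norm (a k)) summable_on UNIV"
    and r: "\<And>K. finite K \<Longrightarrow> (\<Sum>k\<in>K. w k * norm (a k)) \<le> r"
  shows "wb w r (fser a)"
  unfolding wb_def
proof (intro allI impI)
  fix e :: real assume "e > 0"
  then obtain K ps where K: "finite K" "\<And>x. norm (fser a x - tpoly ps x) \<le> e"
    "\<And>w. tnorm w ps = (\<Sum>k\<in>K. w k * norm (a k))" using fser_tpoly[OF a _ finite.emptyI] by metis
  then show "\<exists>ps. tnorm w ps \<le> r \<and> (\<forall>x. norm (fser a x - tpoly ps x) \<le> e)"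
    using r by (intro exI[of _ ps]) simp
qed

lemma wb_fser_1:
  assumes a: "(\<lambda>k. norm (a k)) summable_on UNIV" shows "wb (\<lambda>_. 1) (infsum (\<lambda>k. norm (a k)) UNIV) (fser a)"
  by (rule wb_fser[OF a]) (simp add: finite_sum_le_infsum[OF a])

lemma fser_continuous: "(\<lambda>k. norm (a k)) summable_on UNIV \<Longrightarrow> continuous_on UNIV (fser a)"
  and fser_periodic: "(\<lambda>k. norm (a k)) summable_on UNIV \<Longrightarrow> periodic (fser a)"
  using wb_continuous[OF wb_fser_1] wb_periodic[OF wb_fser_1] by blast+

lemma mfc_fser:
  assumes a: "(\<lambda>k. norm (a k)) summable_on UNIV" shows "mfc (fser a) k = a k"
proof -
  have "norm (mfc (fser a) k - a k) \<le> 0"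
  proof (rule field_le_epsilon)
    fix e :: real assume "e > 0"
    then have "e / 2 > 0" by simp
    obtain K ps where K: "finite K" "{k} \<subseteq> K" "\<And>x. norm (fser a x - tpoly ps x) \<le> e / 2"
      "\<And>l. mfc (tpoly ps) l = (if l \<in> K then a l else 0)"
      using fser_tpoly[OF a \<open>e / 2 > 0\<close>, of "{k}"] by (metis finite.emptyI finite.insertI)
    have "norm (mfc (fser a) k - mfc (tpoly ps) k) \<le> e / 2"
      by (rule norm_mfc_diff_le[OF fser_continuous[OF a] fser_periodic[OF a] continuous_on_tpoly periodic_tpoly K(3)])
    then show "norm (mfc (fser a) k - a k) \<le> 0 + e" using K(2,4) \<open>e > 0\<close> by simp
  qed
  then show ?thesis by simp
qed

lemma fourier_inversion:
  assumes "continuous_on UNIV f" "periodic f" "(\<lambda>k. norm (mfc f k)) summable_on UNIV"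
  shows "f = fser (mfc f)"
  using assms by (intro mfc_inject fser_continuous fser_periodic) (simp_all add: mfc_fser)

text \<open>The surplus of \<open>2 * CARD('d)\<close> powers pays for summation over the lattice:
  bounds on single coefficients become a bound on their weighted sum.\<close>

lemma wb_of_decay:
  fixes f :: "real^'d \<Rightarrow> complex^'n^'n"
  assumes f: "continuous_on UNIV f" "periodic f"
    and b: "\<And>k. norm (mfc f k) * (1 + norm (real_vec k)) ^ (m + 2 * CARD('d)) \<le> b"
  shows "wb (wgt 1 m) (b * lattice_sum TYPE('d)) f"
proof -
  have b0: "b \<ge> 0" using b[of 0] by (rule order_trans[rotated]) simp
  have "norm (mfc f k) * (1 + norm (real_vec k)) ^ (2 * CARD('d)) \<le> b" for k
  proof -
    have "norm (mfc f k) * (1 + norm (real_vec k)) ^ (2 * CARD('d)) \<le> norm (mfc f k) * (1 + norm (real_vec k)) ^ (m + 2 * CARD('d))"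
      by (intro mult_left_mono power_increasing) auto
    then show ?thesis using b[of k] by linarith
  qed
  then have s: "(\<lambda>k. norm (mfc f k)) summable_on UNIV" by (rule summable_of_decay)
  have "wb (wgt 1 m) (b * lattice_sum TYPE('d)) (fser (mfc f))"
  proof (rule wb_fser[OF s])
    fix K :: "(int^'d) set" assume K: "finite K"
    have "(\<Sum>k\<in>K. wgt 1 m k * norm (mfc f k)) \<le> (\<Sum>k\<in>K. b * (1 / (1 + norm (real_vec k)) ^ (2 * CARD('d))))"
    proof (rule sum_mono)
      show "wgt 1 m k * norm (mfc f k) \<le> b * (1 / (1 + norm (real_vec k)) ^ (2 * CARD('d)))" for k
        using decay_divide[of "mfc f" k m, OF b[of k]] by (simp add: wgt_def)
    qed
    also have "\<dots> = b * (\<Sum>k\<in>K. 1 / (1 + norm (real_vec k)) ^ (2 * CARD('d)))" by (simp only: sum_distrib_left)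
    also have "\<dots> \<le> b * lattice_sum TYPE('d)" by (intro mult_left_mono lattice_sum_ge K b0)
    finally show "(\<Sum>k\<in>K. wgt 1 m k * norm (mfc f k)) \<le> b * lattice_sum TYPE('d)" .
  qed
  then show ?thesis using fourier_inversion[OF f s] by simp
qed

section \<open>Derivatives and decay of Fourier coefficients\<close>

lemma smooth_partials:
  fixes f :: "real^'d \<Rightarrow> 'b::real_normed_vector"
  assumes f: "smooth f" "periodic f"
  shows "continuous_on UNIV (partials is f)" "periodic (partials is f)" "partials is f differentiable at x"
proof -
  show d: "partials is f differentiable at x" for "is" x
    using f(1) by (auto simp: smooth_def differentiable_on_def)
  show "continuous_on UNIV (partials is f)"
    using f(1) by (auto simp: smooth_def intro: differentiable_imp_continuous_on)
  show "periodic (partials is f)"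
  proof (induction "is")
    case (Cons i "is")
    let ?g = "partials is f"
    have "frechet_derivative ?g (at (x + real_vec k)) = frechet_derivative ?g (at x)" for x k
    proof -
      have sh: "((\<lambda>y. y + real_vec k) has_derivative (\<lambda>h. h)) (at x)" by (auto intro!: derivative_eq_intros)
      have "(?g has_derivative frechet_derivative ?g (at (x + real_vec k))) (at (x + real_vec k))"
        using d frechet_derivative_works by blast
      then have "((\<lambda>y. ?g (y + real_vec k)) has_derivative frechet_derivative ?g (at (x + real_vec k))) (at x)"
        using has_derivative_compose[OF sh] by blast
      then have "(?g has_derivative frechet_derivative ?g (at (x + real_vec k))) (at x)"
        using Cons by (simp add: periodicD)
      then show ?thesis by (rule frechet_derivative_at)
    qed
    then show ?case by (simp add: periodic_def)
  qed (use f in simp)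
qed

text \<open>The derivative is a limit of difference quotients along the axis, bounded by the mean
  value inequality, so dominated convergence applies. The shift rule makes the coefficients of the
  quotients explicit and replaces integration by parts.\<close>

lemma mfc_partial:
  fixes f :: "real^'d \<Rightarrow> complex^'n^'n"
  assumes f: "continuous_on UNIV f" "periodic f" "\<And>x. f differentiable at x"
    and g: "continuous_on UNIV g" "periodic g" "\<And>x. g x = frechet_derivative f (at x) (axis i 1)"
  shows "mfc g k = mscale (2 * \<i> * of_real pi * of_int (k $ i)) (mfc f k)"
proof -
  obtain B where B: "\<And>x. norm (g x) \<le> B" using periodic_continuous_bounded[OF g(1,2)] by blast
  obtain Bf where Bf: "\<And>x. norm (f x) \<le> Bf" using periodic_continuous_bounded[OF f(1,2)] by blast
  let ?v = "axis i (1::real) :: real^'d"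
  have line: "((\<lambda>t. f (x + t *\<^sub>R ?v)) has_vector_derivative g (x + t *\<^sub>R ?v)) (at t within S)" for x t S
  proof -
    have "(f has_derivative frechet_derivative f (at (x + t *\<^sub>R ?v))) (at (x + t *\<^sub>R ?v))"
      using f(3) frechet_derivative_works by blast
    moreover have "((\<lambda>t. x + t *\<^sub>R ?v) has_vector_derivative ?v) (at t within S)"
      by (auto intro!: derivative_eq_intros)
    ultimately have "((f \<circ> (\<lambda>t. x + t *\<^sub>R ?v)) has_vector_derivative frechet_derivative f (at (x + t *\<^sub>R ?v)) ?v) (at t within S)"
      by (intro vector_derivative_diff_chain_within) (auto intro: has_derivative_at_withinI)
    then show ?thesis by (simp add: o_def g(3))
  qed
  define s where "s n = inverse (real (Suc n))" for n
  have s0: "s n > 0" for n by (simp add: s_def)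
  have sl: "s \<longlonglongrightarrow> 0" unfolding s_def by (rule LIMSEQ_inverse_real_of_nat)
  define q where "q n x = (f (x + s n *\<^sub>R ?v) - f x) /\<^sub>R s n" for n x
  have fv: "continuous_on UNIV (\<lambda>x. f (x + v))" for v
    by (intro continuous_on_compose2[OF f(1)] continuous_intros) auto
  have qc: "continuous_on UNIV (q n)" for n
    unfolding q_def by (intro continuous_intros fv f)
  have qB: "norm (q n x) \<le> B" for n x
  proof -
    have "norm (f (x + s n *\<^sub>R ?v) - f (x + 0 *\<^sub>R ?v)) \<le> B * norm (s n - 0)"
    proof (rule differentiable_bound[where S=UNIV and f="\<lambda>t. f (x + t *\<^sub>R ?v)" and f'="\<lambda>t h. h *\<^sub>R g (x + t *\<^sub>R ?v)"])
      show "((\<lambda>t. f (x + t *\<^sub>R ?v)) has_derivative (\<lambda>h. h *\<^sub>R g (x + t *\<^sub>R ?v))) (at t within UNIV)" for t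
        using line by (simp add: has_vector_derivative_def)
      show "onorm (\<lambda>h. h *\<^sub>R g (x + t *\<^sub>R ?v)) \<le> B" for t
        using B by (intro onorm_bound) (auto simp: mult.commute[of B] mult_left_mono order_trans[OF norm_ge_zero B])
    qed auto
    then have "norm (f (x + s n *\<^sub>R ?v) - f x) / s n \<le> B" using s0[of n] by (simp add: field_simps)
    moreover have "norm (q n x) = norm (f (x + s n *\<^sub>R ?v) - f x) / s n"
      unfolding q_def norm_scaleR using s0[of n] by (simp add: divide_inverse mult.commute)
    ultimately show ?thesis by simp
  qed
  have qlim: "(\<lambda>n. q n x) \<longlonglongrightarrow> g x" for x
  proof -
    have "((\<lambda>h. norm (f (x + h *\<^sub>R ?v) - f x - h *\<^sub>R g x) / norm h) \<longlongrightarrow> 0) (at 0)"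
      using line[of x 0 UNIV] by (simp add: has_vector_derivative_def has_derivative_at)
    moreover have "filterlim s (at 0) sequentially"
      using sl s0 by (auto simp: filterlim_at less_imp_neq[symmetric])
    ultimately have "(\<lambda>n. norm (f (x + s n *\<^sub>R ?v) - f x - s n *\<^sub>R g x) / norm (s n)) \<longlonglongrightarrow> 0"
      by (rule filterlim_compose)
    moreover have "norm (f (x + s n *\<^sub>R ?v) - f x - s n *\<^sub>R g x) / norm (s n) = norm (q n x - g x)" for n
    proof -
      have "f (x + s n *\<^sub>R ?v) - f x - s n *\<^sub>R g x = s n *\<^sub>R (q n x - g x)"
        using s0[of n] by (simp add: q_def scaleR_diff_right)
      then show ?thesis using s0[of n] by simp
    qed
    ultimately have "(\<lambda>n. norm (q n x - g x)) \<longlonglongrightarrow> 0" by simp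
    then show ?thesis using LIM_zero_iff tendsto_norm_zero_iff by blast
  qed
  have meas: "(\<lambda>x. mscale (ek (- k) x) (h x)) \<in> borel_measurable cube" if "continuous_on UNIV h" for h :: "real^'d \<Rightarrow> complex^'n^'n"
    using that by (intro measurable_mscale measurable_cube_continuous continuous_on_ek)
  have "(\<lambda>n. mfc (q n) k) \<longlonglongrightarrow> mfc g k"
    unfolding mfc_def
  proof (rule integral_dominated_convergence[where w="\<lambda>_. B"])
    show "AE x in cube. (\<lambda>n. mscale (ek (- k) x) (q n x)) \<longlonglongrightarrow> mscale (ek (- k) x) (g x)"
      by (intro always_eventually allI ms.tendsto tendsto_const qlim)
  qed (use qB in \<open>auto intro!: meas qc g simp: norm_mscale\<close>)
  moreover have "mfc (q n) k = mscale ((ek k (s n *\<^sub>R ?v) - 1) / of_real (s n)) (mfc f k)" for n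
  proof -
    have "mfc (q n) k = (1 / s n) *\<^sub>R mfc (\<lambda>x. f (x + s n *\<^sub>R ?v) - f x) k"
      unfolding q_def mfc_scaleR by (simp add: divide_inverse)
    also have "mfc (\<lambda>x. f (x + s n *\<^sub>R ?v) - f x) k = mfc (\<lambda>x. f (x + s n *\<^sub>R ?v)) k - mfc f k"
      by (rule mfc_diff[OF measurable_cube_continuous[OF fv] _ measurable_cube_continuous[OF f(1)]]) (use Bf in auto)
    also have "mfc (\<lambda>x. f (x + s n *\<^sub>R ?v)) k = mscale (ek k (s n *\<^sub>R ?v)) (mfc f k)" by (rule mfc_shift[OF f(1,2)])
    finally show ?thesis
      unfolding mscale_of_real[symmetric] by (simp add: mscale_diff mscale_diff_left diff_divide_distrib)
  qed
  moreover have "(\<lambda>n. mscale ((ek k (s n *\<^sub>R ?v) - 1) / of_real (s n)) (mfc f k)) \<longlonglongrightarrow>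
      mscale (2 * \<i> * of_real pi * of_int (k $ i)) (mfc f k)"
  proof (intro ms.tendsto tendsto_const)
    define c where "c = 2 * \<i> * of_real pi * of_int (k $ i)"
    have e: "ek k (s n *\<^sub>R ?v) = exp (c * of_real (s n))" for n
      by (simp add: ek_def c_def inner_axis mult_ac)
    have "((\<lambda>z. exp (c * z)) has_field_derivative c) (at 0)" by (auto intro!: derivative_eq_intros)
    then have "((\<lambda>z. (exp (c * z) - 1) / z) \<longlongrightarrow> c) (at 0)" by (simp add: has_field_derivative_iff)
    moreover have "filterlim (\<lambda>n. complex_of_real (s n)) (at 0) sequentially"
      using tendsto_of_real[OF sl, where 'a=complex] s0 by (auto simp: filterlim_at less_imp_neq[symmetric])
    ultimately show "(\<lambda>n. (ek k (s n *\<^sub>R ?v) - 1) / of_real (s n)) \<longlonglongrightarrow> c"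
      unfolding e by (rule filterlim_compose)
  qed
  ultimately show ?thesis using LIMSEQ_unique by simp
qed

lemma mfc_partials_replicate:
  fixes f :: "real^'d \<Rightarrow> complex^'n^'n"
  assumes f: "smooth f" "periodic f"
  shows "mfc (partials (replicate m i) f) k = mscale ((2 * \<i> * of_real pi * of_int (k $ i)) ^ m) (mfc f k)"
proof (induction m)
  case (Suc m)
  have "mfc (partials (i # replicate m i) f) k = mscale (2 * \<i> * of_real pi * of_int (k $ i)) (mfc (partials (replicate m i) f) k)"
    by (rule mfc_partial) (intro smooth_partials[OF f] | simp)+
  then show ?case using Suc by simp
qed simp

text \<open>For the coordinate i with the largest |k i|, 1 + |k| is at most 2
  \<open>CARD('d)\<close> |k i|, so m derivatives in that one direction suffice. The direction
  depends on k, hence the bound B for all i.\<close>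

lemma smooth_decay:
  fixes f :: "real^'d \<Rightarrow> complex^'n^'n"
  assumes f: "smooth f" "periodic f" and B: "\<And>i x. norm (partials (replicate m i) f x) \<le> B" and k: "k \<noteq> 0"
  shows "norm (mfc f k) * (1 + norm (real_vec k)) ^ m \<le> (2 * real CARD('d)) ^ m * B"
proof -
  obtain i where i: "norm (real_vec k) \<le> real CARD('d) * \<bar>real_of_int (k $ i)\<bar>"
  proof -
    have "Max (range (\<lambda>i. \<bar>k $ i\<bar>)) \<in> range (\<lambda>i. \<bar>k $ i\<bar>)" by (intro Max_in) auto
    then obtain j where "Max (range (\<lambda>i. \<bar>k $ i\<bar>)) = \<bar>k $ j\<bar>" by blast
    then have j: "\<bar>k $ i\<bar> \<le> \<bar>k $ j\<bar>" for i
      by (metis Max_ge finite_class.finite_UNIV finite_imageI rangeI)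
    have "norm (real_vec k) \<le> (\<Sum>i\<in>UNIV. \<bar>real_vec k $ i\<bar>)" by (rule norm_le_l1_cart)
    also have "\<dots> \<le> (\<Sum>i\<in>(UNIV::'d set). \<bar>real_of_int (k $ j)\<bar>)"
      by (intro sum_mono) (use j in \<open>simp flip: of_int_abs\<close>)
    finally show thesis using that[of j] by simp
  qed
  have "k $ i \<noteq> 0" using i k by auto
  then have ki: "1 \<le> \<bar>real_of_int (k $ i)\<bar>" by linarith
  have "1 + norm (real_vec k) \<le> (2 * real CARD('d)) * \<bar>real_of_int (k $ i)\<bar>"
  proof -
    have "1 \<le> real CARD('d) * \<bar>real_of_int (k $ i)\<bar>" using ki mult_mono[of 1 "real CARD('d)" 1 "\<bar>real_of_int (k $ i)\<bar>"]
      by (simp add: Suc_le_eq)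
    then show ?thesis using i by linarith
  qed
  also have "\<dots> \<le> (2 * real CARD('d)) * cmod (2 * \<i> * of_real pi * of_int (k $ i))"
    using pi_ge_two by (intro mult_left_mono) (auto simp: norm_mult intro!: mult_right_mono[of 1 "2 * pi", simplified])
  finally have "(1 + norm (real_vec k)) ^ m \<le> ((2 * real CARD('d)) * cmod (2 * \<i> * of_real pi * of_int (k $ i))) ^ m"
    by (intro power_mono) auto
  then have "norm (mfc f k) * (1 + norm (real_vec k)) ^ m \<le>
      norm (mfc f k) * ((2 * real CARD('d)) * cmod (2 * \<i> * of_real pi * of_int (k $ i))) ^ m"
    by (rule mult_left_mono) simp
  also have "\<dots> = (2 * real CARD('d)) ^ m * norm (mfc (partials (replicate m i) f) k)"
    unfolding mfc_partials_replicate[OF f] norm_mscale norm_power by (simp only: power_mult_distrib mult_ac)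
  also have "\<dots> \<le> (2 * real CARD('d)) ^ m * B"
    by (intro mult_left_mono norm_mfc_le measurable_cube_continuous smooth_partials(1)[OF f] B) simp
  finally show ?thesis .
qed

lemma wb_smooth:
  fixes f :: "real^'d \<Rightarrow> complex^'n^'n"
  assumes f: "smooth f" "periodic f" obtains r where "wb (wgt 1 m) r f"
proof -
  let ?m = "m + 2 * CARD('d)"
  have "\<exists>B. \<forall>x. norm (partials (replicate ?m i) f x) \<le> B" for i
    using periodic_continuous_bounded[OF smooth_partials(1,2)[OF f]] by metis
  then obtain B where B: "\<And>i x. norm (partials (replicate ?m i) f x) \<le> B i" by metis
  define b where "b = (\<Sum>i\<in>UNIV. B i)"
  have B0: "B i \<ge> 0" for i using B norm_ge_zero order_trans by blast
  have Bb: "B i \<le> b" for i unfolding b_def using B0 by (intro member_le_sum) auto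
  define b' where "b' = max (norm (mfc f 0)) ((2 * real CARD('d)) ^ ?m * b)"
  have "norm (mfc f k) * (1 + norm (real_vec k)) ^ ?m \<le> b'" for k
  proof (cases "k = 0")
    case False
    then have "norm (mfc f k) * (1 + norm (real_vec k)) ^ ?m \<le> (2 * real CARD('d)) ^ ?m * b"
      using B Bb order_trans by (intro smooth_decay[OF f]) blast+
    then show ?thesis by (simp add: b'_def)
  qed (simp add: b'_def)
  then show thesis
    using that wb_of_decay[OF smooth_partials(1,2)[OF f, of "[]", simplified]] by blast
qed

section \<open>Smoothness of rapidly decaying series\<close>

definition dcoeff :: "'d \<Rightarrow> (int^'d \<Rightarrow> complex^'n^'n) \<Rightarrow> int^'d \<Rightarrow> complex^'n^'n" where
  "dcoeff i a k = mscale (2 * \<i> * of_real pi * of_int (k $ i)) (a k)"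

definition rapid :: "(int^'d \<Rightarrow> complex^'n^'n) \<Rightarrow> bool" where
  "rapid a \<longleftrightarrow> (\<forall>m. \<exists>b. \<forall>k. norm (a k) * (1 + norm (real_vec k)) ^ m \<le> b)"

lemma rapid_summable:
  fixes a :: "int^'d \<Rightarrow> complex^'n^'n"
  assumes "rapid a" shows "(\<lambda>k. norm (a k) * (1 + norm (real_vec k)) ^ m) summable_on UNIV"
proof -
  obtain b where b: "\<And>k. norm (a k) * (1 + norm (real_vec k)) ^ (m + 2 * CARD('d)) \<le> b" using assms by (auto simp: rapid_def)
  show ?thesis
    using summable_of_decay[of "\<lambda>k. norm (a k) * (1 + norm (real_vec k)) ^ m" b] b
    by (simp add: power_add mult.assoc)
qed

lemma rapid_dcoeff: assumes "rapid a" shows "rapid (dcoeff i a)"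
  unfolding rapid_def
proof
  fix m
  obtain b where b: "\<And>k. norm (a k) * (1 + norm (real_vec k)) ^ Suc m \<le> b" using assms by (auto simp only: rapid_def)
  have "norm (dcoeff i a k) * (1 + norm (real_vec k)) ^ m \<le> 2 * pi * b" for k
  proof -
    have "\<bar>real_of_int (k $ i)\<bar> \<le> 1 + norm (real_vec k)" using component_le_norm_cart[of "real_vec k" i] by simp
    then have "\<bar>real_of_int (k $ i)\<bar> * (norm (a k) * (1 + norm (real_vec k)) ^ m) \<le> (1 + norm (real_vec k)) * (norm (a k) * (1 + norm (real_vec k)) ^ m)"
      by (intro mult_right_mono) auto
    also have "\<dots> \<le> b" using b[of k] by (simp add: mult_ac)
    finally have "2 * pi * (\<bar>real_of_int (k $ i)\<bar> * (norm (a k) * (1 + norm (real_vec k)) ^ m)) \<le> 2 * pi * b"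
      by (intro mult_left_mono) auto
    then show ?thesis by (simp add: dcoeff_def norm_mscale norm_mult mult_ac)
  qed
  then show "\<exists>b. \<forall>k. norm (dcoeff i a k) * (1 + norm (real_vec k)) ^ m \<le> b" by blast
qed

lemma norm_cis_remainder: "cmod (cis \<theta> - 1 - \<i> * of_real \<theta>) \<le> \<theta>\<^sup>2"
proof -
  have s: "\<bar>sin \<theta> - \<theta>\<bar> \<le> \<theta>\<^sup>2 / 2"
    using Maclaurin_sin_bound[of \<theta> 2] by (simp add: numeral_2_eq_2 sin_coeff_def)
  have c: "\<bar>cos \<theta> - 1\<bar> \<le> \<theta>\<^sup>2 / 2"
  proof -
    have "\<bar>sin (\<theta>/2)\<bar> \<le> \<bar>\<theta>/2\<bar>" by (rule abs_sin_x_le_abs_x)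
    then have "(sin (\<theta>/2))\<^sup>2 \<le> (\<theta>/2)\<^sup>2" by (rule abs_le_square_iff[THEN iffD1])
    moreover have "cos \<theta> = 1 - 2 * (sin (\<theta>/2))\<^sup>2" using cos_double_sin[of "\<theta>/2"] by simp
    ultimately show ?thesis by (simp add: power_divide)
  qed
  have "cmod (cis \<theta> - 1 - \<i> * of_real \<theta>) \<le> \<bar>Re (cis \<theta> - 1 - \<i> * of_real \<theta>)\<bar> + \<bar>Im (cis \<theta> - 1 - \<i> * of_real \<theta>)\<bar>"
    by (rule cmod_le)
  also have "\<dots> \<le> \<theta>\<^sup>2" using s c by simp
  finally show ?thesis .
qed

lemma has_sum_finite_sum:
  fixes f :: "'i \<Rightarrow> 'a \<Rightarrow> 'b::real_normed_vector"
  shows "finite I \<Longrightarrow> (\<And>i. i \<in> I \<Longrightarrow> (f i has_sum s i) A) \<Longrightarrow> ((\<lambda>x. \<Sum>i\<in>I. f i x) has_sum (\<Sum>i\<in>I. s i)) A"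
  by (induction I rule: finite_induct) (auto intro: has_sum_add)

lemma has_sum_minus:
  fixes f g :: "'a \<Rightarrow> 'b::real_normed_vector"
  assumes "(f has_sum a) A" "(g has_sum b) A" shows "((\<lambda>x. f x - g x) has_sum (a - b)) A"
  using has_sum_add[OF assms(1), of "\<lambda>x. - g x" "- b"] assms(2) by (simp add: has_sum_uminus)

text \<open>The first-order Taylor remainder of a character under a shift by h is at most (2 pi)^2
  |k|^2 |h|^2, so that of the series is at most |h|^2 times a second moment of the
  coefficients.\<close>

lemma fser_has_derivative:
  fixes a :: "int^'d \<Rightarrow> complex^'n^'n"
  assumes a: "rapid a"
  shows "(fser a has_derivative (\<lambda>h. \<Sum>i\<in>UNIV. (h $ i) *\<^sub>R fser (dcoeff i a) x)) (at x)"
proof -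
  define D where "D h = (\<Sum>i\<in>UNIV. (h $ i) *\<^sub>R fser (dcoeff i a) x)" for h :: "real^'d"
  have s0: "(\<lambda>k. norm (a k)) summable_on UNIV" using rapid_summable[OF a, of 0] by simp
  have s1: "(\<lambda>k. norm (dcoeff i a k)) summable_on UNIV" for i using rapid_summable[OF rapid_dcoeff[OF a], of _ 0] by simp
  have s2: "(\<lambda>k. norm (a k) * (1 + norm (real_vec k)) ^ 2) summable_on UNIV" by (rule rapid_summable[OF a])
  define C where "C = (2 * pi)\<^sup>2 * (\<Sum>\<^sub>\<infinity>k. norm (a k) * (1 + norm (real_vec k)) ^ 2)"
  have hs: "((\<lambda>k. mscale (ek k y) (c k)) has_sum fser c y) UNIV" if "(\<lambda>k. norm (c k)) summable_on UNIV"
    for c :: "int^'d \<Rightarrow> complex^'n^'n" and y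
    unfolding fser_def using fser_summable[OF that] by (rule has_sum_infsum)
  have rem: "norm (fser a (x + h) - fser a x - D h) \<le> C * (norm h)\<^sup>2" for h
  proof -
    let ?\<theta> = "\<lambda>k. 2 * pi * (real_vec k \<bullet> h)"
    have Dh: "((\<lambda>k. \<Sum>i\<in>UNIV. (h $ i) *\<^sub>R mscale (ek k x) (dcoeff i a k)) has_sum D h) UNIV"
      unfolding D_def by (intro has_sum_finite_sum has_sum_scaleR hs s1) simp
    have "((\<lambda>k. mscale (ek k (x + h)) (a k) - mscale (ek k x) (a k) - (\<Sum>i\<in>UNIV. (h $ i) *\<^sub>R mscale (ek k x) (dcoeff i a k)))
        has_sum (fser a (x + h) - fser a x - D h)) UNIV"
      by (intro has_sum_minus hs s0 Dh)
    moreover have "mscale (ek k (x + h)) (a k) - mscale (ek k x) (a k) - (\<Sum>i\<in>UNIV. (h $ i) *\<^sub>R mscale (ek k x) (dcoeff i a k)) =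
        mscale (ek k x * (cis (?\<theta> k) - 1 - \<i> * of_real (?\<theta> k))) (a k)" for k
    proof -
      have "(\<Sum>i\<in>UNIV. (h $ i) *\<^sub>R mscale (ek k x) (dcoeff i a k)) =
          (\<Sum>i\<in>UNIV. mscale (ek k x * (2 * \<i> * of_real pi * of_real (real_vec k $ i * h $ i))) (a k))"
        by (intro sum.cong refl) (simp add: dcoeff_def mult_ac flip: mscale_of_real)
      also have "\<dots> = mscale (\<Sum>i\<in>UNIV. ek k x * (2 * \<i> * of_real pi * of_real (real_vec k $ i * h $ i))) (a k)"
        by (simp only: ms.sum_left)
      also have "(\<Sum>i\<in>UNIV. ek k x * (2 * \<i> * of_real pi * of_real (real_vec k $ i * h $ i))) = ek k x * (\<i> * of_real (?\<theta> k))"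
        by (simp add: inner_vec_def sum_distrib_left mult_ac)
      finally have "(\<Sum>i\<in>UNIV. (h $ i) *\<^sub>R mscale (ek k x) (dcoeff i a k)) = mscale (ek k x * (\<i> * of_real (?\<theta> k))) (a k)" .
      moreover have "ek k (x + h) = ek k x * cis (?\<theta> k)" using ek_shift[of k x h] ek_cis[of k h] by simp
      ultimately show ?thesis by (simp add: right_diff_distrib mscale_diff_left)
    qed
    ultimately have hs': "((\<lambda>k. mscale (ek k x * (cis (?\<theta> k) - 1 - \<i> * of_real (?\<theta> k))) (a k)) has_sum (fser a (x + h) - fser a x - D h)) UNIV"
      by simp
    have bd: "norm (mscale (ek k x * (cis (?\<theta> k) - 1 - \<i> * of_real (?\<theta> k))) (a k)) \<le>
        ((2 * pi)\<^sup>2 * (norm h)\<^sup>2) * (norm (a k) * (1 + norm (real_vec k)) ^ 2)" for k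
    proof -
      have "cmod (cis (?\<theta> k) - 1 - \<i> * of_real (?\<theta> k)) \<le> (?\<theta> k)\<^sup>2" by (rule norm_cis_remainder)
      also have "\<dots> = (2 * pi)\<^sup>2 * \<bar>real_vec k \<bullet> h\<bar>\<^sup>2" by (simp add: power_mult_distrib)
      also have "\<dots> \<le> (2 * pi)\<^sup>2 * (norm (real_vec k) * norm h)\<^sup>2"
        by (intro mult_left_mono power_mono Cauchy_Schwarz_ineq2) auto
      also have "\<dots> \<le> (2 * pi)\<^sup>2 * ((1 + norm (real_vec k)) * norm h)\<^sup>2"
        by (intro mult_left_mono power_mono mult_right_mono) auto
      finally have "cmod (cis (?\<theta> k) - 1 - \<i> * of_real (?\<theta> k)) * norm (a k) \<le> (2 * pi)\<^sup>2 * ((1 + norm (real_vec k)) * norm h)\<^sup>2 * norm (a k)"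
        by (rule mult_right_mono) simp
      then show ?thesis by (simp add: norm_mscale norm_mult power_mult_distrib mult_ac)
    qed
    have "norm (fser a (x + h) - fser a x - D h) \<le> ((2 * pi)\<^sup>2 * (norm h)\<^sup>2) * (\<Sum>\<^sub>\<infinity>k. norm (a k) * (1 + norm (real_vec k)) ^ 2)"
      by (rule norm_infsum_le[OF hs' has_sum_cmult_right[OF has_sum_infsum[OF s2]] bd])
    then show ?thesis by (simp add: C_def mult_ac)
  qed
  have "bounded_linear D"
    unfolding D_def by (intro bounded_linear_sum bounded_linear_scaleR_left[THEN bounded_linear_compose] bounded_linear_vec_nth)
  moreover have "((\<lambda>h. norm (fser a (x + h) - fser a x - D h) / norm h) \<longlongrightarrow> 0) (at 0)"
  proof (rule Lim_null_comparison)
    show "\<forall>\<^sub>F h in at 0. norm (norm (fser a (x + h) - fser a x - D h) / norm h) \<le> C * norm h"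
      unfolding eventually_at
    proof (intro exI[of _ 1] conjI ballI impI)
      fix h :: "real^'d" assume "h \<noteq> 0 \<and> dist h 0 < 1"
      then show "norm (norm (fser a (x + h) - fser a x - D h) / norm h) \<le> C * norm h"
        using rem[of h] by (simp add: field_simps power2_eq_square)
    qed simp
    show "((\<lambda>h. C * norm h) \<longlongrightarrow> 0) (at (0::real^'d))" by (rule tendsto_eq_intros | simp)+
  qed
  ultimately show ?thesis unfolding has_derivative_at D_def[abs_def] by blast
qed

text \<open>A partial derivative of a rapidly decaying series is again one, so the induction over
  the list of derivatives closes.\<close>

lemma smooth_fser:
  fixes a :: "int^'d \<Rightarrow> complex^'n^'n"
  assumes a: "rapid a" shows "smooth (fser a)"
proof -
  have "\<exists>b. rapid b \<and> partials is (fser a) = fser b" for "is" :: "'d list"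
  proof (induction "is")
    case Nil then show ?case using a by auto
  next
    case (Cons i "is")
    then obtain b where b: "rapid b" "partials is (fser a) = fser b" by blast
    have "partials (i # is) (fser a) = fser (dcoeff i b)"
    proof
      fix x
      have "frechet_derivative (fser b) (at x) = (\<lambda>h. \<Sum>j\<in>UNIV. (h $ j) *\<^sub>R fser (dcoeff j b) x)"
        using frechet_derivative_at[OF fser_has_derivative[OF b(1)]] by simp
      then show "partials (i # is) (fser a) x = fser (dcoeff i b) x"
        by (simp add: b(2) axis_def if_distrib[where f="\<lambda>t. t *\<^sub>R _"] cong: if_cong)
    qed
    then show ?case using rapid_dcoeff[OF b(1)] by blast
  qed
  moreover have "fser b differentiable_on UNIV" if "rapid b" for b :: "int^'d \<Rightarrow> complex^'n^'n"
    unfolding differentiable_on_def differentiable_def using fser_has_derivative[OF that] by auto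
  ultimately show ?thesis unfolding smooth_def by metis
qed

lemma smooth_of_wb:
  fixes f :: "real^'d \<Rightarrow> complex^'n^'n"
  assumes "\<And>m. \<exists>r. wb (wgt 1 m) r f" shows "smooth f"
proof -
  have "rapid (mfc f)"
    unfolding rapid_def
  proof
    fix m
    obtain r where r: "wb (wgt 1 m) r f" using assms by blast
    have "wgt 1 m k * norm (mfc f k) \<le> r" for k by (rule wb_mfc[OF weight_wgt[OF zero_less_one] r])
    then show "\<exists>b. \<forall>k. norm (mfc f k) * (1 + norm (real_vec k)) ^ m \<le> b"
      by (intro exI[of _ r]) (simp add: wgt_def mult.commute)
  qed
  obtain r where r: "wb (wgt 1 0) r f" using assms by blast
  have "f = fser (mfc f)"
    using rapid_summable[OF \<open>rapid (mfc f)\<close>, of 0] wb_continuous[OF r] wb_periodic[OF r] by (intro fourier_inversion) simp_all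
  then show ?thesis using smooth_fser[OF \<open>rapid (mfc f)\<close>] by simp
qed

text \<open>The bound is the square root of the least eigenvalue of a commuting self-adjoint operator, whose
  eigenspace contains a joint eigenvector of the torus.\<close>

lemma Ad_shift_lower_bound:
  fixes E :: "complex^'n^'n"
  assumes W: "csubspace W" and inv: "\<And>b v. b \<in> t \<Longrightarrow> v \<in> W \<Longrightarrow> b ** v - v ** b \<in> W"
    and skew: "\<And>b. b \<in> t \<Longrightarrow> conj_transpose b = - b"
    and comm: "\<And>b c. b \<in> t \<Longrightarrow> c \<in> t \<Longrightarrow> b ** c = c ** b"
    and E: "unitary E" "\<And>b. b \<in> t \<Longrightarrow> E ** b = b ** E"
    and WE: "\<And>v. v \<in> W \<Longrightarrow> E ** v ** conj_transpose E \<in> W" "\<And>v. v \<in> W \<Longrightarrow> conj_transpose E ** v ** E \<in> W"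
    and bound: "\<And>j r. j \<in> W \<Longrightarrow> j \<noteq> 0 \<Longrightarrow> (\<And>b. b \<in> t \<Longrightarrow> b ** j - j ** b = mscale (\<i> * of_real (r b)) j) \<Longrightarrow>
        c * norm j \<le> norm (mscale z j - E ** j ** conj_transpose E)"
    and c: "c \<ge> 0" and v: "v \<in> W"
  shows "c * norm v \<le> norm (mscale z v - E ** v ** conj_transpose E)"
proof (cases "W = {0}")
  case False
  define N where "N v = mscale z v - E ** v ** conj_transpose E" for v
  define M where "M v = mscale (cnj z) v - conj_transpose E ** v ** E" for v
  have adj: "N u \<bullet> v = u \<bullet> M v" for u v
  proof -
    have "(E ** u ** conj_transpose E) \<bullet> v = u \<bullet> (conj_transpose E ** v ** E)"
      unfolding inner_mult_right[of "E ** u" "conj_transpose E"] inner_mult_left[of E u]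
      by (simp add: matrix_mul_assoc)
    then show ?thesis by (simp add: N_def M_def inner_diff_left inner_diff_right inner_mscale)
  qed
  have sub: "subspace W" using W by (simp add: csubspace_def)
  have NW: "N v \<in> W" and MW: "M v \<in> W" if "v \<in> W" for v
    using that W WE by (auto simp: N_def M_def csubspace_def intro: subspace_diff)
  have linN: "linear N" and linM: "linear M"
    by (rule linearI; simp add: N_def M_def mat_simps mscale_add mscale_scaleR scaleR_diff_right)+
  have Nsc: "N (mscale d v) = mscale d (N v)" and Msc: "M (mscale d v) = mscale d (M v)" for d v
    by (simp_all add: N_def M_def mat_simps mscale_diff mult.commute)
  \<comment> \<open>\<open>M\<close> is the adjoint of \<open>N\<close>, so S v . v is the square of
    the norm of N v.\<close>
  define S where "S v = M (N v)" for v
  have linS: "linear S" using linear_compose[OF linN linM] by (simp add: S_def[abs_def] o_def)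
  have SW: "S v \<in> W" if "v \<in> W" for v using that by (simp add: S_def NW MW)
  have sa: "S u \<bullet> v = u \<bullet> S v" for u v
    by (metis S_def adj inner_commute)
  have Ssc: "S (mscale d v) = mscale d (S v)" for d v by (simp add: S_def Nsc Msc)
  obtain \<nu> w where w: "w \<in> W" "w \<noteq> 0" "S w = \<nu> *\<^sub>R w" and min: "\<And>w. w \<in> W \<Longrightarrow> \<nu> * (w \<bullet> w) \<le> S w \<bullet> w"
    using self_adjoint_min_eigenvector[OF sub False linS SW sa] by blast
  let ?V = "{v \<in> W. S v = \<nu> *\<^sub>R v}"
  have V: "csubspace ?V" by (rule csubspace_eigenspace[OF W linS Ssc])
  have "?V \<noteq> {0}" using w by blast
  have Vinv: "b ** v - v ** b \<in> ?V" if b: "b \<in> t" and v: "v \<in> ?V" for b v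
  proof -
    have Eb: "E ** b = b ** E" using E(2)[OF b] .
    have "conj_transpose (E ** b) = conj_transpose (b ** E)" by (simp only: Eb)
    then have Eb': "conj_transpose E ** b = b ** conj_transpose E"
      by (simp add: ct_mult skew[OF b] mat_simps)
    have NbL: "N (b ** v) = b ** N v" and NbR: "N (v ** b) = N v ** b"
      and MbL: "M (b ** v) = b ** M v" and MbR: "M (v ** b) = M v ** b" for v
    proof -
      have "E ** (b ** v) ** conj_transpose E = (E ** b) ** v ** conj_transpose E" by (simp only: matrix_mul_assoc)
      also have "\<dots> = b ** (E ** v ** conj_transpose E)" by (simp only: Eb matrix_mul_assoc)
      finally show "N (b ** v) = b ** N v" by (simp add: N_def mm.diff_right mscale_mult_right)
      have "conj_transpose E ** (b ** v) ** E = (conj_transpose E ** b) ** v ** E" by (simp only: matrix_mul_assoc)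
      also have "\<dots> = b ** (conj_transpose E ** v ** E)" by (simp only: Eb' matrix_mul_assoc)
      finally show "M (b ** v) = b ** M v" by (simp add: M_def mm.diff_right mscale_mult_right)
      have "E ** (v ** b) ** conj_transpose E = E ** v ** (b ** conj_transpose E)" by (simp only: matrix_mul_assoc)
      also have "\<dots> = (E ** v ** conj_transpose E) ** b" by (simp only: Eb'[symmetric] matrix_mul_assoc)
      finally show "N (v ** b) = N v ** b" by (simp add: N_def mm.diff_left mscale_mult_left)
      have "conj_transpose E ** (v ** b) ** E = conj_transpose E ** v ** (b ** E)" by (simp only: matrix_mul_assoc)
      also have "\<dots> = (conj_transpose E ** v ** E) ** b" by (simp only: Eb[symmetric] matrix_mul_assoc)
      finally show "M (v ** b) = M v ** b" by (simp add: M_def mm.diff_left mscale_mult_left)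
    qed
    have "S (b ** v - v ** b) = b ** S v - S v ** b"
      by (simp add: S_def linear_diff[OF linN] linear_diff[OF linM] NbL NbR MbL MbR)
    then show ?thesis using v inv[OF b] by (simp add: mat_simps scaleR_diff_right)
  qed
  obtain j r where j: "j \<in> ?V" "j \<noteq> 0" "\<And>b. b \<in> t \<Longrightarrow> b ** j - j ** b = mscale (\<i> * of_real (r b)) j"
    using joint_eigenvector[OF V \<open>?V \<noteq> {0}\<close> Vinv skew comm] by blast
  have nrm: "(norm (N v))\<^sup>2 = S v \<bullet> v" for v
    by (metis S_def adj dot_square_norm inner_commute)
  have "c * norm j \<le> norm (N j)" using bound[of j r] j by (simp add: N_def)
  then have "(c * norm j)\<^sup>2 \<le> (norm (N j))\<^sup>2" using c by (intro power_mono) auto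
  also have "\<dots> = \<nu> * (norm j)\<^sup>2" using j(1) by (simp add: nrm dot_square_norm)
  finally have "c\<^sup>2 * (norm j)\<^sup>2 \<le> \<nu> * (norm j)\<^sup>2" by (simp add: power_mult_distrib)
  then have "c\<^sup>2 \<le> \<nu>" using j(2) by simp
  then have "c\<^sup>2 * (norm v)\<^sup>2 \<le> \<nu> * (v \<bullet> v)" by (simp add: dot_square_norm mult_right_mono)
  also have "\<dots> \<le> (norm (N v))\<^sup>2" using min[OF v] by (simp add: nrm)
  finally have "(c * norm v)\<^sup>2 \<le> (norm (N v))\<^sup>2" by (simp add: power_mult_distrib)
  then show ?thesis unfolding N_def by (rule power2_le_imp_le) simp
qed (use v in simp)

text \<open>For k nonzero the operator is bounded below, hence injective and, in finite dimension,
  onto. For k = 0 it has a kernel; as the adjoint action of a unitary matrix is orthogonal, this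
  kernel is the orthogonal complement of the image, and D is the component in it.\<close>

lemma small_divisors:
  fixes G T :: "(complex^'n^'n) set" and \<alpha> :: "real^'d"
  assumes G: "compact_group G" and T: "compact_group T" "T \<subseteq> G" "\<And>A B. A \<in> T \<Longrightarrow> B \<in> T \<Longrightarrow> A ** B = B ** A"
    and a: "a \<in> lie_algebra T" and dio: "diophantine \<alpha>"
    and \<gamma>: "\<gamma> > 0" "\<tau> > 0" and DC: "\<forall>\<rho>\<in>roots G T. \<rho> a \<in> DC \<alpha> \<gamma> \<tau>"
  obtains C :: real and m :: nat where "C \<ge> 1"
    "\<And>k Z. k \<noteq> 0 \<Longrightarrow> Z \<in> complexification (lie_algebra G) \<Longrightarrow> \<exists>W\<in>complexification (lie_algebra G).
       mscale (ek k \<alpha>) W - mexp a ** W ** conj_transpose (mexp a) = Z \<and>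
       norm W \<le> C * (1 + norm (real_vec k)) ^ m * norm Z"
    "\<And>Z. Z \<in> complexification (lie_algebra G) \<Longrightarrow>
       \<exists>W\<in>complexification (lie_algebra G). \<exists>D\<in>complexification (lie_algebra G).
       W - mexp a ** W ** conj_transpose (mexp a) = Z - D \<and>
       mexp a ** D ** conj_transpose (mexp a) = D \<and> norm W \<le> C * norm Z"
proof -
  let ?g = "complexification (lie_algebra G)" and ?t = "lie_algebra T"
  define E where "E = mexp a"
  have ET: "E \<in> T" unfolding E_def by (rule mexp_in_group[OF a])
  then have EG: "E \<in> G" and u: "unitary E" using T compact_groupD(1)[OF T(1)] by auto
  have gsub: "subspace (lie_algebra G)" by (rule subspace_lie_algebra[OF G])
  have cs: "csubspace ?g" by (rule csubspace_complexification[OF gsub])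
  have sub: "subspace ?g" using cs by (simp add: csubspace_def)
  have inv: "b ** v - v ** b \<in> ?g" if "b \<in> ?t" "v \<in> ?g" for b v
    using that(2)
  proof (rule complexification_image)
    have "b \<in> lie_algebra G" using that T(2) by (auto simp: lie_algebra_def)
    then show "b ** X - X ** b \<in> lie_algebra G" if "X \<in> lie_algebra G" for X using lie_algebra_bracket[OF G that] by blast
  qed (simp_all add: mat_simps mscale_diff)
  have skew: "conj_transpose b = - b" if "b \<in> ?t" for b using lie_algebra_skew[OF T(1) that] .
  have comm: "b ** c = c ** b" if "b \<in> ?t" "c \<in> ?t" for b c using lie_algebra_commute[OF T(1,3) that] .
  have Ecomm: "E ** b = b ** E" if "b \<in> ?t" for b unfolding E_def using comm[OF a that] by (rule mexp_intertwine)
  have Ad_g: "A ** v ** conj_transpose A \<in> ?g" if "A \<in> G" "v \<in> ?g" for A v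
    using that(2) by (rule complexification_image) (auto simp: mat_simps intro: lie_algebra_Ad[OF G _ that(1)])
  have WE: "E ** v ** conj_transpose E \<in> ?g" "conj_transpose E ** v ** E \<in> ?g" if "v \<in> ?g" for v
    using Ad_g[OF EG that] Ad_g[OF compact_groupD(4)[OF G EG] that] by simp_all
  obtain \<gamma>' \<tau>' where dio': "\<gamma>' > 0" "\<tau>' > 0"
    "\<And>k::int^'d. k \<noteq> 0 \<Longrightarrow> inverse \<gamma>' * norm (real_vec k) powr (- \<tau>') \<le> infdist (\<alpha> \<bullet> real_vec k) \<int>"
    using dio unfolding diophantine_def by blast
  define m where "m = nat \<lceil>max \<tau> \<tau>'\<rceil>"
  define C where "C = max 1 (max \<gamma> \<gamma>')"
  have C1: "C \<ge> 1" "C \<ge> \<gamma>" "C \<ge> \<gamma>'" by (auto simp: C_def)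
  have mt: "\<tau> \<le> real m" "\<tau>' \<le> real m" by (simp_all add: m_def) linarith+
  \<comment> \<open>A common lower bound for all divisors. With 1 + |k| in place of |k| and one
    natural exponent above both given ones, it lies below the bound for the roots as well as the
    bound for \<alpha>.\<close>
  define cc where "cc k = inverse (C * (1 + norm (real_vec k)) ^ m)" for k :: "int^'d"
  have cc0: "cc k > 0" for k using C1 by (simp add: cc_def add_pos_nonneg)
  have cc: "cc k \<le> inverse g * norm (real_vec k) powr (- s)" if "k \<noteq> 0" "0 < g" "g \<le> C" "0 < s" "s \<le> real m" for k g s
  proof -
    define R where "R = norm (real_vec k)"
    have R: "R > 0" using that by (simp add: R_def)
    have "R powr s \<le> (1 + R) powr s" using R that by (intro powr_mono2) auto
    also have "\<dots> \<le> (1 + R) powr real m" using R that by (intro powr_mono) auto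
    also have "\<dots> = (1 + R) ^ m" using R by (simp add: powr_realpow)
    finally have "g * R powr s \<le> C * (1 + R) ^ m" using that R by (intro mult_mono) auto
    then have "inverse (C * (1 + R) ^ m) \<le> inverse (g * R powr s)"
      using that R by (intro le_imp_inverse_le) auto
    then show ?thesis by (simp add: cc_def R_def powr_minus)
  qed
  have div: "cc k * norm v \<le> norm (mscale (ek k \<alpha>) v - E ** v ** conj_transpose E)" if k: "k \<noteq> 0" and v: "v \<in> ?g" for k v
  proof (rule Ad_shift_lower_bound[OF cs inv skew comm u Ecomm WE _ _ v])
    fix j r assume j: "j \<in> ?g" "j \<noteq> 0" and r: "\<And>b. b \<in> ?t \<Longrightarrow> b ** j - j ** b = mscale (\<i> * of_real (r b)) j"
    define \<theta> where "\<theta> = r a / (2 * pi)"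
    have "E ** j ** conj_transpose E = mscale (exp (\<i> * of_real (r a))) j"
      unfolding E_def mexp_eigen[OF r[OF a]] using u by (simp add: E_def mat_simps unitaryD flip: matrix_mul_assoc)
    also have "exp (\<i> * of_real (r a)) = cis (2 * pi * \<theta>)" by (simp add: cis_conv_exp \<theta>_def)
    finally have Ej: "mscale (ek k \<alpha>) j - E ** j ** conj_transpose E = mscale (ek k \<alpha> - cis (2 * pi * \<theta>)) j"
      by (simp add: mscale_diff_left)
    have "cc k \<le> infdist (\<theta> - \<alpha> \<bullet> real_vec k) \<int>"
      using eigenvalue_trivial_or_root[OF G T j r]
    proof
      \<comment> \<open>An eigenvector fixed by the torus: the divisor is the character at \<alpha>
        minus 1, which the condition on \<alpha> estimates.\<close>
      assume "\<forall>b\<in>?t. r b = 0"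
      then have "\<theta> = 0" using a by (simp add: \<theta>_def)
      moreover have "infdist (- x) \<int> = infdist x \<int>" for x :: real
      proof -
        have "infdist x \<int> \<le> infdist (- x) \<int>" for x :: real
        proof -
          have "dist (- x) ` \<int> = dist x ` \<int>"
            by (auto simp: dist_real_def image_iff) (metis Ints_minus abs_minus_commute add.commute diff_minus_eq_add uminus_add_conv_diff)+
          then show ?thesis by (simp add: infdist_def)
        qed
        from this[of x] this[of "-x"] show ?thesis by simp
      qed
      ultimately show ?thesis
        using cc[OF k dio'(1) C1(3) dio'(2) mt(2)] dio'(3)[OF k] by simp
    next
      assume "restrict (\<lambda>b. r b / (2 * pi)) ?t \<in> roots G T"
      then have "\<theta> \<in> DC \<alpha> \<gamma> \<tau>" using DC a by (force simp: \<theta>_def)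
      then show ?thesis
        using cc[OF k \<gamma>(1) C1(2) \<gamma>(2) mt(1)] k by (force simp: DC_def)
    qed
    also have "\<dots> \<le> cmod (cis (2 * pi * \<theta>) - ek k \<alpha>)"
      using cmod_cis_diff[of \<theta> "\<alpha> \<bullet> real_vec k"] by (simp add: ek_cis inner_commute)
    finally show "cc k * norm j \<le> norm (mscale (ek k \<alpha>) j - E ** j ** conj_transpose E)"
      unfolding Ej norm_mscale by (simp add: norm_minus_commute mult_right_mono)
  qed (use cc0[of k] in auto)
  have 1: "\<exists>W\<in>?g. mscale (ek k \<alpha>) W - E ** W ** conj_transpose E = Z \<and> norm W \<le> C * (1 + norm (real_vec k)) ^ m * norm Z"
    if k: "k \<noteq> 0" and Z: "Z \<in> ?g" for k Z
  proof -
    define N where "N v = mscale (ek k \<alpha>) v - E ** v ** conj_transpose E" for v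
    have lin: "linear N" by (rule linearI; simp add: N_def mat_simps mscale_add mscale_scaleR scaleR_diff_right)
    have NW: "N ` ?g \<subseteq> ?g" using cs WE by (auto simp: N_def csubspace_def intro: subspace_diff)
    have "inj_on N (span ?g)"
    proof (rule inj_onI)
      fix x y assume xy: "x \<in> span ?g" "y \<in> span ?g" "N x = N y"
      then have "x - y \<in> ?g" using sub by (simp add: span_eq_iff[THEN iffD2] subspace_diff)
      then have "cc k * norm (x - y) \<le> norm (N (x - y))" using div[OF k] by (simp add: N_def)
      also have "\<dots> = 0" using xy by (simp add: linear_diff[OF lin])
      finally show "x = y" using cc0[of k] by (simp add: mult_le_0_iff)
    qed
    then have "dim (N ` ?g) = dim ?g" using lin by (rule dim_image_eq[rotated])
    then have "N ` ?g = ?g" using NW sub lin by (intro subspace_dim_equal linear_subspace_image) auto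
    then have "Z \<in> N ` ?g" using Z by simp
    then obtain W where W: "W \<in> ?g" "N W = Z" by (metis imageE)
    have "cc k * norm W \<le> norm Z" using div[OF k W(1)] W(2) by (simp add: N_def)
    then have "norm W \<le> C * (1 + norm (real_vec k)) ^ m * norm Z"
      using cc0[of k] C1 by (simp add: cc_def field_simps add_pos_nonneg)
    then show ?thesis using W by (auto simp: N_def)
  qed
  define N where "N v = v - E ** v ** conj_transpose E" for v
  have lin: "linear N" by (rule linearI; simp add: N_def mat_simps scaleR_diff_right)
  have Ng: "N v \<in> ?g" if "v \<in> ?g" for v using that sub WE by (auto simp: N_def intro: subspace_diff)
  \<comment> \<open>The orthogonal complement of the kernel. There \<open>N\<close> is injective,
    hence bounded below by some e > 0.\<close>
  define K where "K = {v \<in> ?g. \<forall>w\<in>?g. N w = 0 \<longrightarrow> v \<bullet> w = 0}"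
  have Ksub: "subspace K" using sub by (auto simp: K_def subspace_def inner_add_left)
  obtain e where e: "e > 0" "\<And>x. x \<in> K \<Longrightarrow> norm (N x) \<ge> e * norm x"
  proof -
    have "\<forall>x\<in>K. N x = 0 \<longrightarrow> x = 0" unfolding K_def by (metis (mono_tags, lifting) inner_eq_zero_iff mem_Collect_eq)
    moreover have "bounded_linear N" using lin by (simp add: linear_conv_bounded_linear)
    ultimately show thesis
      using injective_imp_isometric[OF closed_subspace[OF Ksub] Ksub, of N] that by blast
  qed
  have 2: "\<exists>W\<in>?g. \<exists>D\<in>?g. W - E ** W ** conj_transpose E = Z - D \<and> E ** D ** conj_transpose E = D \<and> norm W \<le> inverse e * norm Z"
    if Z: "Z \<in> ?g" for Z
  proof -
    have Rsub: "subspace (N ` ?g)" using lin sub by (rule linear_subspace_image)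
    obtain y D where y: "y \<in> N ` ?g" "\<And>w. w \<in> N ` ?g \<Longrightarrow> orthogonal D w" "Z = y + D"
      using orthogonal_subspace_decomp_exists[of "N ` ?g" Z] Rsub by (metis span_eq_iff)
    obtain w where w: "w \<in> ?g" "y = N w" using y by blast
    have D: "D \<in> ?g" using y(3) Z w Ng[OF w(1)] subspace_diff[OF sub Z, of y] by auto
    \<comment> \<open>D is orthogonal to the image, so both D and its image under the adjoint action
      of E are orthogonal to N D; their difference is N D itself.\<close>
    have ND: "N D = 0"
    proof -
      have inn: "(E ** D ** conj_transpose E) \<bullet> v = D \<bullet> (conj_transpose E ** v ** E)" for v
        unfolding inner_mult_right[of "E ** D" "conj_transpose E"] inner_mult_left[of E D]
        by (simp add: matrix_mul_assoc)
      have "conj_transpose E ** N D ** E = N (conj_transpose E ** D ** E)"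
      proof -
        have "conj_transpose E ** (E ** D ** conj_transpose E) ** E = (conj_transpose E ** E) ** D ** (conj_transpose E ** E)"
          by (simp only: matrix_mul_assoc)
        moreover have "E ** (conj_transpose E ** D ** E) ** conj_transpose E = (E ** conj_transpose E) ** D ** (E ** conj_transpose E)"
          by (simp only: matrix_mul_assoc)
        ultimately show ?thesis by (simp add: N_def mm.diff_left mm.diff_right unitaryD[OF u])
      qed
      then have "(E ** D ** conj_transpose E) \<bullet> N D = 0" "D \<bullet> N D = 0"
        unfolding inn using y(2) WE D by (auto simp: orthogonal_def)
      then have "N D \<bullet> N D = 0" by (simp add: N_def[of D] inner_diff_left)
      then show ?thesis by simp
    qed
    define K0 where "K0 = {v \<in> ?g. N v = 0}"
    have K0: "subspace K0" using sub by (auto simp: K0_def subspace_def linear_0[OF lin] linear_add[OF lin] linear_cmul[OF lin])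
    obtain w2 w1 where ww: "w2 \<in> K0" "\<And>v. v \<in> K0 \<Longrightarrow> orthogonal w1 v" "w = w2 + w1"
      using orthogonal_subspace_decomp_exists[of K0 w] K0 by (metis span_eq_iff)
    have w1: "w1 \<in> ?g" using ww w subspace_diff[OF sub w(1), of w2] by (auto simp: K0_def)
    then have "w1 \<in> K" using ww(2) by (auto simp: K_def K0_def orthogonal_def)
    have Nw: "N w1 = y" using ww(1,3) w(2) by (simp add: linear_add[OF lin] K0_def)
    have "(norm Z)\<^sup>2 = (norm y)\<^sup>2 + (norm D)\<^sup>2"
      unfolding y(3) using y(2)[OF y(1)] by (intro norm_add_Pythagorean) (simp add: orthogonal_commute)
    then have "(norm y)\<^sup>2 \<le> (norm Z)\<^sup>2" by simp
    then have "norm y \<le> norm Z" by (rule power2_le_imp_le) simp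
    then have "e * norm w1 \<le> norm Z" using e(2)[OF \<open>w1 \<in> K\<close>] Nw by simp
    then have "norm w1 \<le> inverse e * norm Z" using e(1) by (simp add: field_simps)
    moreover have "w1 - E ** w1 ** conj_transpose E = Z - D" using Nw y(3) by (simp add: N_def)
    moreover have "E ** D ** conj_transpose E = D" using ND by (simp add: N_def)
    ultimately show ?thesis using w1 D by blast
  qed
  define C' where "C' = max C (inverse e)"
  have C': "C \<le> C'" "inverse e \<le> C'" by (simp_all add: C'_def)
  show thesis
  proof (rule that[of C' m])
    show "C' \<ge> 1" using C1 C' by simp
  next
    fix k Z assume k: "(k::int^'d) \<noteq> 0" and Z: "Z \<in> ?g"
    have "C * (1 + norm (real_vec k)) ^ m * norm Z \<le> C' * (1 + norm (real_vec k)) ^ m * norm Z"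
      using C' by (intro mult_right_mono) auto
    with 1[OF k Z] show "\<exists>W\<in>?g. mscale (ek k \<alpha>) W - mexp a ** W ** conj_transpose (mexp a) = Z \<and>
       norm W \<le> C' * (1 + norm (real_vec k)) ^ m * norm Z"
      unfolding E_def by (meson order_trans)
  next
    fix Z assume Z: "Z \<in> ?g"
    have "inverse e * norm Z \<le> C' * norm Z" using C' by (intro mult_right_mono) auto
    with 2[OF Z] show "\<exists>W\<in>?g. \<exists>D\<in>?g. W - mexp a ** W ** conj_transpose (mexp a) = Z - D \<and>
       mexp a ** D ** conj_transpose (mexp a) = D \<and> norm W \<le> C' * norm Z"
      unfolding E_def by (meson order_trans)
  qed
qed

subsection \<open>One step of the iteration\<close>

lemma finite_lattice_ball: "finite {k::int^'d. norm (real_vec k) \<le> R}"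
proof (rule finite_subset)
  let ?B = "{-\<lceil>R\<rceil>..\<lceil>R\<rceil>}"
  show "finite {k::int^'d. \<forall>i. k $ i \<in> ?B}"
  proof -
    have "finite (Pi\<^sub>E (UNIV::'d set) (\<lambda>_. ?B))" by (intro finite_PiE) auto
    moreover have "vec_nth ` {k::int^'d. \<forall>i. k $ i \<in> ?B} \<subseteq> Pi\<^sub>E UNIV (\<lambda>_. ?B)" by auto
    ultimately have "finite (vec_nth ` {k::int^'d. \<forall>i. k $ i \<in> ?B})" by (rule finite_subset[rotated])
    then show ?thesis by (rule finite_imageD) (auto simp: inj_on_def vec_nth_inject)
  qed
  show "{k::int^'d. norm (real_vec k) \<le> R} \<subseteq> {k. \<forall>i. k $ i \<in> ?B}"
  proof clarify
    fix k :: "int^'d" and i assume "norm (real_vec k) \<le> R"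
    then have "\<bar>real_of_int (k $ i)\<bar> \<le> R" using component_le_norm_cart[of "real_vec k" i] by simp
    then show "k $ i \<in> ?B" by simp linarith
  qed
qed

text \<open>The integrand is everywhere orthogonal to the component z of the coefficient outside V,
  hence so is the integral, and z = 0.\<close>

lemma mfc_in_csubspace:
  fixes f :: "real^'d \<Rightarrow> complex^'n^'n"
  assumes V: "csubspace V" and f: "f \<in> borel_measurable cube" "\<And>x. norm (f x) \<le> B" and fV: "\<And>x. f x \<in> V"
  shows "mfc f k \<in> V"
proof -
  have sub: "subspace V" using V by (simp add: csubspace_def)
  obtain y z where yz: "y \<in> span V" "\<And>w. w \<in> span V \<Longrightarrow> orthogonal z w" "mfc f k = y + z"
    using orthogonal_subspace_decomp_exists[of V "mfc f k"] by blast
  then have y: "y \<in> V" using sub by (simp add: span_eq_iff[THEN iffD2])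
  have "mscale (ek (- k) x) (f x) \<bullet> z = 0" for x
    using yz(2)[of "mscale (ek (- k) x) (f x)"] V fV by (auto simp: csubspace_def orthogonal_def inner_commute intro: span_base)
  then have "mfc f k \<bullet> z = 0"
    unfolding mfc_def by (subst integral_inner_left[symmetric]) (simp_all add: integrable_mfc[OF f])
  moreover have "y \<bullet> z = 0" using yz(2)[OF yz(1)] by (simp add: orthogonal_def inner_commute)
  ultimately have "z = 0" using yz(3) by (simp add: inner_add_left)
  then show ?thesis using yz(3) y by simp
qed

lemma wgt_le:
  assumes "0 < N" "N \<le> N'" shows "wgt N' S k \<le> wgt N S k"
  unfolding wgt_def using assms by (intro power_mono add_left_mono divide_left_mono) auto

lemma wb_wgt_mono:
  assumes "wb (wgt N S) r f" "0 < N" "N \<le> N'" shows "wb (wgt N' S) r f"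
proof -
  have "wb (wgt N' S) (1 * r) f"
    by (rule wb_weight[OF assms(1)]) (simp_all add: wgt_le[OF assms(2,3)])
  then show ?thesis by simp
qed

text \<open>The projection of the complexified Lie algebra onto its real part; the cohomological equation is
  solved in the complexification.\<close>

definition skp :: "complex^'n^'n \<Rightarrow> complex^'n^'n" where
  "skp v = (1/2) *\<^sub>R (v - conj_transpose v)"

lemma skp_add: "skp (u + v) = skp u + skp v" and skp_diff: "skp (u - v) = skp u - skp v"
  by (simp_all add: skp_def ct_add ct_diff algebra_simps)

lemma skp_id: "conj_transpose v = - v \<Longrightarrow> skp v = v"
  by (simp add: skp_def flip: scaleR_2)

lemma skp_Ad: "skp (E ** v ** conj_transpose E) = E ** skp v ** conj_transpose E"
  by (simp add: skp_def mat_simps ct_mult)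

lemma wb_skp: assumes "weight w" "wb w r f" shows "wb w r (\<lambda>x. skp (f x))"
  using wb_scaleR[OF assms(1) wb_diff[OF assms wb_ct[OF assms]], of "1/2"] by (simp add: skp_def)

locale small_divisor_group =
  fixes G :: "(complex^'n^'n) set" and E :: "complex^'n^'n" and \<alpha> :: "real^'d" and C :: real and \<tau> :: nat
  assumes G: "compact_group G" and E: "E \<in> G" and C: "C \<ge> 1"
    and div: "\<And>k Z. k \<noteq> 0 \<Longrightarrow> Z \<in> complexification (lie_algebra G) \<Longrightarrow> \<exists>W\<in>complexification (lie_algebra G).
       mscale (ek k \<alpha>) W - E ** W ** conj_transpose E = Z \<and>
       norm W \<le> C * (1 + norm (real_vec k)) ^ \<tau> * norm Z"
    and div0: "\<And>Z. Z \<in> complexification (lie_algebra G) \<Longrightarrow>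
       \<exists>W\<in>complexification (lie_algebra G). \<exists>D\<in>complexification (lie_algebra G).
       W - E ** W ** conj_transpose E = Z - D \<and>
       E ** D ** conj_transpose E = D \<and> norm W \<le> C * norm Z"
begin

lemma unitaryE: "unitary E"
  using G E by (rule compact_groupD)

text \<open>The equation is solved at frequencies up to N' only, where the divisors cost at most C
  (1 + N')^\<tau>. The rest is left as T and gains (2N/N')^S from comparing the weights of the two
  scales. The bound on Y is stated for any weight because it is used twice: at scale N' for the new
  error, and at scale 1 for the conjugacy.\<close>

lemma cohomological_equation:
  assumes X: "wb (wgt N S) r X" "\<And>x. X x \<in> lie_algebra G" and N: "0 < N" "N \<le> N'"
  obtains Y D T where "\<And>x. Y x \<in> lie_algebra G"
    "\<And>w b. weight w \<Longrightarrow> (\<And>k. norm (real_vec k) \<le> N' \<Longrightarrow> w k \<le> b) \<Longrightarrow> wb w (b * (C * (1 + N') ^ \<tau> * r)) Y"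
    "E ** D ** conj_transpose E = D"
    "\<And>x. X x + Y (x + \<alpha>) - E ** Y x ** conj_transpose E = D + T x"
    "wb (wgt N' S) ((2 * N / N') ^ S * r) T"
proof -
  let ?g = "complexification (lie_algebra G)"
  define K where "K = {k::int^'d. norm (real_vec k) \<le> N'}"
  have K: "finite K" unfolding K_def by (rule finite_lattice_ball)
  have N': "N' > 0" using N by simp
  have cs: "csubspace ?g" by (rule csubspace_complexification[OF subspace_lie_algebra[OF G]])
  have sub: "subspace ?g" using cs by (simp add: csubspace_def)
  have X_g: "X x \<in> ?g" for x
    using X(2)[of x] subspace_0[OF subspace_lie_algebra[OF G]] unfolding complexification_def by force
  have wN: "weight (wgt N S :: int^'d \<Rightarrow> real)" and wN': "weight (wgt N' S :: int^'d \<Rightarrow> real)" using N N' by (auto intro: weight_wgt)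
  have mX: "mfc X k \<in> ?g" for k
    by (rule mfc_in_csubspace[OF cs measurable_cube_continuous[OF wb_continuous[OF X(1)]] wb_norm[OF wN X(1)] X_g])
  \<comment> \<open>A resonant term may remain at k = 0 only, so D is constant. The minus sign
    before \<open>mfc X k\<close> makes Y cancel X.\<close>
  define P where "P k W D \<longleftrightarrow> W \<in> ?g \<and> mscale (ek k \<alpha>) W - E ** W ** conj_transpose E = D - mfc X k \<and> (k \<noteq> 0 \<longrightarrow> D = 0) \<and>
      E ** D ** conj_transpose E = D \<and> norm W \<le> C * (1 + norm (real_vec k)) ^ \<tau> * norm (mfc X k)" for k W D
  have "\<exists>W D. P k W D" for k
  proof (cases "k = 0")
    case True
    obtain W D where WD: "W \<in> ?g" "W - E ** W ** conj_transpose E = - mfc X 0 - D"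
      "E ** D ** conj_transpose E = D" "norm W \<le> C * norm (- mfc X 0)"
      using div0[OF subspace_neg[OF sub mX[of 0]]] by blast
    then show ?thesis using True by (intro exI[of _ W] exI[of _ "- D"]) (auto simp: P_def mat_simps)
  next
    case False
    obtain W where W: "W \<in> ?g" "mscale (ek k \<alpha>) W - E ** W ** conj_transpose E = - mfc X k"
      "norm W \<le> C * (1 + norm (real_vec k)) ^ \<tau> * norm (- mfc X k)"
      using div[OF False subspace_neg[OF sub mX[of k]]] by blast
    then show ?thesis using False by (intro exI[of _ W] exI[of _ 0]) (auto simp: P_def mat_simps)
  qed
  then obtain W D0 where WP: "\<And>k. P k (W k) (D0 k)" by metis
  then have W: "\<And>k. W k \<in> ?g"
    "\<And>k. mscale (ek k \<alpha>) (W k) - E ** W k ** conj_transpose E = D0 k - mfc X k"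
    "\<And>k. k \<noteq> 0 \<Longrightarrow> D0 k = 0" "\<And>k. E ** D0 k ** conj_transpose E = D0 k"
    "\<And>k. norm (W k) \<le> C * (1 + norm (real_vec k)) ^ \<tau> * norm (mfc X k)"
    by (simp_all add: P_def)
  define Y0 where "Y0 x = (\<Sum>k\<in>K. mscale (ek k x) (W k))" for x
  have 0: "0 \<in> K" using N' by (simp add: K_def)
  have eq0: "X x + Y0 (x + \<alpha>) - E ** Y0 x ** conj_transpose E = D0 0 + (X x - trunc K X x)" for x
  proof -
    have "Y0 (x + \<alpha>) - E ** Y0 x ** conj_transpose E =
        (\<Sum>k\<in>K. mscale (ek k x) (mscale (ek k \<alpha>) (W k) - E ** W k ** conj_transpose E))"
      unfolding Y0_def by (simp add: mm.sum_left mm.sum_right mat_simps ek_shift mscale_diff sum_subtractf)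
    also have "\<dots> = (\<Sum>k\<in>K. mscale (ek k x) (D0 k)) - trunc K X x"
      by (simp add: W(2) mscale_diff sum_subtractf trunc_def)
    also have "(\<Sum>k\<in>K. mscale (ek k x) (D0 k)) = (\<Sum>k\<in>{0}. mscale (ek k x) (D0 k))"
      using K 0 W(3) by (intro sum.mono_neutral_right) auto
    finally show ?thesis by simp
  qed
  have Y0g: "Y0 x \<in> ?g" for x
    unfolding Y0_def using cs W(1) by (intro subspace_sum[OF sub]) (auto simp: csubspace_def)
  show thesis
  proof (rule that[of "\<lambda>x. skp (Y0 x)" "skp (D0 0)" "\<lambda>x. skp (X x - trunc K X x)"])
    show "skp (Y0 x) \<in> lie_algebra G" for x
      unfolding skp_def by (rule skew_part_complexification[OF G Y0g])
    show "E ** skp (D0 0) ** conj_transpose E = skp (D0 0)"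
      using W(4)[of 0] skp_Ad[of E "D0 0"] by simp
    show "X x + skp (Y0 (x + \<alpha>)) - E ** skp (Y0 x) ** conj_transpose E = skp (D0 0) + skp (X x - trunc K X x)" for x
      using arg_cong[OF eq0[of x], of skp] skp_id[OF lie_algebra_skew[OF G X(2)[of x]]]
      by (simp add: skp_add skp_diff skp_Ad)
    have "wb (wgt N' S) ((2 * N / N') ^ S * r) (\<lambda>x. X x - trunc K X x)"
    proof (rule wb_trunc_diff[OF wN X(1) K])
      fix k assume "k \<notin> K"
      then have k: "norm (real_vec k) > N'" by (simp add: K_def)
      \<comment> \<open>For |k| > N' the left-hand side is at most 2 |k| / N', which is one of the
        two terms of the expanded right-hand side.\<close>
      have "1 + norm (real_vec k) / N' \<le> (2 * N / N') * (1 + norm (real_vec k) / N)"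
      proof -
        have "1 \<le> norm (real_vec k) / N'" "0 \<le> 2 * N / N'" using k N N' by auto
        moreover have "(2 * N / N') * (1 + norm (real_vec k) / N) = 2 * N / N' + 2 * (norm (real_vec k) / N')"
          using N by (simp add: distrib_left)
        ultimately show ?thesis by linarith
      qed
      then have "wgt N' S k \<le> ((2 * N / N') * (1 + norm (real_vec k) / N)) ^ S"
        unfolding wgt_def using N' by (intro power_mono) auto
      then show "wgt N' S k \<le> (2 * N / N') ^ S * wgt N S k" by (simp only: wgt_def power_mult_distrib)
    qed (use N N' in simp)
    then show "wb (wgt N' S) ((2 * N / N') ^ S * r) (\<lambda>x. skp (X x - trunc K X x))" by (rule wb_skp[OF wN'])
    fix w :: "int^'d \<Rightarrow> real" and b assume w: "weight w" and b: "\<And>k. norm (real_vec k) \<le> N' \<Longrightarrow> w k \<le> b"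
    obtain ps where ps: "\<And>x. tpoly ps x = Y0 x" "tnorm w ps = (\<Sum>k\<in>K. w k * norm (W k))"
      unfolding Y0_def using sum_eq_tpoly[OF K, of W] by metis
    have "b \<ge> 0" using b[of 0] weightD(3)[OF w, of 0] N' by simp
    have "tnorm w ps \<le> (\<Sum>k\<in>K. b * (C * (1 + N') ^ \<tau> * (wgt N S k * norm (mfc X k))))"
      unfolding ps(2)
    proof (rule sum_mono)
      fix k assume "k \<in> K"
      then have k: "norm (real_vec k) \<le> N'" by (simp add: K_def)
      have "norm (W k) \<le> C * (1 + norm (real_vec k)) ^ \<tau> * norm (mfc X k)" by (rule W)
      also have "\<dots> \<le> C * (1 + N') ^ \<tau> * norm (mfc X k)"
        using C k by (intro mult_right_mono mult_left_mono power_mono) auto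
      also have "\<dots> \<le> C * (1 + N') ^ \<tau> * (wgt N S k * norm (mfc X k))"
        using C N' weightD(2)[OF wN, of k] mult_right_mono[of 1 "wgt N S k" "norm (mfc X k)"]
        by (intro mult_left_mono) auto
      finally show "w k * norm (W k) \<le> b * (C * (1 + N') ^ \<tau> * (wgt N S k * norm (mfc X k)))"
        using b[OF k] weightD(3)[OF w, of k] \<open>b \<ge> 0\<close> by (intro mult_mono) auto
    qed
    also have "\<dots> = b * (C * (1 + N') ^ \<tau> * (\<Sum>k\<in>K. wgt N S k * norm (mfc X k)))"
      by (simp only: sum_distrib_left)
    also have "\<dots> \<le> b * (C * (1 + N') ^ \<tau> * r)"
      using wb_mfc_sum[OF wN X(1) K] \<open>b \<ge> 0\<close> C N' by (intro mult_left_mono) auto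
    finally have "wb w (b * (C * (1 + N') ^ \<tau> * r)) (tpoly ps)" by (rule wb_tpoly)
    moreover have "tpoly ps = Y0" using ps by auto
    ultimately show "wb w (b * (C * (1 + N') ^ \<tau> * r)) (\<lambda>x. skp (Y0 x))" using wb_skp[OF w] by simp
  qed
qed

text \<open>The resonant part \<open>D\<close> of the perturbation is of second order: an almost invariant \<open>U\<close> close to
  the identity in mean would otherwise have its component along \<open>D\<close> drift.\<close>

lemma drift_bound:
  fixes B K :: "real^'d \<Rightarrow> complex^'n^'n"
  assumes U: "\<And>\<epsilon>. \<epsilon> > 0 \<Longrightarrow> \<exists>U. continuous_on UNIV U \<and> periodic U \<and> (\<forall>x. unitary (U x)) \<and>
      (LINT x|cube. norm (U x - mat 1)) \<le> 1/4 \<and> (\<forall>x. norm (U (x + \<alpha>) ** B x - E ** U x) \<le> \<epsilon>)"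
    and K: "continuous_on UNIV K" "periodic K" "\<And>x. unitary (K x)" "\<And>x. norm (K x - mat 1) \<le> 1/4"
    and eq: "\<And>x. K (x + \<alpha>) ** B x ** conj_transpose (K x) ** conj_transpose E = mat 1 + D + R x"
    and D: "E ** D ** conj_transpose E = D" and R: "\<And>x. norm (R x) \<le> \<rho>"
  shows "norm D \<le> 2 * \<rho>"
proof (rule field_le_epsilon)
  fix e :: real assume "e > 0"
  define \<epsilon> where "\<epsilon> = e / 2"
  have "\<epsilon> > 0" using \<open>e > 0\<close> by (simp add: \<epsilon>_def)
  from U[OF this] obtain U where U: "continuous_on UNIV U" "periodic U" "\<And>x. unitary (U x)"
    "(LINT x|cube. norm (U x - mat 1)) \<le> 1/4" "\<And>x. norm (U (x + \<alpha>) ** B x - E ** U x) \<le> \<epsilon>" by blast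
  \<comment> \<open>Correcting \<open>U\<close> by the adjoint of K makes \<open>V\<close> almost
    intertwine the nearly constant cocycle (1 + D + R) E with E.\<close>
  define V where "V x = U x ** conj_transpose (K x)" for x
  have Vc: "continuous_on UNIV V"
    unfolding V_def by (intro mm.continuous_on U bounded_linear.continuous_on[OF bounded_linear_ct] K)
  have Vp: "periodic V" using U(2) K(2) by (simp add: V_def periodic_def)
  have Vu: "unitary (V x)" for x unfolding V_def by (intro unitary_mult U unitary_ct K)
  have Vn: "norm (V x) \<le> norm (mat 1 :: complex^'n^'n)" for x using norm_unitary_eq[OF Vu] by simp
  have V1: "norm (V x - mat 1) \<le> norm (U x - mat 1) + 1/4" for x
  proof -
    have "norm (V x - mat 1) = norm ((V x - mat 1) ** K x)" by (simp add: norm_unitary[OF K(3)])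
    also have "(V x - mat 1) ** K x = (U x - mat 1) - (K x - mat 1)"
      using unitaryD(1)[OF K(3)[of x]] by (simp add: V_def mm.diff_left flip: matrix_mul_assoc)
    also have "norm \<dots> \<le> norm (U x - mat 1) + norm (K x - mat 1)" by (rule norm_triangle_ineq4)
    finally show ?thesis using K(4)[of x] by simp
  qed
  have D': "conj_transpose E ** D ** E = D"
  proof -
    have "conj_transpose E ** (E ** D ** conj_transpose E) ** E = (conj_transpose E ** E) ** D ** (conj_transpose E ** E)"
      by (simp only: matrix_mul_assoc)
    then show ?thesis by (simp add: D unitaryD[OF unitaryE])
  qed
  \<comment> \<open>Pairing with D: the conjugate of V by E pairs with D as V does, because D
    commutes with E, and V D . D differs from |D|^2 by at most |V - 1| |D|^2. The base point is
    moved to x - \<alpha> so that |V - 1| is evaluated at x.\<close>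
  have pt: "norm D * norm D - norm D * norm D * norm (V x - mat 1) + V x \<bullet> D - V (x - \<alpha>) \<bullet> D \<le> (\<epsilon> + \<rho>) * norm D" for x
  proof -
    define y where "y = x - \<alpha>"
    have "V (y + \<alpha>) ** (mat 1 + D + R y) - E ** V y ** conj_transpose E =
        (U (y + \<alpha>) ** B y - E ** U y) ** conj_transpose (K y) ** conj_transpose E"
    proof -
      have "V (y + \<alpha>) ** (mat 1 + D + R y) =
          U (y + \<alpha>) ** (conj_transpose (K (y + \<alpha>)) ** K (y + \<alpha>)) ** B y ** conj_transpose (K y) ** conj_transpose E"
        unfolding eq[symmetric] V_def by (simp only: matrix_mul_assoc)
      then show ?thesis by (simp add: unitaryD[OF K(3)] V_def mat_simps)
    qed
    moreover have "norm ((U (y + \<alpha>) ** B y - E ** U y) ** conj_transpose (K y) ** conj_transpose E) \<le> \<epsilon>"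
      by (simp add: norm_unitary unitary_ct K(3) unitaryE U(5))
    ultimately have e1: "norm (V x ** (mat 1 + D + R y) - E ** V y ** conj_transpose E) \<le> \<epsilon>" by (simp add: y_def)
    have e2: "norm (V x ** R y) \<le> \<rho>" by (simp add: norm_unitary[OF Vu] R)
    have "norm ((V x - mat 1) ** D) \<le> norm (V x - mat 1) * norm D" by (rule norm_matrix_mult_le)
    then have e3: "\<bar>((V x - mat 1) ** D) \<bullet> D\<bar> \<le> norm (V x - mat 1) * norm D * norm D"
      using Cauchy_Schwarz_ineq2[of "(V x - mat 1) ** D" D] by (meson mult_right_mono norm_ge_zero order_trans)
    have e4: "(E ** V y ** conj_transpose E) \<bullet> D = V y \<bullet> D"
      unfolding inner_mult_right[of "E ** V y"] inner_mult_left[of E "V y"] by (simp add: D' matrix_mul_assoc)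
    have "(V x ** (mat 1 + D + R y) - E ** V y ** conj_transpose E) \<bullet> D \<le> \<epsilon> * norm D"
      using norm_cauchy_schwarz[of "V x ** (mat 1 + D + R y) - E ** V y ** conj_transpose E" D] e1
      by (meson mult_right_mono norm_ge_zero order_trans)
    moreover have "(V x ** (mat 1 + D + R y) - E ** V y ** conj_transpose E) \<bullet> D =
        V x \<bullet> D + D \<bullet> D + ((V x - mat 1) ** D) \<bullet> D + (V x ** R y) \<bullet> D - V y \<bullet> D"
      by (simp add: e4 mat_simps inner_add_left inner_diff_left)
    moreover have "\<bar>(V x ** R y) \<bullet> D\<bar> \<le> \<rho> * norm D"
      using Cauchy_Schwarz_ineq2[of "V x ** R y" D] e2 by (meson mult_right_mono norm_ge_zero order_trans)
    ultimately have "V x \<bullet> D + D \<bullet> D - norm (V x - mat 1) * norm D * norm D - \<rho> * norm D - V y \<bullet> D \<le> \<epsilon> * norm D"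
      using e3 by linarith
    then show ?thesis by (simp add: y_def dot_square_norm power2_eq_square algebra_simps)
  qed
  have Vm: "V \<in> borel_measurable cube" by (rule measurable_cube_continuous[OF Vc])
  have Vmc: "continuous_on UNIV (\<lambda>x. V (x - \<alpha>))"
    by (intro continuous_on_compose2[OF Vc] continuous_intros) auto
  have Vmm: "(\<lambda>x. V (x - \<alpha>)) \<in> borel_measurable cube" by (rule measurable_cube_continuous[OF Vmc])
  have iV: "integrable cube V" by (rule integrable_cube_bounded[OF Vm Vn])
  have iVm: "integrable cube (\<lambda>x. V (x - \<alpha>))" by (rule integrable_cube_bounded[OF Vmm Vn])
  have i1: "integrable cube (\<lambda>x. norm (V x - mat 1))"
    using iV by (intro integrable_norm Bochner_Integration.integrable_diff) auto
  have iU: "integrable cube (\<lambda>x. norm (U x - mat 1))"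
  proof -
    have "integrable cube U"
      by (rule integrable_cube_bounded[OF measurable_cube_continuous[OF U(1)], of "norm (mat 1 :: complex^'n^'n)"])
        (simp add: norm_unitary_eq[OF U(3)])
    then show ?thesis by (intro integrable_norm Bochner_Integration.integrable_diff) auto
  qed
  have half: "(LINT x|cube. norm (V x - mat 1)) \<le> 1/2"
  proof -
    have "(LINT x|cube. norm (V x - mat 1)) \<le> (LINT x|cube. norm (U x - mat 1) + 1/4)"
      by (rule integral_mono) (use i1 iU V1 in auto)
    also have "\<dots> = (LINT x|cube. norm (U x - mat 1)) + 1/4" using iU by simp
    finally show ?thesis using U(4) by simp
  qed
  \<comment> \<open>The mean is the coefficient at frequency 0, which shifts do not change. The two
    terms in \<open>V\<close> thus cancel after integration.\<close>
  have mean: "(LINT x|cube. V (x - \<alpha>) \<bullet> D) = (LINT x|cube. V x \<bullet> D)"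
  proof -
    have "mfc (\<lambda>x. V (x + (- \<alpha>))) 0 = mfc V 0" by (subst mfc_shift[OF Vc Vp]) simp
    then have "(LINT x|cube. V (x - \<alpha>)) = (LINT x|cube. V x)" by (simp add: mfc_def)
    then show ?thesis using iV iVm by simp
  qed
  have "(LINT x|cube. norm D * norm D - norm D * norm D * norm (V x - mat 1) + V x \<bullet> D - V (x - \<alpha>) \<bullet> D) \<le> (\<epsilon> + \<rho>) * norm D"
    by (rule integral_cube_le[OF _ pt]) (use iV iVm i1 in simp)
  also have "(LINT x|cube. norm D * norm D - norm D * norm D * norm (V x - mat 1) + V x \<bullet> D - V (x - \<alpha>) \<bullet> D) =
      norm D * norm D - norm D * norm D * (LINT x|cube. norm (V x - mat 1))"
  proof -
    have 1: "integrable cube (\<lambda>x. V x \<bullet> D)" "integrable cube (\<lambda>x. V (x - \<alpha>) \<bullet> D)"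
      "integrable cube (\<lambda>x. norm D * norm D - norm D * norm D * norm (V x - mat 1))"
      using iV iVm i1 by auto
    then have "(LINT x|cube. norm D * norm D - norm D * norm D * norm (V x - mat 1) + V x \<bullet> D - V (x - \<alpha>) \<bullet> D) =
      (LINT x|cube. norm D * norm D - norm D * norm D * norm (V x - mat 1))"
      by (simp add: mean)
    also have "\<dots> = norm D * norm D - norm D * norm D * (LINT x|cube. norm (V x - mat 1))"
      using i1 by (subst Bochner_Integration.integral_diff) auto
    finally show ?thesis .
  qed
  finally have "norm D * norm D * (1 - (LINT x|cube. norm (V x - mat 1))) \<le> (\<epsilon> + \<rho>) * norm D" by (simp add: algebra_simps)
  moreover have "norm D * norm D * (1/2) \<le> norm D * norm D * (1 - (LINT x|cube. norm (V x - mat 1)))"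
    using half by (intro mult_left_mono) auto
  ultimately have "norm D * norm D * (1/2) \<le> (\<epsilon> + \<rho>) * norm D" by linarith
  then have "norm D * (norm D * (1/2)) \<le> norm D * (\<epsilon> + \<rho>)" by (simp add: mult_ac)
  moreover have "0 \<le> \<rho>" using R[of 0] norm_ge_zero order_trans by blast
  ultimately have "norm D * (1/2) \<le> \<epsilon> + \<rho>" using \<open>\<epsilon> > 0\<close> by (cases "D = 0") auto
  then show "norm D \<le> 2 * \<rho> + e" by (simp add: \<epsilon>_def)
qed

end

subsection \<open>Convergence of the iteration\<close>

lemma power_divide_le:
  fixes b :: real assumes "1 \<le> b" "p < q" shows "b ^ p / b ^ q \<le> 1 / b"
proof -
  have "b ^ Suc p \<le> b ^ q" using assms by (intro power_increasing) auto
  then show ?thesis using assms by (simp add: field_simps)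
qed

text \<open>The scale \<open>N = b\<^sup>2\<close> passes to \<open>N\<^bsup>3/2\<^esup>\<close>, and the error \<open>\<delta> = N\<^bsup>-M\<^esup>\<close> to \<open>\<delta>\<^bsup>3/2\<^esup>\<close>.\<close>

lemma iteration_parameters:
  fixes C b :: real and m \<tau> n :: nat
  defines "M \<equiv> 2 * m + 8 * \<tau> + 8"
  defines "S \<equiv> 2 * M"
  defines "A \<equiv> 2 ^ (S + \<tau> + 1) * C"
  defines "\<delta> \<equiv> 1 / b ^ (2 * M)"
  assumes C: "C \<ge> 1" and b: "16 \<le> b" "8 * A \<le> b" "3 * (2 ^ (S + 1) + 15 * A\<^sup>2) \<le> b"
    "32 * (2 ^ (m + \<tau> + 1) * C) * 2 ^ n \<le> b"
  shows "\<delta> \<le> 1 / b" "2 ^ S * (C * (1 + b ^ 3) ^ \<tau> * (2 * \<delta>)) \<le> 1/8"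
    "(1 + b ^ 3) ^ m * (C * (1 + b ^ 3) ^ \<tau> * (2 * \<delta>)) \<le> (1/32) * (1/2) ^ n"
    "3 * ((2 * b\<^sup>2 / b ^ 3) ^ S * (2 * \<delta>) + 15 * (2 ^ S * (C * (1 + b ^ 3) ^ \<tau> * (2 * \<delta>)))\<^sup>2) \<le> 1 / (b ^ 3) ^ M"
proof -
  have b1: "1 \<le> b" "0 < b" using b by auto
  have \<delta>0: "\<delta> \<ge> 0" using b1 by (simp add: \<delta>_def)
  \<comment> \<open>The choice of M leaves a surplus power of b in each comparison, and that power
    absorbs all constants. The exponents on the left come from frequencies up to b^3, those on the
    right from \<delta> = b^(-2M).\<close>
  have M: "0 < 2 * M" "3 * (m + \<tau>) < 2 * M" "3 * \<tau> < 2 * M" "6 * \<tau> < M" "0 < M" by (simp_all add: M_def)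
  have p1: "1 + b ^ 3 \<le> 2 * b ^ 3" using b1 by (simp add: one_le_power)
  have pow: "(1 + b ^ 3) ^ j \<le> 2 ^ j * b ^ (3 * j)" for j
  proof -
    have "(1 + b ^ 3) ^ j \<le> (2 * b ^ 3) ^ j" using p1 b1 by (intro power_mono) auto
    then show ?thesis by (simp add: power_mult_distrib power_mult)
  qed
  show "\<delta> \<le> 1 / b" using power_divide_le[OF b1(1) M(1)] by (simp add: \<delta>_def)
  have \<eta>: "2 ^ S * (C * (1 + b ^ 3) ^ \<tau> * (2 * \<delta>)) \<le> A * (b ^ (3 * \<tau>) / b ^ (2 * M))"
  proof -
    have "2 ^ S * (C * (1 + b ^ 3) ^ \<tau> * (2 * \<delta>)) \<le> 2 ^ S * (C * (2 ^ \<tau> * b ^ (3 * \<tau>)) * (2 * \<delta>))"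
      using C \<delta>0 pow[of \<tau>] by (intro mult_left_mono mult_right_mono) auto
    also have "\<dots> = A * (b ^ (3 * \<tau>) / b ^ (2 * M))" by (simp add: A_def \<delta>_def power_add)
    finally show ?thesis .
  qed
  have A0: "A \<ge> 0" using C by (simp add: A_def)
  have "A * (b ^ (3 * \<tau>) / b ^ (2 * M)) \<le> A * (1 / b)"
    using A0 by (intro mult_left_mono power_divide_le b1 M)
  also have "\<dots> \<le> 1/8" using b(2) b1 by (simp add: field_simps)
  finally show "2 ^ S * (C * (1 + b ^ 3) ^ \<tau> * (2 * \<delta>)) \<le> 1/8" using \<eta> by linarith
  have "(1 + b ^ 3) ^ m * (C * (1 + b ^ 3) ^ \<tau> * (2 * \<delta>)) = C * (1 + b ^ 3) ^ (m + \<tau>) * (2 * \<delta>)"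
    by (simp add: power_add)
  also have "\<dots> \<le> C * (2 ^ (m + \<tau>) * b ^ (3 * (m + \<tau>))) * (2 * \<delta>)"
    using C \<delta>0 pow[of "m + \<tau>"] by (intro mult_left_mono mult_right_mono) auto
  also have "\<dots> = (2 ^ (m + \<tau> + 1) * C) * (b ^ (3 * (m + \<tau>)) / b ^ (2 * M))"
    by (simp add: \<delta>_def)
  also have "\<dots> \<le> (2 ^ (m + \<tau> + 1) * C) * (1 / b)"
    using C by (intro mult_left_mono power_divide_le b1 M) auto
  also have "\<dots> \<le> (1/32) * (1/2) ^ n"
    using b(4) b1 by (simp add: field_simps)
  finally show "(1 + b ^ 3) ^ m * (C * (1 + b ^ 3) ^ \<tau> * (2 * \<delta>)) \<le> (1/32) * (1/2) ^ n" .
  \<comment> \<open>As S = 2M, truncation gains b^(-2M), up to a constant; together with \<delta>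
    this is b^(-4M), below the target b^(-3M).\<close>
  have t1: "(2 * b\<^sup>2 / b ^ 3) ^ S * (2 * \<delta>) \<le> 2 ^ (S + 1) / b * (1 / (b ^ 3) ^ M)"
  proof -
    have "2 * b\<^sup>2 / b ^ 3 = 2 / b" using b1 by (simp add: power2_eq_square power3_eq_cube)
    then have "(2 * b\<^sup>2 / b ^ 3) ^ S * (2 * \<delta>) = 2 ^ (S + 1) * (1 / b ^ M) * (1 / (b ^ 3) ^ M)"
      unfolding \<delta>_def S_def
      by (simp add: power_divide power_mult[symmetric] power_add[symmetric])
    also have "\<dots> \<le> 2 ^ (S + 1) * (1 / b) * (1 / (b ^ 3) ^ M)"
      using power_divide_le[OF b1(1) M(5)] b1 by (intro mult_left_mono mult_right_mono) auto
    finally show ?thesis by simp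
  qed
  \<comment> \<open>The quadratic error is of order b^(6\<tau> - 4M), and 6\<tau> < M leaves room
    below the target.\<close>
  have t2: "(2 ^ S * (C * (1 + b ^ 3) ^ \<tau> * (2 * \<delta>)))\<^sup>2 \<le> A\<^sup>2 / b * (1 / (b ^ 3) ^ M)"
  proof -
    have "(2 ^ S * (C * (1 + b ^ 3) ^ \<tau> * (2 * \<delta>)))\<^sup>2 \<le> (A * (b ^ (3 * \<tau>) / b ^ (2 * M)))\<^sup>2"
      using \<eta> C \<delta>0 b1 by (intro power_mono mult_nonneg_nonneg) auto
    also have "\<dots> = A\<^sup>2 * (b ^ (6 * \<tau>) / b ^ M) * (1 / (b ^ 3) ^ M)"
      by (simp add: power_mult_distrib power_divide power_mult[symmetric] power_add[symmetric] mult.commute)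
    also have "\<dots> \<le> A\<^sup>2 * (1 / b) * (1 / (b ^ 3) ^ M)"
      using b1 by (intro mult_right_mono mult_left_mono power_divide_le M) auto
    finally show ?thesis by simp
  qed
  have "3 * ((2 * b\<^sup>2 / b ^ 3) ^ S * (2 * \<delta>) + 15 * (2 ^ S * (C * (1 + b ^ 3) ^ \<tau> * (2 * \<delta>)))\<^sup>2) \<le>
      3 * (2 ^ (S + 1) / b * (1 / (b ^ 3) ^ M) + 15 * (A\<^sup>2 / b * (1 / (b ^ 3) ^ M)))"
    by (intro mult_left_mono add_mono t1 t2) auto
  also have "\<dots> = (3 * (2 ^ (S + 1) + 15 * A\<^sup>2) / b) * (1 / (b ^ 3) ^ M)"
    by (simp add: add_divide_distrib distrib_left distrib_right)
  also have "\<dots> \<le> 1 * (1 / (b ^ 3) ^ M)"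
    using b(3) b1 by (intro mult_right_mono) (auto simp: field_simps)
  finally show "3 * ((2 * b\<^sup>2 / b ^ 3) ^ S * (2 * \<delta>) + 15 * (2 ^ S * (C * (1 + b ^ 3) ^ \<tau> * (2 * \<delta>)))\<^sup>2) \<le> 1 / (b ^ 3) ^ M"
    by simp
qed

context small_divisor_group
begin

text \<open>In the expanded product the linear terms combine to D + T by the cohomological equation;
  all others are of second order. The constant 15 is 6 for the three exponential remainders, 8 for
  the products of two factors and 1 for the product of three, which uses \<eta> at most 1/8.\<close>

lemma step_remainder:
  assumes w: "weight w" and Y: "wb w \<eta> Y" and F: "wb w \<delta> F" and X: "wb w (2 * \<delta>) X" and T: "wb w t T"
    and le: "2 * \<delta> \<le> \<eta>" "\<eta> \<le> 1/8" and XF: "\<And>x. mexp (X x) = mat 1 + F x"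
    and eq: "\<And>x. X x + Y (x + \<alpha>) - E ** Y x ** conj_transpose E = D + T x"
  shows "wb w (t + 15 * \<eta> * \<eta>)
    (\<lambda>x. mexp (Y (x + \<alpha>)) ** (mat 1 + F x) ** mexp (- (E ** Y x ** conj_transpose E)) - (mat 1 + D))"
proof -
  define a where "a x = Y (x + \<alpha>)" for x
  define z where "z x = - (E ** Y x ** conj_transpose E)" for x
  have \<eta>0: "\<eta> \<ge> 0" by (rule wb_nonneg[OF w Y])
  have \<delta>0: "\<delta> \<ge> 0" by (rule wb_nonneg[OF w F])
  have \<eta>sq: "\<eta> * \<eta> \<le> \<eta> / 8" using mult_left_mono[OF le(2) \<eta>0] by simp
  have a: "wb w \<eta> a" unfolding a_def by (rule wb_shift[OF w Y])
  have z: "wb w \<eta> z" unfolding z_def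
    by (intro wb_minus wb_unitary_sandwich w Y unitaryE unitary_ct)
  have qa: "wb w (2 * \<eta> * \<eta>) (\<lambda>x. mexp2 (a x))" and qz: "wb w (2 * \<eta> * \<eta>) (\<lambda>x. mexp2 (z x))"
    using a z le by (auto intro: wb_mexp2[OF w])
  have "wb w (2 * (2 * \<delta>) * (2 * \<delta>)) (\<lambda>x. mexp2 (X x))" using le by (intro wb_mexp2 w X) simp
  moreover have "(2 * \<delta>) * (2 * \<delta>) \<le> \<eta> * \<eta>" using le \<delta>0 \<eta>0 by (intro mult_mono) auto
  ultimately have qX: "wb w (2 * \<eta> * \<eta>) (\<lambda>x. mexp2 (X x))" by (elim wb_mono) simp
  define u where "u x = a x + mexp2 (a x)" for x
  define v where "v x = z x + mexp2 (z x)" for x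
  have u: "wb w (2 * \<eta>) u" unfolding u_def by (rule wb_mono[OF wb_add[OF a qa]]) (use \<eta>sq \<eta>0 in linarith)
  have v: "wb w (2 * \<eta>) v" unfolding v_def by (rule wb_mono[OF wb_add[OF z qz]]) (use \<eta>sq \<eta>0 in linarith)
  have F': "wb w \<eta> F" by (rule wb_mono[OF F]) (use le \<delta>0 in linarith)
  have "wb w (t + (2 * \<eta> * \<eta> + 2 * \<eta> * \<eta> + 2 * \<eta> * \<eta>) + ((2 * \<eta>) * \<eta> + (2 * \<eta>) * (2 * \<eta>) + \<eta> * (2 * \<eta>) + (2 * \<eta>) * \<eta> * (2 * \<eta>)))
    (\<lambda>x. T x + (mexp2 (a x) + mexp2 (X x) + mexp2 (z x)) + (u x ** F x + u x ** v x + F x ** v x + u x ** F x ** v x))"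
    by (intro wb_add wb_mult w T qa qX qz u v F')
  moreover have "t + (2 * \<eta> * \<eta> + 2 * \<eta> * \<eta> + 2 * \<eta> * \<eta>) + ((2 * \<eta>) * \<eta> + (2 * \<eta>) * (2 * \<eta>) + \<eta> * (2 * \<eta>) + (2 * \<eta>) * \<eta> * (2 * \<eta>))
      \<le> t + 15 * \<eta> * \<eta>"
  proof -
    have "\<eta> * (\<eta> * \<eta>) \<le> (1/8) * (\<eta> * \<eta>)" using le \<eta>0 by (intro mult_right_mono) auto
    moreover have "(2 * \<eta>) * \<eta> * (2 * \<eta>) = 4 * (\<eta> * (\<eta> * \<eta>))" by simp
    moreover have "0 \<le> \<eta> * \<eta>" by simp
    ultimately have "(2 * \<eta>) * \<eta> * (2 * \<eta>) \<le> \<eta> * \<eta>" by linarith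
    then show ?thesis by (simp only: mult.assoc mult.left_commute[of \<eta> 2])
  qed
  moreover have "T x + (mexp2 (a x) + mexp2 (X x) + mexp2 (z x)) + (u x ** F x + u x ** v x + F x ** v x + u x ** F x ** v x) =
      mexp (Y (x + \<alpha>)) ** (mat 1 + F x) ** mexp (- (E ** Y x ** conj_transpose E)) - (mat 1 + D)" for x
  proof -
    have 1: "mexp (Y (x + \<alpha>)) = mat 1 + u x" "mexp (- (E ** Y x ** conj_transpose E)) = mat 1 + v x"
      by (simp_all add: u_def v_def a_def z_def mexp_eq)
    have 2: "F x = X x + mexp2 (X x)" using XF[of x] by (simp add: mexp_eq add.assoc)
    have 3: "X x + a x + z x = D + T x" using eq[of x] by (simp add: a_def z_def)
    have "(mat 1 + u x) ** (mat 1 + F x) ** (mat 1 + v x) - (mat 1 + D) =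
        (u x + F x + v x - D) + (u x ** F x + u x ** v x + F x ** v x + u x ** F x ** v x)"
      by (simp add: mat_simps algebra_simps)
    also have "u x + F x + v x - D = (X x + a x + z x - D) + (mexp2 (a x) + mexp2 (X x) + mexp2 (z x))"
      unfolding u_def v_def 2 by (simp add: algebra_simps)
    also have "X x + a x + z x - D = T x" unfolding 3 by simp
    finally show ?thesis unfolding 1 by simp
  qed
  ultimately show ?thesis using wb_mono by (simp only:)
qed

text \<open>What the iteration retains of the Sobolev limit. Closeness to the identity is a fixed
  bound in mean, while the intertwining error is arbitrarily small. The property is used for the
  initial cocycle and never updated.\<close>

definition almost_invariant :: "(real^'d \<Rightarrow> complex^'n^'n) \<Rightarrow> bool" where
  "almost_invariant B \<longleftrightarrow> (\<forall>\<epsilon>>0. \<exists>U. continuous_on UNIV U \<and> periodic U \<and> (\<forall>x. unitary (U x)) \<and>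
      (LINT x|cube. norm (U x - mat 1)) \<le> 1/4 \<and> (\<forall>x. norm (U (x + \<alpha>) ** B x - E ** U x) \<le> \<epsilon>))"

text \<open>The deviation of the conjugated cocycle from E, multiplied by the adjoint of E so that
  the comparison is with the identity and logarithms apply.\<close>

definition defect :: "(real^'d \<Rightarrow> complex^'n^'n) \<Rightarrow> (real^'d \<Rightarrow> complex^'n^'n) \<Rightarrow> real^'d \<Rightarrow> complex^'n^'n" where
  "defect B K x = K (x + \<alpha>) ** B x ** conj_transpose (K x) ** conj_transpose E - mat 1"

text \<open>One Newton step. The total conjugacy K is updated while B is kept, because the bound on
  the drift rests on the almost invariance of the original B and on K being uniformly close to the
  identity; q records this closeness. The norm at scale 1 measures the regularity of the
  limit.\<close>

lemma iteration_step:
  assumes B: "\<And>x. B x \<in> G" "almost_invariant B"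
    and log: "\<And>g. g \<in> G \<Longrightarrow> norm (g - mat 1) \<le> r \<Longrightarrow> \<exists>X\<in>lie_algebra G. mexp X = g \<and> norm X \<le> 2 * norm (g - mat 1)"
    and K: "\<And>x. K x \<in> G" "\<And>x. norm (K x - mat 1) \<le> q" "wb (wgt 1 m) k K"
    and F: "wb (wgt N S) \<delta> (defect B K)"
    and N: "1 \<le> N" "N \<le> N'" and \<delta>: "\<delta> \<le> r" "\<delta> \<le> 1/16"
    and \<eta>: "2 ^ S * (C * (1 + N') ^ \<tau> * (2 * \<delta>)) \<le> 1/8"
    and \<zeta>: "(1 + N') ^ m * (C * (1 + N') ^ \<tau> * (2 * \<delta>)) \<le> \<zeta>" "\<zeta> \<le> 1/8" "2 * \<zeta> + q \<le> 1/4"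
    and \<delta>': "3 * ((2 * N / N') ^ S * (2 * \<delta>) + 15 * (2 ^ S * (C * (1 + N') ^ \<tau> * (2 * \<delta>)))\<^sup>2) \<le> \<delta>'"
  obtains K' where "\<And>x. K' x \<in> G" "\<And>x. norm (K' x - K x) \<le> 2 * \<zeta>"
    "wb (wgt 1 m) (2 * \<zeta> * k) (\<lambda>x. K' x - K x)" "wb (wgt N' S) \<delta>' (defect B K')"
proof -
  let ?F = "defect B K"
  define \<eta>0 where "\<eta>0 = C * (1 + N') ^ \<tau> * (2 * \<delta>)"
  have pos: "0 < N" "0 < N'" "1 \<le> N'" using N by auto
  have w: "weight (wgt N S :: int^'d \<Rightarrow> real)" and w': "weight (wgt N' S :: int^'d \<Rightarrow> real)"
    and w1: "weight (wgt 1 m :: int^'d \<Rightarrow> real)" using pos by (auto intro: weight_wgt)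
  have \<delta>0: "\<delta> \<ge> 0" by (rule wb_nonneg[OF w F])
  have pow1: "1 \<le> (1 + N') ^ \<tau>" "1 \<le> (1 + N') ^ m" using pos by (auto intro: one_le_power)
  have "1 * 1 \<le> C * (1 + N') ^ \<tau>" using C pow1 by (intro mult_mono) auto
  then have \<eta>0: "2 * \<delta> \<le> \<eta>0" using mult_right_mono[of 1 "C * (1 + N') ^ \<tau>" "2 * \<delta>"] \<delta>0 by (simp add: \<eta>0_def)
  have \<eta>0_nonneg: "\<eta>0 \<ge> 0" using \<eta>0 \<delta>0 by linarith
  have Fn: "norm (?F x) \<le> \<delta>" for x by (rule wb_norm[OF w F])
  have Ku: "unitary (K x)" for x by (rule compact_groupD(1)[OF G K(1)])
  have F1: "mat 1 + ?F x = K (x + \<alpha>) ** B x ** conj_transpose (K x) ** conj_transpose E" for x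
    by (simp add: defect_def)
  then have FG: "mat 1 + ?F x \<in> G" for x
    using compact_groupD(3,4)[OF G] K(1) B(1) E by simp
  obtain X where X: "wb (wgt N S) (2 * \<delta>) X" "\<And>x. mexp (X x) = mat 1 + ?F x"
    using wb_log[OF w F] \<delta> by auto
  \<comment> \<open>The logarithm in function space must be the one in the Lie algebra, by
    injectivity of the exponential on small matrices. This keeps the corrections in the
    group.\<close>
  have Xg: "X x \<in> lie_algebra G" for x
  proof -
    obtain X' where X': "X' \<in> lie_algebra G" "mexp X' = mat 1 + ?F x" "norm X' \<le> 2 * norm (?F x)"
      using log[OF FG[of x]] Fn[of x] \<delta> by auto
    have "X x = X'"
    proof (rule mexp_inj_small)
      show "norm (X x) \<le> 1/4" using wb_norm[OF w X(1), of x] \<delta> by linarith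
      show "norm X' \<le> 1/4" using X'(3) Fn[of x] \<delta> by linarith
    qed (simp add: X X')
    then show ?thesis using X' by simp
  qed
  obtain Y D T where Yg: "\<And>x. Y x \<in> lie_algebra G"
    and Yw: "\<And>w b. weight w \<Longrightarrow> (\<And>k. norm (real_vec k) \<le> N' \<Longrightarrow> w k \<le> b) \<Longrightarrow> wb w (b * (C * (1 + N') ^ \<tau> * (2 * \<delta>))) Y"
    and D: "E ** D ** conj_transpose E = D"
    and eq: "\<And>x. X x + Y (x + \<alpha>) - E ** Y x ** conj_transpose E = D + T x"
    and T: "wb (wgt N' S) ((2 * N / N') ^ S * (2 * \<delta>)) T"
    using cohomological_equation[OF X(1) Xg pos(1) N(2)] by blast
  define \<eta> where "\<eta> = 2 ^ S * \<eta>0"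
  have Y\<eta>: "wb (wgt N' S) \<eta> Y"
    unfolding \<eta>_def \<eta>0_def
  proof (rule Yw[OF w'])
    fix k :: "int^'d" assume "norm (real_vec k) \<le> N'"
    then have "1 + norm (real_vec k) / N' \<le> 2" using pos by simp
    then show "wgt N' S k \<le> 2 ^ S" unfolding wgt_def using pos by (intro power_mono) auto
  qed
  have "1 * \<eta>0 \<le> \<eta>" unfolding \<eta>_def using \<eta>0_nonneg by (intro mult_right_mono) auto
  then have \<eta>le1: "2 * \<delta> \<le> \<eta>" using \<eta>0 by linarith
  have \<eta>le2: "\<eta> \<le> 1/8" unfolding \<eta>_def \<eta>0_def by (rule \<eta>)
  note \<eta>le = \<eta>le1 \<eta>le2
  define \<zeta>0 where "\<zeta>0 = (1 + N') ^ m * \<eta>0"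
  have Y\<zeta>: "wb (wgt 1 m) \<zeta>0 Y"
    unfolding \<zeta>0_def \<eta>0_def
    by (rule Yw[OF w1]) (use pos in \<open>auto simp: wgt_def intro!: power_mono\<close>)
  have \<zeta>0: "\<zeta>0 \<le> \<zeta>" using \<zeta> by (simp add: \<zeta>0_def \<eta>0_def)
  have Y\<zeta>': "wb (wgt 1 m) \<zeta> Y" by (rule wb_mono[OF Y\<zeta> \<zeta>0])
  have \<zeta>nn: "\<zeta> \<ge> 0" by (rule wb_nonneg[OF w1 Y\<zeta>'])
  have \<zeta>sq: "2 * \<zeta> * \<zeta> \<le> \<zeta>" using mult_left_mono[OF \<zeta>(2) \<zeta>nn] \<zeta>nn by simp
  have eY: "wb (wgt 1 m) (2 * \<zeta>) (\<lambda>x. mexp (Y x) - mat 1)"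
  proof -
    have "wb (wgt 1 m) (\<zeta> + 2 * \<zeta> * \<zeta>) (\<lambda>x. Y x + mexp2 (Y x))"
      using \<zeta> by (intro wb_add wb_mexp2 w1 Y\<zeta>') simp
    moreover have "Y x + mexp2 (Y x) = mexp (Y x) - mat 1" for x by (simp add: mexp_eq)
    ultimately have "wb (wgt 1 m) (\<zeta> + 2 * \<zeta> * \<zeta>) (\<lambda>x. mexp (Y x) - mat 1)" by simp
    then show ?thesis by (rule wb_mono) (use \<zeta>sq in linarith)
  qed
  define K' where "K' x = mexp (Y x) ** K x" for x
  have eYG: "mexp (Y x) \<in> G" for x by (rule mexp_in_group[OF Yg])
  have K'G: "K' x \<in> G" for x unfolding K'_def by (intro compact_groupD(3)[OF G] eYG K)
  have K'u: "unitary (K' x)" for x by (rule compact_groupD(1)[OF G K'G])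
  have diff: "K' x - K x = (mexp (Y x) - mat 1) ** K x" for x by (simp add: K'_def mat_simps)
  have d\<zeta>: "norm (K' x - K x) \<le> 2 * \<zeta>" for x
    unfolding diff norm_unitary(2)[OF Ku] by (rule wb_norm[OF w1 eY])
  have dw: "wb (wgt 1 m) (2 * \<zeta> * k) (\<lambda>x. K' x - K x)"
    unfolding diff by (intro wb_mult w1 eY K(3))
  have F': "defect B K' x = mexp (Y (x + \<alpha>)) ** (mat 1 + ?F x) ** mexp (- (E ** Y x ** conj_transpose E)) - mat 1" for x
  proof -
    have "(- (E ** Y x ** conj_transpose E)) ** E = - (E ** Y x ** (conj_transpose E ** E))"
      by (simp only: mat_simps)
    also have "\<dots> = E ** (- Y x)" by (simp add: unitaryD[OF unitaryE] mat_simps)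
    finally have "mexp (- (E ** Y x ** conj_transpose E)) ** E = E ** mexp (- Y x)" by (rule mexp_intertwine)
    then have "mexp (- (E ** Y x ** conj_transpose E)) ** (E ** conj_transpose E) = E ** mexp (- Y x) ** conj_transpose E"
      by (simp only: matrix_mul_assoc)
    then have 1: "mexp (- (E ** Y x ** conj_transpose E)) = E ** mexp (- Y x) ** conj_transpose E"
      by (simp add: unitaryD[OF unitaryE])
    have "mexp (Y (x + \<alpha>)) ** (mat 1 + ?F x) ** mexp (- (E ** Y x ** conj_transpose E)) =
        mexp (Y (x + \<alpha>)) ** K (x + \<alpha>) ** B x ** conj_transpose (K x) ** (conj_transpose E ** E) ** mexp (- Y x) ** conj_transpose E"
      unfolding F1 1 by (simp only: matrix_mul_assoc)
    also have "\<dots> = K' (x + \<alpha>) ** B x ** conj_transpose (K' x) ** conj_transpose E"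
      by (simp add: unitaryD[OF unitaryE] K'_def ct_mult ct_mexp[OF G Yg] matrix_mul_assoc)
    finally show ?thesis by (simp add: defect_def)
  qed
  define R where "R x = defect B K' x - D" for x
  define \<rho> where "\<rho> = (2 * N / N') ^ S * (2 * \<delta>) + 15 * \<eta> * \<eta>"
  have R: "wb (wgt N' S) \<rho> R"
  proof -
    have "wb (wgt N' S) \<rho> (\<lambda>x. mexp (Y (x + \<alpha>)) ** (mat 1 + ?F x) ** mexp (- (E ** Y x ** conj_transpose E)) - (mat 1 + D))"
      unfolding \<rho>_def
      by (rule step_remainder[OF w' Y\<eta> wb_wgt_mono[OF F pos(1) N(2)] wb_wgt_mono[OF X(1) pos(1) N(2)] T \<eta>le X(2) eq])
    then show ?thesis by (simp add: R_def[abs_def] F' diff_diff_eq)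
  qed
  have K'c: "continuous_on UNIV K'" "periodic K'"
  proof -
    have "wb (wgt 1 m) (2 * \<zeta> * k + k) (\<lambda>x. (K' x - K x) + K x)" by (intro wb_add dw K(3))
    then have "wb (wgt 1 m) (2 * \<zeta> * k + k) K'" by simp
    then show "continuous_on UNIV K'" "periodic K'" by (rule wb_continuous, rule wb_periodic)
  qed
  \<comment> \<open>The drift is at most twice the remainder, so the new defect is at most three
    times it: the factor 3 in the bound for \<delta>'.\<close>
  have "norm D \<le> 2 * \<rho>"
  proof (rule drift_bound[of B K' D R])
    show "norm (K' x - mat 1) \<le> 1/4" for x
      using d\<zeta>[of x] K(2)[of x] \<zeta>(3) norm_triangle_ineq[of "K' x - K x" "K x - mat 1"] by simp
    show "K' (x + \<alpha>) ** B x ** conj_transpose (K' x) ** conj_transpose E = mat 1 + D + R x" for x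
      by (simp add: R_def defect_def)
    show "norm (R x) \<le> \<rho>" for x by (rule wb_norm[OF w' R])
  qed (use B(2) K'c K'u D in \<open>auto simp: almost_invariant_def\<close>)
  then have "wb (wgt N' S) (2 * \<rho> + \<rho>) (\<lambda>x. D + R x)" by (intro wb_add wb_const w' R)
  then have "wb (wgt N' S) (2 * \<rho> + \<rho>) (defect B K')" by (simp add: R_def)
  moreover have "2 * \<rho> + \<rho> \<le> \<delta>'" using \<delta>' by (simp add: \<rho>_def \<eta>_def \<eta>0_def power2_eq_square mult_ac)
  ultimately have "wb (wgt N' S) \<delta>' (defect B K')" by (rule wb_mono)
  with K'G d\<zeta> dw show thesis by (rule that)
qed


text \<open>The order S and the threshold \<theta> depend on the requested regularity m but not on
  B. In the limit the defect vanishes, and the limit takes values in G because G is closed.\<close>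

theorem reducibility:
  "\<exists>S. \<exists>\<theta>>0. \<forall>B. range B \<subseteq> G \<longrightarrow> almost_invariant B \<longrightarrow> wb (wgt 1 S) \<theta> (\<lambda>x. B x ** conj_transpose E - mat 1) \<longrightarrow>
     (\<exists>L r. (\<forall>x. L x \<in> G) \<and> wb (wgt 1 m) r L \<and> (\<forall>x. L (x + \<alpha>) ** B x = E ** L x))"
proof -
  obtain r0 where r0: "r0 > 0"
    "\<And>g. g \<in> G \<Longrightarrow> norm (g - mat 1) \<le> r0 \<Longrightarrow> \<exists>X\<in>lie_algebra G. mexp X = g \<and> norm X \<le> 2 * norm (g - mat 1)"
    using group_log[OF G] by blast
  define M where "M = 2 * m + 8 * \<tau> + 8"
  define S where "S = 2 * M"
  define A where "A = 2 ^ (S + \<tau> + 1) * C"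
  \<comment> \<open>A sum of nonnegative terms, one for each requirement on the starting scale; 1/r0
    makes the first defect small enough for the logarithm in G.\<close>
  define b0 where "b0 = 16 + 8 * A + 3 * (2 ^ (S + 1) + 15 * A\<^sup>2) + 32 * (2 ^ (m + \<tau> + 1) * C) + 1 / r0"
  have A0: "A \<ge> 0" using C by (simp add: A_def)
  have b0: "16 \<le> b0" "8 * A \<le> b0" "3 * (2 ^ (S + 1) + 15 * A\<^sup>2) \<le> b0" "32 * (2 ^ (m + \<tau> + 1) * C) \<le> b0" "1 / r0 \<le> b0"
    using A0 C r0(1) by (simp_all add: b0_def)
  \<comment> \<open>The next b is the power 3/2 of b. Thus b^3 is at once the truncation frequency
    of a step and the scale b^2 of the following one.\<close>
  define b where "b = rec_nat b0 (\<lambda>_ x. sqrt (x ^ 3))"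
  have bS: "b 0 = b0" "b (Suc n) = sqrt (b n ^ 3)" for n by (simp_all add: b_def)
  \<comment> \<open>As b is at least 16, each step at least doubles it. This growth beats the
    factors 2^n in the conditions on b.\<close>
  have bge: "b0 * 2 ^ n \<le> b n" for n
  proof (induction n)
    case (Suc n)
    have "b0 * 1 \<le> b0 * 2 ^ n" using b0 by (intro mult_left_mono) auto
    then have 16: "16 \<le> b n" using Suc b0 by linarith
    then have "4 * (b n)\<^sup>2 \<le> b n * (b n)\<^sup>2" by (intro mult_right_mono) auto
    then have "(2 * b n)\<^sup>2 \<le> b n ^ 3" by (simp add: power2_eq_square power3_eq_cube)
    then have "2 * b n \<le> b (Suc n)" unfolding bS by (rule real_le_rsqrt)
    then show ?case using Suc by simp
  qed (simp add: bS)
  have bb0: "b0 \<le> b n" for n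
  proof -
    have "b0 * 1 \<le> b0 * 2 ^ n" using b0 by (intro mult_left_mono) auto
    then show ?thesis using bge[of n] by linarith
  qed
  have b16: "16 \<le> b n" for n using bb0[of n] b0 by linarith
  have bsq: "(b (Suc n))\<^sup>2 = b n ^ 3" for n unfolding bS using b16[of n] by (simp add: real_sqrt_pow2)
  define \<delta> where "\<delta> n = 1 / b n ^ S" for n
  have \<delta>S: "\<delta> (Suc n) = 1 / (b n ^ 3) ^ M" for n
    by (simp add: \<delta>_def S_def power_mult bsq)
  have bcond: "32 * (2 ^ (m + \<tau> + 1) * C) * 2 ^ n \<le> b n" for n
    by (rule order_trans[OF mult_right_mono[OF b0(4)] bge]) simp
  have bp: "16 \<le> b n" "8 * A \<le> b n" "3 * (2 ^ (S + 1) + 15 * A\<^sup>2) \<le> b n" for n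
    using b0 bb0[of n] by linarith+
  note par = iteration_parameters[OF C bp(1) bp(2)[unfolded A_def S_def M_def] bp(3)[unfolded A_def S_def M_def] bcond,
    folded M_def, folded S_def, folded \<delta>_def]
  have \<delta>r: "\<delta> n \<le> r0" "\<delta> n \<le> 1/16" for n
  proof -
    have "\<delta> n \<le> 1 / b n" by (rule par)
    also have "1 / b n \<le> 1 / b0" using bb0[of n] b0 by (intro divide_left_mono) auto
    finally have 1: "\<delta> n \<le> 1 / b0" .
    have "1 / b0 \<le> r0" using b0 r0(1) by (simp add: field_simps)
    then show "\<delta> n \<le> r0" using 1 by linarith
    have "1 / b0 \<le> 1/16" using b0 by (simp add: field_simps)
    then show "\<delta> n \<le> 1/16" using 1 by linarith
  qed
  define \<kappa> where "\<kappa> = norm (mat 1 :: complex^'n^'n)"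
  have w1: "weight (wgt 1 m :: int^'d \<Rightarrow> real)" by (rule weight_wgt) simp
  show ?thesis
  proof (rule exI[of _ S], rule exI[of _ "\<delta> 0"], intro conjI allI impI)
    show "\<delta> 0 > 0" using b16[of 0] by (simp add: \<delta>_def)
    fix B assume BG: "range B \<subseteq> G" and B2: "almost_invariant B" and F0: "wb (wgt 1 S) (\<delta> 0) (\<lambda>x. B x ** conj_transpose E - mat 1)"
    have B: "\<And>x. B x \<in> G" "almost_invariant B" using BG B2 by auto
    \<comment> \<open>The distances to the identity add up to less than 1/8 and the weighted norms
      stay below 2\<kappa>, where \<kappa> is the norm of the identity matrix, the starting point of
      the iteration.\<close>
    define P where "P n K \<longleftrightarrow> (\<forall>x. K x \<in> G) \<and> (\<forall>x. norm (K x - mat 1) \<le> (1/8) * (1 - (1/2) ^ n)) \<and>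
        wb (wgt 1 m) (\<kappa> * (2 - (1/2) ^ n)) K \<and> wb (wgt ((b n)\<^sup>2) S) (\<delta> n) (defect B K)" for n K
    define Q where "Q n K K' \<longleftrightarrow> wb (wgt 1 m) (\<kappa> * (1/2) ^ Suc n) (\<lambda>x. K' x - K x)"
      for n :: nat and K K' :: "real^'d \<Rightarrow> complex^'n^'n"
    have "\<exists>K. \<forall>n. P n (K n) \<and> Q n (K n) (K (Suc n))"
    proof (rule dependent_nat_choice)
      show "\<exists>K. P 0 K"
      proof (intro exI[of _ "\<lambda>_. mat 1"])
        have "wb (wgt ((b 0)\<^sup>2) S) (\<delta> 0) (\<lambda>x. B x ** conj_transpose E - mat 1)"
          by (rule wb_wgt_mono[OF F0]) (use one_le_power[of "b 0" 2] b16[of 0] in auto)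
        then show "P 0 (\<lambda>_. mat 1)"
          unfolding P_def defect_def[abs_def] using compact_groupD(2)[OF G] by (auto simp: \<kappa>_def intro: wb_const w1)
      qed
      fix K n assume PK: "P n K"
      let ?\<zeta> = "(1/32) * (1/2::real) ^ n"
      have hn: "0 < (1/2::real) ^ n" "(1/2::real) ^ n \<le> 1" by (auto intro: power_le_one)
      obtain K' where K': "\<And>x. K' x \<in> G" "\<And>x. norm (K' x - K x) \<le> 2 * ?\<zeta>"
        "wb (wgt 1 m) (2 * ?\<zeta> * (\<kappa> * (2 - (1/2) ^ n))) (\<lambda>x. K' x - K x)" "wb (wgt (b n ^ 3) S) (\<delta> (Suc n)) (defect B K')"
      proof (rule iteration_step[OF B r0(2), where K=K and q="(1/8) * (1 - (1/2) ^ n)" and m=m and k="\<kappa> * (2 - (1/2) ^ n)"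
            and N="(b n)\<^sup>2" and S=S and \<delta>="\<delta> n" and N'="b n ^ 3" and \<zeta>="?\<zeta>" and \<delta>'="\<delta> (Suc n)"])
        show "1 \<le> (b n)\<^sup>2" using b16[of n] by (intro one_le_power) simp
        show "(b n)\<^sup>2 \<le> b n ^ 3" using b16[of n] by (intro power_increasing) auto
        have "(1/32) * h \<le> 1/8 \<and> 2 * ((1/32) * h) + (1/8) * (1 - h) \<le> 1/4" if "0 < h" "h \<le> 1" for h :: real
          using that by (auto simp: field_simps)
        from this[OF hn] show "?\<zeta> \<le> 1/8" "2 * ?\<zeta> + (1/8) * (1 - (1/2) ^ n) \<le> 1/4" by blast+
        show "3 * ((2 * (b n)\<^sup>2 / b n ^ 3) ^ S * (2 * \<delta> n) + 15 * (2 ^ S * (C * (1 + b n ^ 3) ^ \<tau> * (2 * \<delta> n)))\<^sup>2) \<le> \<delta> (Suc n)"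
          unfolding \<delta>S by (rule par)
      qed (use PK par \<delta>r in \<open>auto simp: P_def\<close>)
      show "\<exists>K'. P (Suc n) K' \<and> Q n K K'"
      proof (intro exI conjI)
        have \<kappa>0: "\<kappa> \<ge> 0" by (simp add: \<kappa>_def)
        have "2 * ?\<zeta> * (\<kappa> * (2 - (1/2) ^ n)) \<le> 2 * ?\<zeta> * (\<kappa> * 2)"
          using hn \<kappa>0 by (intro mult_left_mono) auto
        also have "\<dots> = \<kappa> * (1/2) ^ n * (1/8)" by simp
        also have "\<dots> \<le> \<kappa> * (1/2) ^ n * (1/2)" using \<kappa>0 hn by (intro mult_left_mono) auto
        finally have "2 * ?\<zeta> * (\<kappa> * (2 - (1/2) ^ n)) \<le> \<kappa> * (1/2) ^ Suc n" by simp
        then show Q: "Q n K K'" unfolding Q_def by (rule wb_mono[OF K'(3)])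
        have "norm (K' x - mat 1) \<le> (1/8) * (1 - (1/2) ^ Suc n)" for x
        proof -
          have "norm (K x - mat 1) \<le> (1/8) * (1 - (1/2) ^ n)" using PK by (simp add: P_def)
          moreover have "norm (K' x - mat 1) \<le> norm (K' x - K x) + norm (K x - mat 1)"
            using norm_triangle_ineq[of "K' x - K x" "K x - mat 1"] by simp
          moreover have "(1/2::real) ^ Suc n = (1/2) * (1/2) ^ n" by simp
          moreover have "c \<le> (1/8) * (1 - h')"
            if "a \<le> (1/8) * (1 - h)" "c \<le> d + a" "h' = (1/2) * h" "d \<le> 2 * ((1/32) * h)" for a c d h h' :: real
            using that by (simp add: field_simps)
          ultimately show ?thesis using K'(2)[of x] by blast
        qed
        moreover have "wb (wgt 1 m) (\<kappa> * (1/2) ^ Suc n + \<kappa> * (2 - (1/2) ^ n)) (\<lambda>x. (K' x - K x) + K x)"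
          using Q PK by (intro wb_add) (auto simp: P_def Q_def)
        then have "wb (wgt 1 m) (\<kappa> * (2 - (1/2) ^ Suc n)) K'"
          by (simp add: algebra_simps)
        ultimately show "P (Suc n) K'" using K' by (simp add: P_def bsq)
      qed
    qed
    then obtain K where K: "\<And>n. P n (K n)" "\<And>n. Q n (K n) (K (Suc n))" by blast
    have geo: "(\<lambda>n. \<kappa> * (1/2) ^ Suc n) sums \<kappa>"
      using sums_mult[OF power_half_series, of \<kappa>] by simp
    have d: "wb (wgt 1 m) (\<kappa> * (1/2) ^ Suc n) (\<lambda>x. K (Suc n) x - K n x)" for n using K(2)[of n] by (simp add: Q_def)
    have "summable (\<lambda>n. K (Suc n) x - K n x)" for x
      by (rule summable_comparison_test'[OF sums_summable[OF geo], of 0]) (use wb_norm[OF w1 d] in auto)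
    then have dsum: "(\<lambda>n. K (Suc n) x - K n x) sums (\<Sum>n. K (Suc n) x - K n x)" for x by (rule summable_sums)
    define L where "L x = K 0 x + (\<Sum>n. K (Suc n) x - K n x)" for x
    have "wb (wgt 1 m) \<kappa> (\<lambda>x. \<Sum>n. K (Suc n) x - K n x)" by (rule wb_sums[OF w1 d geo dsum])
    moreover have "wb (wgt 1 m) (\<kappa> * (2 - (1/2) ^ 0)) (K 0)" using K(1)[of 0] by (simp add: P_def)
    ultimately have L1: "wb (wgt 1 m) (\<kappa> * (2 - (1/2) ^ 0) + \<kappa>) L" unfolding L_def[abs_def] by (intro wb_add)
    have lim: "(\<lambda>n. K n x) \<longlonglongrightarrow> L x" for x
    proof -
      have "(\<lambda>n. \<Sum>i<n. K (Suc i) x - K i x) \<longlonglongrightarrow> (\<Sum>n. K (Suc n) x - K n x)" using dsum[of x] by (simp add: sums_def)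
      moreover have "(\<Sum>i<n. K (Suc i) x - K i x) = K n x - K 0 x" for n
        by (rule sum_lessThan_telescope[of "\<lambda>n. K n x"])
      ultimately have "(\<lambda>n. K n x - K 0 x) \<longlonglongrightarrow> (\<Sum>n. K (Suc n) x - K n x)" by simp
      then have "(\<lambda>n. K 0 x + (K n x - K 0 x)) \<longlonglongrightarrow> L x" unfolding L_def by (intro tendsto_intros)
      then show ?thesis by simp
    qed
    have KG: "K n x \<in> G" for n x using K(1)[of n] by (simp add: P_def)
    have LG: "L x \<in> G" for x
      by (rule Lim_in_closed_set[OF compact_groupD(5)[OF G] _ _ lim[of x]]) (auto simp: KG)
    have "L (x + \<alpha>) ** B x = E ** L x" for x
    proof -
      have dl: "\<delta> \<longlonglongrightarrow> 0"
      proof (rule Lim_null_comparison)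
        show "\<forall>\<^sub>F n in sequentially. norm (\<delta> n) \<le> (1/2) ^ n"
        proof (rule always_eventually, rule allI)
          fix n
          have "\<delta> n \<le> 1 / b n" by (rule par)
          also have "\<dots> \<le> 1 / 2 ^ n"
          proof (rule divide_left_mono)
            have "1 * 2 ^ n \<le> b0 * 2 ^ n" using b0 by (intro mult_right_mono) auto
            then show "2 ^ n \<le> b n" using bge[of n] by linarith
            show "0 < b n * 2 ^ n" using b16[of n] by (intro mult_pos_pos) auto
          qed simp
          finally show "norm (\<delta> n) \<le> (1/2) ^ n" using b16[of n] by (simp add: \<delta>_def power_one_over)
        qed
      qed (rule LIMSEQ_realpow_zero, auto)
      have "(\<lambda>n. defect B (K n) x) \<longlonglongrightarrow> 0"
      proof (rule Lim_null_comparison[OF _ dl], rule always_eventually, rule allI)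
        fix n
        have "wb (wgt ((b n)\<^sup>2) S) (\<delta> n) (defect B (K n))" using K(1)[of n] by (simp add: P_def)
        then show "norm (defect B (K n) x) \<le> \<delta> n"
          by (rule wb_norm[rotated]) (rule weight_wgt, use b16[of n] in simp)
      qed
      moreover have "(\<lambda>n. defect B (K n) x) \<longlonglongrightarrow> defect B L x"
        unfolding defect_def by (intro tendsto_diff mm.tendsto lim tendsto_const bounded_linear.tendsto[OF bounded_linear_ct])
      ultimately have "defect B L x = 0" using LIMSEQ_unique by blast
      then have "L (x + \<alpha>) ** B x ** conj_transpose (L x) ** conj_transpose E = mat 1" by (simp add: defect_def)
      then have "L (x + \<alpha>) ** B x ** conj_transpose (L x) ** (conj_transpose E ** E) ** L x = mat 1 ** E ** L x"
        by (simp only: matrix_mul_assoc)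
      then have "L (x + \<alpha>) ** B x ** (conj_transpose (L x) ** L x) = E ** L x"
        by (simp add: unitaryD[OF unitaryE] matrix_mul_assoc)
      then show ?thesis using unitaryD(1)[OF compact_groupD(1)[OF G LG[of x]]] by simp
    qed
    with LG L1 show "\<exists>L r. (\<forall>x. L x \<in> G) \<and> wb (wgt 1 m) r L \<and> (\<forall>x. L (x + \<alpha>) ** B x = E ** L x)" by blast
  qed
qed

end

subsection \<open>Weak convergence of unitary maps\<close>

text \<open>A single term of a sum of nonnegative ones. For fixed k its weight is a positive
  constant whatever s is, so Sobolev convergence of any order gives convergence of each
  coefficient.\<close>

lemma sobolev_term_le:
  "ennreal ((1 + (norm (real_vec k))\<^sup>2) powr s * (cmod (fourier_coeff u k))\<^sup>2) \<le> sobolev_norm2 s u"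
proof -
  let ?f = "\<lambda>k. ennreal ((1 + (norm (real_vec k))\<^sup>2) powr s * (cmod (fourier_coeff u k))\<^sup>2)"
  have "infsum ?f {k} \<le> infsum ?f UNIV"
    by (rule infsum_mono_neutral) (auto intro: nonneg_summable_on_complete)
  then show ?thesis by (simp add: sobolev_norm2_def)
qed

lemma measurable_unitary_bounded:
  fixes f :: "real^'d \<Rightarrow> complex^'n^'n"
  assumes "\<And>x. unitary (f x)" shows "norm (f x) \<le> norm (mat 1 :: complex^'n^'n)"
  using norm_unitary_eq[OF assms, of x] by simp

lemma sobolev_lim_mfc:
  fixes f :: "nat \<Rightarrow> real^'d \<Rightarrow> complex^'n^'n"
  assumes lim: "sobolev_lim s f g"
    and f: "\<And>i. f i \<in> borel_measurable cube" "\<And>i x. unitary (f i x)" and g: "g \<in> borel_measurable cube" "\<And>x. unitary (g x)"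
  shows "(\<lambda>i. mfc (f i) k) \<longlonglongrightarrow> mfc g k"
proof -
  let ?b = "norm (mat 1 :: complex^'n^'n)"
  note fb = measurable_unitary_bounded[of "f i" for i, OF f(2)]
  note gb = measurable_unitary_bounded[of g, OF g(2)]
  have "(\<lambda>i. (mfc (f i) k - mfc g k) $ p $ q) \<longlonglongrightarrow> 0" for p q
  proof -
    define c where "c = (1 + (norm (real_vec k))\<^sup>2) powr s"
    have c: "c > 0" unfolding c_def by (metis add_pos_nonneg powr_gt_zero zero_less_one zero_le_power2 less_irrefl)
    let ?u = "\<lambda>i x. f i x $ p $ q - g x $ p $ q"
    have eq: "(mfc (f i) k - mfc g k) $ p $ q = fourier_coeff (?u i) k" for i
    proof -
      have "mfc (\<lambda>x. f i x - g x) k = mfc (f i) k - mfc g k"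
        by (rule mfc_diff[OF f(1) fb g(1) gb])
      moreover have "mfc (\<lambda>x. f i x - g x) k $ p $ q = fourier_coeff (\<lambda>x. (f i x - g x) $ p $ q) k"
      proof (rule mfc_nth)
        show "(\<lambda>x. f i x - g x) \<in> borel_measurable cube" using f(1) g(1) by simp
        show "norm (f i x - g x) \<le> ?b + ?b" for x
          using norm_triangle_ineq4[of "f i x" "g x"] fb[of i x] gb[of x] by linarith
      qed
      ultimately show ?thesis by simp
    qed
    have "(\<lambda>i. sobolev_norm2 s (?u i)) \<longlonglongrightarrow> 0" using lim by (simp add: sobolev_lim_def)
    then have "(\<lambda>i. ennreal (c * (cmod (fourier_coeff (?u i) k))\<^sup>2)) \<longlonglongrightarrow> 0"
      by (rule tendsto_sandwich[OF always_eventually always_eventually tendsto_const, rotated 2])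
        (auto simp: c_def sobolev_term_le)
    then have "(\<lambda>i. c * (cmod (fourier_coeff (?u i) k))\<^sup>2) \<longlonglongrightarrow> 0"
      by (rule tendsto_ennrealD[of _ 0, simplified]) (use c in auto)
    then have "(\<lambda>i. (1 / c) * (c * (cmod (fourier_coeff (?u i) k))\<^sup>2)) \<longlonglongrightarrow> (1 / c) * 0"
      by (intro tendsto_intros)
    then have "(\<lambda>i. (cmod (fourier_coeff (?u i) k))\<^sup>2) \<longlonglongrightarrow> 0" using c by simp
    then have "(\<lambda>i. sqrt ((cmod (fourier_coeff (?u i) k))\<^sup>2)) \<longlonglongrightarrow> sqrt 0" by (rule tendsto_real_sqrt)
    then have "(\<lambda>i. norm (fourier_coeff (?u i) k)) \<longlonglongrightarrow> 0" by simp
    then show ?thesis unfolding eq by (rule tendsto_norm_zero_cancel)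
  qed
  then have "(\<lambda>i. mfc (f i) k - mfc g k) \<longlonglongrightarrow> 0"
    by (intro vec_tendstoI) simp
  then show ?thesis by (rule LIM_zero_cancel)
qed

text \<open>Equality of the \<open>L\<^sup>2\<close> norms upgrades weak to strong convergence, whatever the sign of the Sobolev
  exponent.\<close>

lemma weak_imp_L1:
  fixes f :: "nat \<Rightarrow> real^'d \<Rightarrow> complex^'n^'n"
  assumes f: "\<And>i. f i \<in> borel_measurable cube" "\<And>i x. unitary (f i x)"
    and g: "g \<in> borel_measurable lebesgue" "\<And>x. unitary (g x)"
    and lim: "\<And>k. (\<lambda>i. mfc (f i) k) \<longlonglongrightarrow> mfc g k"
  shows "(\<lambda>i. LINT x|cube. norm (f i x - g x)) \<longlonglongrightarrow> 0"
proof -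
  define b where "b = norm (mat 1 :: complex^'n^'n)"
  have b0: "b \<ge> 0" by (simp add: b_def)
  have gc: "g \<in> borel_measurable cube" by (rule measurable_cube_lebesgue[OF g(1)])
  have fb: "norm (f i x) = b" for i x using norm_unitary_eq[OF f(2)] by (simp add: b_def)
  have gb: "norm (g x) = b" for x using norm_unitary_eq[OF g(2)] by (simp add: b_def)
  have inn: "integrable cube (\<lambda>x. u x \<bullet> v x)" if "u \<in> borel_measurable cube" "v \<in> borel_measurable cube" "\<And>x. norm (u x) \<le> r" "\<And>x. norm (v x) \<le> t"
    for u v :: "real^'d \<Rightarrow> complex^'n^'n" and r t
  proof (rule integrable_cube_bounded)
    show "(\<lambda>x. u x \<bullet> v x) \<in> borel_measurable cube" using that by (intro borel_measurable_inner)
    show "norm (u x \<bullet> v x) \<le> r * t" for x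
      using Cauchy_Schwarz_ineq2[of "u x" "v x"] mult_mono[OF that(3,4), of x x] order_trans[OF norm_ge_zero that(3)] by force
  qed
  have main: "(\<lambda>i. LINT x|cube. f i x \<bullet> g x) \<longlonglongrightarrow> b * b"
  proof (rule LIMSEQ_I)
    fix e :: real assume "e > 0"
    define d where "d = e / (2 * b + 2)"
    have d0: "d > 0" using \<open>e > 0\<close> b0 by (simp add: d_def)
    obtain ps where ps: "(LINT x|cube. norm (g x - tpoly ps x)) < d"
      using L1_approx[OF g(1), of b d] gb d0 by auto
    have ig: "integrable cube (\<lambda>x. norm (g x - tpoly ps x))"
    proof (rule integrable_cube_bounded)
      show "(\<lambda>x. norm (g x - tpoly ps x)) \<in> borel_measurable cube" using gc measurable_tpoly[of ps] by simp
      show "norm (norm (g x - tpoly ps x)) \<le> b + tnorm (\<lambda>_. 1) ps" for x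
        using norm_triangle_ineq4[of "g x" "tpoly ps x"] gb[of x] tpoly_bound[of ps x] by simp
    qed
    have close: "\<bar>(LINT x|cube. u x \<bullet> g x) - (LINT x|cube. u x \<bullet> tpoly ps x)\<bar> \<le> b * d"
      if u: "u \<in> borel_measurable cube" "\<And>x. norm (u x) = b" for u
    proof -
      have i1: "integrable cube (\<lambda>x. u x \<bullet> g x)" using inn[OF u(1) gc, of b b] u(2) gb by simp
      have i2: "integrable cube (\<lambda>x. u x \<bullet> tpoly ps x)" by (rule inn[OF u(1) measurable_tpoly _ tpoly_bound, of b]) (simp add: u(2))
      have "\<bar>(LINT x|cube. u x \<bullet> g x) - (LINT x|cube. u x \<bullet> tpoly ps x)\<bar> = \<bar>LINT x|cube. u x \<bullet> g x - u x \<bullet> tpoly ps x\<bar>"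
        using i1 i2 by simp
      also have "\<dots> \<le> (LINT x|cube. \<bar>u x \<bullet> g x - u x \<bullet> tpoly ps x\<bar>)" by (rule integral_abs_bound)
      also have "\<dots> \<le> (LINT x|cube. b * norm (g x - tpoly ps x))"
      proof (rule integral_mono)
        show "\<bar>u x \<bullet> g x - u x \<bullet> tpoly ps x\<bar> \<le> b * norm (g x - tpoly ps x)" for x
          using Cauchy_Schwarz_ineq2[of "u x" "g x - tpoly ps x"] by (simp add: inner_diff_right u(2))
      qed (use i1 i2 ig in auto)
      also have "\<dots> = b * (LINT x|cube. norm (g x - tpoly ps x))" by simp
      also have "\<dots> \<le> b * d" using ps b0 by (intro mult_left_mono) auto
      finally show ?thesis .
    qed
    have "(\<lambda>i. \<Sum>p\<leftarrow>ps. mfc (f i) (fst p) \<bullet> snd p) \<longlonglongrightarrow> (\<Sum>p\<leftarrow>ps. mfc g (fst p) \<bullet> snd p)"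
      by (induction ps) (auto intro!: tendsto_intros lim)
    then have "(\<lambda>i. LINT x|cube. f i x \<bullet> tpoly ps x) \<longlonglongrightarrow> (LINT x|cube. g x \<bullet> tpoly ps x)"
      using inner_mfc[OF f(1), of _ b] inner_mfc[OF gc, of b] fb gb by simp
    then obtain n0 where n0: "\<And>i. i \<ge> n0 \<Longrightarrow> norm ((LINT x|cube. f i x \<bullet> tpoly ps x) - (LINT x|cube. g x \<bullet> tpoly ps x)) < d"
      using LIMSEQ_D[OF _ d0] by blast
    have gg: "(LINT x|cube. g x \<bullet> g x) = b * b" by (simp add: dot_square_norm gb power2_eq_square)
    have "norm ((LINT x|cube. f i x \<bullet> g x) - b * b) < e" if "i \<ge> n0" for i
    proof -
      have "norm ((LINT x|cube. f i x \<bullet> g x) - b * b) < b * d + d + b * d"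
        using close[OF f(1)[of i] fb[of i]] close[OF gc gb] n0[OF that] unfolding gg[symmetric] real_norm_def by linarith
      also have "\<dots> \<le> d * (2 * b + 2)" using d0 by (simp add: algebra_simps)
      also have "\<dots> = e" using b0 by (simp add: d_def)
      finally show ?thesis .
    qed
    then show "\<exists>n0. \<forall>i\<ge>n0. norm ((LINT x|cube. f i x \<bullet> g x) - b * b) < e" by blast
  qed
  have ifg: "integrable cube (\<lambda>x. f i x \<bullet> g x)" for i using inn[OF f(1) gc, where r=b and t=b] fb gb by simp
  have sq: "(norm (f i x - g x))\<^sup>2 = 2 * (b * b) - 2 * (f i x \<bullet> g x)" for i x
    using dot_norm_neg[of "f i x" "g x"] by (simp add: fb gb power2_eq_square)
  have i1: "integrable cube (\<lambda>x. norm (f i x - g x))" for i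
  proof (rule integrable_cube_bounded)
    show "(\<lambda>x. norm (f i x - g x)) \<in> borel_measurable cube" using gc f(1) by simp
    show "norm (norm (f i x - g x)) \<le> b + b" for x
      using norm_triangle_ineq4[of "f i x" "g x"] gb[of x] fb[of i x] by simp
  qed
  show ?thesis
  proof (rule LIMSEQ_I)
    fix e :: real assume "e > 0"
    then have "e\<^sup>2 / 2 > 0" by simp
    then obtain n0 where n0: "\<And>i. i \<ge> n0 \<Longrightarrow> norm ((LINT x|cube. f i x \<bullet> g x) - b * b) < e\<^sup>2 / 2"
      using LIMSEQ_D[OF main] by blast
    have "norm ((LINT x|cube. norm (f i x - g x)) - 0) < e" if "i \<ge> n0" for i
    proof -
      have lt: "2 * (b * b) - 2 * (LINT x|cube. f i x \<bullet> g x) < e\<^sup>2"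
        using n0[OF that] unfolding real_norm_def by linarith
      have "(LINT x|cube. norm (f i x - g x)) \<le> (LINT x|cube. e / 2 + (1 / (2 * e)) * (2 * (b * b) - 2 * (f i x \<bullet> g x)))"
      proof (rule integral_mono)
        fix x
        \<comment> \<open>Young's inequality |z| <= e/2 + |z|^2 / (2e), with e the target accuracy,
          passes from the integrated square to the L1 norm.\<close>
        have "0 \<le> (norm (f i x - g x) - e)\<^sup>2" by simp
        then have "2 * e * norm (f i x - g x) \<le> e\<^sup>2 + (norm (f i x - g x))\<^sup>2" by (simp add: power2_diff algebra_simps)
        then show "norm (f i x - g x) \<le> e / 2 + (1 / (2 * e)) * (2 * (b * b) - 2 * (f i x \<bullet> g x))"
          unfolding sq[symmetric] using \<open>e > 0\<close> by (simp add: field_simps power2_eq_square)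
      qed (use i1 ifg in auto)
      also have "\<dots> = e / 2 + (1 / (2 * e)) * (2 * (b * b) - 2 * (LINT x|cube. f i x \<bullet> g x))"
        using ifg by simp
      also have "\<dots> < e / 2 + (1 / (2 * e)) * e\<^sup>2"
        using \<open>e > 0\<close> lt by (intro add_strict_left_mono mult_strict_left_mono) auto
      also have "\<dots> = e" using \<open>e > 0\<close> by (simp add: power2_eq_square)
      finally show ?thesis by (simp add: integral_nonneg_AE)
    qed
    then show "\<exists>n0. \<forall>i\<ge>n0. norm ((LINT x|cube. norm (f i x - g x)) - 0) < e" by blast
  qed
qed

subsection \<open>Smooth conjugacies with smooth limit\<close>

lemma partials_const: "partials is (\<lambda>_. c) = (if is = [] then (\<lambda>_. c) else (\<lambda>_. 0))"
  by (induction "is") (auto simp: frechet_derivative_const)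

lemma smooth_lim_dist:
  assumes "smooth_lim f (\<lambda>_. c)" "e > 0"
  shows "\<forall>\<^sub>F i in sequentially. \<forall>x. dist (f i x) c < e"
proof -
  have "uniform_limit UNIV (\<lambda>i. partials [] (f i)) (partials [] (\<lambda>_. c)) sequentially"
    using assms(1) unfolding smooth_lim_def by blast
  from uniform_limitD[OF this assms(2)] show ?thesis by simp
qed

text \<open>Away from k = 0 a coefficient is controlled by derivatives of order
  \<open>S + 2 * CARD('d)\<close>, to which the constant c contributes nothing; at k = 0 it is
  controlled by the uniform distance to c.\<close>

lemma smooth_lim_const_wb:
  fixes f :: "nat \<Rightarrow> real^'d \<Rightarrow> complex^'n^'n"
  assumes f: "\<And>i. smooth (f i)" "\<And>i. periodic (f i)" and lim: "smooth_lim f (\<lambda>_. c)" and \<theta>: "\<theta> > 0"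
  shows "\<forall>\<^sub>F i in sequentially. wb (wgt 1 S) \<theta> (\<lambda>x. f i x - c)"
proof -
  let ?p = "S + 2 * CARD('d)"
  define b where "b = \<theta> / (lattice_sum TYPE('d) + 1)"
  have ls: "lattice_sum TYPE('d) \<ge> 0" by (rule lattice_sum_nonneg)
  have b: "b > 0" "b * lattice_sum TYPE('d) \<le> \<theta>"
    using \<theta> ls by (simp_all add: b_def field_simps)
  define b' where "b' = b / (2 * real CARD('d)) ^ ?p"
  have b': "b' > 0" using b by (simp add: b'_def)
  have "\<forall>\<^sub>F i in sequentially. \<forall>x\<in>UNIV. dist (partials (replicate ?p j) (f i) x) (partials (replicate ?p j) (\<lambda>_. c) x) < b'" for j
    using lim b' unfolding smooth_lim_def by (intro uniform_limitD) auto
  then have ev1: "\<forall>\<^sub>F i in sequentially. \<forall>j. \<forall>x\<in>UNIV. dist (partials (replicate ?p j) (f i) x) (partials (replicate ?p j) (\<lambda>_. c) x) < b'"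
    by (simp add: eventually_all_finite)
  note ev2 = smooth_lim_dist[OF lim b(1)]
  from ev1 ev2 show ?thesis
  proof eventually_elim
    case (elim i)
    have cont: "continuous_on UNIV (f i)" using smooth_partials(1)[OF f(1)[of i] f(2)[of i], of "[]"] by simp
    have small: "norm (partials (replicate ?p j) (f i) x) \<le> b'" for j x
      using less_imp_le[OF elim(1)[THEN spec, THEN bspec[OF _ UNIV_I], of j x]] by (simp add: partials_const dist_norm)
    have "wb (wgt 1 S) (b * lattice_sum TYPE('d)) (\<lambda>x. f i x - c)"
    proof (rule wb_of_decay)
      show "continuous_on UNIV (\<lambda>x. f i x - c)" by (intro continuous_intros cont)
      show "periodic (\<lambda>x. f i x - c)" using f(2)[of i] by (simp add: periodic_def)
      fix k :: "int^'d"
      obtain B where B: "\<And>x. norm (f i x) \<le> B" using periodic_continuous_bounded[OF cont f(2)] by blast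
      have d: "mfc (\<lambda>x. f i x - c) k = mfc (f i) k - mfc (\<lambda>_. c) k"
        by (rule mfc_diff[OF measurable_cube_continuous[OF cont] B, of "\<lambda>_. c" "norm c"]) auto
      show "norm (mfc (\<lambda>x. f i x - c) k) * (1 + norm (real_vec k)) ^ ?p \<le> b"
      proof (cases "k = 0")
        case True
        have "norm (mfc (\<lambda>x. f i x - c) k) \<le> b"
          by (rule norm_mfc_le) (use elim(2) cont in \<open>auto simp: dist_norm less_imp_le intro!: measurable_cube_continuous continuous_intros\<close>)
        then show ?thesis using True by simp
      next
        case False
        have "tpoly [(0, c)] = (\<lambda>_::real^'d. c)" by (simp add: fun_eq_iff)
        then have "mfc (\<lambda>_::real^'d. c) k = 0" using mfc_tpoly[of "[(0, c)]" k] False by simp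
        then have "norm (mfc (\<lambda>x. f i x - c) k) * (1 + norm (real_vec k)) ^ ?p \<le> (2 * real CARD('d)) ^ ?p * b'"
          using smooth_decay[OF f(1)[of i] f(2)[of i], where m="?p" and B=b' and k=k] small False d by simp
        also have "\<dots> = b" by (simp add: b'_def)
        finally show ?thesis .
      qed
    qed
    then show ?case using b(2) by (rule wb_mono)
  qed
qed

section \<open>Smooth group-valued maps and rotation vectors\<close>

lemma smooth_mapsD:
  assumes "compact_group G" "f \<in> smooth_maps G"
  shows "smooth f" "periodic f" "f x \<in> G" "unitary (f x)" "continuous_on UNIV f"
  using assms smooth_partials(1)[of f "[]"] by (auto simp: smooth_maps_def intro: compact_groupD(1))

lemma smooth_maps_wb:
  fixes f :: "real^'d \<Rightarrow> complex^'n^'n"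
  assumes "compact_group G" "f \<in> smooth_maps G" shows "\<exists>r. wb (wgt 1 m) r f"
  using wb_smooth[OF smooth_mapsD(1,2)[OF assms], of m] by blast

lemma conj_cocycle_eq:
  "compact_group G \<Longrightarrow> H \<in> smooth_maps G \<Longrightarrow> conj_cocycle \<alpha> H A x = H (x + \<alpha>) ** A x ** conj_transpose (H x)"
  by (simp add: conj_cocycle_def matrix_inv_unitary smooth_mapsD)

text \<open>Smoothness is checked through the weighted norms of all orders, which are stable under
  products, shifts and adjoints.\<close>

lemma conj_cocycle_smooth_maps:
  fixes H A :: "real^'d \<Rightarrow> complex^'n^'n"
  assumes G: "compact_group G" and H: "H \<in> smooth_maps G" and A: "A \<in> smooth_maps G"
  shows "conj_cocycle \<alpha> H A \<in> smooth_maps G"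
proof -
  have eq: "conj_cocycle \<alpha> H A = (\<lambda>x. H (x + \<alpha>) ** A x ** conj_transpose (H x))"
    using conj_cocycle_eq[OF G H] by auto
  have wb: "\<exists>r. wb (wgt 1 m) r (conj_cocycle \<alpha> H A)" for m
  proof -
    have w: "weight (wgt 1 m :: int^'d \<Rightarrow> real)" by (rule weight_wgt) simp
    obtain r s where "wb (wgt 1 m) r H" "wb (wgt 1 m) s A" using smooth_maps_wb[OF G] H A by blast
    then have "wb (wgt 1 m) (r * s * r) (conj_cocycle \<alpha> H A)"
      unfolding eq by (intro wb_mult w wb_shift wb_ct)
    then show ?thesis by blast
  qed
  have "conj_cocycle \<alpha> H A x \<in> G" for x
    unfolding eq using smooth_mapsD(3)[OF G] H A by (intro compact_groupD(3,4)[OF G]) auto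
  then show ?thesis
    using smooth_of_wb[OF wb] wb[of 0] wb_periodic by (auto simp: smooth_maps_def)
qed

text \<open>The Sobolev condition is spent here: afterwards only L1 convergence of the conjugacies
  matters, whatever the order s was.\<close>

lemma rotation_vectorE:
  fixes A :: "real^'d \<Rightarrow> complex^'n^'n"
  assumes G: "compact_group G" and a: "a \<in> rotation_vectors G T \<alpha> A"
  obtains H h where "a \<in> lie_algebra T" "h \<in> borel_measurable lebesgue" "periodic h" "\<And>x. h x \<in> G"
    "\<And>i. H i \<in> smooth_maps G" "(\<lambda>i. LINT x|cube. norm (H i x - h x)) \<longlonglongrightarrow> 0"
    "smooth_lim (\<lambda>i. conj_cocycle \<alpha> (H i) A) (\<lambda>_. mexp a)"
proof -
  obtain s H h where 1: "a \<in> lie_algebra T" "h \<in> sobolev_maps s G" "\<And>i. H i \<in> smooth_maps G" "sobolev_lim s H h"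
    "smooth_lim (\<lambda>i. conj_cocycle \<alpha> (H i) A) (\<lambda>x. mexp a)"
    using a unfolding rotation_vectors_def by blast
  have h: "h \<in> borel_measurable lebesgue" "periodic h" "\<And>x. h x \<in> G"
    using 1(2) by (auto simp: sobolev_maps_def)
  have hu: "unitary (h x)" for x by (rule compact_groupD(1)[OF G h(3)])
  have Hm: "H i \<in> borel_measurable cube" for i by (rule measurable_cube_continuous[OF smooth_mapsD(5)[OF G 1(3)]])
  have Hu: "unitary (H i x)" for i x by (rule smooth_mapsD(4)[OF G 1(3)])
  have "(\<lambda>i. LINT x|cube. norm (H i x - h x)) \<longlonglongrightarrow> 0"
    by (rule weak_imp_L1[OF Hm Hu h(1) hu sobolev_lim_mfc[OF 1(4) Hm Hu measurable_cube_lebesgue[OF h(1)] hu]])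
  then show thesis using that[OF 1(1) h 1(3) _ 1(5)] by blast
qed

text \<open>Conjugation by one late \<open>H i\<close> brings the cocycle close to E. For large j
  the product of \<open>H j\<close> with the inverse of \<open>H i\<close> conjugates it ever closer
  to E, and it stays close to the identity in mean since \<open>H i\<close> and \<open>H j\<close>
  are both L1-close to h. The bound 1/4 is the sum of two distances below 1/8.\<close>

lemma (in small_divisor_group) finite_regularity_reducibility:
  assumes H: "\<And>i. H i \<in> smooth_maps G" and A: "A \<in> smooth_maps G"
    and h: "h \<in> borel_measurable lebesgue" "\<And>x. h x \<in> G"
    and L1: "(\<lambda>i. LINT x|cube. norm (H i x - h x)) \<longlonglongrightarrow> 0"
    and lim: "smooth_lim (\<lambda>i. conj_cocycle \<alpha> (H i) A) (\<lambda>_. E)"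
  shows "\<exists>K r. (\<forall>x. K x \<in> G) \<and> wb (wgt 1 m) r K \<and> (\<forall>x. K (x + \<alpha>) ** A x = E ** K x)"
proof -
  obtain S \<theta> where \<theta>: "\<theta> > 0"
    "\<forall>B. range B \<subseteq> G \<longrightarrow> almost_invariant B \<longrightarrow> wb (wgt 1 S) \<theta> (\<lambda>x. B x ** conj_transpose E - mat 1) \<longrightarrow>
     (\<exists>L r. (\<forall>x. L x \<in> G) \<and> wb (wgt 1 m) r L \<and> (\<forall>x. L (x + \<alpha>) ** B x = E ** L x))"
    using reducibility[of m] by (elim exE conjE) rule
  define B where "B i = conj_cocycle \<alpha> (H i) A" for i
  have Bs: "B i \<in> smooth_maps G" for i unfolding B_def by (rule conj_cocycle_smooth_maps[OF G H A])
  have Beq: "B i x = H i (x + \<alpha>) ** A x ** conj_transpose (H i x)" for i x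
    unfolding B_def by (rule conj_cocycle_eq[OF G H])
  have Hu: "unitary (H i x)" for i x by (rule smooth_mapsD(4)[OF G H])
  have BH: "B i x ** H i x = H i (x + \<alpha>) ** A x" for i x
    using unitaryD(1)[OF Hu[of i x]] by (simp add: Beq flip: matrix_mul_assoc)
  have w: "weight (wgt 1 j :: int^'d \<Rightarrow> real)" for j by (rule weight_wgt) simp
  have "\<forall>\<^sub>F i in sequentially. wb (wgt 1 S) \<theta> (\<lambda>x. B i x - E)"
    by (rule smooth_lim_const_wb) (use smooth_mapsD[OF G Bs] lim \<theta>(1) in \<open>auto simp: B_def[abs_def]\<close>)
  moreover have "\<forall>\<^sub>F i in sequentially. (LINT x|cube. norm (H i x - h x)) < 1/8"
    by (rule order_tendstoD(2)[OF L1]) simp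
  ultimately have ev: "\<forall>\<^sub>F i in sequentially. wb (wgt 1 S) \<theta> (\<lambda>x. B i x - E) \<and> (LINT x|cube. norm (H i x - h x)) < 1/8"
    by (rule eventually_conj)
  then obtain i where i: "wb (wgt 1 S) \<theta> (\<lambda>x. B i x - E)" "(LINT x|cube. norm (H i x - h x)) < 1/8"
    by (auto simp: eventually_sequentially)
  have Hm: "H j \<in> borel_measurable cube" for j by (rule measurable_cube_continuous[OF smooth_mapsD(5)[OF G H]])
  have hm: "h \<in> borel_measurable cube" by (rule measurable_cube_lebesgue[OF h(1)])
  have intg: "integrable cube (\<lambda>x. norm (u x - v x))" if "u \<in> borel_measurable cube" "v \<in> borel_measurable cube" "\<And>x. unitary (u x)" "\<And>x. unitary (v x)"
    for u v :: "real^'d \<Rightarrow> complex^'n^'n"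
  proof (rule integrable_cube_bounded)
    show "(\<lambda>x. norm (u x - v x)) \<in> borel_measurable cube" using that by simp
    show "norm (norm (u x - v x)) \<le> norm (mat 1 :: complex^'n^'n) + norm (mat 1 :: complex^'n^'n)" for x
      using norm_triangle_ineq4[of "u x" "v x"] norm_unitary_eq[OF that(3), of x] norm_unitary_eq[OF that(4), of x] by simp
  qed
  have hu: "unitary (h x)" for x by (rule compact_groupD(1)[OF G h(2)])
  have "almost_invariant (B i)"
    unfolding almost_invariant_def
  proof (intro allI impI)
    fix \<epsilon> :: real assume \<epsilon>: "\<epsilon> > 0"
    have "\<forall>\<^sub>F j in sequentially. \<forall>x. dist (B j x) E < \<epsilon>"
      unfolding B_def by (rule smooth_lim_dist[OF lim \<epsilon>])
    with ev have "\<forall>\<^sub>F j in sequentially. (LINT x|cube. norm (H j x - h x)) < 1/8 \<and> (\<forall>x. dist (B j x) E < \<epsilon>)"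
      by eventually_elim auto
    then obtain j where j: "(LINT x|cube. norm (H j x - h x)) < 1/8" "\<And>x. dist (B j x) E < \<epsilon>"
      by (auto simp: eventually_sequentially)
    define U where "U x = H j x ** conj_transpose (H i x)" for x
    have "norm (U x - mat 1) = norm (H j x - H i x)" for x
    proof -
      have "norm (U x - mat 1) = norm ((U x - mat 1) ** H i x)" by (simp add: norm_unitary[OF Hu])
      also have "(U x - mat 1) ** H i x = H j x - H i x"
        using unitaryD(1)[OF Hu[of i x]] by (simp add: U_def mm.diff_left flip: matrix_mul_assoc)
      finally show ?thesis .
    qed
    then have "(LINT x|cube. norm (U x - mat 1)) \<le> (LINT x|cube. norm (H j x - h x) + norm (H i x - h x))"
    proof (simp only:, intro integral_mono)
      show "norm (H j x - H i x) \<le> norm (H j x - h x) + norm (H i x - h x)" for x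
        using norm_triangle_ineq4[of "H j x - h x" "H i x - h x"] by simp
    qed (auto intro!: intg Hm hm Hu hu)
    also have "\<dots> = (LINT x|cube. norm (H j x - h x)) + (LINT x|cube. norm (H i x - h x))"
      by (rule Bochner_Integration.integral_add) (intro intg Hm hm Hu hu)+
    finally have "(LINT x|cube. norm (U x - mat 1)) \<le> 1/4" using i(2) j(1) by linarith
    moreover have "norm (U (x + \<alpha>) ** B i x - E ** U x) \<le> \<epsilon>" for x
    proof -
      have "U (x + \<alpha>) ** B i x = H j (x + \<alpha>) ** (conj_transpose (H i (x + \<alpha>)) ** H i (x + \<alpha>)) ** A x ** conj_transpose (H i x)"
        unfolding U_def Beq by (simp only: matrix_mul_assoc)
      also have "\<dots> = B j x ** H j x ** conj_transpose (H i x)"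
        unfolding BH by (simp add: unitaryD[OF Hu])
      finally have "U (x + \<alpha>) ** B i x - E ** U x = (B j x - E) ** H j x ** conj_transpose (H i x)"
        by (simp add: U_def mat_simps)
      then have "norm (U (x + \<alpha>) ** B i x - E ** U x) = norm (B j x - E)"
        by (simp add: norm_unitary[OF Hu] norm_unitary[OF unitary_ct[OF Hu]])
      then show ?thesis using j(2)[of x] by (simp add: dist_norm)
    qed
    moreover have "continuous_on UNIV U"
      unfolding U_def by (intro mm.continuous_on bounded_linear.continuous_on[OF bounded_linear_ct] smooth_mapsD(5)[OF G H])
    moreover have "periodic U" using smooth_mapsD(2)[OF G H] by (simp add: U_def periodic_def)
    moreover have "unitary (U x)" for x unfolding U_def by (intro unitary_mult unitary_ct Hu)
    ultimately show "\<exists>U. continuous_on UNIV U \<and> periodic U \<and> (\<forall>x. unitary (U x)) \<and>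
      (LINT x|cube. norm (U x - mat 1)) \<le> 1/4 \<and> (\<forall>x. norm (U (x + \<alpha>) ** B i x - E ** U x) \<le> \<epsilon>)" by blast
  qed
  moreover have "wb (wgt 1 S) \<theta> (\<lambda>x. B i x ** conj_transpose E - mat 1)"
  proof -
    have "wb (wgt 1 S) \<theta> (\<lambda>x. mat 1 ** (B i x - E) ** conj_transpose E)"
      by (rule wb_unitary_sandwich[OF w i(1)]) (auto intro: unitary_ct unitaryE compact_groupD[OF G])
    then show ?thesis by (simp add: mm.diff_left unitaryD[OF unitaryE])
  qed
  ultimately obtain L r where L: "\<And>x. L x \<in> G" "wb (wgt 1 m) r L" "\<And>x. L (x + \<alpha>) ** B i x = E ** L x"
    using \<theta>(2)[THEN spec, of "B i"] smooth_mapsD(3)[OF G Bs] by blast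
  obtain t where t: "wb (wgt 1 m) t (H i)" using smooth_maps_wb[OF G H] by blast
  show ?thesis
  proof (intro exI conjI allI)
    show "L x ** H i x \<in> G" for x by (intro compact_groupD(3)[OF G] L smooth_mapsD(3)[OF G H])
    show "wb (wgt 1 m) (r * t) (\<lambda>x. L x ** H i x)" by (intro wb_mult w L t)
    show "L (x + \<alpha>) ** H i (x + \<alpha>) ** A x = E ** (L x ** H i x)" for x
      by (metis BH L(3) matrix_mul_assoc)
  qed
qed

subsection \<open>Transition maps between conjugacies\<close>

lemma mfc_mult:
  assumes "f \<in> borel_measurable cube" "\<And>x. norm (f x) \<le> B"
  shows "mfc (\<lambda>x. f x ** M) k = mfc f k ** M" "mfc (\<lambda>x. M ** f x) k = M ** mfc f k"
  unfolding mfc_def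
    integral_bounded_linear[OF mm.bounded_linear_left integrable_mfc[OF assms], symmetric]
    integral_bounded_linear[OF mm.bounded_linear_right integrable_mfc[OF assms], symmetric]
  by (simp_all add: mscale_mult_left mscale_mult_right)

lemma L1_imp_mfc_tendsto:
  assumes f: "\<And>i. f i \<in> borel_measurable cube" "\<And>i x. norm (f i x) \<le> B"
    and g: "g \<in> borel_measurable cube" "\<And>x. norm (g x) \<le> B"
    and lim: "(\<lambda>i. LINT x|cube. norm (f i x - g x)) \<longlonglongrightarrow> 0"
  shows "(\<lambda>i. mfc (f i) k) \<longlonglongrightarrow> mfc g k"
proof (rule LIM_zero_cancel, rule Lim_null_comparison[OF always_eventually lim], rule allI)
  fix i
  have "mfc (f i) k - mfc g k = (LINT x|cube. mscale (ek (- k) x) (f i x - g x))"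
    using mfc_diff[OF f g, of i k] by (simp add: mfc_def)
  then show "norm (mfc (f i) k - mfc g k) \<le> (LINT x|cube. norm (f i x - g x))"
    using integral_norm_bound[of cube "\<lambda>x. mscale (ek (- k) x) (f i x - g x)"] by (simp add: norm_mscale)
qed

lemma ek_ne_1:
  assumes "diophantine \<alpha>" "k \<noteq> 0" shows "ek k \<alpha> \<noteq> 1"
proof
  assume 1: "ek k \<alpha> = 1"
  obtain \<gamma> \<tau> where *: "\<gamma> > 0" "\<And>k. k \<noteq> 0 \<Longrightarrow> infdist (\<alpha> \<bullet> real_vec k) \<int> \<ge> inverse \<gamma> * norm (real_vec k) powr (- \<tau>)"
    using assms(1) unfolding diophantine_def by blast
  have "0 < inverse \<gamma> * norm (real_vec k) powr (- \<tau>)" using *(1) assms(2) by simp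
  also have "\<dots> \<le> cmod (cis (2 * pi * (\<alpha> \<bullet> real_vec k)) - cis (2 * pi * 0))"
    using *(2)[OF assms(2)] cmod_cis_diff[of "\<alpha> \<bullet> real_vec k" 0] by simp
  also have "\<dots> = 0" using 1 by (simp add: ek_cis inner_commute)
  finally show False by simp
qed

text \<open>Both sides of the relation are unitary transforms of the coefficients, so the inner product of two
  coefficients is invariant under multiplication by \<open>ek (k - l) \<alpha> \<noteq> 1\<close>: it vanishes.\<close>

lemma finite_resonant_coefficients:
  fixes c :: "int^'d \<Rightarrow> complex^'n^'n"
  assumes dio: "diophantine \<alpha>" and E: "unitary E" and F: "unitary F"
    and eq: "\<And>k. mscale (ek k \<alpha>) (c k) ** E = F ** c k"
  shows "finite {k. c k \<noteq> 0}"
proof -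
  have orth: "c k \<bullet> c l = 0" if "k \<noteq> l" for k l
  proof -
    define z where "z = ek (k - l) \<alpha>"
    have z: "z \<noteq> 1" unfolding z_def using that by (intro ek_ne_1[OF dio]) simp
    have zkl: "cnj (ek l \<alpha>) * ek k \<alpha> = z" unfolding z_def cnj_ek ek_add[symmetric] by simp
    have inv: "mscale w (c k) \<bullet> c l = mscale (z * w) (c k) \<bullet> c l" for w
    proof -
      have "mscale w (c k) \<bullet> c l = (F ** mscale w (c k)) \<bullet> (F ** c l)"
        by (simp add: inner_unitary(1)[OF F])
      also have "F ** mscale w (c k) = mscale (w * ek k \<alpha>) (c k) ** E"
        by (simp add: mscale_mult_right mscale_mult_left flip: eq)
      also have "F ** c l = mscale (ek l \<alpha>) (c l) ** E" by (simp add: eq)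
      also have "(mscale (w * ek k \<alpha>) (c k) ** E) \<bullet> (mscale (ek l \<alpha>) (c l) ** E) = mscale (w * ek k \<alpha>) (c k) \<bullet> mscale (ek l \<alpha>) (c l)"
        by (rule inner_unitary(2)[OF E])
      also have "\<dots> = mscale (cnj (ek l \<alpha>) * (w * ek k \<alpha>)) (c k) \<bullet> c l"
        using inner_mscale[of "cnj (ek l \<alpha>)" "mscale (w * ek k \<alpha>) (c k)" "c l"] by simp
      also have "cnj (ek l \<alpha>) * (w * ek k \<alpha>) = z * w" using zkl by (simp add: ac_simps)
      finally show ?thesis .
    qed
    \<comment> \<open>Since w and z w give the same inner product, w = 1/(1 - z), for which w - z w
      = 1, yields 0. The scalar w is carried inside because the inner product is only
      real-bilinear.\<close>
    have "c k \<bullet> c l = mscale (1 / (1 - z) - z * (1 / (1 - z))) (c k) \<bullet> c l"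
      using z by (simp flip: diff_divide_distrib)
    also have "\<dots> = 0" unfolding mscale_diff_left inner_diff_left inv[symmetric] by simp
    finally show ?thesis .
  qed
  have "pairwise orthogonal (c ` {k. c k \<noteq> 0})"
    unfolding pairwise_def orthogonal_def by (auto intro!: orth)
  then have "finite (c ` {k. c k \<noteq> 0})" by (rule pairwise_orthogonal_imp_finite)
  moreover have "inj_on c {k. c k \<noteq> 0}"
  proof (rule inj_onI, rule ccontr)
    fix k l assume "k \<in> {k. c k \<noteq> 0}" "c k = c l" "k \<noteq> l"
    then show False using orth[of k l] by simp
  qed
  ultimately show ?thesis by (rule finite_imageD)
qed

text \<open>The maps \<open>V i\<close> satisfy the intertwining relation up to a small error and
  converge in L1 only, but their Fourier coefficients converge, and the limits satisfy it exactly.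
  The polynomial with these coefficients equals U almost everywhere and satisfies the relation at
  every point.\<close>

lemma transition_tpoly:
  fixes V :: "nat \<Rightarrow> real^'d \<Rightarrow> complex^'n^'n"
  assumes dio: "diophantine \<alpha>" and E: "unitary E" and F: "unitary F"
    and V: "\<And>i. continuous_on UNIV (V i)" "\<And>i. periodic (V i)" "\<And>i x. unitary (V i x)"
    and U: "U \<in> borel_measurable lebesgue" "\<And>x. unitary (U x)"
    and L1: "(\<lambda>i. LINT x|cube. norm (V i x - U x)) \<longlonglongrightarrow> 0"
    and inv: "\<And>e. e > 0 \<Longrightarrow> \<forall>\<^sub>F i in sequentially. \<forall>x. norm (V i (x + \<alpha>) ** E - F ** V i x) \<le> e"
  shows "\<exists>ps. (AE x in cube. U x = tpoly ps x) \<and> (\<forall>x. tpoly ps (x + \<alpha>) ** E = F ** tpoly ps x)"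
proof -
  let ?b = "norm (mat 1 :: complex^'n^'n)"
  note Vm = measurable_cube_continuous[OF V(1)] and Um = measurable_cube_lebesgue[OF U(1)]
  have Vb: "norm (V i x) \<le> ?b" for i x by (rule measurable_unitary_bounded[OF V(3)])
  have Ub: "norm (U x) \<le> ?b" for x by (rule measurable_unitary_bounded[OF U(2)])
  have lim: "(\<lambda>i. mfc (V i) k) \<longlonglongrightarrow> mfc U k" for k
    by (rule L1_imp_mfc_tendsto[OF Vm Vb Um Ub L1])
  have eq: "mscale (ek k \<alpha>) (mfc U k) ** E = F ** mfc U k" for k
  proof -
    have le: "norm (mscale (ek k \<alpha>) (mfc U k) ** E - F ** mfc U k) \<le> e" if "e > 0" for e
    proof (rule Lim_norm_ubound)
      show "(\<lambda>i. mscale (ek k \<alpha>) (mfc (V i) k) ** E - F ** mfc (V i) k) \<longlonglongrightarrow> mscale (ek k \<alpha>) (mfc U k) ** E - F ** mfc U k"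
        by (intro tendsto_diff mm.tendsto ms.tendsto tendsto_const lim)
      show "\<forall>\<^sub>F i in sequentially. norm (mscale (ek k \<alpha>) (mfc (V i) k) ** E - F ** mfc (V i) k) \<le> e"
        using inv[OF that]
      proof eventually_elim
        case (elim i)
        have Vs: "continuous_on UNIV (\<lambda>x. V i (x + \<alpha>))"
          by (intro continuous_on_compose2[OF V(1)] continuous_intros) auto
        note Vsm = measurable_cube_continuous[OF Vs]
        have c: "continuous_on UNIV (\<lambda>x. V i (x + \<alpha>) ** E)" "continuous_on UNIV (\<lambda>x. F ** V i x)"
          by (intro mm.continuous_on continuous_on_const V(1) Vs)+
        have b: "norm (V i (x + \<alpha>) ** E) \<le> ?b" "norm (F ** V i x) \<le> ?b" for x
          using Vb by (simp_all add: norm_unitary E F)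
        have "mfc (\<lambda>x. V i (x + \<alpha>) ** E - F ** V i x) k = mscale (ek k \<alpha>) (mfc (V i) k) ** E - F ** mfc (V i) k"
          unfolding mfc_diff[OF measurable_cube_continuous[OF c(1)] b(1) measurable_cube_continuous[OF c(2)] b(2)]
            mfc_mult(1)[OF Vsm Vb] mfc_mult(2)[OF Vm Vb] mfc_shift[OF V(1,2)] ..
        moreover have "norm (mfc (\<lambda>x. V i (x + \<alpha>) ** E - F ** V i x) k) \<le> e"
          by (rule norm_mfc_le[OF measurable_cube_continuous[OF continuous_on_diff[OF c]]]) (use elim in blast)
        ultimately show ?case by simp
      qed
    qed simp
    have "norm (mscale (ek k \<alpha>) (mfc U k) ** E - F ** mfc U k) \<le> 0"
      by (rule field_le_epsilon) (simp only: add_0 le)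
    then show ?thesis by simp
  qed
  have fin: "finite {k. mfc U k \<noteq> 0}" by (rule finite_resonant_coefficients[OF dio E F eq])
  obtain ps where ps: "\<And>x. tpoly ps x = (\<Sum>k\<in>{k. mfc U k \<noteq> 0}. mscale (ek k x) (mfc U k))"
    "\<And>l. mfc (tpoly ps) l = (if l \<in> {k. mfc U k \<noteq> 0} then mfc U l else 0)"
    using sum_eq_tpoly[OF fin, of "mfc U"] by auto
  show ?thesis
  proof (intro exI conjI allI)
    have "AE x in cube. U x - tpoly ps x = 0"
    proof (rule mfc_eq_0_AE)
      have "tpoly ps \<in> borel_measurable lborel"
        using borel_measurable_continuous_onI[OF continuous_on_tpoly[of UNIV ps]] by simp
      then show "(\<lambda>x. U x - tpoly ps x) \<in> borel_measurable lebesgue"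
        by (rule borel_measurable_diff[OF U(1) measurable_completion])
      show "norm (U x - tpoly ps x) \<le> ?b + tnorm (\<lambda>_. 1) ps" for x
        using norm_triangle_ineq4[of "U x" "tpoly ps x"] Ub[of x] tpoly_bound[of ps x] by linarith
      show "mfc (\<lambda>x. U x - tpoly ps x) k = 0" for k
        using mfc_diff[OF Um Ub measurable_tpoly tpoly_bound, of ps k] by (simp add: ps(2))
    qed
    then show "AE x in cube. U x = tpoly ps x" by simp
    show "tpoly ps (x + \<alpha>) ** E = F ** tpoly ps x" for x
    proof -
      have "mscale (ek k (x + \<alpha>)) (mfc U k) ** E = F ** mscale (ek k x) (mfc U k)" for k
        using arg_cong[OF eq[of k], of "mscale (ek k x)"]
        by (simp add: ek_shift mscale_mult_left mscale_mult_right)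
      then show ?thesis by (simp add: ps(1) mm.sum_left mm.sum_right)
    qed
  qed
qed

text \<open>Conjugacies K of different regularity are unrelated, but h is the same for all of them:
  each product of a transition polynomial and K is a continuous representative of h, and such a
  representative is unique. It therefore has every regularity at once.\<close>

lemma smooth_conjugacy:
  fixes G :: "(complex^'n^'n) set" and A :: "real^'d \<Rightarrow> complex^'n^'n"
  assumes G: "compact_group G" and dio: "diophantine \<alpha>" and A: "A \<in> smooth_maps G" and E: "unitary E"
    and red: "\<And>m. \<exists>K r. (\<forall>x. K x \<in> G) \<and> wb (wgt 1 m) r K \<and> (\<forall>x. K (x + \<alpha>) ** A x = E ** K x)"
    and F: "unitary F" and H: "\<And>i. H i \<in> smooth_maps G"
    and h: "h \<in> borel_measurable lebesgue" "\<And>x. h x \<in> G"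
    and L1: "(\<lambda>i. LINT x|cube. norm (H i x - h x)) \<longlonglongrightarrow> 0"
    and lim: "smooth_lim (\<lambda>i. conj_cocycle \<alpha> (H i) A) (\<lambda>_. F)"
  shows "\<exists>W\<in>smooth_maps G. \<forall>x. W (x + \<alpha>) ** A x = F ** W x"
proof -
  have Hu: "unitary (H i x)" for i x by (rule smooth_mapsD(4)[OF G H])
  have hu: "unitary (h x)" for x by (rule compact_groupD(1)[OF G h(2)])
  have w: "weight (wgt 1 j :: int^'d \<Rightarrow> real)" for j by (rule weight_wgt) simp
  have W: "\<exists>W r. wb (wgt 1 m) r W \<and> (AE x in cube. h x = W x) \<and> (\<forall>x. W (x + \<alpha>) ** A x = F ** W x)" for m
  proof -
    obtain K r where K: "\<And>x. K x \<in> G" "wb (wgt 1 m) r K" "\<And>x. K (x + \<alpha>) ** A x = E ** K x"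
      using red by blast
    have Ku: "unitary (K x)" for x by (rule compact_groupD(1)[OF G K(1)])
    have Kc: "continuous_on UNIV (\<lambda>x. conj_transpose (K x))"
      by (intro bounded_linear.continuous_on[OF bounded_linear_ct] wb_continuous[OF K(2)])
    define V where "V i x = H i x ** conj_transpose (K x)" for i x
    define U where "U x = h x ** conj_transpose (K x)" for x
    have "\<exists>ps. (AE x in cube. U x = tpoly ps x) \<and> (\<forall>x. tpoly ps (x + \<alpha>) ** E = F ** tpoly ps x)"
    proof (rule transition_tpoly[OF dio E F])
      show "continuous_on UNIV (V i)" for i
        unfolding V_def[abs_def] by (intro mm.continuous_on Kc smooth_mapsD(5)[OF G H])
      show "periodic (V i)" for i
        using smooth_mapsD(2)[OF G H, of i] wb_periodic[OF K(2)] by (simp add: V_def periodic_def)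
      show "unitary (V i x)" "unitary (U x)" for i x
        unfolding V_def U_def by (intro unitary_mult unitary_ct Hu Ku hu)+
      have "(\<lambda>x. conj_transpose (K x)) \<in> borel_measurable lborel"
        using borel_measurable_continuous_onI[OF Kc] by simp
      then have "(\<lambda>x. conj_transpose (K x)) \<in> borel_measurable lebesgue" by (rule measurable_completion)
      then show "U \<in> borel_measurable lebesgue"
        unfolding U_def[abs_def]
        by (rule borel_measurable_continuous_Pair[OF h(1)]) (intro mm.continuous_on continuous_intros)
      have "norm (V i x - U x) = norm (H i x - h x)" for i x
        using norm_unitary(2)[OF unitary_ct[OF Ku[of x]], of "H i x - h x"] by (simp add: V_def U_def mm.diff_left)
      then show "(\<lambda>i. LINT x|cube. norm (V i x - U x)) \<longlonglongrightarrow> 0" using L1 by simp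
      fix e :: real assume "e > 0"
      show "\<forall>\<^sub>F i in sequentially. \<forall>x. norm (V i (x + \<alpha>) ** E - F ** V i x) \<le> e"
        using smooth_lim_dist[OF lim \<open>e > 0\<close>]
      proof eventually_elim
        case (elim i)
        have "norm (V i (x + \<alpha>) ** E - F ** V i x) \<le> e" for x
        proof -
          have "conj_transpose (K (x + \<alpha>)) ** E = A x ** conj_transpose (K x)"
          proof -
            have "conj_transpose (K (x + \<alpha>)) ** (E ** K x) ** conj_transpose (K x) = conj_transpose (K (x + \<alpha>)) ** (K (x + \<alpha>) ** A x) ** conj_transpose (K x)"
              by (simp add: K(3))
            then have "conj_transpose (K (x + \<alpha>)) ** E ** (K x ** conj_transpose (K x)) = (conj_transpose (K (x + \<alpha>)) ** K (x + \<alpha>)) ** A x ** conj_transpose (K x)"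
              by (simp only: matrix_mul_assoc)
            then show ?thesis by (simp add: unitaryD[OF Ku])
          qed
          moreover have "V i (x + \<alpha>) ** E = H i (x + \<alpha>) ** (conj_transpose (K (x + \<alpha>)) ** E)"
            by (simp add: V_def matrix_mul_assoc)
          moreover have "conj_cocycle \<alpha> (H i) A x ** H i x = H i (x + \<alpha>) ** A x"
            using unitaryD(1)[OF Hu[of i x]] by (simp add: conj_cocycle_eq[OF G H] flip: matrix_mul_assoc)
          ultimately have "V i (x + \<alpha>) ** E = conj_cocycle \<alpha> (H i) A x ** V i x"
            by (simp add: V_def matrix_mul_assoc)
          moreover have "unitary (V i x)" unfolding V_def by (intro unitary_mult unitary_ct Hu Ku)
          ultimately have "norm (V i (x + \<alpha>) ** E - F ** V i x) = norm (conj_cocycle \<alpha> (H i) A x - F)"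
            using norm_unitary(2)[of "V i x" "conj_cocycle \<alpha> (H i) A x - F"] by (simp add: mm.diff_left)
          also have "\<dots> \<le> e" using elim[rule_format, of x] by (simp add: dist_norm)
          finally show ?thesis .
        qed
        then show ?case by blast
      qed
    qed
    then obtain ps where ps: "AE x in cube. U x = tpoly ps x" "\<And>x. tpoly ps (x + \<alpha>) ** E = F ** tpoly ps x" by blast
    have "wb (wgt 1 m) (tnorm (wgt 1 m) ps * r) (\<lambda>x. tpoly ps x ** K x)"
      by (intro wb_mult w wb_tpoly K(2)) simp
    moreover have "AE x in cube. h x = tpoly ps x ** K x"
      using ps(1)
    proof (eventually_elim)
      case (elim x)
      have "tpoly ps x ** K x = h x ** (conj_transpose (K x) ** K x)"
        unfolding elim[symmetric] U_def by (simp only: matrix_mul_assoc)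
      then show ?case by (simp add: unitaryD[OF Ku])
    qed
    moreover have "tpoly ps (x + \<alpha>) ** K (x + \<alpha>) ** A x = F ** (tpoly ps x ** K x)" for x
    proof -
      have "tpoly ps (x + \<alpha>) ** K (x + \<alpha>) ** A x = tpoly ps (x + \<alpha>) ** E ** K x"
        using K(3)[of x] by (simp flip: matrix_mul_assoc)
      then show ?thesis by (simp add: ps(2) matrix_mul_assoc)
    qed
    ultimately show ?thesis by blast
  qed
  define P where "P m W \<longleftrightarrow> (\<exists>r. wb (wgt 1 m) r W) \<and> (AE x in cube. h x = W x) \<and> (\<forall>x. W (x + \<alpha>) ** A x = F ** W x)"
    for m and W :: "real^'d \<Rightarrow> complex^'n^'n"
  have ex: "\<exists>W. P m W" for m using W[of m] unfolding P_def by blast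
  have uniq: "W = W'" if PWW: "P m W" "P l W'" for m l W W'
  proof (rule continuous_AE_cube_eq)
    obtain r s where rs: "wb (wgt 1 m) r W" "wb (wgt 1 l) s W'" using PWW unfolding P_def by blast
    show "continuous_on UNIV W" "periodic W" "continuous_on UNIV W'" "periodic W'"
      using wb_continuous wb_periodic rs by blast+
    have "AE x in cube. h x = W x" "AE x in cube. h x = W' x" using PWW unfolding P_def by blast+
    then show "AE x in cube. W x = W' x" by eventually_elim simp
  qed
  obtain W where W0: "P 0 W" using ex by blast
  have PW: "P m W" for m using ex[of m] uniq[OF W0] by metis
  have Ws: "smooth W" by (rule smooth_of_wb) (use PW in \<open>auto simp: P_def\<close>)
  obtain r where r: "wb (wgt 1 0) r W" using PW[of 0] unfolding P_def by blast
  note Wc = wb_continuous[OF r] and Wp = wb_periodic[OF r]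
  \<comment> \<open>W agrees with the G-valued h almost everywhere only. The distance to the closed
    set G is continuous and periodic along W, so it vanishes everywhere.\<close>
  have "(\<lambda>x. infdist (W x) G) = (\<lambda>_. 0)"
  proof (rule continuous_AE_cube_eq)
    show "continuous_on UNIV (\<lambda>x. infdist (W x) G)" by (intro continuous_on_infdist Wc)
    show "periodic (\<lambda>x. infdist (W x) G)" using Wp by (simp add: periodic_def)
    have "AE x in cube. h x = W x" using PW[of 0] unfolding P_def by blast
    then show "AE x in cube. infdist (W x) G = 0"
      by eventually_elim (metis h(2) infdist_zero)
  qed (auto simp: periodic_def)
  then have "infdist (W x) G = 0" for x by (rule fun_cong)
  then have "W x \<in> G" for x
    using in_closed_iff_infdist_zero[OF compact_groupD(5)[OF G]] compact_groupD(2)[OF G] by blast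
  then have "W \<in> smooth_maps G" using Ws Wp by (auto simp: smooth_maps_def)
  then show ?thesis using PW[of 0] unfolding P_def by blast
qed

theorem theorem3p6:
  fixes G T :: "(complex^'n^'n) set"
    and \<alpha> :: "real^'d"
    and A :: "real^'d \<Rightarrow> complex^'n^'n"
  assumes "compact_group G"
    and "maximal_torus G T"
    and "diophantine \<alpha>"
    and "A \<in> smooth_maps G"
    and "almost_reducible G \<alpha> A"
    and "rotation_vector_diophantine G T \<alpha> A"
  shows "\<forall>a \<in> rotation_vectors G T \<alpha> A.
           \<exists>H \<in> smooth_maps G. \<forall>x. H (x + \<alpha>) ** A x ** matrix_inv (H x) = mexp a"
proof
  note G = assms(1) and dio = assms(3) and A = assms(4)
  have T: "compact_group T" "T \<subseteq> G" "\<And>X Y. X \<in> T \<Longrightarrow> Y \<in> T \<Longrightarrow> X ** Y = Y ** X"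
    using assms(2) unfolding maximal_torus_def torus_group_def by blast+
  have expG: "mexp b \<in> G" if "b \<in> lie_algebra T" for b
    using that T(2) mexp_in_group by blast
  obtain a0 \<gamma> \<tau> where a0: "a0 \<in> rotation_vectors G T \<alpha> A" and \<gamma>: "\<gamma> > 0" "\<tau> > 0" and DC: "\<forall>\<rho>\<in>roots G T. \<rho> a0 \<in> DC \<alpha> \<gamma> \<tau>"
    using assms(6) unfolding rotation_vector_diophantine_def by blast
  have a0T: "a0 \<in> lie_algebra T" using a0 by (simp add: rotation_vectors_def)
  \<comment> \<open>The Diophantine condition is known for the representative a0, so the iteration
    runs at a0; an arbitrary representative enters through the transition map.\<close>
  have red: "\<exists>K r. (\<forall>x. K x \<in> G) \<and> wb (wgt 1 m) r K \<and> (\<forall>x. K (x + \<alpha>) ** A x = mexp a0 ** K x)" for m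
  proof (rule small_divisors[OF G T a0T dio \<gamma> DC])
    fix C :: real and \<tau> :: nat
    assume div: "C \<ge> 1"
      "\<And>k Z. k \<noteq> 0 \<Longrightarrow> Z \<in> complexification (lie_algebra G) \<Longrightarrow> \<exists>W\<in>complexification (lie_algebra G).
         mscale (ek k \<alpha>) W - mexp a0 ** W ** conj_transpose (mexp a0) = Z \<and>
         norm W \<le> C * (1 + norm (real_vec k)) ^ \<tau> * norm Z"
      "\<And>Z. Z \<in> complexification (lie_algebra G) \<Longrightarrow>
         \<exists>W\<in>complexification (lie_algebra G). \<exists>D\<in>complexification (lie_algebra G).
         W - mexp a0 ** W ** conj_transpose (mexp a0) = Z - D \<and>
         mexp a0 ** D ** conj_transpose (mexp a0) = D \<and> norm W \<le> C * norm Z"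
    interpret small_divisor_group G "mexp a0" \<alpha> C \<tau>
      by unfold_locales (fact G expG[OF a0T] div)+
    show ?thesis
      by (rule rotation_vectorE[OF G a0]) (rule finite_regularity_reducibility[OF _ A])
  qed
  fix a assume a: "a \<in> rotation_vectors G T \<alpha> A"
  have aT: "a \<in> lie_algebra T" using a by (simp add: rotation_vectors_def)
  have "\<exists>W\<in>smooth_maps G. \<forall>x. W (x + \<alpha>) ** A x = mexp a ** W x"
    by (rule rotation_vectorE[OF G a])
      (rule smooth_conjugacy[OF G dio A compact_groupD(1)[OF G expG[OF a0T]] red compact_groupD(1)[OF G expG[OF aT]]])
  then obtain W where W: "W \<in> smooth_maps G" "\<And>x. W (x + \<alpha>) ** A x = mexp a ** W x" by blast
  have "W (x + \<alpha>) ** A x ** matrix_inv (W x) = mexp a" for x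
  proof -
    have "W (x + \<alpha>) ** A x ** matrix_inv (W x) = mexp a ** (W x ** conj_transpose (W x))"
      by (simp add: W(2) matrix_inv_unitary smooth_mapsD(4)[OF G W(1)] matrix_mul_assoc)
    then show ?thesis by (simp add: unitaryD(2)[OF smooth_mapsD(4)[OF G W(1)]])
  qed
  with W(1) show "\<exists>H\<in>smooth_maps G. \<forall>x. H (x + \<alpha>) ** A x ** matrix_inv (H x) = mexp a" by blast
qed

end
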